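(* Let $y$ be the tritronqu\'ee solution of the Painlev\'e-I equation $y''(x)+6y(x)^2-x=0$, i.e. the unique solution with $y(x)=\sqrt{x/6}\,\bigl[1+o(x^{-5/8})\bigr]$ as $x\to+\infty$. Define $y_0$ on $D=D_1\cup D_2\cup D_3\cup D_4$ by \[ y_0(x)=\begin{cases}\sqrt{\tfrac{x}{6}}\Bigl[1+\tfrac{1}{8\sqrt6}x^{-5/2}-\tfrac{49}{768}x^{-5}+\tfrac{1225}{1536\sqrt6}x^{-15/2}+w_0(x)\Bigr], & x\in D_1,\\[2pt] -\tfrac{1}{(x-x_0)^2}+P_u(\tau(x)), & x\in D_2\cup D_3,\\[2pt] -\tfrac{1}{(x-x_0)^2}+(x-x_0)^2P(x-x_0), & x\in D_4.\end{cases} \] Then on $D$ the tritronqu\'ee solution has the representation $y(x)=y_0(x)+E(x)$ with $|E(x)|\le 2.35\times10^{-5}$ and $|E'(x)|\le 1.16\times 10^{-4}$. Moreover, $y$ has a unique double pole singularity $x=x_p$ in the open disk $\{\zeta\in\mathbb C:|\zeta-x_0|<r\}$, with $|x_p-x_0|\le 4.1\times10^{-6}$, and this is the singularity of the tritronqu\'ee solution closest to the origin.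
   Context: Constants: $r=\tfrac{7}{10}$, $x_0=-\tfrac{770766}{323285}$, $L=\tfrac{11}{2}$, $L_0=-\tfrac{49}{100}$, $b=\tfrac45(24)^{1/4}$, $a=\tfrac52 b$. Domains: $D_1=[L,\infty)$, $D_2=[L_0,L)$, $D_3=[x_0+r,L_0)$, $D_4=\{x\in\mathbb C:|x-x_0|=r,\ x\neq x_0+r\}$. Let $\tau(x)=\dfrac{x-(L+x_0+r)/2}{(L-x_0-r)/2}$ and $P_u(\tau)=\sum_{k=0}^{22}c_k\tau^k$ with $(c_0,\dots,c_{22})=\bigl(\tfrac{335867}{539062},\tfrac{419712}{989125},-\tfrac{352463}{3539236},\tfrac{60789}{1703279},-\tfrac{132842}{11825541},\tfrac{43961}{54574472},\tfrac{39599}{12036926},-\tfrac{213665}{48625258},\tfrac{61644}{14973337},-\tfrac{107283}{33444500},\tfrac{44761}{18892011},-\tfrac{28249}{13550715},\tfrac{20641}{14839893},\tfrac{13459}{92774551},-\tfrac{4992}{34838093},-\tfrac{11771}{8149937},\tfrac{24115}{27631671},\tfrac{42106}{39550107},-\tfrac{21163}{32637441},-\tfrac{9782}{15918509},\tfrac{11581}{32652169},\tfrac{14692}{88640147},-\tfrac{12278}{123249611}\bigr)$. Let $P(\zeta)=\sum_{n=0}^{17}a_n\zeta^n$ with $a_0=-x_0/10$, $a_1=-1/6$, $a_2=\tfrac{19949}{321055}$, $a_3=0$, and $a_n=-\tfrac{6}{(n+5)(n-2)}\sum_{k=0}^{n-4}a_ka_{n-4-k}$ for $4\le n\le17$. Let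 $N_0(x)=-\tfrac{4412401}{98304\sqrt6}x^{-19/2}\bigl[1-\tfrac{1225}{90049\sqrt6}x^{-5/2}+\tfrac{30625}{2161176}x^{-5}\bigr]$, $\mathcal G_1(x)=x^{-5/8}e^{-ibx^{5/4}}$, $\mathcal G_2(x)=x^{-5/8}e^{ibx^{5/4}}$, and $w_0(x)=\sum_{j=1}^2\frac{(-1)^j}{ia}\mathcal G_j(x)\int_\infty^x\mathcal G_{3-j}(t)\,t\,N_0(t)\,dt$ for $x\ge L$. *)

theory Defs
  imports "HOL-Complex_Analysis.Complex_Analysis"
begin

definition r0 :: real where "r0 = 7/10"
definition x0 :: real where "x0 = - 770766/323285"
definition LL :: real where "LL = 11/2"
definition L0 :: real where "L0 = - 49/100"
definition bb :: real where "bb = 4/5 * 24 powr (1/4)"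
definition aa :: real where "aa = 5/2 * bb"

definition D1 :: "real set" where "D1 = {LL..}"
definition D2 :: "real set" where "D2 = {L0..<LL}"
definition D3 :: "real set" where "D3 = {x0 + r0..<L0}"
definition D4 :: "complex set" where
  "D4 = {z. cmod (z - complex_of_real x0) = r0 \<and> z \<noteq> complex_of_real (x0 + r0)}"
definition DD :: "complex set" where
  "DD = complex_of_real ` (D1 \<union> D2 \<union> D3) \<union> D4"

definition tau :: "complex \<Rightarrow> complex" where
  "tau x = (x - complex_of_real ((LL + x0 + r0) / 2)) / complex_of_real ((LL - x0 - r0) / 2)"

definition Pu_coeffs :: "real list" where
  "Pu_coeffs = [335867/539062, 419712/989125, -352463/3539236, 60789/1703279,
    -132842/11825541, 43961/54574472, 39599/12036926, -213665/48625258,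
    61644/14973337, -107283/33444500, 44761/18892011, -28249/13550715,
    20641/14839893, 13459/92774551, -4992/34838093, -11771/8149937,
    24115/27631671, 42106/39550107, -21163/32637441, -9782/15918509,
    11581/32652169, 14692/88640147, -12278/123249611]"

definition Pu :: "complex \<Rightarrow> complex" where
  "Pu t = (\<Sum>k\<le>22. complex_of_real (Pu_coeffs ! k) * t ^ k)"

definition P_step :: "real list \<Rightarrow> real list" where
  "P_step l = (let n = length l in
     l @ [ - 6 / (real (n + 5) * real (n - 2)) * (\<Sum>k=0..n-4. l ! k * l ! (n - 4 - k))])"

definition P_coeffs :: "real list" where
  "P_coeffs = (P_step ^^ 14) [- x0 / 10, - 1/6, 19949/321055, 0]"

definition PP :: "complex \<Rightarrow> complex" where
  "PP z = (\<Sum>n\<le>17. complex_of_real (P_coeffs ! n) * z ^ n)"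

definition N0 :: "real \<Rightarrow> real" where
  "N0 x = - 4412401 / (98304 * sqrt 6) * x powr (-19/2) *
     (1 - 1225 / (90049 * sqrt 6) * x powr (-5/2) + 30625/2161176 * x powr (-5))"

definition G1 :: "real \<Rightarrow> complex" where
  "G1 x = complex_of_real (x powr (-5/8)) * exp (- \<i> * complex_of_real (bb * x powr (5/4)))"

definition G2 :: "real \<Rightarrow> complex" where
  "G2 x = complex_of_real (x powr (-5/8)) * exp (\<i> * complex_of_real (bb * x powr (5/4)))"

text \<open>\<open>\<integral>_\<infinity>^x g = - \<integral>_x^\<infinity> g\<close>.\<close>
definition w0 :: "real \<Rightarrow> complex" where
  "w0 x =
     (-1) / (\<i> * complex_of_real aa) * G1 x *
        (- integral {x..} (\<lambda>t. G2 t * complex_of_real (t * N0 t)))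
   + 1 / (\<i> * complex_of_real aa) * G2 x *
        (- integral {x..} (\<lambda>t. G1 t * complex_of_real (t * N0 t)))"

definition y0_D1 :: "real \<Rightarrow> complex" where
  "y0_D1 x = complex_of_real (sqrt (x / 6)) *
     (complex_of_real (1 + 1 / (8 * sqrt 6) * x powr (-5/2) - 49/768 * x powr (-5)
        + 1225 / (1536 * sqrt 6) * x powr (-15/2)) + w0 x)"

definition y0_D23 :: "complex \<Rightarrow> complex" where
  "y0_D23 z = - 1 / (z - complex_of_real x0)^2 + Pu (tau z)"

definition y0_D4 :: "complex \<Rightarrow> complex" where
  "y0_D4 z = - 1 / (z - complex_of_real x0)^2 + (z - complex_of_real x0)^2 * PP (z - complex_of_real x0)"

definition y0 :: "complex \<Rightarrow> complex" where
  "y0 z = (if z \<in> complex_of_real ` D1 then y0_D1 (Re z)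
           else if z \<in> complex_of_real ` (D2 \<union> D3) then y0_D23 z
           else if z \<in> D4 then y0_D4 z else 0)"

end

theory Submission imports Defs begin

text \<open>Each explicit formula is compared with the tritronquee solution by a continuity argument: as long
  as the solution has no pole and stays within a prescribed barrier around an approximant, the differential
  equation forces the strict inequality, and boundedness excludes poles. On the right half line the barrier
  starts at infinity, in the amplitude and phase variables of the linearised equation, after a normal form has
  shown that the error decays fast enough; then an energy of the error is propagated to the left, and finally
  the error is propagated along the two halves of the circle around \<open>x0\<close>. All poles have principal part
  \<open>-1 / (z - p)\<^sup>2\<close>, so the first two moments of \<open>y\<close> over the circle count the poles inside and locate
  the only one. For the minimality of its modulus, the Taylor coefficients at 0 of \<open>- y (- z)\<close> beyond the
  constant one are nonnegative; hence, as in Pringsheim's theorem, a pole of least modulus forces one on the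
  negative axis.\<close>

text \<open>The hypothesis at infinity says only that the scaled error tends to 0, whereas a barrier
  started there must already contain the solution: algebraic decay has to come first. It cannot be
  read off by integrating the error equation, whose quadratic term carries the non-integrable factor
  x^(-3/8); the normal form trades that term for ones of integrable size, and the resulting gain of
  5/8 in the exponent is iterated. The energy used to the left of 11/2 is a real quantity, so
  reality of y on the axis is derived beforehand, from uniqueness at infinity and the identity
  theorem. The correction \<open>w0\<close> takes no part in the dynamics: on the half line y is
  compared with the longer expansion \<open>ac\<close>, and \<open>w0\<close> is small enough to be
  charged to the tolerance. The polynomials of \<open>y0\<close> are rounded to integer numerators
  over 10^14 and 10^12, so that residuals are certified in exact integer arithmetic and rounding is
  paid for at the end. Finally, \<open>is_pole\<close> is a statement about a limit and does not
  exclude accumulating poles, so isolation needs an argument.\<close>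

lemma barrier:
  fixes u1 u2 u1' u2' :: "real \<Rightarrow> 'a :: real_normed_vector" and B1 B2 B1' B2' :: "real \<Rightarrow> real"
  assumes init: "good a" "norm (u1 a) < B1 a" "norm (u2 a) < B2 a"
    and good_open: "\<And>t. t \<in> {a..b} \<Longrightarrow> good t \<Longrightarrow> eventually good (at t within {a..b})"
    and good_closed: "\<And>t. t \<in> {a<..b} \<Longrightarrow>
      (\<And>s. s \<in> {a..<t} \<Longrightarrow> good s \<and> norm (u1 s) < B1 s \<and> norm (u2 s) < B2 s) \<Longrightarrow> good t"
    and u1: "\<And>t. t \<in> {a..b} \<Longrightarrow> good t \<Longrightarrow> (u1 has_vector_derivative u1' t) (at t within {a..b})"
    and u2: "\<And>t. t \<in> {a..b} \<Longrightarrow> good t \<Longrightarrow> (u2 has_vector_derivative u2' t) (at t within {a..b})"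
    and B1: "\<And>t. t \<in> {a..b} \<Longrightarrow> (B1 has_real_derivative B1' t) (at t within {a..b})"
    and B2: "\<And>t. t \<in> {a..b} \<Longrightarrow> (B2 has_real_derivative B2' t) (at t within {a..b})"
    and le1: "\<And>t. t \<in> {a..b} \<Longrightarrow> good t \<Longrightarrow> norm (u1 t) \<le> B1 t \<Longrightarrow> norm (u2 t) \<le> B2 t \<Longrightarrow> norm (u1' t) \<le> B1' t"
    and le2: "\<And>t. t \<in> {a..b} \<Longrightarrow> good t \<Longrightarrow> norm (u1 t) \<le> B1 t \<Longrightarrow> norm (u2 t) \<le> B2 t \<Longrightarrow> norm (u2' t) \<le> B2' t"
    and t: "t \<in> {a..b}"
  shows "good t \<and> norm (u1 t) < B1 t \<and> norm (u2 t) < B2 t"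
proof -
  define ok where "ok s \<longleftrightarrow> good s \<and> norm (u1 s) < B1 s \<and> norm (u2 s) < B2 s" for s
  define S where "S = {s \<in> {a..b}. \<forall>r\<in>{a..s}. ok r}"
  have ab: "a \<le> b" using t by auto
  have aS: "a \<in> S" using init ab by (auto simp: S_def ok_def)
  have bdd: "bdd_above S" unfolding S_def by (rule bdd_aboveI[of _ b]) auto
  define m where "m = Sup S"
  have am: "a \<le> m" and mb: "m \<le> b"
    using aS bdd ab unfolding m_def by (auto intro!: cSup_upper cSup_least simp: S_def)
  have below: "ok s" if "s \<in> {a..<m}" for s
  proof -
    have "s < Sup S" "S \<noteq> {}" using that aS by (auto simp: m_def)
    then obtain r where "r \<in> S" "s < r" using less_cSup_iff[of S s] bdd by blast
    then show ?thesis using that by (auto simp: S_def)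
  qed
  \<comment> \<open>Since |u'| <= B' on [a, m), the increment of |u| is at most that of B. The gap B
    - |u| at m is therefore at least the positive gap at a, which is why the strict inequality
    survives the passage to the supremum.\<close>
  have bound: "norm (u m) < B m"
    if d: "\<And>t. t \<in> {a..b} \<Longrightarrow> good t \<Longrightarrow> (u has_vector_derivative u' t) (at t within {a..b})"
      and dB: "\<And>t. t \<in> {a..b} \<Longrightarrow> (B has_real_derivative B' t) (at t within {a..b})"
      and le: "\<And>t. t \<in> {a..<m} \<Longrightarrow> norm (u' t) \<le> B' t"
      and "norm (u a) < B a" "good m" "a < m" for u u' :: "real \<Rightarrow> 'a" and B B' :: "real \<Rightarrow> real"
  proof -
    have g: "good s" if "s \<in> {a..m}" for s
      using below[of s] \<open>good m\<close> that by (cases "s = m") (auto simp: ok_def)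
    have "norm (u m - u a) \<le> B m - B a"
    proof (rule differentiable_bound_general[OF \<open>a < m\<close>])
      show "continuous_on {a..m} u"
        unfolding continuous_on_eq_continuous_within
      proof
        fix s assume s: "s \<in> {a..m}"
        have "continuous (at s within {a..b}) u"
          using d[of s] g[OF s] s mb by (auto intro: has_vector_derivative_continuous)
        then show "continuous (at s within {a..m}) u"
          by (rule continuous_within_subset) (use mb in auto)
      qed
      show "continuous_on {a..m} B"
        unfolding continuous_on_eq_continuous_within
      proof
        fix s assume s: "s \<in> {a..m}"
        have "continuous (at s within {a..b}) B"
          using dB[of s] s mb by (auto intro: DERIV_continuous)
        then show "continuous (at s within {a..m}) B"
          by (rule continuous_within_subset) (use mb in auto)
      qed
      fix s assume s: "a < s" "s < m"
      have at: "at s within {a..b} = at s"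
        using s mb by (intro at_within_interior) auto
      show "(u has_vector_derivative u' s) (at s)" using d[of s] g[of s] s mb at by auto
      show "(B has_vector_derivative B' s) (at s)"
        using dB[of s] s mb at by (auto simp: has_real_derivative_iff_has_vector_derivative)
      show "norm (u' s) \<le> B' s" using le[of s] s by auto
    qed
    then show ?thesis using \<open>norm (u a) < B a\<close> norm_triangle_ineq2[of "u m" "u a"] by linarith
  qed
  have okm: "ok m"
  proof (cases "a = m")
    case True
    then show ?thesis using init by (auto simp: ok_def)
  next
    case False
    then have "a < m" using am by simp
    have gm: "good m"
      using good_closed[of m] below \<open>a < m\<close> mb by (auto simp: ok_def)
    have "norm (u1 m) < B1 m"
      by (rule bound[OF u1 B1]) (use le1 below init gm \<open>a < m\<close> mb in \<open>auto simp: ok_def less_imp_le\<close>)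
    moreover have "norm (u2 m) < B2 m"
      by (rule bound[OF u2 B2]) (use le2 below init gm \<open>a < m\<close> mb in \<open>auto simp: ok_def less_imp_le\<close>)
    ultimately show ?thesis using gm by (simp add: ok_def)
  qed
  have "m = b"
  proof (rule ccontr)
    assume "m \<noteq> b"
    then have "m < b" using mb by simp
    have mi: "m \<in> {a..b}" using am mb by simp
    have gm: "good m" using okm by (simp add: ok_def)
    have cont: "\<forall>\<^sub>F s in at m within {a..b}. norm (u s) < B s"
      if "(u has_vector_derivative du) (at m within {a..b})"
        "(B has_real_derivative dB) (at m within {a..b})" "norm (u m) < B m"
      for u :: "real \<Rightarrow> 'a" and B :: "real \<Rightarrow> real" and du dB
    proof -
      have "(u \<longlongrightarrow> u m) (at m within {a..b})" "(B \<longlongrightarrow> B m) (at m within {a..b})"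
        using has_vector_derivative_continuous[OF that(1)] DERIV_continuous[OF that(2)]
        by (auto simp: continuous_within)
      then have "((\<lambda>s. B s - norm (u s)) \<longlongrightarrow> B m - norm (u m)) (at m within {a..b})"
        by (intro tendsto_intros)
      then have "\<forall>\<^sub>F s in at m within {a..b}. 0 < B s - norm (u s)"
        by (rule order_tendstoD(1)) (use that(3) in simp)
      then show ?thesis by (simp add: algebra_simps)
    qed
    have "\<forall>\<^sub>F s in at m within {a..b}. ok s"
      unfolding ok_def using okm
      by (intro eventually_conj good_open[OF mi gm] cont[of u1 "u1' m" B1 "B1' m"] cont[of u2 "u2' m" B2 "B2' m"]
            u1[OF mi gm] u2[OF mi gm] B1[OF mi] B2[OF mi]) (auto simp: ok_def)
    then obtain d where d: "d > 0" "\<And>s. s \<in> {a..b} \<Longrightarrow> s \<noteq> m \<Longrightarrow> dist s m < d \<Longrightarrow> ok s"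
      unfolding eventually_at by auto
    define q where "q = min b (m + d / 2)"
    have q: "m < q" "q \<le> b" "q < m + d" using \<open>m < b\<close> \<open>d > 0\<close> by (auto simp: q_def)
    have "q \<in> S"
      unfolding S_def
    proof (intro CollectI conjI ballI)
      show "q \<in> {a..b}" using q am by auto
      fix r assume r: "r \<in> {a..q}"
      consider "r < m" | "r = m" | "r > m" by linarith
      then show "ok r"
      proof cases
        case 3
        show ?thesis by (rule d(2)) (use 3 r q in \<open>auto simp: dist_real_def\<close>)
      qed (use below okm r in auto)
    qed
    then have "q \<le> m" unfolding m_def using bdd by (rule cSup_upper)
    then show False using q by simp
  qed
  then have "ok t" using below[of t] okm t by (cases "t = m") auto
  then show ?thesis by (simp add: ok_def)
qed

section \<open>Meromorphic solutions of Painleve I\<close>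

lemma not_islimptE:
  fixes x :: "'a :: metric_space"
  assumes "\<not> x islimpt S"
  obtains d where "d > 0" "\<And>v. v \<in> S \<Longrightarrow> v \<noteq> x \<Longrightarrow> dist v x \<ge> d"
proof -
  have "\<exists>d>0. \<forall>v\<in>S. v \<noteq> x \<longrightarrow> \<not> dist v x < d"
    using assms unfolding islimpt_approachable by blast
  then show ?thesis using that by (auto simp: not_less)
qed

text \<open>A pole means here only that y tends to infinity at the point; the value of y there is
  arbitrary, and analyticity is demanded at the other points alone. Isolation, order and principal
  part of the poles all have to be extracted from these two assumptions.\<close>

locale painleve_I =
  fixes y :: "complex \<Rightarrow> complex"
  assumes mero: "y analytic_on {z. \<not> is_pole y z}"
    and ode: "\<not> is_pole y z \<Longrightarrow> deriv (deriv y) z = z - 6 * (y z)\<^sup>2"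
begin

lemma open_nonpoles: "open {z. \<not> is_pole y z}"
  unfolding open_contains_ball
proof
  fix z assume "z \<in> {z. \<not> is_pole y z}"
  then obtain e where e: "e > 0" "y holomorphic_on ball z e"
    using mero unfolding analytic_on_def by blast
  then have "ball z e \<subseteq> {z. \<not> is_pole y z}"
    using not_is_pole_holomorphic[of "ball z e" _ y] by auto
  then show "\<exists>e>0. ball z e \<subseteq> {z. \<not> is_pole y z}" using e by blast
qed

lemma holomorphic_nonpoles: "y holomorphic_on {z. \<not> is_pole y z}"
  using mero by (rule analytic_imp_holomorphic)

lemma holomorphic_onI: "(\<And>z. z \<in> S \<Longrightarrow> \<not> is_pole y z) \<Longrightarrow> y holomorphic_on S"
  using holomorphic_nonpoles by (rule holomorphic_on_subset) auto

lemma has_derivs: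
  assumes "\<not> is_pole y z"
  shows "(y has_field_derivative deriv y z) (at z)"
    and "(deriv y has_field_derivative z - 6 * (y z)\<^sup>2) (at z)"
proof -
  show "(y has_field_derivative deriv y z) (at z)"
    using holomorphic_derivI[OF holomorphic_nonpoles open_nonpoles] assms by auto
  have "deriv y holomorphic_on {z. \<not> is_pole y z}"
    by (rule holomorphic_deriv[OF holomorphic_nonpoles open_nonpoles])
  then have "(deriv y has_field_derivative deriv (deriv y) z) (at z)"
    by (rule holomorphic_derivI[OF _ open_nonpoles]) (use assms in auto)
  then show "(deriv y has_field_derivative z - 6 * (y z)\<^sup>2) (at z)"
    by (simp add: ode assms)
qed

text \<open>The arbitrary values at the poles sort them into countably many classes |y p| <= n. Near
  a pole p all other values exceed n in modulus, so within its class p is isolated, and a set of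
  isolated points of the plane is countable.\<close>

lemma countable_poles: "countable {z. is_pole y z}"
proof -
  have "countable {z. is_pole y z \<and> cmod (y z) \<le> real n}" (is "countable ?D") for n
  proof -
    obtain B :: "complex set set" where B: "countable B" "topological_basis B"
      using ex_countable_basis by blast
    have "\<exists>b\<in>B. b \<inter> ?D = {p}" if p: "p \<in> ?D" for p
    proof -
      have pole: "is_pole y p" and "(0::real) < real n + 1" using p by auto
      then obtain U where U: "open U" "p \<in> U" "\<And>w. w \<in> U \<Longrightarrow> w \<noteq> p \<Longrightarrow> cmod (y w) \<ge> real n + 1"
        unfolding is_pole_alt by meson
      obtain b where "b \<in> B" "p \<in> b" "b \<subseteq> U"
        using topological_basisE[OF B(2) U(1,2)] by blast
      then have "b \<inter> ?D = {p}" using U(3) p by fastforce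
      then show ?thesis using \<open>b \<in> B\<close> by blast
    qed
    then obtain f where f: "\<And>p. p \<in> ?D \<Longrightarrow> f p \<in> B \<and> f p \<inter> ?D = {p}" by metis
    have "inj_on f ?D" by (rule inj_onI) (metis f singleton_inject)
    moreover have "countable (f ` ?D)" using B(1) by (rule countable_subset[rotated]) (use f in auto)
    ultimately show ?thesis by (rule countable_image_inj_on[rotated])
  qed
  then have "countable (\<Union>n. {z. is_pole y z \<and> cmod (y z) \<le> real n})" by blast
  moreover have "{z. is_pole y z} \<subseteq> (\<Union>n. {z. is_pole y z \<and> cmod (y z) \<le> real n})"
    using real_arch_simple by auto
  ultimately show ?thesis by (rule countable_subset[rotated])
qed

text \<open>A pole that is a limit of isolated poles only would be an accumulation point of zeros of
  the holomorphic function \<open>1/y\<close>.  So the set of non-isolated poles is closed, countable and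
  without isolated points, hence empty by Baire's theorem.\<close>

lemma poles_isolated:
  assumes "is_pole y p"
  shows "\<not> p islimpt {z. is_pole y z}"
proof -
  define P where "P = {z. is_pole y z}"
  have "closed P" unfolding P_def using open_nonpoles by (simp add: closed_def Compl_eq)
  define S where "S = {z. z islimpt P}"
  have SP: "S \<subseteq> P" using \<open>closed P\<close> by (auto simp: S_def closed_limpt)
  have "closed S" unfolding S_def by (rule closed_limpts)
  have no_iso: "x islimpt S" if x: "x \<in> S" for x
  proof (rule ccontr)
    assume nl: "\<not> x islimpt S"
    obtain e1 where e1: "e1 > 0" "\<And>w. w \<in> S \<Longrightarrow> w \<noteq> x \<Longrightarrow> dist w x \<ge> e1"
      using not_islimptE[OF nl] by blast
    have px: "is_pole y x" using x SP by (auto simp: P_def)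
    obtain U where U: "open U" "x \<in> U" "\<And>w. w \<in> U \<Longrightarrow> w \<noteq> x \<Longrightarrow> cmod (y w) \<ge> 1"
      using px unfolding is_pole_alt by (meson zero_less_one)
    obtain e2 where e2: "e2 > 0" "ball x e2 \<subseteq> U" using U by (meson open_contains_ball)
    define e where "e = min e1 e2"
    have e: "e > 0" using e1 e2 by (simp add: e_def)
    \<comment> \<open>With the value 0 at poles, 1/y becomes continuous at every pole, isolated or
      not. Poles near x other than x are isolated from each other, so there the singularity is
      removable, and afterwards it is removable at x as well.\<close>
    define g where "g = (\<lambda>w. if is_pole y w then 0 else inverse (y w))"
    have g0: "g \<midarrow>w\<rightarrow> 0" if "is_pole y w" for w
    proof -
      have 1: "((\<lambda>w. inverse (y w)) \<longlongrightarrow> 0) (at w)"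
        using is_pole_tendsto[OF that] by (simp add: comp_def)
      show ?thesis
        by (rule Lim_null_comparison[OF _ tendsto_norm_zero[OF 1]]) (auto simp: g_def)
    qed
    have hol_at: "g field_differentiable at w" if "\<not> is_pole y w" "y w \<noteq> 0" for w
    proof -
      have "(\<lambda>w. inverse (y w)) field_differentiable at w"
        using has_derivs(1)[OF that(1)] that(2)
        by (intro field_differentiable_inverse) (auto simp: field_differentiable_def)
      then obtain D where D: "((\<lambda>w. inverse (y w)) has_field_derivative D) (at w)"
        by (auto simp: field_differentiable_def)
      have "eventually (\<lambda>v. g v = inverse (y v)) (nhds w)"
        using open_nonpoles that(1) by (auto simp: eventually_nhds g_def intro!: exI[of _ "{z. \<not> is_pole y z}"])
      then have "(g has_field_derivative D) (at w)"
        using D DERIV_cong_ev[of w w g "\<lambda>w. inverse (y w)" D D] by blast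
      then show ?thesis by (auto simp: field_differentiable_def)
    qed
    have hol_pole: "g field_differentiable at w" if w: "is_pole y w" "w \<in> ball x e" "w \<noteq> x" for w
    proof -
      have "w \<notin> S" using e1(2)[of w] w by (auto simp: e_def dist_commute)
      then have nl: "\<not> w islimpt P" by (simp add: S_def)
      obtain d where d: "d > 0" "\<And>v. v \<in> P \<Longrightarrow> v \<noteq> w \<Longrightarrow> dist v w \<ge> d"
        using not_islimptE[OF nl] by blast
      obtain d' where d': "d' > 0" "ball w d' \<subseteq> ball x e - {x}"
        using w openE[of "ball x e - {x}" w] by (metis Diff_iff open_Diff open_ball closed_singleton singletonD)
      define V where "V = ball w (min d d')"
      have V: "open V" "w \<in> V" using d d' by (auto simp: V_def)
      have "g holomorphic_on V"
      proof (rule no_isolated_singularity'[of "{w}"])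
        show "(g \<longlongrightarrow> g z) (at z within V)" if "z \<in> {w}" for z
          using g0[OF w(1)] that w(1) by (auto simp: g_def intro: tendsto_within_subset)
        show "g holomorphic_on V - {w}"
        proof (unfold holomorphic_on_def, rule ballI, rule field_differentiable_at_within, rule hol_at)
          fix v assume v: "v \<in> V - {w}"
          then show "\<not> is_pole y v" using d(2)[of v] by (auto simp: V_def P_def dist_commute)
          have "v \<in> ball w d'" using v by (auto simp: V_def)
          then have "v \<in> ball x e - {x}" using d'(2) by (rule subsetD[rotated])
          then have "v \<in> U" "v \<noteq> x" using e2 by (auto simp: e_def)
          then show "y v \<noteq> 0" using U(3)[of v] by auto
        qed
      qed (use V in auto)
      then show ?thesis using V by (auto simp: holomorphic_on_open field_differentiable_def)
    qed
    have hol: "g holomorphic_on ball x e"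
    proof (rule no_isolated_singularity'[of "{x}"])
      show "(g \<longlongrightarrow> g z) (at z within ball x e)" if "z \<in> {x}" for z
        using g0[OF px] that px by (auto simp: g_def intro: tendsto_within_subset)
      show "g holomorphic_on ball x e - {x}"
        unfolding holomorphic_on_def
      proof (rule ballI, rule field_differentiable_at_within)
        fix v assume v: "v \<in> ball x e - {x}"
        then have "v \<in> U" "v \<noteq> x" using e2 by (auto simp: e_def)
        then have "y v \<noteq> 0" using U(3)[of v] by auto
        then show "g field_differentiable at v" using hol_at[of v] hol_pole[of v] v by auto
      qed
    qed auto
    have "\<exists>z. z \<in> ball x e \<and> \<not> is_pole y z"
    proof (rule ccontr)
      assume "\<not> ?thesis"
      then have "ball x e \<subseteq> P" by (auto simp: P_def)
      then have "countable (ball x e)" using countable_poles unfolding P_def by (rule countable_subset)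
      then show False using uncountable_ball[OF e, of x] by simp
    qed
    then obtain z where z: "z \<in> ball x e" "\<not> is_pole y z" by blast
    have "z \<in> U" "z \<noteq> x" using z px e2 by (auto simp: e_def)
    then have "y z \<noteq> 0" using U(3)[of z] by auto
    have "x islimpt P \<inter> ball x e"
      by (rule islimpt_Int_eventually) (use x e eventually_at_in_open'[of "ball x e" x] in \<open>auto simp: S_def\<close>)
    have "g z = 0"
    proof (rule analytic_continuation[OF hol open_ball connected_ball _ _ \<open>x islimpt P \<inter> ball x e\<close>])
      show "g w = 0" if "w \<in> P \<inter> ball x e" for w using that by (simp add: P_def g_def)
    qed (use z e in auto)
    then show False using z \<open>y z \<noteq> 0\<close> by (simp add: g_def)
  qed
  have "S = {}"
  proof -
    have "S \<subseteq> closure (\<Inter>((\<lambda>x. S - {x}) ` S))"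
    proof (rule Baire[OF \<open>closed S\<close>])
      show "countable ((\<lambda>x. S - {x}) ` S)"
        using countable_subset[OF SP] countable_poles by (auto simp: P_def)
      fix T assume "T \<in> (\<lambda>x. S - {x}) ` S"
      then obtain x where x: "x \<in> S" "T = S - {x}" by auto
      have "openin (top_of_set S) (S - {x})" by (simp add: openin_delete)
      moreover have "S \<subseteq> closure (S - {x})"
        using no_iso[OF x(1)] islimpt_punctured[of x S] by (auto simp: closure_def)
      ultimately show "openin (top_of_set S) T \<and> S \<subseteq> closure T" using x by simp
    qed
    moreover have "\<Inter>((\<lambda>x. S - {x}) ` S) \<subseteq> {}" if "S \<noteq> {}" using that by auto
    ultimately show ?thesis by (metis closure_empty subset_empty)
  qed
  then show ?thesis by (auto simp: S_def P_def)
qed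


end

context painleve_I begin

text \<open>Insert y = g / (z - p)^N into the equation. Balancing the orders N + 2 of y'' and 2 N of
  y^2 forces N = 2; the leading coefficients then give 6 g(p) = -6 g(p)^2, and the next order gives
  g'(p) = 0. Vanishing of g'(p) means that y has no residue, which makes the moments over the circle
  computable.\<close>

lemma pole_expansion:
  assumes pole: "is_pole y p"
  obtains e g where "e > 0" "g holomorphic_on ball p e"
    "\<And>w. w \<in> ball p e \<Longrightarrow> w \<noteq> p \<Longrightarrow> \<not> is_pole y w \<and> y w = g w / (w - p)\<^sup>2"
    "g p = -1" "deriv g p = 0" "zorder y p = -2"
proof -
  obtain d where d: "d > 0" "\<And>w. is_pole y w \<Longrightarrow> w \<noteq> p \<Longrightarrow> dist w p \<ge> d"
    using not_islimptE[OF poles_isolated[OF pole]] by (metis mem_Collect_eq)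
  have "y holomorphic_on ball p d - {p}"
    by (rule holomorphic_onI) (metis DiffE d(2) dist_commute insertI1 mem_ball not_le)
  from zorder_exist_pole[OF this open_ball _ pole] d(1)
  obtain r where r: "zorder y p < 0" "zor_poly y p p \<noteq> 0" "r > 0" "cball p r \<subseteq> ball p d"
    "zor_poly y p holomorphic_on cball p r"
    "\<And>w. w \<in> cball p r - {p} \<Longrightarrow> y w = zor_poly y p w / (w - p) ^ nat (- zorder y p)"
    by auto
  define g where "g = zor_poly y p"
  define N where "N = nat (- zorder y p)"
  have N: "N \<ge> 1" using r(1) by (simp add: N_def)
  have g: "g holomorphic_on ball p r" using r(5) by (auto simp: g_def intro: holomorphic_on_subset)
  have np: "\<not> is_pole y w" if "w \<in> ball p r - {p}" for w
  proof -
    have "w \<in> ball p d" using that r(4) by (meson DiffD1 ball_subset_cball subsetD)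
    then show ?thesis using d(2)[of w] that by (auto simp: dist_commute)
  qed
  have yg: "y w = g w / (w - p) ^ N" if "w \<in> ball p r - {p}" for w
    using r(6)[of w] that by (auto simp: g_def N_def)
  have gp: "g p \<noteq> 0" using r(2) by (simp add: g_def)
  have g': "deriv g holomorphic_on ball p r" by (rule holomorphic_deriv[OF g open_ball])
  have g'': "deriv (deriv g) holomorphic_on ball p r" by (rule holomorphic_deriv[OF g' open_ball])
  \<comment> \<open>The left-hand side is u^(N+2) y'' expressed through g; the equation replaces y''
    on the right.\<close>
  have G: "u\<^sup>2 * deriv (deriv g) w - 2 * N * u * deriv g w + N * (N + 1) * g w = u ^ (N + 2) * (w - 6 * (y w)\<^sup>2)"
    if w: "w \<in> ball p r - {p}" and u: "u = w - p" for w u :: complex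
  proof -
    have o: "open (ball p r - {p})" by (simp add: open_Diff)
    have u0: "u \<noteq> 0" using w u by auto
    have ev: "eventually (\<lambda>v. v \<in> ball p r - {p}) (nhds w)" using o w eventually_nhds by blast
    have d1: "deriv g v = deriv y v * (v - p) ^ N + y v * (N * (v - p) ^ (N - 1))"
      if v: "v \<in> ball p r - {p}" for v
    proof -
      have "((\<lambda>v. y v * (v - p) ^ N) has_field_derivative
          deriv y v * (v - p) ^ N + y v * (N * (v - p) ^ (N - 1))) (at v)"
        by (auto intro!: derivative_eq_intros has_derivs np v)
      moreover have "eventually (\<lambda>x. g x = y x * (x - p) ^ N) (nhds v)"
        using o v yg unfolding eventually_nhds by (intro exI[of _ "ball p r - {p}"]) auto
      ultimately have "(g has_field_derivative
          deriv y v * (v - p) ^ N + y v * (N * (v - p) ^ (N - 1))) (at v)"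
        by (subst DERIV_cong_ev[OF refl _ refl])
      then show ?thesis by (rule DERIV_imp_deriv)
    qed
    have "((\<lambda>v. deriv y v * (v - p) ^ N + y v * (N * (v - p) ^ (N - 1))) has_field_derivative
        (w - 6 * (y w)\<^sup>2) * (w - p) ^ N + deriv y w * (N * (w - p) ^ (N - 1))
        + (deriv y w * (N * (w - p) ^ (N - 1)) + y w * (N * ((N - 1) * (w - p) ^ (N - 1 - 1))))) (at w)"
      using N by (auto intro!: derivative_eq_intros has_derivs np w simp: of_nat_diff)
    moreover have "eventually (\<lambda>v. deriv g v = deriv y v * (v - p) ^ N + y v * (N * (v - p) ^ (N - 1))) (nhds w)"
      using ev by eventually_elim (rule d1)
    ultimately have "(deriv g has_field_derivative
        (w - 6 * (y w)\<^sup>2) * (w - p) ^ N + deriv y w * (N * (w - p) ^ (N - 1))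
        + (deriv y w * (N * (w - p) ^ (N - 1)) + y w * (N * ((N - 1) * (w - p) ^ (N - 1 - 1))))) (at w)"
      by (subst DERIV_cong_ev[OF refl _ refl])
    from DERIV_imp_deriv[OF this] have d2: "deriv (deriv g) w = (w - 6 * (y w)\<^sup>2) * u ^ N + 2 * deriv y w * (N * u ^ (N - 1))
        + y w * (N * ((N - 1) * u ^ (N - 1 - 1)))"
      by (simp add: u)
    have gw: "g w = y w * u ^ N" using yg[OF w] u0 u by simp
    \<comment> \<open>For N = 1 the exponent N - 1 - 1 is truncated to 0, while its coefficient N -
      1 vanishes; the two cases therefore simplify differently.\<close>
    show ?thesis
    proof (cases "N = 1")
      case True
      then show ?thesis unfolding d2 d1[OF w] gw by (simp add: u algebra_simps power2_eq_square power3_eq_cube)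
    next
      case False
      define M where "M = N - 2"
      have M: "N = M + 2" using N False by (simp add: M_def)
      show ?thesis unfolding d2 d1[OF w] gw M u[symmetric]
        by (simp add: algebra_simps power2_eq_square power_add)
    qed
  qed
  have cont: "isCont f p" if "f holomorphic_on ball p r" for f
    using that r(3) by (metis centre_in_ball continuous_on_eq_continuous_at holomorphic_on_imp_continuous_on open_ball)
  have ext: "f p = 0" if "f holomorphic_on ball p r" "\<And>w. w \<in> ball p r - {p} \<Longrightarrow> f w = 0" for f :: "complex \<Rightarrow> complex"
  proof -
    have "f \<midarrow>p\<rightarrow> f p" using cont[OF that(1)] by (simp add: isCont_def)
    moreover have "f \<midarrow>p\<rightarrow> 0"
      by (rule tendsto_eventually)
         (use r(3) that(2) in \<open>auto simp: eventually_at dist_commute intro!: exI[of _ r]\<close>)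
    ultimately show ?thesis by (rule LIM_unique)
  qed
  have N2: "N = 2"
  proof (rule ccontr)
    assume "N \<noteq> 2"
    then consider "N = 1" | "N \<ge> 3" using N by linarith
    then show False
    proof cases
      case 1
      \<comment> \<open>For N = 1 the linear part dominates: after multiplication by (w - p)^3 the
        value at p is 2 g(p), which cannot vanish.\<close>
      define f where "f = (\<lambda>w. (w - p)\<^sup>2 * deriv (deriv g) w - 2 * (w - p) * deriv g w + 2 * g w
         - (w - p) ^ 3 * w + 6 * (w - p) * (g w)\<^sup>2)"
      have "f p = 0"
      proof (rule ext)
        show "f holomorphic_on ball p r" unfolding f_def by (intro holomorphic_intros g g' g'')
        fix w assume w: "w \<in> ball p r - {p}"
        have gw: "g w = y w * (w - p)" using yg[OF w] w 1 by simp
        define u where "u = w - p"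
        have "f w = ((w - p)\<^sup>2 * deriv (deriv g) w - 2 * N * (w - p) * deriv g w + N * (N + 1) * g w)
            - (w - p) ^ 3 * w + 6 * (w - p) * (g w)\<^sup>2"
          by (simp add: f_def 1)
        also have "\<dots> = 0" unfolding G[OF w refl] unfolding gw 1 unfolding u_def[symmetric]
          by (simp add: algebra_simps eval_nat_numeral)
        finally show "f w = 0" .
      qed
      then show False using gp by (simp add: f_def)
    next
      case ge3: 2
      define M where "M = N - 3"
      have 2: "N = M + 3" using ge3 by (simp add: M_def)
      \<comment> \<open>For N >= 3 the square dominates: after multiplication by (w - p)^(2 N) the
        value at p is 6 g(p)^2, which cannot vanish either.\<close>
      define f where "f = (\<lambda>w. (w - p) ^ (M + 1) * ((w - p)\<^sup>2 * deriv (deriv g) w - 2 * N * (w - p) * deriv g w + N * (N + 1) * g w)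
         - (w - p) ^ (2 * N) * w + 6 * (g w)\<^sup>2)"
      have "f p = 0"
      proof (rule ext)
        show "f holomorphic_on ball p r" unfolding f_def by (intro holomorphic_intros g g' g'')
        fix w assume w: "w \<in> ball p r - {p}"
        have gw: "g w = y w * (w - p) ^ N" using yg[OF w] w by simp
        define u where "u = w - p"
        show "f w = 0" unfolding f_def G[OF w refl] unfolding gw 2 unfolding u_def[symmetric]
          by (simp add: algebra_simps power_add mult_2 eval_nat_numeral)
      qed
      then show False using gp 2 by (simp add: f_def power_0_left)
    qed
  qed
  define f where "f = (\<lambda>w. (w - p)\<^sup>2 * deriv (deriv g) w - 4 * (w - p) * deriv g w + 6 * g w
     - (w - p) ^ 4 * w + 6 * (g w)\<^sup>2)"
  have fh: "f holomorphic_on ball p r" unfolding f_def by (intro holomorphic_intros g g' g'')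
  have f0: "f w = 0" if w: "w \<in> ball p r - {p}" for w
  proof -
    have gw: "g w = y w * (w - p) ^ 2" using yg[OF w] w N2 by simp
    define u where "u = w - p"
    have "f w = ((w - p)\<^sup>2 * deriv (deriv g) w - 2 * N * (w - p) * deriv g w + N * (N + 1) * g w)
       - (w - p) ^ 4 * w + 6 * (g w)\<^sup>2" by (simp add: f_def N2)
    also have "\<dots> = 0" unfolding G[OF w refl] unfolding gw N2 unfolding u_def[symmetric]
      by (simp add: algebra_simps eval_nat_numeral)
    finally show ?thesis .
  qed
  have fp: "f p = 0" by (rule ext[OF fh f0])
  then have "6 * (g p * (1 + g p)) = 0" by (simp add: f_def power2_eq_square algebra_simps)
  then have "g p * (1 + g p) = 0" by simp
  then have g1: "g p = -1" using gp by (simp add: add_eq_0_iff)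
  have pin: "p \<in> ball p r" using r(3) by simp
  \<comment> \<open>All second and third derivatives of g come with a factor z - p. At p there
    remains (-4 + 6 + 12 g(p)) g'(p) = -10 g'(p).\<close>
  have "(f has_field_derivative
      (0 * deriv (deriv g) p + 0 * deriv (deriv (deriv g)) p) - 4 * (1 * deriv g p) + 6 * deriv g p - 0 + 12 * g p * deriv g p) (at p)"
    unfolding f_def
    by (rule derivative_eq_intros refl holomorphic_derivI[OF g open_ball pin]
          holomorphic_derivI[OF g' open_ball pin] holomorphic_derivI[OF g'' open_ball pin] | simp)+
  moreover have "(f has_field_derivative 0) (at p)"
  proof -
    have "f w = 0" if "w \<in> ball p r" for w using f0[of w] fp that by (cases "w = p") auto
    then have "eventually (\<lambda>w. f w = 0) (nhds p)"
      unfolding eventually_nhds using r(3) by (intro exI[of _ "ball p r"]) auto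
    then have "(f has_field_derivative 0) (at p) \<longleftrightarrow> ((\<lambda>_. 0) has_field_derivative 0) (at p)"
      by (intro DERIV_cong_ev refl)
    then show ?thesis by simp
  qed
  ultimately have "- 4 * deriv g p + 6 * deriv g p + 12 * g p * deriv g p = 0"
    using DERIV_unique by fastforce
  then have "deriv g p = 0" by (simp add: g1)
  moreover have "zorder y p = -2" using N2 r(1) by (simp add: N_def)
  ultimately show ?thesis
    using that[of r g] r(3) g np yg N2 g1 by blast
qed

end

section \<open>Decay of perturbed oscillators\<close>

text \<open>This is f(x) = O(x^(-a)) as x tends to infinity.\<close>

definition dec :: "real \<Rightarrow> (real \<Rightarrow> 'a :: real_normed_vector) \<Rightarrow> bool" where
  "dec a f \<longleftrightarrow> (\<exists>K. eventually (\<lambda>x. norm (f x) \<le> K * x powr (-a)) at_top)"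

lemma decI: "eventually (\<lambda>x. norm (f x) \<le> K * x powr (-a)) at_top \<Longrightarrow> dec a f"
  by (auto simp: dec_def)

lemma decE:
  assumes "dec a f"
  obtains K where "K > 0" "eventually (\<lambda>x. norm (f x) \<le> K * x powr (-a)) at_top"
proof -
  obtain K where K: "eventually (\<lambda>x. norm (f x) \<le> K * x powr (-a)) at_top"
    using assms by (auto simp: dec_def)
  have "eventually (\<lambda>x. norm (f x) \<le> (\<bar>K\<bar> + 1) * x powr (-a)) at_top"
    using K
  proof eventually_elim
    case (elim x)
    have "K * x powr (-a) \<le> (\<bar>K\<bar> + 1) * x powr (-a)" by (intro mult_right_mono) auto
    then show ?case using elim by linarith
  qed
  then show ?thesis using that[of "\<bar>K\<bar> + 1"] by simp
qed

lemma dec_le: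
  assumes "dec a f" "eventually (\<lambda>x. norm (h x) \<le> norm (f x)) at_top"
  shows "dec a h"
proof -
  obtain K where "eventually (\<lambda>x. norm (f x) \<le> K * x powr (-a)) at_top" using assms(1) by (rule decE)
  with assms(2) have "eventually (\<lambda>x. norm (h x) \<le> K * x powr (-a)) at_top"
    by eventually_elim linarith
  then show ?thesis by (rule decI)
qed

lemma dec_mono:
  assumes "dec a f" "b \<le> a"
  shows "dec b f"
proof -
  obtain K where K: "K > 0" "eventually (\<lambda>x. norm (f x) \<le> K * x powr (-a)) at_top"
    using assms(1) by (rule decE)
  have "eventually (\<lambda>x. norm (f x) \<le> K * x powr (-b)) at_top"
    using K(2) eventually_ge_at_top[of 1]
  proof eventually_elim
    case (elim x)
    have "K * x powr (-a) \<le> K * x powr (-b)"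
      using elim K assms(2) by (intro mult_left_mono powr_mono) auto
    then show ?case using elim by linarith
  qed
  then show ?thesis by (rule decI)
qed

lemma dec_add:
  assumes "dec a f" "dec a h"
  shows "dec a (\<lambda>x. f x + h x)"
proof -
  obtain K where K: "eventually (\<lambda>x. norm (f x) \<le> K * x powr (-a)) at_top" using assms(1) by (rule decE)
  obtain L where L: "eventually (\<lambda>x. norm (h x) \<le> L * x powr (-a)) at_top" using assms(2) by (rule decE)
  have "eventually (\<lambda>x. norm (f x + h x) \<le> (K + L) * x powr (-a)) at_top"
    using K L
  proof eventually_elim
    case (elim x)
    then show ?case using norm_triangle_ineq[of "f x" "h x"] by (simp add: algebra_simps)
  qed
  then show ?thesis by (rule decI)
qed

lemma dec_minus: "dec a f \<Longrightarrow> dec a (\<lambda>x. - f x)"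
  by (simp add: dec_def)

lemma dec_diff: "dec a f \<Longrightarrow> dec a h \<Longrightarrow> dec a (\<lambda>x. f x - h x)"
  using dec_add[of a f "\<lambda>x. - h x"] dec_minus[of a h] by simp

lemma dec_mult:
  fixes f h :: "real \<Rightarrow> 'a :: real_normed_algebra"
  assumes "dec a f" "dec b h" "c \<le> a + b"
  shows "dec c (\<lambda>x. f x * h x)"
proof -
  obtain K where K: "K > 0" "eventually (\<lambda>x. norm (f x) \<le> K * x powr (-a)) at_top" using assms(1) by (rule decE)
  obtain L where L: "L > 0" "eventually (\<lambda>x. norm (h x) \<le> L * x powr (-b)) at_top" using assms(2) by (rule decE)
  have "eventually (\<lambda>x. norm (f x * h x) \<le> (K * L) * x powr (-(a + b))) at_top"
    using K(2) L(2)
  proof eventually_elim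
    case (elim x)
    have "norm (f x * h x) \<le> norm (f x) * norm (h x)" by (rule norm_mult_ineq)
    also have "\<dots> \<le> (K * x powr (-a)) * (L * x powr (-b))"
      using elim K L by (intro mult_mono) auto
    also have "\<dots> = (K * L) * x powr (-(a + b))" by (simp add: powr_add[of x "-a" "-b", simplified])
    finally show ?case .
  qed
  then have "dec (a + b) (\<lambda>x. f x * h x)" by (rule decI)
  then show ?thesis using assms(3) by (rule dec_mono)
qed

lemma dec_const: "a \<le> 0 \<Longrightarrow> dec a (\<lambda>x. c)"
  by (rule dec_mono[of 0]) (auto intro!: decI[of _ "norm c"] eventually_mono[OF eventually_gt_at_top[of 0]])

lemma dec_powr: "a \<le> - p \<Longrightarrow> dec a (\<lambda>x. of_real (x powr p) :: 'a :: real_normed_algebra_1)"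
  by (rule dec_mono[of "-p"]) (auto intro!: decI[of _ 1])

lemma dec_powr_real: "a \<le> - p \<Longrightarrow> dec a (\<lambda>x. x powr p)"
  using dec_powr[of a p, where 'a = real] by simp

lemma dec_tendsto:
  assumes "(f \<longlongrightarrow> l) at_top"
  shows "dec 0 f"
proof -
  have "eventually (\<lambda>x. norm (f x) < norm l + 1) at_top"
    by (rule order_tendstoD(2)[OF tendsto_norm[OF assms]]) simp
  then have "eventually (\<lambda>x. norm (f x) \<le> (norm l + 1) * x powr (-0)) at_top"
    using eventually_gt_at_top[of 0] by eventually_elim auto
  then show ?thesis by (rule decI)
qed

lemma dec_imp_tendsto:
  assumes "dec a f" "a > 0"
  shows "(f \<longlongrightarrow> 0) at_top"
proof -
  obtain K where K: "K > 0" "eventually (\<lambda>x. norm (f x) \<le> K * x powr (-a)) at_top" using assms(1) by (rule decE)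
  have "((\<lambda>x. K * x powr (-a)) \<longlongrightarrow> K * 0) at_top"
    by (intro tendsto_intros tendsto_neg_powr filterlim_ident) (use assms in auto)
  then show ?thesis using K(2) by (intro Lim_null_comparison[of f]) auto
qed

text \<open>On [x, z] the function is compared with the antiderivative -(K/b) t^(-b), and then z
  goes to infinity. The constant is kept explicit because \<open>linear_oscillator_zero\<close>
  iterates this bound.\<close>

lemma integrate_bound:
  fixes f f' :: "real \<Rightarrow> 'a :: real_normed_vector"
  assumes b: "b > 0" and lim: "(f \<longlongrightarrow> 0) at_top" and X: "X > 0"
    "\<And>x. x \<ge> X \<Longrightarrow> (f has_vector_derivative f' x) (at x)"
    "\<And>x. x \<ge> X \<Longrightarrow> norm (f' x) \<le> K * x powr (-(1 + b))"
    and x: "x \<ge> X"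
  shows "norm (f x) \<le> K / b * x powr (-b)"
proof -
  have K0: "K \<ge> 0"
    using order_trans[OF norm_ge_zero X(3)[OF x]] X(1) x by (simp add: zero_le_mult_iff not_le[symmetric])
  have bd: "norm (f x) \<le> norm (f z) + K / b * x powr (-b)" if z: "z > x" for z
  proof -
    have "norm (f z - f x) \<le> - (K / b) * z powr (-b) - (- (K / b) * x powr (-b))"
    proof (rule differentiable_bound_general[OF z])
      show "continuous_on {x..z} f"
        using x by (intro continuous_at_imp_continuous_on ballI has_vector_derivative_continuous[OF X(2)]) auto
      show "continuous_on {x..z} (\<lambda>x. - (K / b) * x powr - b)"
        using X(1) x by (intro continuous_intros) auto
      fix t assume t: "x < t" "t < z"
      show "(f has_vector_derivative f' t) (at t)" using X(2) x t by auto
      have "((\<lambda>x. - (K / b) * x powr - b) has_real_derivative - (K / b) * (- b * t powr (- b - 1))) (at t)"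
        using t x X(1) by (auto intro!: derivative_eq_intros)
      moreover have "- (K / b) * (- b * t powr (- b - 1)) = K * t powr (-(1 + b))"
      proof -
        have "- b - 1 = -(1 + b)" by simp
        then show ?thesis using b by (simp only:) simp
      qed
      ultimately have "((\<lambda>x. - (K / b) * x powr - b) has_real_derivative K * t powr (-(1 + b))) (at t)"
        by simp
      then show "((\<lambda>x. - (K / b) * x powr - b) has_vector_derivative K * t powr (-(1 + b))) (at t)"
        by (simp add: has_real_derivative_iff_has_vector_derivative)
      show "norm (f' t) \<le> K * t powr (-(1 + b))" using X(3) x t by auto
    qed
    moreover have "K / b * z powr (-b) \<ge> 0" using K0 b by simp
    ultimately show ?thesis using norm_triangle_ineq2[of "f x" "f z"] by (simp add: norm_minus_commute)
  qed
  have "((\<lambda>z. norm (f z) + K / b * x powr (-b)) \<longlongrightarrow> norm (0::'a) + K / b * x powr (-b)) at_top"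
    by (intro tendsto_intros lim)
  moreover have "eventually (\<lambda>z. norm (f x) \<le> norm (f z) + K / b * x powr (-b)) at_top"
    using eventually_gt_at_top[of x] by eventually_elim (rule bd)
  ultimately show ?thesis
    using tendsto_lowerbound[of _ _ at_top "norm (f x)"] by fastforce
qed

lemma dec_integrate:
  fixes f f' :: "real \<Rightarrow> 'a :: real_normed_vector"
  assumes b: "b > 0" and lim: "(f \<longlongrightarrow> 0) at_top"
    and d: "eventually (\<lambda>x. (f has_vector_derivative f' x) (at x)) at_top"
    and f': "dec (1 + b) f'"
  shows "dec b f"
proof -
  obtain K where K: "K > 0" "eventually (\<lambda>x. norm (f' x) \<le> K * x powr (-(1 + b))) at_top"
    using f' by (rule decE)
  obtain X where X: "X > 0" "\<And>x. x \<ge> X \<Longrightarrow> (f has_vector_derivative f' x) (at x)"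
      "\<And>x. x \<ge> X \<Longrightarrow> norm (f' x) \<le> K * x powr (-(1 + b))"
    using eventually_conj[OF d eventually_conj[OF K(2) eventually_gt_at_top[of 0]]]
    unfolding eventually_at_top_linorder by (metis dual_order.refl)
  have "norm (f x) \<le> K / b * x powr (-b)" if x: "x \<ge> X" for x
    by (rule integrate_bound[OF b lim X x])
  then show ?thesis
    by (intro decI[of f "K / b"]) (auto simp: eventually_at_top_linorder)
qed

lemmas vderiv = has_vector_derivative_add has_vector_derivative_diff has_vector_derivative_minus has_vector_derivative_mult has_vector_derivative_const

text \<open>A near-identity change of P, scaled by 48 to clear denominators. A monomial P^a Q^b
  rotates with frequency (a - b) w, so it is removed from the equation of P by dividing its
  coefficient by i (a - b - 1). This disposes of all three quadratic terms and of the cubic terms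
  P^3 and Q^3. The cubic terms that stay, including the resonant P^2 Q, are divisible by P Q; the
  others contain g^3 w, the derivative of g, or the forcing \<open>ps\<close>.\<close>

lemma normal_form_identity: fixes i w P Q g dg ps F :: complex
  assumes "i * i = -1" 
  shows "48 * (i * w * P + (g*w/4*((P-Q)*(P-Q)) + ps)) +
         (g * (12 * i * (P * (i * w * P + (g*w/4*((P-Q)*(P-Q)) + ps)) + (i * w * P + (g*w/4*((P-Q)*(P-Q)) + ps)) * P)
              + 24 * i * (P * (- (i * w * Q) + (g*w/4*((P-Q)*(P-Q)) + ps)) + (i * w * P + (g*w/4*((P-Q)*(P-Q)) + ps)) * Q)
              - 4 * i * (Q * (- (i * w * Q) + (g*w/4*((P-Q)*(P-Q)) + ps)) + (- (i * w * Q) + (g*w/4*((P-Q)*(P-Q)) + ps)) * Q))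
          + dg * (12 * i * (P * P) + 24 * i * (P * Q) - 4 * i * (Q * Q)))
         + (g * g * (3 * (Q * Q) * (- (i * w * Q) + (g*w/4*((P-Q)*(P-Q)) + ps)) - 18 * (P * P) * (i * w * P + (g*w/4*((P-Q)*(P-Q)) + ps)))
           + 2 * g * dg * (Q * Q * Q - 6 * (P * P * P))) = i * w * (48 * P + g * (12 * i * (P * P) + 24 * i * (P * Q) - 4 * i * (Q * Q))
        + g * g * (Q * Q * Q - 6 * (P * P * P))) + (ps * (48 + g * (48 * i * P + 16 * i * Q) + g * g * (3 * (Q * Q) - 18 * (P * P)))
        + i * (g * g * w) * ((P * Q) * (4 * Q - 20 * P))
        + (g * g * (g * w)) * ((P - Q) * (P - Q) * (3/4 * (Q * Q) - 9/2 * (P * P)))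
        + dg * (12 * i * (P * P) + 24 * i * (P * Q) - 4 * i * (Q * Q))
        + 2 * g * dg * (Q * Q * Q - 6 * (P * P * P)))"
  using assms by algebra

lemma normal_form_derivative:
  fixes P Q g :: "real \<Rightarrow> complex"
  assumes P: "(P has_vector_derivative p) (at x)" and Q: "(Q has_vector_derivative q) (at x)"
    and g: "(g has_vector_derivative dg) (at x)"
  shows "((\<lambda>x. 48 * P x + g x * (12 * i * (P x * P x) + 24 * i * (P x * Q x) - 4 * i * (Q x * Q x))
        + g x * g x * (Q x * Q x * Q x - 6 * (P x * P x * P x))) has_vector_derivative
     48 * p + (g x * (12 * i * (P x * p + p * P x) + 24 * i * (P x * q + p * Q x) - 4 * i * (Q x * q + q * Q x))
        + dg * (12 * i * (P x * P x) + 24 * i * (P x * Q x) - 4 * i * (Q x * Q x)))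
      + (g x * g x * (3 * (Q x * Q x) * q - 18 * (P x * P x) * p)
        + 2 * g x * dg * (Q x * Q x * Q x - 6 * (P x * P x * P x)))) (at x)"
proof -
  note m = has_vector_derivative_mult has_vector_derivative_mult_right has_vector_derivative_add has_vector_derivative_diff
  have 1: "((\<lambda>x. 12 * i * (P x * P x) + 24 * i * (P x * Q x) - 4 * i * (Q x * Q x)) has_vector_derivative
     12 * i * (P x * p + p * P x) + 24 * i * (P x * q + p * Q x) - 4 * i * (Q x * q + q * Q x)) (at x)"
    by (intro has_vector_derivative_add has_vector_derivative_diff has_vector_derivative_mult_right
        has_vector_derivative_mult P Q)
  have 2: "((\<lambda>x. g x * g x) has_vector_derivative g x * dg + dg * g x) (at x)"
    by (intro has_vector_derivative_mult g)
  have 3: "((\<lambda>x. Q x * Q x * Q x - 6 * (P x * P x * P x)) has_vector_derivative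
     (Q x * Q x * q + (Q x * q + q * Q x) * Q x) - 6 * (P x * P x * p + (P x * p + p * P x) * P x)) (at x)"
    by (intro has_vector_derivative_diff has_vector_derivative_mult_right has_vector_derivative_mult P Q)
  show ?thesis
    by (rule has_vector_derivative_eq_rhs[OF has_vector_derivative_add[OF has_vector_derivative_add[OF
          has_vector_derivative_mult_right[OF P, of 48] has_vector_derivative_mult[OF g 1]] has_vector_derivative_mult[OF 2 3]]])
       (simp add: algebra_simps)
qed

text \<open>For constant g and no forcing this quantity is a first integral. Squares stand in place
  of moduli because W^2 + V^2 = (W + i V)(W - i V) is the product that the normal form leaves
  behind.\<close>

lemma energy_derivative:
  fixes V W g :: "real \<Rightarrow> complex"
  assumes V: "(V has_vector_derivative w * W x) (at x)"
    and W: "(W has_vector_derivative - w * V x - g x * w * (V x * V x) + ps) (at x)"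
    and g: "(g has_vector_derivative dg) (at x)"
  shows "((\<lambda>x. W x * W x + V x * V x + 2 / 3 * (g x * (V x * V x * V x))) has_vector_derivative
      2 * (W x * ps) + 2 / 3 * (dg * (V x * V x * V x))) (at x)"
  by (rule has_vector_derivative_eq_rhs[OF has_vector_derivative_add[OF has_vector_derivative_add[OF
        has_vector_derivative_mult[OF W W] has_vector_derivative_mult[OF V V]]
        has_vector_derivative_mult_right[OF has_vector_derivative_mult[OF g has_vector_derivative_mult[OF has_vector_derivative_mult[OF V V] V]], of "2/3"]]])
     (simp add: algebra_simps)
text \<open>The frequency is c x^(1/4) and the nonlinearity has relative strength k x^(-5/8). The
  limit 55/4 = 22 * 5/8 is the exponent from which the last of the 23 steps in \<open>decay\<close>
  departs.\<close>

locale perturbed_oscillator =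
  fixes c k :: real and V W \<psi> :: "real \<Rightarrow> complex"
  assumes V: "eventually (\<lambda>x. (V has_vector_derivative of_real (c * x powr (1/4)) * W x) (at x)) at_top"
    and W: "eventually (\<lambda>x. (W has_vector_derivative
        - of_real (c * x powr (1/4)) * V x - of_real (k * x powr (-5/8)) * of_real (c * x powr (1/4)) * (V x * V x) + \<psi> x) (at x)) at_top"
    and V_lim: "(V \<longlongrightarrow> 0) at_top" and W_lim: "(W \<longlongrightarrow> 0) at_top"
    and \<psi>: "\<And>a. dec a V \<Longrightarrow> a \<le> 55/4 \<Longrightarrow> dec (a + 9/4) \<psi>"
begin

definition P :: "complex \<Rightarrow> real \<Rightarrow> complex" where "P \<iota> x = W x + \<iota> * V x"
definition w :: "real \<Rightarrow> complex" where "w x = of_real (c * x powr (1/4))"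
definition g :: "real \<Rightarrow> complex" where "g x = of_real (k * x powr (-5/8))"
definition dg :: "real \<Rightarrow> complex" where "dg x = of_real (- (5/8) * k * x powr (-13/8))"

lemma dec_w: "dec (-1/4) w" unfolding w_def of_real_mult
  by (rule dec_mult[OF dec_const[OF order.refl] dec_powr[OF order.refl]]) auto

lemma dec_g: "dec (5/8) g" unfolding g_def of_real_mult
  by (rule dec_mult[OF dec_const[OF order.refl] dec_powr[OF order.refl]]) auto

lemma dec_dg: "dec (13/8) dg" unfolding dg_def of_real_mult
  by (rule dec_mult[OF dec_const[OF order.refl] dec_powr[OF order.refl]]) auto

lemma deriv_g: "x > 0 \<Longrightarrow> (g has_vector_derivative dg x) (at x)"
  unfolding g_def dg_def
  by (intro has_vector_derivative_of_real)
     (auto intro!: derivative_eq_intros simp: has_real_derivative_iff_has_vector_derivative[symmetric])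

lemma deriv_P:
  assumes "\<iota> * \<iota> = -1"
  shows "eventually (\<lambda>x. (P \<iota> has_vector_derivative
    \<iota> * w x * P \<iota> x + (g x * w x / 4 * ((P \<iota> x - P (-\<iota>) x) * (P \<iota> x - P (-\<iota>) x)) + \<psi> x)) (at x)) at_top"
  using V W
proof eventually_elim
  case (elim x)
  have d: "(P \<iota> has_vector_derivative
    (- w x * V x - g x * w x * (V x * V x) + \<psi> x) + (\<iota> * (w x * W x))) (at x)"
    unfolding P_def
    by (intro has_vector_derivative_add has_vector_derivative_mult_right) (use elim in \<open>simp_all add: w_def g_def\<close>)
  have eq: "(- w x * V x - g x * w x * (V x * V x) + \<psi> x) + (\<iota> * (w x * W x))
     = \<iota> * w x * P \<iota> x + (g x * w x / 4 * ((P \<iota> x - P (-\<iota>) x) * (P \<iota> x - P (-\<iota>) x)) + \<psi> x)"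
  proof -
    have 1: "\<iota> * w x * P \<iota> x = \<iota> * (w x * W x) + (\<iota> * \<iota>) * (w x * V x)"
      by (simp add: P_def algebra_simps)
    have 2: "(P \<iota> x - P (-\<iota>) x) * (P \<iota> x - P (-\<iota>) x) = 4 * (\<iota> * \<iota>) * (V x * V x)"
      by (simp add: P_def algebra_simps)
    show ?thesis unfolding 1 2 assms by (simp add: algebra_simps)
  qed
  show ?case using d unfolding eq .
qed

text \<open>The energy drifts at a rate O(x^(-(a + 13/8))), so W^2 + V^2 gains 5/8 by integration
  from infinity. This does not bound V and W separately, as they are complex. It does tame the cubic
  terms of the normal form, whose variable U, freed from its rotation, can then be integrated from
  infinity with the same gain.\<close>

lemma decay_step:
  assumes dV: "dec a V" and dW: "dec a W" and a: "0 \<le> a" "a \<le> 55/4"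
  shows "dec (a + 5/8) V \<and> dec (a + 5/8) W"
proof -
  have d\<psi>: "dec (a + 9/4) \<psi>" by (rule \<psi>[OF dV a(2)])
  have V0: "dec 0 V" and W0: "dec 0 W" using V_lim W_lim by (auto intro: dec_tendsto)
  define Cf where "Cf = (\<lambda>x. W x * W x + V x * V x + 2 / 3 * (g x * (V x * V x * V x)))"
  have "eventually (\<lambda>x. (Cf has_vector_derivative
      2 * (W x * \<psi> x) + 2 / 3 * (dg x * (V x * V x * V x))) (at x)) at_top"
    using V W eventually_gt_at_top[of 0]
  proof eventually_elim
    case (elim x)
    note Vd = elim(1)[folded w_def]
    note Wd = elim(2)[folded w_def g_def]
    show ?case unfolding Cf_def by (rule energy_derivative[OF Vd Wd deriv_g[OF elim(3)]])
  qed
  moreover have "dec (1 + (a + 5/8)) (\<lambda>x. 2 * (W x * \<psi> x) + 2 / 3 * (dg x * (V x * V x * V x)))"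
  proof -
    have "dec (13/8 + a) (\<lambda>x. 2 * (W x * \<psi> x))"
      by (rule dec_mult[OF dec_const[OF order.refl] dec_mult[OF W0 d\<psi> order.refl]]) auto
    moreover have "dec (13/8 + a) (\<lambda>x. 2 / 3 * (dg x * (V x * V x * V x)))"
      by (rule dec_mult[OF dec_const[OF order.refl] dec_mult[OF dec_dg
            dec_mult[OF dec_mult[OF V0 V0 order.refl] dV order.refl] order.refl]]) auto
    ultimately show ?thesis using dec_add by (simp add: add.commute)
  qed
  moreover have g_lim: "(g \<longlongrightarrow> 0) at_top" by (rule dec_imp_tendsto[OF dec_g]) simp
  have "(Cf \<longlongrightarrow> 0 * 0 + 0 * 0 + 2 / 3 * (0 * (0 * 0 * 0))) at_top"
    unfolding Cf_def by (intro tendsto_intros V_lim W_lim g_lim)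
  ultimately have "dec (a + 5/8) Cf"
    using a by (intro dec_integrate[of "a + 5/8" Cf]) auto
  moreover have "dec (a + 5/8) (\<lambda>x. 2 / 3 * (g x * (V x * V x * V x)))"
    by (rule dec_mult[OF dec_const[OF order.refl] dec_mult[OF dec_g
          dec_mult[OF dec_mult[OF V0 V0 order.refl] dV order.refl] order.refl]]) auto
  ultimately have "dec (a + 5/8) (\<lambda>x. Cf x - 2 / 3 * (g x * (V x * V x * V x)))" by (rule dec_diff)
  then have dPQ: "dec (a + 5/8) (\<lambda>x. W x * W x + V x * V x)" by (simp add: Cf_def)
  have main: "dec (a + 5/8) (P \<iota>)" if \<iota>: "\<iota> * \<iota> = -1" for \<iota>
  proof -
    define Q where "Q = P (-\<iota>)"
    have P\<iota>: "\<iota> * (\<iota> * z) = - z" for z using \<iota> by (simp add: mult.assoc[symmetric])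
    have norm_\<iota>: "norm \<iota> = 1"
      using \<iota> by (metis norm_minus_cancel norm_mult norm_one abs_norm_cancel real_sqrt_abs2 real_sqrt_one)
    have PQ: "P \<iota> x * Q x = W x * W x + V x * V x" for x
      unfolding Q_def P_def by (simp add: algebra_simps P\<iota>)
    have dPQ': "dec (a + 5/8) (\<lambda>x. P \<iota> x * Q x)" unfolding PQ by (rule dPQ)
    have dP: "dec b (P j)" if "dec b V" "dec b W" for b j unfolding P_def
      by (rule dec_add[OF that(2) dec_mult[OF dec_const[OF order.refl] that(1)]]) auto
    have P0: "dec 0 (P \<iota>)" and Q0: "dec 0 Q" and Pa: "dec a (P \<iota>)" and Qa: "dec a Q"
      unfolding Q_def by (rule dP V0 W0 dV dW)+
    define U where "U = (\<lambda>x. 48 * P \<iota> x + g x * (12 * \<iota> * (P \<iota> x * P \<iota> x) + 24 * \<iota> * (P \<iota> x * Q x) - 4 * \<iota> * (Q x * Q x))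
        + g x * g x * (Q x * Q x * Q x - 6 * (P \<iota> x * P \<iota> x * P \<iota> x)))"
    define Rm where "Rm x = \<psi> x * (48 + g x * (48 * \<iota> * P \<iota> x + 16 * \<iota> * Q x) + g x * g x * (3 * (Q x * Q x) - 18 * (P \<iota> x * P \<iota> x)))
        + \<iota> * (g x * g x * w x) * ((P \<iota> x * Q x) * (4 * Q x - 20 * P \<iota> x))
        + (g x * g x * (g x * w x)) * ((P \<iota> x - Q x) * (P \<iota> x - Q x) * (3/4 * (Q x * Q x) - 9/2 * (P \<iota> x * P \<iota> x)))
        + dg x * (12 * \<iota> * (P \<iota> x * P \<iota> x) + 24 * \<iota> * (P \<iota> x * Q x) - 4 * \<iota> * (Q x * Q x))
        + 2 * g x * dg x * (Q x * Q x * Q x - 6 * (P \<iota> x * P \<iota> x * P \<iota> x))" for x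
    define \<phi> where "\<phi> = (\<lambda>x::real. 4/5 * c * x powr (5/4))"
    \<comment> \<open>An integrating factor of modulus 1: \<open>\<phi>\<close> is an antiderivative
      of the frequency and \<open>\<iota>\<close> is purely imaginary.\<close>
    define e where "e = (\<lambda>x. exp (- \<iota> * of_real (\<phi> x)))"
    have dU: "eventually (\<lambda>x. (U has_vector_derivative \<iota> * w x * U x + Rm x) (at x)) at_top"
      using deriv_P[OF \<iota>] deriv_P[of "- \<iota>", simplified, OF \<iota>] eventually_gt_at_top[of 0]
    proof eventually_elim
      case (elim x)
      note Pd = elim(1)[folded Q_def]
      note gd = deriv_g[OF elim(3)]
      define F where "F = g x * w x / 4 * ((P \<iota> x - Q x) * (P \<iota> x - Q x)) + \<psi> x"
      have F': "g x * w x / 4 * ((Q x - P \<iota> x) * (Q x - P \<iota> x)) + \<psi> x = F"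
        by (simp add: F_def algebra_simps)
      note Pd = Pd[folded F_def]
      have Qd': "(Q has_vector_derivative - (\<iota> * w x * Q x) + F) (at x)"
        using elim(2)[folded Q_def] F' by simp
      have eq: "48 * (\<iota> * w x * P \<iota> x + F) +
         (g x * (12 * \<iota> * (P \<iota> x * (\<iota> * w x * P \<iota> x + F) + (\<iota> * w x * P \<iota> x + F) * P \<iota> x)
              + 24 * \<iota> * (P \<iota> x * (- (\<iota> * w x * Q x) + F) + (\<iota> * w x * P \<iota> x + F) * Q x)
              - 4 * \<iota> * (Q x * (- (\<iota> * w x * Q x) + F) + (- (\<iota> * w x * Q x) + F) * Q x))
          + dg x * (12 * \<iota> * (P \<iota> x * P \<iota> x) + 24 * \<iota> * (P \<iota> x * Q x) - 4 * \<iota> * (Q x * Q x)))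
         + (g x * g x * (3 * (Q x * Q x) * (- (\<iota> * w x * Q x) + F) - 18 * (P \<iota> x * P \<iota> x) * (\<iota> * w x * P \<iota> x + F))
           + 2 * g x * dg x * (Q x * Q x * Q x - 6 * (P \<iota> x * P \<iota> x * P \<iota> x))) = \<iota> * w x * U x + Rm x"
        unfolding U_def Rm_def F_def by (rule normal_form_identity[OF \<iota>])
      show ?case
        unfolding eq[symmetric] unfolding U_def by (rule normal_form_derivative[OF Pd Qd' gd])
    qed
    have dRm: "dec (1 + (a + 5/8)) Rm"
    proof -
      note cst = dec_const[OF order.refl]
      have c0: "dec 0 (\<lambda>x. r * f x)" if "dec 0 f" for r and f :: "real \<Rightarrow> complex"
        by (rule dec_mult[OF cst that]) simp
      have ca: "dec b (\<lambda>x. r * f x)" if "dec b f" for r b and f :: "real \<Rightarrow> complex"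
        by (rule dec_mult[OF cst that]) simp
      have m00: "dec 0 (\<lambda>x. f x * h x)" if "dec 0 f" "dec 0 h" for f h :: "real \<Rightarrow> complex"
        by (rule dec_mult[OF that]) simp
      have m0a: "dec a (\<lambda>x. f x * h x)" if "dec 0 f" "dec a h" for f h :: "real \<Rightarrow> complex"
        by (rule dec_mult[OF that]) simp
      have g0: "dec 0 g" by (rule dec_mono[OF dec_g]) simp
      note z = P0 Q0 g0 m00 c0 dec_add dec_diff cst
      have t1: "dec (a + 9/4) (\<lambda>x. \<psi> x * (48 + g x * (48 * \<iota> * P \<iota> x + 16 * \<iota> * Q x) + g x * g x * (3 * (Q x * Q x) - 18 * (P \<iota> x * P \<iota> x))))"
        by (rule dec_mult[OF d\<psi>, of 0]) (intro z, simp)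
      have ggw: "dec 1 (\<lambda>x. g x * g x * w x)"
        by (rule dec_mult[OF dec_mult[OF dec_g dec_g order.refl] dec_w]) simp
      \<comment> \<open>Here g^2 w is only O(1/x); the factor P Q, which has already gained 5/8
        through the energy, makes the term integrable with the required exponent.\<close>
      have t2: "dec (1 + (a + 5/8)) (\<lambda>x. \<iota> * (g x * g x * w x) * ((P \<iota> x * Q x) * (4 * Q x - 20 * P \<iota> x)))"
        by (rule dec_mult[OF ca[OF ggw] dec_mult[OF dPQ', of 0 _ "a + 5/8"]]) ((intro z)?, simp)+
      have gggw: "dec (13/8) (\<lambda>x. g x * g x * (g x * w x))"
        by (rule dec_mult[OF dec_mult[OF dec_g dec_g order.refl] dec_mult[OF dec_g dec_w order.refl]]) simp
      have t3: "dec (13/8 + a) (\<lambda>x. (g x * g x * (g x * w x)) * ((P \<iota> x - Q x) * (P \<iota> x - Q x) * (3/4 * (Q x * Q x) - 9/2 * (P \<iota> x * P \<iota> x))))"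
        by (rule dec_mult[OF gggw, of a]) (intro m0a z dec_diff ca Pa Qa, simp)
      have t4: "dec (13/8 + a) (\<lambda>x. dg x * (12 * \<iota> * (P \<iota> x * P \<iota> x) + 24 * \<iota> * (P \<iota> x * Q x) - 4 * \<iota> * (Q x * Q x)))"
        by (rule dec_mult[OF dec_dg, of a]) (intro m0a dec_add dec_diff ca Pa Qa P0 Q0, simp)
      have t5: "dec (13/8 + a) (\<lambda>x. 2 * g x * dg x * (Q x * Q x * Q x - 6 * (P \<iota> x * P \<iota> x * P \<iota> x)))"
        by (rule dec_mult[OF dec_mult[OF ca[OF g0] dec_dg order.refl], of a])
           (intro dec_diff ca m0a[of "\<lambda>x. _ x * _ x"] m00 Pa Qa P0 Q0, simp)
      have r: "13/8 + a = 1 + (a + 5/8)" by simp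
      show ?thesis unfolding Rm_def
        by (intro dec_add dec_mono[OF t1] t2 t3[unfolded r] t4[unfolded r] t5[unfolded r]) simp
    qed
    have norm_e: "norm (e x) = 1" for x
    proof -
      have "Re \<iota> = 0"
        using \<iota> by (auto simp: complex_eq_iff) (metis add.inverse_inverse mult_eq_0_iff neg_0_le_iff_le
            not_one_le_zero zero_le_square mult_zero_left diff_0_right add_0)
      then show ?thesis by (simp add: e_def norm_exp_eq_Re)
    qed
    have de: "(e has_vector_derivative - \<iota> * w x * e x) (at x)" if "x > 0" for x
    proof -
      have "(\<phi> has_real_derivative c * x powr (1/4)) (at x)"
        unfolding \<phi>_def using that by (auto intro!: derivative_eq_intros)
      then have 1: "((\<lambda>x. - \<iota> * of_real (\<phi> x)) has_vector_derivative - \<iota> * w x) (at x)"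
        unfolding w_def by (intro has_vector_derivative_mult_right has_vector_derivative_of_real)
      have 2: "(exp has_field_derivative exp (- \<iota> * of_real (\<phi> x))) (at (- \<iota> * of_real (\<phi> x)))" by (rule DERIV_exp)
      show ?thesis using field_vector_diff_chain_at[OF 1 2] by (simp add: e_def o_def)
    qed
    have "dec (a + 5/8) (\<lambda>x. e x * U x)"
    proof (rule dec_integrate)
      have gl: "(g \<longlongrightarrow> 0) at_top" by (rule g_lim)
      have Pl: "(P j \<longlongrightarrow> 0 + j * 0) at_top" for j unfolding P_def by (intro tendsto_intros V_lim W_lim)
      have "(U \<longlongrightarrow> 48 * 0 + 0 * (12 * \<iota> * (0 * 0) + 24 * \<iota> * (0 * 0) - 4 * \<iota> * (0 * 0)) + 0 * 0 * (0 * 0 * 0 - 6 * (0 * 0 * 0))) at_top"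
        unfolding U_def Q_def using Pl by (intro tendsto_intros gl) auto
      then have "((\<lambda>x. norm (U x)) \<longlongrightarrow> 0) at_top" by (simp add: tendsto_norm_zero)
      then show "((\<lambda>x. e x * U x) \<longlongrightarrow> 0) at_top"
        by (intro Lim_null_comparison[of "\<lambda>x. e x * U x" "\<lambda>x. norm (U x)"]) (auto simp: norm_mult norm_e)
      show "eventually (\<lambda>x. ((\<lambda>x. e x * U x) has_vector_derivative e x * Rm x) (at x)) at_top"
        using dU eventually_gt_at_top[of 0]
      proof eventually_elim
        case (elim x)
        show ?case
          by (rule has_vector_derivative_eq_rhs, rule has_vector_derivative_mult[OF de[OF elim(2)] elim(1)])
             (simp add: algebra_simps)
      qed
      show "dec (1 + (a + 5/8)) (\<lambda>x. e x * Rm x)"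
        by (rule dec_le[OF dRm]) (simp add: norm_mult norm_e)
    qed (use a in simp)
    then have dUa: "dec (a + 5/8) U" by (rule dec_le) (simp add: norm_mult norm_e)
    have "dec (a + 5/8) (\<lambda>x. U x - (g x * (12 * \<iota> * (P \<iota> x * P \<iota> x) + 24 * \<iota> * (P \<iota> x * Q x) - 4 * \<iota> * (Q x * Q x))
        + g x * g x * (Q x * Q x * Q x - 6 * (P \<iota> x * P \<iota> x * P \<iota> x))))" (is "dec _ (\<lambda>x. _ - (?A x + ?B x))")
    proof -
      note cst = dec_const[OF order.refl]
      have ca: "dec b (\<lambda>x. r * f x)" if "dec b f" for r b and f :: "real \<Rightarrow> complex"
        by (rule dec_mult[OF cst that]) simp
      have m00: "dec 0 (\<lambda>x. f x * h x)" if "dec 0 f" "dec 0 h" for f h :: "real \<Rightarrow> complex"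
        by (rule dec_mult[OF that]) simp
      have m0a: "dec a (\<lambda>x. f x * h x)" if "dec 0 f" "dec a h" for f h :: "real \<Rightarrow> complex"
        by (rule dec_mult[OF that]) simp
      have g0: "dec 0 g" by (rule dec_mono[OF dec_g]) simp
      have "dec (a + 5/8) ?A"
        by (rule dec_mult[OF dec_g, of a]) (intro m0a dec_add dec_diff ca Pa Qa P0 Q0, simp)
      moreover have "dec (a + 5/8) ?B"
        by (rule dec_mult[OF dec_mult[OF g0 dec_g order.refl], of a])
           (intro dec_diff ca m0a[of "\<lambda>x. _ x * _ x"] m00 Pa Qa P0 Q0, simp)
      ultimately show ?thesis by (intro dec_diff dec_add dUa)
    qed
    then have "dec (a + 5/8) (\<lambda>x. 48 * P \<iota> x)" by (simp add: U_def algebra_simps)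
    then show ?thesis by (rule dec_le) (simp add: norm_mult)
  qed
  have p: "dec (a + 5/8) (P \<i>)" and q: "dec (a + 5/8) (P (-\<i>))" by (auto intro!: main)
  have "dec (a + 5/8) (\<lambda>x. P \<i> x + P (-\<i>) x)" "dec (a + 5/8) (\<lambda>x. P \<i> x - P (-\<i>) x)"
    by (intro dec_add dec_diff p q)+
  then show ?thesis by (auto simp: P_def norm_mult intro: dec_le)
qed

text \<open>Twenty-three gains of 5/8 reach 115/8, which exceeds the exponent 14 of the barrier on
  the right half line.\<close>

lemma decay: "dec (115/8) V" "dec (115/8) W"
proof -
  have "dec (real n * (5/8)) V \<and> dec (real n * (5/8)) W" if "n \<le> 23" for n
    using that
  proof (induction n)
    case 0
    show ?case using V_lim W_lim by (auto intro: dec_tendsto)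
  next
    case (Suc n)
    then have "dec (real n * (5/8) + 5/8) V \<and> dec (real n * (5/8) + 5/8) W"
      by (intro decay_step) auto
    moreover have "real n * (5/8) + 5/8 = real (Suc n) * (5/8)" by simp
    ultimately show ?case by (simp only:)
  qed
  from this[of 23] show "dec (115/8) V" "dec (115/8) W" by auto
qed

end

section \<open>The asymptotic expansion at infinity\<close>

text \<open>The division by sqrt 6 makes the coefficients of the expansion at infinity
  rational.\<close>

definition sx :: "real \<Rightarrow> real" where "sx x = x powr (-5/2) / sqrt 6"
definition qx :: "real \<Rightarrow> real" where "qx x = x powr (1/2) / sqrt 6"
definition asy :: "real poly \<Rightarrow> real \<Rightarrow> real" where "asy p x = qx x * poly p (sx x)"
text \<open>The Euler operator x d/dx carried over to polynomials in s: the prefactor sqrt(x/6) is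
  homogeneous of degree 1/2 in x, and s of degree -5/2.\<close>

definition Dp :: "real poly \<Rightarrow> real poly" where
  "Dp p = smult (1/2) p - smult (5/2) (pCons 0 (pderiv p))"
text \<open>The formal series solution of the equation in powers of s, cut off after s^6. The
  expansion in \<open>y0\<close> stops at s^3; the additional terms push the residual down to
  O(x^(-33/2)).\<close>

definition ac :: "real poly" where
  "ac = [:1, 1/8, -49/128, 1225/256, -4412401/32768, 220680075/32768, -2207064977649/4194304:]"
definition rc :: "real poly" where
  "rc = [:-7759635184525/65536, 521259289724005/1073741824, -919345895307525/134217728,
    12855236226571785249/68719476736, -487055264797454643675/68719476736,
    4871135815564780869567201/17592186044416:]"
definition resid :: "real \<Rightarrow> real" where "resid x = x * sx x ^ 7 * poly rc (sx x)"

lemma asy_deriv: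
  assumes "x > 0"
  shows "(asy p has_real_derivative asy (Dp p) x / x) (at x)"
proof -
  have q: "(qx has_real_derivative qx x / (2 * x)) (at x)"
    unfolding qx_def using assms
    using assms powr_diff[of x "1/2" 1]
    by (intro DERIV_cong[OF DERIV_cdivide[OF has_real_derivative_powr[OF assms]]]) simp
  have s: "(sx has_real_derivative - (5/2) * sx x / x) (at x)"
    unfolding sx_def using assms
    by (intro DERIV_cong[OF DERIV_cdivide[OF has_real_derivative_powr[OF assms]]])
       (simp add: powr_diff[of x "-5/2" 1, simplified])
  have "((\<lambda>x. qx x * poly p (sx x)) has_real_derivative
     qx x / (2 * x) * poly p (sx x) + qx x * (poly (pderiv p) (sx x) * (- (5/2) * sx x / x))) (at x)"
    by (auto intro!: derivative_eq_intros q s DERIV_chain2[OF poly_DERIV s])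
  moreover have "qx x / (2 * x) * poly p (sx x) + qx x * (poly (pderiv p) (sx x) * (- (5/2) * sx x / x))
     = asy (Dp p) x / x"
    using assms by (simp add: asy_def Dp_def field_simps)
  ultimately show ?thesis by (simp add: asy_def[abs_def])
qed

lemma asy_deriv2:
  assumes "x > 0"
  shows "((\<lambda>x. asy (Dp p) x / x) has_real_derivative asy (Dp (Dp p) - Dp p) x / x\<^sup>2) (at x)"
  by (rule DERIV_cong[OF DERIV_divide[OF asy_deriv[OF assms] DERIV_ident]])
     (use assms in \<open>auto simp: asy_def field_simps power2_eq_square\<close>)

lemma Dp_ac: "Dp ac = [:1/2, -1/4, 441/256, -8575/256, 83835619/65536, -662040225/8192, 64004884351821/8388608:]"
  by (simp add: Dp_def ac_def pderiv_pCons)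

lemma Dp_Dp_ac: "Dp (Dp ac) - Dp ac = [:-1/4, 3/4, -4851/512, 8575/32, -1760547999/131072, 8606522925/8192, -1984151414906451/16777216:]"
  unfolding Dp_ac by (simp add: Dp_def pderiv_pCons)

lemma ac_sq: "ac * ac = [:1, 1/4, -3/4, 4851/512, -8575/32, 1760547999/131072, -8606522925/8192, -2315192331949/16777216, 521259289724005/1073741824, -919345895307525/134217728, 12855236226571785249/68719476736, -487055264797454643675/68719476736, 4871135815564780869567201/17592186044416:]"
  by (simp add: ac_def)

text \<open>This is y'' + 6 y^2 - x divided by x. The second derivative acquires a factor s because
  qx / x^2 = x s, and the square is normalised by 6 qx^2 = x. The seven leading zeros say that the
  coefficients of \<open>ac\<close> are the right ones.\<close>

lemma rc_identity:
  "pCons 0 (Dp (Dp ac) - Dp ac) + ac * ac - 1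
    = pCons 0 (pCons 0 (pCons 0 (pCons 0 (pCons 0 (pCons 0 (pCons 0 rc))))))"
  unfolding ac_sq Dp_Dp_ac rc_def by (simp add: one_pCons)

lemma qx_sq: "x > 0 \<Longrightarrow> 6 * (qx x * qx x) = x"
  by (simp add: qx_def powr_add[symmetric])

lemma qx_sx:
  assumes "x > 0"
  shows "qx x = x ^ 3 * sx x"
proof -
  have "x ^ 3 = x powr 3" using assms by simp
  then show ?thesis unfolding qx_def sx_def by (simp only: times_divide_eq_right powr_add[symmetric]) simp
qed

lemma asy_ode:
  assumes "x > 0"
  shows "asy (Dp (Dp ac) - Dp ac) x / x\<^sup>2 = x - 6 * (asy ac x)\<^sup>2 + resid x"
proof -
  define A B C where "A = poly (Dp (Dp ac) - Dp ac) (sx x)" and "B = poly ac (sx x)" and "C = poly rc (sx x)"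
  have 1: "sx x * A + B * B - 1 = sx x ^ 7 * C"
    using arg_cong[OF rc_identity, of "\<lambda>p. poly p (sx x)"]
    unfolding A_def B_def C_def poly_add poly_diff poly_pCons poly_mult poly_1
    by (simp add: eval_nat_numeral mult_ac)
  have 2: "asy (Dp (Dp ac) - Dp ac) x / x\<^sup>2 = x * (sx x * A)"
    unfolding asy_def qx_sx[OF assms] A_def[symmetric] using assms by (simp add: field_simps eval_nat_numeral)
  have "6 * (asy ac x)\<^sup>2 = (6 * (qx x * qx x)) * (B * B)"
    unfolding asy_def B_def[symmetric] by (simp add: power2_eq_square algebra_simps)
  then have 3: "6 * (asy ac x)\<^sup>2 = x * (B * B)" unfolding qx_sq[OF assms] .
  have "x * (sx x * A) = x - x * (B * B) + x * (sx x ^ 7 * C)"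
    unfolding 1[symmetric] by (simp add: algebra_simps)
  then show ?thesis unfolding 2 3 resid_def C_def[symmetric] by (simp add: mult.assoc)
qed

lemma dec_sx: "dec (5/2) sx"
proof -
  have "dec (5/2) (\<lambda>x. x powr (-5/2) * (1 / sqrt 6))"
    by (rule dec_mult[OF dec_powr_real[of "5/2"] dec_const[of 0]]) auto
  then show ?thesis by (simp add: sx_def[abs_def])
qed

lemma dec_qx: "dec (-1/2) qx"
proof -
  have "dec (-1/2) (\<lambda>x. x powr (1/2) * (1 / sqrt 6))"
    by (rule dec_mult[OF dec_powr_real[of "-1/2"] dec_const[of 0]]) auto
  then show ?thesis by (simp add: qx_def[abs_def])
qed

lemma dec_poly_sx: "dec 0 (\<lambda>x. poly p (sx x))"
proof (rule dec_tendsto)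
  have "(sx \<longlongrightarrow> 0) at_top" by (rule dec_imp_tendsto[OF dec_sx]) simp
  then show "((\<lambda>x. poly p (sx x)) \<longlongrightarrow> poly p 0) at_top" by (intro tendsto_intros)
qed

lemma dec_power:
  fixes f :: "real \<Rightarrow> 'a :: real_normed_algebra_1"
  assumes "dec a f"
  shows "dec (real n * a) (\<lambda>x. f x ^ n)"
proof (induction n)
  case 0
  show ?case by (simp add: dec_const)
next
  case (Suc n)
  have "dec (real (Suc n) * a) (\<lambda>x. f x * f x ^ n)"
    by (rule dec_mult[OF assms Suc]) (simp add: algebra_simps)
  then show ?case by simp
qed

lemma dec_resid: "dec (33/2) resid"
proof -
  have "dec (35/2) (\<lambda>x. sx x ^ 7)"
    using dec_power[OF dec_sx, of 7] by simp
  moreover have "dec (-1) (\<lambda>x. x powr 1)" by (rule dec_powr_real) simp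
  ultimately have "dec (33/2) (\<lambda>x. x powr 1 * sx x ^ 7 * poly rc (sx x))"
    by (intro dec_mult[OF dec_mult[OF _ _ order.refl] dec_poly_sx]) auto
  then show ?thesis
    by (rule dec_le) (auto simp: resid_def eventually_at_top_linorder intro!: exI[of _ 0])
qed

section \<open>The error of the tritronquee solution as a perturbed oscillator\<close>

locale tritronquee = painleve_I +
  assumes trit: "((\<lambda>x::real. (y (complex_of_real x) / complex_of_real (sqrt (x / 6)) - 1)
                      * complex_of_real (x powr (5/8))) \<longlongrightarrow> 0) at_top"

context painleve_I
begin

lemma not_pole_if_bounded:
  assumes lim: "(\<gamma> \<longlongrightarrow> z) F" and F: "F \<noteq> bot" and ne: "eventually (\<lambda>s. \<gamma> s \<noteq> z) F"
    and bd: "eventually (\<lambda>s. cmod (y (\<gamma> s)) \<le> C) F"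
  shows "\<not> is_pole y z"
proof
  assume "is_pole y z"
  then have "filterlim y at_infinity (at z)" by (simp add: is_pole_def)
  moreover have "filterlim \<gamma> (at z) F" using lim ne by (simp add: filterlim_at)
  ultimately have "filterlim (\<lambda>s. y (\<gamma> s)) at_infinity F" by (rule filterlim_compose)
  then have "eventually (\<lambda>s. cmod (y (\<gamma> s)) \<ge> \<bar>C\<bar> + 1) F"
    by (subst (asm) filterlim_at_infinity[of 0]) auto
  with bd have "eventually (\<lambda>s. False) F" by eventually_elim auto
  then show False using F by simp
qed

lemma vderiv_real:
  assumes "\<not> is_pole y (of_real x)"
  shows "((\<lambda>x. y (of_real x)) has_vector_derivative deriv y (of_real x)) (at x within S)"
    and "((\<lambda>x. deriv y (of_real x)) has_vector_derivative of_real x - 6 * (y (of_real x))\<^sup>2) (at x within S)"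
  using has_derivs[OF assms] by (auto intro: has_vector_derivative_real_field)

end

text \<open>Landau's inequality from a first-order Taylor expansion on [x, x + h]. The asymptotic
  hypothesis speaks of y only; smallness of y' is recovered from y and from y'', which the
  differential equation supplies.\<close>

lemma landau_derivative_bound:
  fixes f f' f'' :: "real \<Rightarrow> complex"
  assumes h: "h > 0"
    and d1: "\<And>t. t \<in> {x..x+h} \<Longrightarrow> (f has_vector_derivative f' t) (at t)"
    and d2: "\<And>t. t \<in> {x..x+h} \<Longrightarrow> (f' has_vector_derivative f'' t) (at t)"
    and f: "\<And>t. t \<in> {x..x+h} \<Longrightarrow> norm (f t) \<le> d"
    and f'': "\<And>t. t \<in> {x..x+h} \<Longrightarrow> norm (f'' t) \<le> M"
  shows "norm (f' x) \<le> 2 * d / h + h * M"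
proof -
  have M0: "0 \<le> M" using order_trans[OF norm_ge_zero f''[of x]] h by simp
  have M: "norm (f' t - f' x) \<le> h * M" if t: "t \<in> {x..x+h}" for t
  proof (cases "t = x")
    case True
    then show ?thesis using True h M0 by simp
  next
    case False
    then have "x < t" using t by auto
    have "norm (f' t - f' x) \<le> M * t - M * x"
    proof (rule differentiable_bound_general[OF \<open>x < t\<close>])
      show "continuous_on {x..t} f'"
        using t by (intro continuous_at_imp_continuous_on ballI has_vector_derivative_continuous[OF d2]) auto
      show "continuous_on {x..t} (\<lambda>t. M * t)" by (intro continuous_intros)
      fix s assume s: "x < s" "s < t"
      show "(f' has_vector_derivative f'' s) (at s)" using d2 s t by auto
      show "((\<lambda>t. M * t) has_vector_derivative M) (at s)"
        unfolding has_real_derivative_iff_has_vector_derivative[symmetric] by (auto intro!: derivative_eq_intros)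
      show "norm (f'' s) \<le> M" using f'' s t by auto
    qed
    also have "\<dots> = (t - x) * M" by (simp add: algebra_simps)
    also have "\<dots> \<le> h * M"
      using t M0 by (intro mult_right_mono) auto
    finally show ?thesis .
  qed
  define g where "g = (\<lambda>t. f t - of_real t * f' x)"
  have "norm (g (x + h) - g x) \<le> (h * M) * (x + h) - (h * M) * x"
  proof (rule differentiable_bound_general)
    show "x < x + h" using h by simp
    have dg: "(g has_vector_derivative f' t - f' x) (at t)" if "t \<in> {x..x+h}" for t
    proof -
      have 1: "(of_real has_vector_derivative (1::complex)) (at t)"
        using has_vector_derivative_of_real[OF DERIV_ident, of "at t", where 'a = complex] by simp
      show ?thesis unfolding g_def
        by (rule has_vector_derivative_eq_rhs[OF has_vector_derivative_diff[OF d1[OF that] has_vector_derivative_mult_left[OF 1]]]) simp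
    qed
    show "continuous_on {x..x+h} g"
      by (intro continuous_at_imp_continuous_on ballI has_vector_derivative_continuous[OF dg]) auto
    show "continuous_on {x..x+h} (\<lambda>t. (h * M) * t)" by (intro continuous_intros)
    fix s assume s: "x < s" "s < x + h"
    show "(g has_vector_derivative f' s - f' x) (at s)" using dg s by auto
    show "((\<lambda>t. (h * M) * t) has_vector_derivative h * M) (at s)"
      unfolding has_real_derivative_iff_has_vector_derivative[symmetric] by (auto intro!: derivative_eq_intros)
    show "norm (f' s - f' x) \<le> h * M" using M s by auto
  qed
  then have 1: "norm (f (x + h) - f x - of_real h * f' x) \<le> h * (h * M)"
    by (simp add: g_def algebra_simps)
  have "norm (of_real h * f' x) \<le> norm (f (x + h) - f x) + norm (f (x + h) - f x - of_real h * f' x)"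
    using norm_triangle_ineq4[of "f (x + h) - f x" "f (x + h) - f x - of_real h * f' x"] by simp
  also have "\<dots> \<le> 2 * d + h * (h * M)"
    using 1 f[of x] f[of "x + h"] h norm_triangle_ineq4[of "f (x + h)" "f x"] by auto
  finally have "h * norm (f' x) \<le> 2 * d + h * (h * M)" using h by (simp add: norm_mult)
  then show ?thesis using h by (simp add: field_simps)
qed

text \<open>Linearised at sqrt(x/6) the error satisfies E'' = -12 sqrt(x/6) E, an oscillator of
  frequency (24 x)^(1/4) = c4 x^(1/4).\<close>

definition c4 :: real where "c4 = 24 powr (1/4)"

lemma c4: "c4 > 0" "c4 ^ 4 = 24" "sqrt 6 = c4\<^sup>2 / 2"
proof -
  show "c4 > 0" by (simp add: c4_def)
  show 4: "c4 ^ 4 = 24" by (simp add: c4_def powr_power)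
  have "(c4\<^sup>2 / 2)\<^sup>2 = 6" using 4 by (simp add: power_divide power_mult[symmetric])
  then show "sqrt 6 = c4\<^sup>2 / 2" by (metis abs_power2 abs_divide abs_numeral real_sqrt_abs)
qed

text \<open>All exponents in the change of variables are multiples of 1/8; with a = x^(1/8) the
  analytic identities turn into polynomial ones.\<close>

lemma eighth_powers:
  fixes x :: real
  assumes "x > 0"
  defines "a \<equiv> x powr (1/8)"
  shows "a > 0" "a ^ 8 = x" "x powr (1/4) = a\<^sup>2" "x powr (5/8) = a ^ 5" "x powr (1/2) = a ^ 4" "x powr (3/8) = a ^ 3"
    "x powr (-1/8) = 1 / a" "x powr (-9/8) = 1 / a ^ 9" "x powr (-5/8) = 1 / a ^ 5" "x powr (-7/8) = 1 / a ^ 7"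
proof -
  have p: "a ^ n = x powr (real n / 8)" if "n > 0" for n using that assms by (simp add: a_def powr_power)
  show "a > 0" using assms by simp
  show "a ^ 8 = x" using p[of 8] assms by simp
  show "x powr (1/4) = a\<^sup>2" "x powr (5/8) = a ^ 5" "x powr (1/2) = a ^ 4" "x powr (3/8) = a ^ 3"
    using p by simp_all
  show "x powr (-1/8) = 1 / a" "x powr (-9/8) = 1 / a ^ 9" "x powr (-5/8) = 1 / a ^ 5" "x powr (-7/8) = 1 / a ^ 7"
    using p[of 1] p[of 9] p[of 5] p[of 7] by (simp_all add: powr_minus_divide[symmetric])
qed

text \<open>The derivative of \<open>Wf\<close> with a = x^(1/8), c = c4 and their inverses as
  letters. The relation c^4 = 24 turns the main part of -12 Y E, where Y is replaced by 2 a^4 / c^2,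
  into -w V; the rest of Y joins the Liouville-Green term 9/64 a^(-16) in the forcing.\<close>

lemma oscillator_identity:
  fixes a c ia ic E D Y R :: complex
  assumes "a * ia = 1" "c * ic = 1" "c ^ 4 = 24"
  shows "(ia * ic) * ((- 12 * Y * E - 6 * (E * E) - R) + (ia ^ 8 / 8 * D + - (ia ^ 16 / 8) * E)) + - (ia ^ 9 * ic / 8) * (D + ia ^ 8 / 8 * E)
     = - (c * a\<^sup>2) * (a * E) - (6 * ic\<^sup>2 * ia ^ 5) * (c * a\<^sup>2) * ((a * E) * (a * E))
       + - (ia * ic) * ((12 * (Y - 2 * a ^ 4 * ic\<^sup>2) + 9 / 64 * ia ^ 16) * E + R)"
proof -
  have 1: "(6 * ic\<^sup>2 * ia ^ 5) * (c * a\<^sup>2) * ((a * E) * (a * E)) = 6 * ic * ia * (c * ic) * (a * ia) ^ 4 * (E * E)"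
    by (simp add: power_mult_distrib power2_eq_square eval_nat_numeral)
  then have 1: "(6 * ic\<^sup>2 * ia ^ 5) * (c * a\<^sup>2) * ((a * E) * (a * E)) = 6 * ic * ia * (E * E)"
    by (simp add: assms)
  have "24 * ia * a ^ 4 * ic ^ 3 * E = (a * ia) * (c * ic) ^ 3 * (c * a ^ 3 * E)"
    unfolding assms(3)[symmetric] by (simp add: eval_nat_numeral)
  then have 2: "24 * ia * a ^ 4 * ic ^ 3 * E = c * a ^ 3 * E" by (simp add: assms)
  have "(ia * ic) * ((- 12 * Y * E - 6 * (E * E) - R) + (ia ^ 8 / 8 * D + - (ia ^ 16 / 8) * E)) + - (ia ^ 9 * ic / 8) * (D + ia ^ 8 / 8 * E)
     = - (c * a\<^sup>2) * (a * E) - 6 * ic * ia * (E * E)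
       + - (ia * ic) * ((12 * (Y - 2 * a ^ 4 * ic\<^sup>2) + 9 / 64 * ia ^ 16) * E + R)
       + (c * a ^ 3 * E - 24 * ia * a ^ 4 * ic ^ 3 * E)"
  proof -
    define u where "u = ia ^ 8"
    have u: "ia ^ 9 = ia * u" "ia ^ 16 = u * u" by (simp_all add: u_def eval_nat_numeral)
    show ?thesis unfolding u u_def[symmetric]
      by (simp add: field_simps eval_nat_numeral)
  qed
  then show ?thesis unfolding 1 2 by simp
qed

context tritronquee
begin

definition Ef :: "real \<Rightarrow> complex" where "Ef x = y (of_real x) - of_real (asy ac x)"
definition Ed :: "real \<Rightarrow> complex" where "Ed x = deriv y (of_real x) - of_real (asy (Dp ac) x / x)"
definition E2 :: "real \<Rightarrow> complex" where
  "E2 x = - 12 * of_real (asy ac x) * Ef x - 6 * (Ef x * Ef x) - of_real (resid x)"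
text \<open>Liouville-Green variables: x^(1/8) is proportional to the square root of the frequency,
  which makes the amplitude of the free oscillation constant. \<open>Wf\<close> is V' divided by the
  frequency.\<close>

definition Vf :: "real \<Rightarrow> complex" where "Vf x = of_real (x powr (1/8)) * Ef x"
definition Wf :: "real \<Rightarrow> complex" where
  "Wf x = of_real (x powr (-1/8) / c4) * (Ed x + of_real (1 / (8 * x)) * Ef x)"
definition psi :: "real \<Rightarrow> complex" where
  "psi x = - of_real (x powr (-1/8) / c4) *
     (of_real (12 * (asy ac x - qx x) + 9 / (64 * x\<^sup>2)) * Ef x + of_real (resid x))"

lemma Ef_deriv:
  assumes "x > 0" "\<not> is_pole y (of_real x)"
  shows "(Ef has_vector_derivative Ed x) (at x)" "(Ed has_vector_derivative E2 x) (at x)"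
proof -
  show "(Ef has_vector_derivative Ed x) (at x)"
    unfolding Ef_def[abs_def] Ed_def
    by (intro has_vector_derivative_diff vderiv_real assms has_vector_derivative_of_real asy_deriv)
  have "(Ed has_vector_derivative of_real x - 6 * (y (of_real x))\<^sup>2 - of_real (asy (Dp (Dp ac) - Dp ac) x / x\<^sup>2)) (at x)"
    unfolding Ed_def[abs_def]
    by (intro has_vector_derivative_diff vderiv_real assms has_vector_derivative_of_real asy_deriv2)
  moreover have "of_real x - 6 * (y (of_real x))\<^sup>2 - of_real (asy (Dp (Dp ac) - Dp ac) x / x\<^sup>2) = E2 x"
    unfolding asy_ode[OF assms(1)] E2_def Ef_def by (simp add: algebra_simps power2_eq_square)
  ultimately show "(Ed has_vector_derivative E2 x) (at x)" by simp
qed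

lemma Vf_deriv:
  assumes x: "x > 0" and np: "\<not> is_pole y (of_real x)"
  shows "(Vf has_vector_derivative of_real (c4 * x powr (1/4)) * Wf x) (at x)"
proof -
  note e = eighth_powers[OF x]
  define a where "a = x powr (1/8)"
  have h: "((\<lambda>x. x powr (1/8)) has_real_derivative 1 / (8 * a ^ 7)) (at x)"
    by (rule DERIV_cong[OF has_real_derivative_powr[OF x]]) (use e(10) in \<open>simp add: a_def mult.commute\<close>)
  have xa: "x = a ^ 8" and a0: "a > 0" using e by (simp_all add: a_def)
  have "(Vf has_vector_derivative of_real a * Ed x + of_real (1 / (8 * a ^ 7)) * Ef x) (at x)"
    unfolding Vf_def[abs_def] a_def
    by (intro has_vector_derivative_mult has_vector_derivative_of_real h[unfolded a_def] Ef_deriv x np)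
  moreover have "of_real a * Ed x + of_real (1 / (8 * a ^ 7)) * Ef x = of_real (c4 * x powr (1/4)) * Wf x"
  proof -
    have 1: "c4 * x powr (1/4) * (x powr (-1/8) / c4) = a"
      using c4(1) a0 unfolding e(3,7) a_def[symmetric] by (simp add: power2_eq_square)
    have 2: "a * (1 / (8 * x)) = 1 / (8 * a ^ 7)"
      using a0 unfolding xa by (simp add: eval_nat_numeral)
    show ?thesis unfolding Wf_def mult.assoc[symmetric] of_real_mult[symmetric] 1
      unfolding distrib_left mult.assoc[symmetric] of_real_mult[symmetric] 2 ..
  qed
  ultimately show ?thesis by simp
qed

lemma Wf_deriv:
  assumes x: "x > 0" and np: "\<not> is_pole y (of_real x)"
  shows "(Wf has_vector_derivative - of_real (c4 * x powr (1/4)) * Vf x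
      - of_real (6 / c4\<^sup>2 * x powr (-5/8)) * of_real (c4 * x powr (1/4)) * (Vf x * Vf x) + psi x) (at x)"
proof -
  note e = eighth_powers[OF x]
  define a where "a = x powr (1/8)"
  have xa: "x = a ^ 8" and a0: "a > 0" using e by (simp_all add: a_def)
  have h0: "((\<lambda>x. x powr (-1/8)) has_real_derivative - (1 / (8 * a ^ 9))) (at x)"
    by (rule DERIV_cong[OF has_real_derivative_powr[OF x]]) (use e(8) in \<open>simp add: a_def mult.commute\<close>)
  have h: "((\<lambda>x. x powr (-1/8) / c4) has_real_derivative - (1 / (8 * a ^ 9)) / c4) (at x)"
    by (rule DERIV_cdivide[OF h0])
  have k: "((\<lambda>x. 1 / (8 * x)) has_real_derivative - (1 / (8 * x\<^sup>2))) (at x)"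
    using x by (auto intro!: derivative_eq_intros simp: power2_eq_square)
  define ia ic where "ia = complex_of_real (1 / a)" and "ic = complex_of_real (1 / c4)"
  have ia: "of_real a * ia = 1" and ic: "of_real c4 * ic = 1"
    using a0 c4(1) by (simp_all add: ia_def ic_def)
  have c4': "complex_of_real c4 ^ 4 = 24" unfolding of_real_power[symmetric] c4(2) by simp
  have d: "(Wf has_vector_derivative
     of_real (x powr (-1/8) / c4) * (E2 x + (of_real (1 / (8 * x)) * Ed x + of_real (- (1 / (8 * x\<^sup>2))) * Ef x))
     + of_real (- (1 / (8 * a ^ 9)) / c4) * (Ed x + of_real (1 / (8 * x)) * Ef x)) (at x)"
    unfolding Wf_def[abs_def]
    by (intro has_vector_derivative_mult has_vector_derivative_add has_vector_derivative_of_real h k Ef_deriv x np)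
  have eqs: "of_real (x powr (-1/8) / c4) = ia * ic"
    "of_real (1 / (8 * x)) = ia ^ 8 / 8" "of_real (- (1 / (8 * x\<^sup>2))) = - (ia ^ 16 / 8)"
    "of_real (- (1 / (8 * a ^ 9)) / c4) = - (ia ^ 9 * ic / 8)"
    "of_real (c4 * x powr (1/4)) = of_real c4 * (of_real a)\<^sup>2"
    "of_real (6 / c4\<^sup>2 * x powr (-5/8)) = 6 * ic\<^sup>2 * ia ^ 5"
    "of_real (x powr (1/8)) = of_real a"
    "of_real (12 * (asy ac x - qx x) + 9 / (64 * x\<^sup>2))
       = 12 * (of_real (asy ac x) - 2 * of_real a ^ 4 * ic\<^sup>2) + 9/64 * ia ^ 16"
  proof -
    have q: "qx x = 2 * a ^ 4 * (1 / c4)\<^sup>2"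
      unfolding qx_def e(5) c4(3) a_def[symmetric] by (simp add: power_divide)
    have x2: "1 / x\<^sup>2 = (1 / a) ^ 16" unfolding xa by (simp add: power_divide power_mult[symmetric])
    show "of_real (x powr (-1/8) / c4) = ia * ic" unfolding e(7) a_def[symmetric] ia_def ic_def by simp
    show "of_real (1 / (8 * x)) = ia ^ 8 / 8" unfolding xa ia_def by (simp add: power_divide)
    have "complex_of_real (- (1 / (8 * x\<^sup>2))) = complex_of_real (- (1 / x\<^sup>2) / 8)" by simp
    then show "of_real (- (1 / (8 * x\<^sup>2))) = - (ia ^ 16 / 8)" unfolding x2 ia_def by simp
    show "of_real (- (1 / (8 * a ^ 9)) / c4) = - (ia ^ 9 * ic / 8)" unfolding ia_def ic_def by (simp add: power_divide)
    show "of_real (c4 * x powr (1/4)) = of_real c4 * (of_real a)\<^sup>2" unfolding e(3) a_def by simp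
    show "of_real (6 / c4\<^sup>2 * x powr (-5/8)) = 6 * ic\<^sup>2 * ia ^ 5"
      unfolding e(9) a_def[symmetric] ia_def ic_def by (simp add: power_divide)
    show "of_real (x powr (1/8)) = of_real a" by (simp add: a_def)
    have "12 * (asy ac x - qx x) + 9 / (64 * x\<^sup>2) = 12 * (asy ac x - 2 * a ^ 4 * (1 / c4)\<^sup>2) + 9/64 * (1 / a) ^ 16"
      unfolding q x2[symmetric] by simp
    then show "of_real (12 * (asy ac x - qx x) + 9 / (64 * x\<^sup>2))
       = 12 * (of_real (asy ac x) - 2 * of_real a ^ 4 * ic\<^sup>2) + 9/64 * ia ^ 16"
      unfolding ia_def ic_def by (simp only: of_real_add of_real_mult of_real_diff of_real_power of_real_numeral of_real_divide)
  qed
  show ?thesis using d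
    unfolding eqs psi_def Vf_def E2_def
      oscillator_identity[OF ia ic c4', of "of_real (asy ac x)" "Ef x" "of_real (resid x)" "Ed x"] .
qed

end

lemma qx_sqrt: "x > 0 \<Longrightarrow> qx x = sqrt (x / 6)"
  by (simp add: qx_def powr_half_sqrt real_sqrt_divide)

lemma qx_pos: "x > 0 \<Longrightarrow> qx x > 0"
  by (simp add: qx_def)

lemma dec_asy_diff: "dec 2 (\<lambda>x. asy ac x - qx x)"
proof -
  obtain r where r: "ac = pCons 1 r" by (simp add: ac_def)
  have "asy ac x - qx x = qx x * sx x * poly r (sx x)" for x
    unfolding asy_def r by (simp add: algebra_simps)
  moreover have "dec 2 (\<lambda>x. qx x * sx x * poly r (sx x))"
    by (rule dec_mult[OF dec_mult[OF dec_qx dec_sx order.refl] dec_poly_sx]) simp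
  ultimately show ?thesis by simp
qed

text \<open>After undoing the rotation only the term kap v is left in the derivative. It is
  integrable, so for large x integration from infinity turns any bound for F into half of it;
  iteration forces F = 0.\<close>

lemma linear_oscillator_zero:
  fixes v w kap :: "real \<Rightarrow> real"
  assumes v: "eventually (\<lambda>x. (v has_real_derivative c * x powr (1/4) * w x) (at x)) at_top"
    and w: "eventually (\<lambda>x. (w has_real_derivative - (c * x powr (1/4)) * v x + kap x * v x) (at x)) at_top"
    and lim: "(v \<longlongrightarrow> 0) at_top" "(w \<longlongrightarrow> 0) at_top" and kap: "dec (9/4) kap"
  shows "eventually (\<lambda>x. v x = 0) at_top"
proof -
  define ph where "ph = (\<lambda>x::real. 4/5 * c * x powr (5/4))"
  define e where "e = (\<lambda>x. exp (- \<i> * complex_of_real (ph x)))"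
  define F where "F = (\<lambda>x. e x * (of_real (w x) + \<i> * of_real (v x)))"
  define F' where "F' = (\<lambda>x. e x * of_real (kap x * v x))"
  have norm_e: "norm (e x) = 1" for x by (simp add: e_def norm_exp_eq_Re)
  have normF: "norm (F x) \<ge> \<bar>v x\<bar>" for x
  proof -
    have "\<bar>v x\<bar> = \<bar>Im (of_real (w x) + \<i> * of_real (v x))\<bar>" by simp
    also have "\<dots> \<le> norm (of_real (w x) + \<i> * complex_of_real (v x))" by (rule abs_Im_le_cmod)
    finally show ?thesis by (simp add: F_def norm_mult norm_e)
  qed
  have dF: "eventually (\<lambda>x. (F has_vector_derivative F' x) (at x)) at_top"
    using v w eventually_gt_at_top[of 0]
  proof eventually_elim
    case (elim x)
    have "(ph has_real_derivative c * x powr (1/4)) (at x)"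
      unfolding ph_def using elim(3) by (auto intro!: derivative_eq_intros)
    then have 1: "((\<lambda>x. - \<i> * complex_of_real (ph x)) has_vector_derivative - \<i> * of_real (c * x powr (1/4))) (at x)"
      by (intro has_vector_derivative_mult_right has_vector_derivative_of_real)
    have 2: "(exp has_field_derivative exp (- \<i> * complex_of_real (ph x))) (at (- \<i> * complex_of_real (ph x)))" by (rule DERIV_exp)
    have de: "(e has_vector_derivative - \<i> * of_real (c * x powr (1/4)) * e x) (at x)"
      using field_vector_diff_chain_at[OF 1 2] by (simp add: e_def o_def)
    have "((\<lambda>x. of_real (w x) + \<i> * complex_of_real (v x)) has_vector_derivative
        of_real (- (c * x powr (1/4)) * v x + kap x * v x) + \<i> * of_real (c * x powr (1/4) * w x)) (at x)"
      by (intro has_vector_derivative_add has_vector_derivative_mult_right has_vector_derivative_of_real elim)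
    from has_vector_derivative_mult[OF de this] show ?case
      unfolding F_def F'_def
      by (rule has_vector_derivative_eq_rhs) (simp add: algebra_simps)
  qed
  have limF: "(F \<longlongrightarrow> 0) at_top"
  proof (rule Lim_null_comparison)
    have "((\<lambda>x. norm (of_real (w x) + \<i> * complex_of_real (v x))) \<longlongrightarrow> norm (of_real 0 + \<i> * complex_of_real 0)) at_top"
      by (intro tendsto_intros lim)
    then show "((\<lambda>x. norm (of_real (w x) + \<i> * complex_of_real (v x))) \<longlongrightarrow> 0) at_top" by simp
    show "eventually (\<lambda>x. norm (F x) \<le> norm (of_real (w x) + \<i> * complex_of_real (v x))) at_top"
      by (simp add: F_def norm_mult norm_e)
  qed
  obtain K where K: "K > 0" "eventually (\<lambda>x. norm (kap x) \<le> K * x powr (-(9/4))) at_top"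
    using kap by (rule decE)
  have "((\<lambda>x. K / (5/4) * x powr (-(5/4))) \<longlongrightarrow> K / (5/4) * 0) at_top"
    by (intro tendsto_intros tendsto_neg_powr filterlim_ident) auto
  then have ev: "eventually (\<lambda>x. K / (5/4) * x powr (-(5/4)) < 1/2) at_top"
    by (rule order_tendstoD(2)) simp
  have ev2: "eventually (\<lambda>x. norm (F x) < 1) at_top"
    using limF by (auto simp: tendsto_iff)
  obtain X where X: "X > 0" "\<And>x. x \<ge> X \<Longrightarrow> (F has_vector_derivative F' x) (at x)"
    "\<And>x. x \<ge> X \<Longrightarrow> norm (kap x) \<le> K * x powr (-(9/4))"
    "\<And>x. x \<ge> X \<Longrightarrow> K / (5/4) * x powr (-(5/4)) < 1/2" "\<And>x. x \<ge> X \<Longrightarrow> norm (F x) < 1"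
    using eventually_conj[OF dF eventually_conj[OF K(2) eventually_conj[OF ev eventually_conj[OF ev2 eventually_gt_at_top[of 0]]]]]
    unfolding eventually_at_top_linorder by (metis order.refl)
  have F: "norm (F x) \<le> (1/2) ^ n" if "x \<ge> X" for x n
    using that
  proof (induction n arbitrary: x)
    case 0
    then show ?case using X(5)[of x] by simp
  next
    case (Suc n)
    have "norm (F x) \<le> (K * (1/2) ^ n) / (5/4) * x powr (-(5/4))"
    proof (rule integrate_bound[OF _ limF X(1,2) _ Suc.prems])
      fix t assume t: "t \<ge> X"
      have "norm (F' t) = norm (kap t) * \<bar>v t\<bar>" by (simp add: F'_def norm_mult norm_e abs_mult)
      also have "\<dots> \<le> (K * t powr (-(9/4))) * (1/2) ^ n"
        using X(3)[OF t] order_trans[OF normF Suc.IH[OF t]] K(1) by (intro mult_mono) auto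
      finally show "norm (F' t) \<le> K * (1/2) ^ n * t powr (-(1 + 5/4))" by (simp add: algebra_simps)
    qed simp_all
    also have "\<dots> = (K / (5/4) * x powr (-(5/4))) * (1/2) ^ n" by simp
    also have "\<dots> \<le> 1/2 * (1/2) ^ n" using X(4)[OF Suc.prems] by (intro mult_right_mono) auto
    finally show ?case by simp
  qed
  have "v x = 0" if "x \<ge> X" for x
  proof -
    have "(\<lambda>n. (1/2::real) ^ n) \<longlonglongrightarrow> 0" by (rule LIMSEQ_realpow_zero) auto
    then have "norm (F x) \<le> 0" by (rule tendsto_lowerbound) (use F[OF that] in auto)
    then show ?thesis using normF[of x] by simp
  qed
  then show ?thesis by (auto simp: eventually_at_top_linorder)
qed

context painleve_I
begin

text \<open>The function y(z) - cnj (y (cnj z)) is holomorphic on the part of the nonpole set that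
  is symmetric under conjugation. It vanishes on a far part of the ray, hence on the whole component
  containing the ray.\<close>

lemma real_on_axis:
  assumes np: "\<And>x. x > a \<Longrightarrow> \<not> is_pole y (of_real x)"
    and re: "eventually (\<lambda>x. Im (y (of_real x)) = 0) at_top" and x: "x > a"
  shows "Im (y (of_real x)) = 0" "Im (deriv y (of_real x)) = 0"
proof -
  define N where "N = {z. \<not> is_pole y z}"
  define U where "U = N \<inter> cnj ` N"
  have oN: "open N" using open_nonpoles by (simp add: N_def)
  have ocN: "open (cnj ` N)"
    using oN by (simp add: open_vimage[of _ cnj] image_cnj_conv_vimage_cnj continuous_on_cnj)
  have oU: "open U" unfolding U_def using oN ocN by (rule open_Int)
  obtain X where X: "X > a" "\<And>t. t \<ge> X \<Longrightarrow> Im (y (of_real t)) = 0"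
    using eventually_conj[OF re eventually_gt_at_top[of a]] unfolding eventually_at_top_linorder by (metis order.refl)
  define S where "S = connected_component_set U (of_real X)"
  have ray: "of_real ` {a<..} \<subseteq> S"
    unfolding S_def
  proof (rule connected_component_maximal)
    show "connected (complex_of_real ` {a<..})"
      by (intro connected_continuous_image continuous_intros) auto
    show "complex_of_real ` {a<..} \<subseteq> U"
    proof
      fix z assume "z \<in> complex_of_real ` {a<..}"
      then obtain t where t: "z = of_real t" "t > a" by auto
      then have "z \<in> N" using np by (simp add: N_def)
      moreover have "z = cnj z" using t by simp
      ultimately show "z \<in> U" unfolding U_def by blast
    qed
  qed (use X in auto)
  have SU: "S \<subseteq> U" unfolding S_def by (rule connected_component_subset)
  define f where "f = (\<lambda>z. y z - (cnj \<circ> y \<circ> cnj) z)"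
  have "f holomorphic_on U" unfolding f_def
  proof (rule holomorphic_on_diff)
    show "y holomorphic_on U" by (rule holomorphic_onI) (auto simp: U_def N_def)
    show "(cnj \<circ> y \<circ> cnj) holomorphic_on U"
      by (rule holomorphic_on_compose_cnj_cnj[OF _ oU], rule holomorphic_onI) (auto simp: U_def N_def)
  qed
  then have holf: "f holomorphic_on S" using SU by (rule holomorphic_on_subset)
  have "complex_of_real (X + 1) islimpt (of_real ` {X<..})"
    unfolding islimpt_approachable
  proof (intro allI impI)
    fix e :: real assume "e > 0"
    then show "\<exists>x'\<in>complex_of_real ` {X<..}. x' \<noteq> of_real (X + 1) \<and> dist x' (of_real (X + 1)) < e"
      by (intro bexI[of _ "of_real (X + 1 + e / 2)"]) (auto simp: dist_norm norm_of_real[symmetric] simp del: norm_of_real of_real_add, simp add: dist_norm flip: of_real_diff)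
  qed
  note lim = this
  have fz: "f z = 0" if "z \<in> of_real ` {X<..}" for z
    using that X(2) by (auto simp: f_def complex_eq_iff)
  have f0: "f z = 0" if "z \<in> S" for z
  proof (rule analytic_continuation[OF holf _ _ _ _ lim fz that])
    show "open S" "connected S" using oU by (auto simp: S_def open_connected_component)
    show "complex_of_real ` {X<..} \<subseteq> S" using ray X(1) by (meson dual_order.trans greaterThan_subset_iff image_mono less_imp_le)
    show "complex_of_real (X + 1) \<in> S" using X(1) by (intro subsetD[OF ray] imageI) simp
  qed
  have Im0: "Im (y (of_real t)) = 0" if "t > a" for t
    using f0[of "of_real t"] ray that by (auto simp: f_def complex_eq_iff)
  show "Im (y (of_real x)) = 0" by (rule Im0[OF x])
  have "((\<lambda>t. y (of_real t)) has_vector_derivative deriv y (of_real x)) (at x)"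
    by (rule vderiv_real[OF np[OF x]])
  from bounded_linear.has_vector_derivative[OF bounded_linear_Im this]
  have "((\<lambda>t. Im (y (of_real t))) has_real_derivative Im (deriv y (of_real x))) (at x)"
    by (simp add: has_real_derivative_iff_has_vector_derivative)
  moreover have "((\<lambda>t. Im (y (of_real t))) has_real_derivative 0) (at x)"
  proof -
    have "eventually (\<lambda>t. t \<in> {a<..}) (nhds x)" using x by (intro eventually_nhds_in_open) auto
    then have "eventually (\<lambda>t. Im (y (of_real t)) = 0) (nhds x)" by eventually_elim (use Im0 in auto)
    then have "((\<lambda>t. Im (y (of_real t))) has_real_derivative 0) (at x) \<longleftrightarrow> ((\<lambda>_. 0) has_real_derivative 0) (at x)"
      by (intro DERIV_cong_ev refl)
    then show ?thesis by simp
  qed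
  ultimately show "Im (deriv y (of_real x)) = 0" by (rule DERIV_unique)
qed

end

context tritronquee
begin

lemma eventually_near_sqrt: "eventually (\<lambda>x. cmod (y (of_real x)) \<le> 2 * qx x) at_top"
proof -
  have "eventually (\<lambda>x. cmod ((y (of_real x) / of_real (sqrt (x / 6)) - 1) * of_real (x powr (5/8))) < 1) at_top"
    using trit by (auto simp: tendsto_iff)
  then show ?thesis using eventually_ge_at_top[of 1]
  proof eventually_elim
    case (elim x)
    define q where "q = complex_of_real (qx x)"
    have q: "q \<noteq> 0" "cmod q = qx x" using qx_pos[of x] elim by (auto simp: q_def)
    have "cmod (y (of_real x) / q - 1) * 1 \<le> cmod (y (of_real x) / q - 1) * x powr (5/8)"
      using elim by (intro mult_left_mono ge_one_powr_ge_zero) auto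
    also have "\<dots> < 1" using elim by (simp add: norm_mult q_def qx_sqrt)
    finally have "cmod (y (of_real x) / q) \<le> 2"
      using norm_triangle_ineq2[of "y (of_real x) / q" 1] by simp
    then show ?case using q qx_pos[of x] elim by (simp add: norm_divide field_simps)
  qed
qed

lemma eventually_not_pole: "eventually (\<lambda>x. \<not> is_pole y (of_real x)) at_top"
proof -
  obtain X where X: "X > 0" "\<And>x. x \<ge> X \<Longrightarrow> cmod (y (of_real x)) \<le> 2 * qx x"
    using eventually_conj[OF eventually_near_sqrt eventually_gt_at_top[of 0]] unfolding eventually_at_top_linorder by (metis order.refl)
  have "\<not> is_pole y (of_real x)" if x: "x > X" for x
  proof (rule not_pole_if_bounded[where \<gamma> = of_real and F = "at x"])
    show "(complex_of_real \<longlongrightarrow> of_real x) (at x)" by (intro tendsto_intros)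
    show "eventually (\<lambda>s. complex_of_real s \<noteq> of_real x) (at x)" by (simp add: eventually_at_filter)
    have "eventually (\<lambda>s. s \<in> {X<..<x + 1}) (at x)" by (rule eventually_at_in_open') (use x in auto)
    then show "eventually (\<lambda>s. cmod (y (of_real s)) \<le> 2 * qx (x + 1)) (at x)"
    proof eventually_elim
      case (elim s)
      have "qx s \<le> qx (x + 1)" using elim X(1) x by (simp add: qx_sqrt)
      then show ?case using X(2)[of s] elim by simp
    qed
  qed simp
  then show ?thesis by (intro eventually_mono[OF eventually_gt_at_top[of X]]) auto
qed

text \<open>Since x^(5/8) (y / qx - 1) = sqrt 6 x^(1/8) (y - qx), the defining asymptotics says
  exactly that this scaled difference vanishes at infinity; replacing qx by the expansion changes it
  by O(x^(-15/8)).\<close>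

lemma Vf_lim: "(Vf \<longlongrightarrow> 0) at_top"
proof -
  define h where "h x = (y (of_real x) / of_real (sqrt (x / 6)) - 1) * of_real (x powr (5/8))" for x :: real
  have "(h \<longlongrightarrow> 0) at_top" using trit by (simp add: h_def[abs_def])
  moreover have "((\<lambda>x. x powr (1/8) * (asy ac x - qx x)) \<longlongrightarrow> 0) at_top"
    by (rule dec_imp_tendsto[OF dec_mult[OF dec_powr_real[OF order.refl] dec_asy_diff order.refl]]) simp
  then have "((\<lambda>x. complex_of_real (x powr (1/8) * (asy ac x - qx x))) \<longlongrightarrow> of_real 0) at_top"
    by (rule tendsto_of_real)
  ultimately have "((\<lambda>x. of_real (1 / sqrt 6) * h x - of_real (x powr (1/8) * (asy ac x - qx x)))
      \<longlongrightarrow> of_real (1 / sqrt 6) * 0 - of_real 0) at_top"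
    by (intro tendsto_diff tendsto_mult tendsto_const)
  moreover have "eventually (\<lambda>x. of_real (1 / sqrt 6) * h x - of_real (x powr (1/8) * (asy ac x - qx x)) = Vf x) at_top"
    using eventually_gt_at_top[of 0]
  proof eventually_elim
    case (elim x)
    define q where "q = complex_of_real (qx x)"
    have q0: "q \<noteq> 0" using qx_pos[OF elim] by (simp add: q_def)
    have "1 / sqrt 6 * x powr (5/8) = x powr (1/8) * qx x"
      by (simp add: qx_def powr_add[symmetric])
    then have "of_real (1 / sqrt 6) * complex_of_real (x powr (5/8)) = of_real (x powr (1/8)) * q"
      unfolding q_def of_real_mult[symmetric] by simp
    moreover have "h x = (y (of_real x) / q - 1) * of_real (x powr (5/8))" using elim by (simp add: h_def q_def qx_sqrt)
    ultimately have "of_real (1 / sqrt 6) * h x = (y (of_real x) / q - 1) * (of_real (x powr (1/8)) * q)"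
      by (simp only: mult.left_commute[of "of_real (1 / sqrt 6)"])
    also have "\<dots> = of_real (x powr (1/8)) * (y (of_real x) - q)" using q0 by (simp add: field_simps)
    finally show ?case by (simp add: Vf_def Ef_def q_def algebra_simps)
  qed
  ultimately show ?thesis by (simp add: Lim_transform_eventually)
qed

lemma Ef_Vf: "x > 0 \<Longrightarrow> Ef x = of_real (x powr (-1/8)) * Vf x"
  by (simp add: Vf_def powr_minus field_simps)

lemma Wf_lim: "(Wf \<longlongrightarrow> 0) at_top"
proof -
  have e2: "((\<lambda>x. of_real (x powr (-3/8)) * E2 x) \<longlongrightarrow> 0) at_top"
  proof -
    have 1: "((\<lambda>x. complex_of_real (poly ac (sx x) / sqrt 6)) \<longlongrightarrow> of_real (poly ac 0 / sqrt 6)) at_top"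
      by (intro tendsto_intros dec_imp_tendsto[OF dec_sx]) auto
    have 2: "((\<lambda>x. complex_of_real (x powr (-5/8))) \<longlongrightarrow> of_real 0) at_top"
      by (intro tendsto_intros tendsto_neg_powr filterlim_ident) auto
    have "((\<lambda>x. x powr (-3/8) * resid x) \<longlongrightarrow> 0) at_top"
      by (rule dec_imp_tendsto[OF dec_mult[OF dec_powr_real[OF order.refl] dec_resid order.refl]]) simp
    then have 3: "((\<lambda>x. complex_of_real (x powr (-3/8) * resid x)) \<longlongrightarrow> of_real 0) at_top" by (rule tendsto_of_real)
    have "((\<lambda>x. - 12 * of_real (poly ac (sx x) / sqrt 6) * Vf x - 6 * (of_real (x powr (-5/8)) * (Vf x * Vf x)) - of_real (x powr (-3/8) * resid x))
      \<longlongrightarrow> - 12 * of_real (poly ac 0 / sqrt 6) * 0 - 6 * (of_real 0 * (0 * 0)) - of_real 0) at_top"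
      by (intro tendsto_intros 1 2 3 Vf_lim)
    moreover have "eventually (\<lambda>x. - 12 * of_real (poly ac (sx x) / sqrt 6) * Vf x - 6 * (of_real (x powr (-5/8)) * (Vf x * Vf x)) - of_real (x powr (-3/8) * resid x)
        = of_real (x powr (-3/8)) * E2 x) at_top"
      using eventually_gt_at_top[of 0]
    proof eventually_elim
      case (elim x)
      have a: "x powr (-3/8) * asy ac x * x powr (-1/8) = poly ac (sx x) / sqrt 6"
        using elim by (simp add: asy_def qx_def powr_add[symmetric] mult.commute mult.left_commute)
      have b: "x powr (-3/8) * x powr (-1/8) * x powr (-1/8) = x powr (-5/8)"
        by (simp add: powr_add[symmetric])
      show ?case unfolding E2_def Ef_Vf[OF elim] a[symmetric] b[symmetric] of_real_mult by (simp add: algebra_simps)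
    qed
    ultimately show ?thesis by (simp add: Lim_transform_eventually)
  qed
  have Ed0: "((\<lambda>x. of_real (x powr (-1/8)) * Ed x) \<longlongrightarrow> 0) at_top"
  proof (rule tendstoI)
    fix \<epsilon>' :: real assume "\<epsilon>' > 0"
    define \<epsilon> where "\<epsilon> = \<epsilon>' / 5"
    have \<epsilon>: "\<epsilon> > 0" using \<open>\<epsilon>' > 0\<close> by (simp add: \<epsilon>_def)
    have "eventually (\<lambda>x. cmod (Vf x) < \<epsilon>) at_top" "eventually (\<lambda>x. cmod (of_real (x powr (-3/8)) * E2 x) < \<epsilon>) at_top"
      using tendstoD[OF Vf_lim \<epsilon>] tendstoD[OF e2 \<epsilon>] by simp_all
    from eventually_conj[OF this(1) eventually_conj[OF this(2) eventually_conj[OF eventually_not_pole eventually_ge_at_top[of 1]]]]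
    obtain X where X: "X \<ge> 1" "\<And>x. x \<ge> X \<Longrightarrow> cmod (Vf x) < \<epsilon>"
       "\<And>x. x \<ge> X \<Longrightarrow> cmod (of_real (x powr (-3/8)) * E2 x) < \<epsilon>" "\<And>x. x \<ge> X \<Longrightarrow> \<not> is_pole y (of_real x)"
      unfolding eventually_at_top_linorder by (metis order.refl)
    have "cmod (of_real (x powr (-1/8)) * Ed x) < \<epsilon>'" if x: "x \<ge> X" for x
    proof -
      have x1: "x \<ge> 1" using x X by simp
      \<comment> \<open>This is the length scale of an oscillation. It balances the two terms of
        Landau's inequality, each of which becomes 2 \<open>\<epsilon>\<close> x^(1/8).\<close>
      define h where "h = x powr (-1/4)"
      have h: "h > 0" "h \<le> 1" using x1 powr_mono[of "-1/4" 0 x] by (auto simp: h_def)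
      have "cmod (Ed x) \<le> 2 * (\<epsilon> * x powr (-1/8)) / h + h * (\<epsilon> * (2 * x powr (3/8)))"
      proof (rule landau_derivative_bound[OF h(1), where f = Ef and f'' = E2])
        fix t assume t: "t \<in> {x..x+h}"
        have t1: "t \<ge> X" "t > 0" using t x X by auto
        show "(Ef has_vector_derivative Ed t) (at t)" "(Ed has_vector_derivative E2 t) (at t)"
          using Ef_deriv X(4) t1 by auto
        have "cmod (Ef t) = t powr (-1/8) * cmod (Vf t)" using t1 by (simp add: Ef_Vf norm_mult)
        also have "\<dots> \<le> x powr (-1/8) * \<epsilon>"
          using t1 X(2)[OF t1(1)] t x1 by (intro mult_mono powr_mono2') auto
        finally show "cmod (Ef t) \<le> \<epsilon> * x powr (-1/8)" by (simp add: mult.commute)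
        have "cmod (E2 t) = t powr (3/8) * cmod (of_real (t powr (-3/8)) * E2 t)"
          using t1 by (simp add: norm_mult norm_divide powr_minus field_simps)
        also have "\<dots> \<le> (2 * x) powr (3/8) * \<epsilon>"
          using t1 X(3)[OF t1(1)] t x1 h by (intro mult_mono powr_mono2) auto
        also have "(2 * x) powr (3/8) \<le> 2 * x powr (3/8)"
          using x1 powr_mono[of "3/8" 1 "2::real"] by (auto simp: powr_mult intro!: mult_right_mono)
        finally show "cmod (E2 t) \<le> \<epsilon> * (2 * x powr (3/8))" using \<epsilon> by (simp add: mult.commute mult_left_mono)
      qed
      also have "\<dots> = 4 * \<epsilon> * x powr (1/8)"
      proof -
        have "x powr (-1/8) / h = x powr (1/8)" "h * x powr (3/8) = x powr (1/8)"
          using x1 by (simp_all add: h_def powr_diff[symmetric] powr_add[symmetric])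
        moreover have "2 * (\<epsilon> * x powr (-1/8)) / h = 2 * \<epsilon> * (x powr (-1/8) / h)"
          "h * (\<epsilon> * (2 * x powr (3/8))) = 2 * \<epsilon> * (h * x powr (3/8))" by simp_all
        ultimately have "2 * (\<epsilon> * x powr (-1/8)) / h + h * (\<epsilon> * (2 * x powr (3/8))) = 2 * \<epsilon> * x powr (1/8) + 2 * \<epsilon> * x powr (1/8)"
          by (simp only:)
        then show ?thesis by simp
      qed
      finally have "x powr (-1/8) * cmod (Ed x) \<le> x powr (-1/8) * (4 * \<epsilon> * x powr (1/8))" by (intro mult_left_mono) auto
      also have "\<dots> = 4 * \<epsilon>" using x1 by (simp add: powr_minus)
      finally show ?thesis using \<epsilon> by (simp add: norm_mult \<epsilon>_def)
    qed
    then show "eventually (\<lambda>x. dist (of_real (x powr (-1/8)) * Ed x) 0 < \<epsilon>') at_top"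
      by (auto simp: eventually_at_top_linorder)
  qed
  have "((\<lambda>x. complex_of_real (1 / 8 * x powr (-5/4))) \<longlongrightarrow> of_real (1 / 8 * 0)) at_top"
    by (intro tendsto_intros tendsto_neg_powr filterlim_ident) auto
  then have "((\<lambda>x. of_real (1 / c4) * (of_real (x powr (-1/8)) * Ed x + of_real (1 / 8 * x powr (-5/4)) * Vf x))
      \<longlongrightarrow> of_real (1 / c4) * (0 + of_real (1 / 8 * 0) * 0)) at_top"
    by (intro tendsto_add tendsto_mult tendsto_const Ed0 Vf_lim)
  moreover have "eventually (\<lambda>x. of_real (1 / c4) * (of_real (x powr (-1/8)) * Ed x + of_real (1 / 8 * x powr (-5/4)) * Vf x) = Wf x) at_top"
    using eventually_gt_at_top[of 0]
  proof eventually_elim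
    case (elim x)
    have "1 / 8 * x powr (-5/4) = x powr (-1/8) * (1 / (8 * x)) * x powr (-1/8)"
      using elim by (simp add: powr_minus_divide powr_add[of x 1 "1/4", simplified] field_simps powr_add[symmetric])
    then show ?case unfolding Wf_def Ef_Vf[OF elim] by (simp add: field_simps)
  qed
  ultimately show ?thesis by (simp add: Lim_transform_eventually)
qed

lemma dec_kappa: "dec 2 (\<lambda>x. 12 * (asy ac x - qx x) + 9 / (64 * x\<^sup>2))"
proof (rule dec_add)
  show "dec 2 (\<lambda>x. 12 * (asy ac x - qx x))" by (rule dec_mult[OF dec_const[OF order.refl] dec_asy_diff]) simp
  have "dec 2 (\<lambda>x. 9 / 64 * x powr (-2))" by (rule dec_mult[OF dec_const[OF order.refl] dec_powr_real]) auto
  then show "dec 2 (\<lambda>x. 9 / (64 * x\<^sup>2))"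
    by (rule dec_le) (auto simp: eventually_at_top_linorder powr_minus powr_numeral divide_simps intro!: exI[of _ 1])
qed

text \<open>The gain 9/4 is made up of 1/8 from E = x^(-1/8) V, 2 from the potential correction and
  1/8 from the prefactor. The residual, of order x^(-33/2), stays below this as long as a + 17/8 <=
  33/2, which covers a <= 55/4.\<close>

lemma dec_psi:
  assumes a: "dec a Vf" "a \<le> 55/4"
  shows "dec (a + 9/4) psi"
proof -
  have h: "dec (1/8) (\<lambda>x. complex_of_real (x powr (-1/8)))" by (rule dec_powr) simp
  have h': "dec (1/8) (\<lambda>x. complex_of_real (x powr (-1/8) / c4))"
    using dec_mult[OF h dec_const[OF order.refl, of "of_real (1 / c4)"], of "1/8"] by simp
  have cplx: "dec b (\<lambda>x. complex_of_real (f x))" if "dec b f" for b f using that by (simp add: dec_def)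
  have "dec (a + 1/8) (\<lambda>x. of_real (x powr (-1/8)) * Vf x)" by (rule dec_mult[OF h a(1)]) simp
  then have E: "dec (a + 1/8) Ef"
    by (rule dec_le) (auto simp: eventually_at_top_linorder Ef_Vf intro!: exI[of _ 1])
  have "dec (a + 17/8) (\<lambda>x. of_real (12 * (asy ac x - qx x) + 9 / (64 * x\<^sup>2)) * Ef x)"
    by (rule dec_mult[OF cplx[OF dec_kappa] E]) simp
  moreover have "dec (a + 17/8) (\<lambda>x. complex_of_real (resid x))"
    by (rule dec_mono[OF cplx[OF dec_resid]]) (use a(2) in simp)
  ultimately show ?thesis unfolding psi_def[abs_def]
    by (intro dec_mult[OF dec_minus[OF h'] dec_add]) auto
qed

sublocale osc: perturbed_oscillator c4 "6 / c4\<^sup>2" Vf Wf psi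
proof
  show "eventually (\<lambda>x. (Vf has_vector_derivative of_real (c4 * x powr (1/4)) * Wf x) (at x)) at_top"
    using eventually_not_pole eventually_gt_at_top[of 0] by eventually_elim (rule Vf_deriv)
  show "eventually (\<lambda>x. (Wf has_vector_derivative
        - of_real (c4 * x powr (1/4)) * Vf x - of_real (6 / c4\<^sup>2 * x powr (-5/8)) * of_real (c4 * x powr (1/4)) * (Vf x * Vf x) + psi x) (at x)) at_top"
    using eventually_not_pole eventually_gt_at_top[of 0] by eventually_elim (rule Wf_deriv)
qed (use Vf_lim Wf_lim dec_psi in auto)

text \<open>The expansion and its residual are real, so Im V solves a homogeneous linear equation.
  Re V occurs in its coefficient only, and there the decay already proved makes the perturbation
  O(x^(-9/4)).\<close>

lemma eventually_real: "eventually (\<lambda>x. Im (y (of_real x)) = 0) at_top"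
proof -
  define kap where "kap x = - (x powr (-1/8) / c4 * x powr (-1/8) * (12 * (asy ac x - qx x) + 9 / (64 * x\<^sup>2)))
     - (6 / c4\<^sup>2 * x powr (-5/8)) * (c4 * x powr (1/4)) * (2 * Re (Vf x))" for x
  have "eventually (\<lambda>x. Im (Vf x) = 0) at_top"
  proof (rule linear_oscillator_zero[where c = c4 and w = "\<lambda>x. Im (Wf x)" and kap = kap])
    show "eventually (\<lambda>x. ((\<lambda>x. Im (Vf x)) has_real_derivative c4 * x powr (1/4) * Im (Wf x)) (at x)) at_top"
      using osc.V
    proof eventually_elim
      case (elim x)
      from bounded_linear.has_vector_derivative[OF bounded_linear_Im this]
      show ?case by (simp add: has_real_derivative_iff_has_vector_derivative)
    qed
    show "eventually (\<lambda>x. ((\<lambda>x. Im (Wf x)) has_real_derivative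
        - (c4 * x powr (1/4)) * Im (Vf x) + kap x * Im (Vf x)) (at x)) at_top"
      using osc.W eventually_gt_at_top[of 0]
    proof eventually_elim
      case (elim x)
      have p: "Im (psi x) = - (x powr (-1/8) / c4 * x powr (-1/8) * (12 * (asy ac x - qx x) + 9 / (64 * x\<^sup>2))) * Im (Vf x)"
        unfolding psi_def Ef_Vf[OF elim(2)] by (simp del: of_real_add of_real_mult of_real_diff of_real_divide add: algebra_simps)
      have q: "Im (of_real A * of_real B * (Vf x * Vf x)) = A * B * (2 * Re (Vf x)) * Im (Vf x)" for A B
        by (simp flip: of_real_mult)
      from bounded_linear.has_vector_derivative[OF bounded_linear_Im elim(1)]
      show ?case unfolding has_real_derivative_iff_has_vector_derivative
        by (rule has_vector_derivative_eq_rhs)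
           (simp only: plus_complex.sel minus_complex.sel p q, simp add: kap_def algebra_simps flip: of_real_mult of_real_minus)
    qed
    show "((\<lambda>x. Im (Vf x)) \<longlongrightarrow> 0) at_top" "((\<lambda>x. Im (Wf x)) \<longlongrightarrow> 0) at_top"
      using tendsto_Im[OF Vf_lim] tendsto_Im[OF Wf_lim] by simp_all
    have d1: "dec (9/4) (\<lambda>x. x powr (-1/8) / c4 * x powr (-1/8) * (12 * (asy ac x - qx x) + 9 / (64 * x\<^sup>2)))"
      unfolding divide_inverse[of _ c4]
      by (rule dec_mult[OF dec_mult[OF dec_mult[OF dec_powr_real[OF order.refl] dec_const[OF order.refl] order.refl]
             dec_powr_real[OF order.refl] order.refl] dec_kappa]) simp
    have "dec (115/8) (\<lambda>x. Re (Vf x))" by (rule dec_le[OF osc.decay(1)]) (simp add: abs_Re_le_cmod)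
    then have r: "dec (115/8) (\<lambda>x. 2 * Re (Vf x))" by (intro dec_mult[OF dec_const[OF order.refl]]) auto
    have c: "dec (-p) (\<lambda>x. b * x powr p)" for b p :: real
      by (rule dec_mult[OF dec_const[OF order.refl] dec_powr_real[OF order.refl]]) simp
    have d2: "dec (9/4) (\<lambda>x. (6 / c4\<^sup>2 * x powr (-5/8)) * (c4 * x powr (1/4)) * (2 * Re (Vf x)))"
      by (rule dec_mult[OF dec_mult[OF c c order.refl] r]) simp
    show "dec (9/4) kap" unfolding kap_def[abs_def] by (intro dec_diff dec_minus d1 d2)
  qed
  then show ?thesis using eventually_gt_at_top[of 0]
    by eventually_elim (auto simp: Vf_def Ef_def)
qed

end

section \<open>Continuation to the left along the real axis\<close>

lemma interval_induct:
  fixes a b :: real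
  assumes "ok a"
    and left: "\<And>t. t \<in> {a<..b} \<Longrightarrow> (\<And>s. s \<in> {a..<t} \<Longrightarrow> ok s) \<Longrightarrow> ok t"
    and right: "\<And>t. t \<in> {a..b} \<Longrightarrow> (\<And>s. s \<in> {a..t} \<Longrightarrow> ok s) \<Longrightarrow> eventually ok (at t within {a..b})"
    and t: "t \<in> {a..b}"
  shows "ok t"
proof -
  define S where "S = {s \<in> {a..b}. \<forall>r\<in>{a..s}. ok r}"
  have ab: "a \<le> b" using t by auto
  have aS: "a \<in> S" using assms(1) ab by (auto simp: S_def)
  have bdd: "bdd_above S" unfolding S_def by (rule bdd_aboveI[of _ b]) auto
  define m where "m = Sup S"
  have am: "a \<le> m" and mb: "m \<le> b"
    using aS bdd ab unfolding m_def by (auto intro!: cSup_upper cSup_least simp: S_def)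
  have below: "ok s" if "s \<in> {a..<m}" for s
  proof -
    have "s < Sup S" "S \<noteq> {}" using that aS by (auto simp: m_def)
    then obtain r where "r \<in> S" "s < r" using less_cSup_iff[of S s] bdd by blast
    then show ?thesis using that by (auto simp: S_def)
  qed
  have okm: "ok m"
    using left[of m] below assms(1) am mb by (cases "a = m") auto
  have "m = b"
  proof (rule ccontr)
    assume "m \<noteq> b"
    then have "m < b" using mb by simp
    have "ok s" if "s \<in> {a..m}" for s using below[of s] okm that by (cases "s = m") auto
    then have "eventually ok (at m within {a..b})" using right am mb by auto
    then obtain d where d: "d > 0" "\<And>s. s \<in> {a..b} \<Longrightarrow> s \<noteq> m \<Longrightarrow> dist s m < d \<Longrightarrow> ok s"
      unfolding eventually_at by auto
    define q where "q = min b (m + d / 2)"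
    have q: "m < q" "q \<le> b" "q < m + d" using \<open>m < b\<close> \<open>d > 0\<close> by (auto simp: q_def)
    have "q \<in> S"
      unfolding S_def
    proof (intro CollectI conjI ballI)
      show "q \<in> {a..b}" using q am by auto
      fix r assume r: "r \<in> {a..q}"
      consider "r < m" | "r = m" | "r > m" by linarith
      then show "ok r"
      proof cases
        case 3
        show ?thesis by (rule d(2)) (use 3 r q in \<open>auto simp: dist_real_def\<close>)
      qed (use below okm r in auto)
    qed
    then have "q \<le> m" unfolding m_def using bdd by (rule cSup_upper)
    then show False using q by simp
  qed
  then show ?thesis using below[of t] okm t by (cases "t = m") auto
qed

context painleve_I
begin

lemma eventually_not_pole_path:
  assumes "continuous (at t within S) \<gamma>" "\<not> is_pole y (\<gamma> t)"
  shows "eventually (\<lambda>s. \<not> is_pole y (\<gamma> s)) (at t within S)"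
proof -
  have "(\<gamma> \<longlongrightarrow> \<gamma> t) (at t within S)" using assms(1) by (simp add: continuous_within)
  from topological_tendstoD[OF this open_nonpoles] show ?thesis using assms(2) by simp
qed

lemma not_pole_left_limit:
  fixes \<gamma> :: "real \<Rightarrow> complex"
  assumes t: "a < t" and cont: "isCont \<gamma> t" and inj: "\<And>s. s \<in> {a..<t} \<Longrightarrow> \<gamma> s \<noteq> \<gamma> t"
    and bd: "\<And>s. s \<in> {a..<t} \<Longrightarrow> cmod (y (\<gamma> s)) \<le> C"
  shows "\<not> is_pole y (\<gamma> t)"
proof (rule not_pole_if_bounded[where F = "at_left t"])
  have "(\<gamma> \<longlongrightarrow> \<gamma> t) (at t)" using cont by (simp add: isCont_def)
  then show "(\<gamma> \<longlongrightarrow> \<gamma> t) (at_left t)" by (rule tendsto_within_subset) auto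
  have ev: "eventually (\<lambda>s. s \<in> {a..<t}) (at_left t)"
    using eventually_at_left_real[OF t] by eventually_elim auto
  then show "eventually (\<lambda>s. \<gamma> s \<noteq> \<gamma> t) (at_left t)" by eventually_elim (rule inj)
  show "eventually (\<lambda>s. cmod (y (\<gamma> s)) \<le> C) (at_left t)" using ev by eventually_elim (rule bd)
qed simp

lemma vderiv_reflect:
  assumes "(u has_vector_derivative d) (at (- t))"
  shows "((\<lambda>t. u (- t)) has_vector_derivative - d) (at t within S)"
proof -
  have "(uminus has_vector_derivative (-1::real)) (at t)"
    using has_vector_derivative_minus[OF has_vector_derivative_id[of "at t"]] by simp
  from vector_diff_chain_at[OF this assms] show ?thesis by (simp add: o_def has_vector_derivative_at_within)
qed

text \<open>The barrier principle in the variable -x. The bound C for |y| inside the barrier is what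
  prevents the next point to the left from being a pole.\<close>

lemma left_barrier:
  fixes u1 u2 u1' u2' :: "real \<Rightarrow> complex"
  assumes init: "\<not> is_pole y (of_real R)" "cmod (u1 R) < B1 R" "cmod (u2 R) < B2 R"
    and u1: "\<And>x. x \<in> {l..R} \<Longrightarrow> \<not> is_pole y (of_real x) \<Longrightarrow> (u1 has_vector_derivative u1' x) (at x)"
    and u2: "\<And>x. x \<in> {l..R} \<Longrightarrow> \<not> is_pole y (of_real x) \<Longrightarrow> (u2 has_vector_derivative u2' x) (at x)"
    and B1: "\<And>x. x \<in> {l..R} \<Longrightarrow> (B1 has_real_derivative - B1' x) (at x)"
    and B2: "\<And>x. x \<in> {l..R} \<Longrightarrow> (B2 has_real_derivative - B2' x) (at x)"
    and le: "\<And>x. x \<in> {l..R} \<Longrightarrow> \<not> is_pole y (of_real x) \<Longrightarrow> cmod (u1 x) \<le> B1 x \<Longrightarrow> cmod (u2 x) \<le> B2 x \<Longrightarrow>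
        cmod (u1' x) \<le> B1' x \<and> cmod (u2' x) \<le> B2' x"
    and bd: "\<And>x. x \<in> {l..R} \<Longrightarrow> \<not> is_pole y (of_real x) \<Longrightarrow> cmod (u1 x) \<le> B1 x \<Longrightarrow> cmod (u2 x) \<le> B2 x \<Longrightarrow>
        cmod (y (of_real x)) \<le> C"
    and x: "x \<in> {l..R}"
  shows "\<not> is_pole y (of_real x) \<and> cmod (u1 x) < B1 x \<and> cmod (u2 x) < B2 x"
proof -
  define \<gamma> where "\<gamma> = (\<lambda>t::real. complex_of_real (- t))"
  have cont: "isCont \<gamma> t" for t unfolding \<gamma>_def by (intro continuous_intros)
  have "\<not> is_pole y (\<gamma> (- x)) \<and> cmod (u1 (- (- x))) < B1 (- (- x)) \<and> cmod (u2 (- (- x))) < B2 (- (- x))"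
  proof (rule barrier[where a = "- R" and b = "- l" and good = "\<lambda>t. \<not> is_pole y (\<gamma> t)"
        and ?u1.0 = "\<lambda>t. u1 (- t)" and ?u2.0 = "\<lambda>t. u2 (- t)" and ?B1.0 = "\<lambda>t. B1 (- t)" and ?B2.0 = "\<lambda>t. B2 (- t)"])
    show "\<not> is_pole y (\<gamma> (- R))" "cmod (u1 (- (- R))) < B1 (- (- R))" "cmod (u2 (- (- R))) < B2 (- (- R))"
      using init by (simp_all add: \<gamma>_def)
    show "- x \<in> {- R..- l}" using x by simp
    fix t assume t: "t \<in> {- R..- l}"
    then have t': "- t \<in> {l..R}" by auto
    show "eventually (\<lambda>t. \<not> is_pole y (\<gamma> t)) (at t within {- R..- l})" if "\<not> is_pole y (\<gamma> t)"
      by (rule eventually_not_pole_path[OF continuous_at_imp_continuous_at_within[OF cont] that])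
    { assume np: "\<not> is_pole y (\<gamma> t)"
      then have np': "\<not> is_pole y (of_real (- t))" by (simp add: \<gamma>_def)
      show "((\<lambda>t. u1 (- t)) has_vector_derivative - u1' (- t)) (at t within {- R..- l})"
        by (rule vderiv_reflect[OF u1[OF t' np']])
      show "((\<lambda>t. u2 (- t)) has_vector_derivative - u2' (- t)) (at t within {- R..- l})"
        by (rule vderiv_reflect[OF u2[OF t' np']])
      assume "cmod (u1 (- t)) \<le> B1 (- t)" "cmod (u2 (- t)) \<le> B2 (- t)"
      then show "cmod (- u1' (- t)) \<le> B1' (- t)" "cmod (- u2' (- t)) \<le> B2' (- t)"
        using le[OF t' np'] by auto }
    show "((\<lambda>t. B1 (- t)) has_real_derivative B1' (- t)) (at t within {- R..- l})"
      using vderiv_reflect[OF B1[OF t', unfolded has_real_derivative_iff_has_vector_derivative]]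
      by (simp add: has_real_derivative_iff_has_vector_derivative)
    show "((\<lambda>t. B2 (- t)) has_real_derivative B2' (- t)) (at t within {- R..- l})"
      using vderiv_reflect[OF B2[OF t', unfolded has_real_derivative_iff_has_vector_derivative]]
      by (simp add: has_real_derivative_iff_has_vector_derivative)
  next
    fix t assume t: "t \<in> {- R<..- l}"
      and prev: "\<And>s. s \<in> {- R..<t} \<Longrightarrow> \<not> is_pole y (\<gamma> s) \<and> cmod (u1 (- s)) < B1 (- s) \<and> cmod (u2 (- s)) < B2 (- s)"
    show "\<not> is_pole y (\<gamma> t)"
    proof (rule not_pole_left_limit[OF _ cont])
      show "- R < t" using t by simp
      fix s assume s: "s \<in> {- R..<t}"
      show "\<gamma> s \<noteq> \<gamma> t" using s by (simp add: \<gamma>_def)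
      show "cmod (y (\<gamma> s)) \<le> C"
        using bd[of "- s"] prev[OF s] s t by (auto simp: \<gamma>_def)
    qed
  qed
  then show ?thesis by (simp add: \<gamma>_def)
qed

text \<open>A one-sided variant for the energy, whose derivative is controlled only from below. The
  assumptions at x may use that the whole of [x, R] is free of poles, because reality of y at x
  depends on what lies to the right.\<close>

lemma left_barrier_real:
  fixes h h' B B' :: "real \<Rightarrow> real"
  assumes init: "\<not> is_pole y (of_real R)" "h R < B R"
    and h: "\<And>x. x \<in> {l..R} \<Longrightarrow> (\<And>z. z \<in> {x..R} \<Longrightarrow> \<not> is_pole y (of_real z)) \<Longrightarrow> (h has_real_derivative h' x) (at x)"
    and B: "\<And>x. x \<in> {l..R} \<Longrightarrow> (B has_real_derivative B' x) (at x)"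
    and le: "\<And>x. x \<in> {l..R} \<Longrightarrow> (\<And>z. z \<in> {x..R} \<Longrightarrow> \<not> is_pole y (of_real z)) \<Longrightarrow> h x \<le> B x \<Longrightarrow> B' x \<le> h' x"
    and bd: "\<And>x. x \<in> {l..R} \<Longrightarrow> (\<And>z. z \<in> {x..R} \<Longrightarrow> \<not> is_pole y (of_real z)) \<Longrightarrow> h x \<le> B x \<Longrightarrow> cmod (y (of_real x)) \<le> C"
    and x: "x \<in> {l..R}"
  shows "\<not> is_pole y (of_real x) \<and> h x < B x"
proof -
  define \<gamma> where "\<gamma> = (\<lambda>t::real. complex_of_real (- t))"
  have cont: "isCont \<gamma> t" for t unfolding \<gamma>_def by (intro continuous_intros)
  define ok where "ok t \<longleftrightarrow> \<not> is_pole y (\<gamma> t) \<and> h (- t) < B (- t)" for t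
  have "ok (- x)"
  proof (rule interval_induct[where a = "- R" and b = "- l"])
    show "ok (- R)" using init by (simp add: ok_def \<gamma>_def)
    show "- x \<in> {- R..- l}" using x by simp
  next
    fix t assume t: "t \<in> {- R<..- l}" and prev: "\<And>s. s \<in> {- R..<t} \<Longrightarrow> ok s"
    have np: "\<not> is_pole y (\<gamma> t)"
    proof (rule not_pole_left_limit[OF _ cont])
      show "- R < t" using t by simp
      fix s assume s: "s \<in> {- R..<t}"
      show "\<gamma> s \<noteq> \<gamma> t" using s by (simp add: \<gamma>_def)
      show "cmod (y (\<gamma> s)) \<le> C"
      proof -
        have "\<not> is_pole y (of_real z)" if "z \<in> {- s..R}" for z
          using prev[of "- z"] that s by (auto simp: ok_def \<gamma>_def)
        then show ?thesis using bd[of "- s"] prev[OF s] s t by (auto simp: \<gamma>_def ok_def)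
      qed
    qed
    have np': "\<not> is_pole y (of_real z)" if "z \<in> {- t..R}" for z
      using prev[of "- z"] np that by (cases "z = - t") (auto simp: ok_def \<gamma>_def)
    define f where "f z = h z - B z" for z
    have "f (- t) \<le> f R"
    proof (rule DERIV_nonneg_imp_increasing_open[where f = f and a = "- t" and b = R])
      show "- t \<le> R" using t by simp
      fix z assume z: "- t < z" "z < R"
      have "h z \<le> B z" using prev[of "- z"] z by (auto simp: ok_def)
      then have "B' z \<le> h' z" using le[of z] np' z t by auto
      moreover have "(f has_real_derivative h' z - B' z) (at z)"
        unfolding f_def using z t np' by (intro DERIV_diff h B) auto
      ultimately show "\<exists>d. (f has_real_derivative d) (at z) \<and> 0 \<le> d" by auto
    next
      have "isCont f z" if "z \<in> {- t..R}" for z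
        unfolding f_def using that t np' by (intro continuous_diff DERIV_isCont[OF h] DERIV_isCont[OF B]) auto
      then show "continuous_on {- t..R} f" by (intro continuous_at_imp_continuous_on) auto
    qed
    then show "ok t" using np init by (simp add: ok_def f_def)
  next
    fix t assume t: "t \<in> {- R..- l}" and prev: "\<And>s. s \<in> {- R..t} \<Longrightarrow> ok s"
    have "ok t" using prev[of t] t by auto
    then have np: "\<not> is_pole y (\<gamma> t)" and lt: "h (- t) < B (- t)" by (auto simp: ok_def)
    have np': "\<not> is_pole y (of_real z)" if "z \<in> {- t..R}" for z
      using prev[of "- z"] that by (auto simp: ok_def \<gamma>_def)
    have t': "- t \<in> {l..R}" using t by auto
    have "isCont (\<lambda>t. B (- t) - h (- t)) t"
    proof (intro continuous_diff)
      have "isCont B (- t)" using DERIV_isCont[OF B[OF t']] .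
      then show "isCont (\<lambda>t. B (- t)) t" by (rule isCont_o2[OF isCont_minus[OF continuous_ident]])
      have "isCont h (- t)" using DERIV_isCont[OF h[OF t' np']] .
      then show "isCont (\<lambda>t. h (- t)) t" by (rule isCont_o2[OF isCont_minus[OF continuous_ident]])
    qed
    then have "((\<lambda>t. B (- t) - h (- t)) \<longlongrightarrow> B (- t) - h (- t)) (at t within {- R..- l})"
      by (auto simp: isCont_def intro: tendsto_within_subset)
    then have "eventually (\<lambda>s. 0 < B (- s) - h (- s)) (at t within {- R..- l})"
      by (rule order_tendstoD(1)) (use lt in simp)
    moreover have "eventually (\<lambda>s. \<not> is_pole y (\<gamma> s)) (at t within {- R..- l})"
      by (rule eventually_not_pole_path[OF continuous_at_imp_continuous_at_within[OF cont] np])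
    ultimately show "eventually ok (at t within {- R..- l})" by eventually_elim (simp add: ok_def)
  qed
  then show ?thesis by (simp add: ok_def \<gamma>_def)
qed

end

section \<open>The barrier that starts at infinity\<close>

lemma sx_bounds:
  assumes "x \<ge> 11/2"
  shows "sx x > 0" "(sx x)\<^sup>2 = 1 / (6 * x ^ 5)" "sx x \<le> 576/100000" "sx x * x \<le> 3166/100000"
    "qx x * sx x = 1 / (6 * x\<^sup>2)"
proof -
  have x: "x > 0" using assms by simp
  show pos: "sx x > 0" using x by (simp add: sx_def)
  have "(x powr (-5/2))\<^sup>2 = x powr (-5)" using x by (simp add: powr_power)
  also have "\<dots> = 1 / x ^ 5" using x by (simp add: powr_minus_divide)
  finally show sq: "(sx x)\<^sup>2 = 1 / (6 * x ^ 5)" by (simp add: sx_def power_divide)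
  have x5: "(11/2) ^ 5 \<le> x ^ 5" and x3: "(11/2) ^ 3 \<le> x ^ 3" using assms by (intro power_mono; simp)+
  have "(sx x)\<^sup>2 \<le> (576/100000)\<^sup>2"
    unfolding sq using x5 x by (simp add: divide_simps power2_eq_square) 
  then show "sx x \<le> 576/100000" using pos by (simp add: power2_le_iff_abs_le)
  have "(sx x * x)\<^sup>2 = 1 / (6 * x ^ 5) * x\<^sup>2" unfolding power_mult_distrib sq ..
  also have "\<dots> = 1 / (6 * x ^ 3)" using x by (simp add: divide_simps eval_nat_numeral)
  finally have "(sx x * x)\<^sup>2 = 1 / (6 * x ^ 3)" .
  also have "\<dots> \<le> (3166/100000)\<^sup>2" using x3 x by (simp add: divide_simps power2_eq_square)
  finally show "sx x * x \<le> 3166/100000" using pos x by (simp add: power2_le_iff_abs_le)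
  have "qx x * sx x = x powr (1/2 + -5/2) / (sqrt 6 * sqrt 6)"
    unfolding qx_def sx_def powr_add by simp
  also have "\<dots> = 1 / (6 * x\<^sup>2)" using x by (simp add: powr_minus_divide powr_numeral)
  finally show "qx x * sx x = 1 / (6 * x\<^sup>2)" .
qed

lemma poly_small_bound:
  fixes cs :: "real list"
  assumes "\<bar>s\<bar> \<le> d"
  shows "\<bar>poly (Poly cs) s\<bar> \<le> foldr (\<lambda>c acc. \<bar>c\<bar> + d * acc) cs 0"
proof (induction cs)
  case (Cons c cs)
  have "\<bar>s * poly (Poly cs) s\<bar> \<le> d * foldr (\<lambda>c acc. \<bar>c\<bar> + d * acc) cs 0"
    unfolding abs_mult using assms Cons by (intro mult_mono) auto
  then show ?case by simp
qed simp

lemma asy_bounds: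
  assumes "x \<ge> 11/2"
  shows "\<bar>asy ac x - qx x\<bar> \<le> 128/1000 / (6 * x\<^sup>2)" "\<bar>resid x\<bar> \<le> 17370 / x ^ 15"
    "\<bar>asy ac x\<bar> \<le> 2 * qx x"
proof -
  note s = sx_bounds[OF assms]
  have x: "x > 0" using assms by simp
  define t where "t = sx x"
  have t: "\<bar>t\<bar> \<le> 576/100000" using s by (simp add: t_def)
  let ?l = "[1/8, -49/128, 1225/256, -4412401/32768, 220680075/32768, -2207064977649/4194304]"
  have acl: "ac = pCons 1 (Poly ?l)" by (simp add: ac_def)
  define p where "p = poly (Poly ?l) t"
  have "poly ac t = 1 + t * p" unfolding acl p_def by (simp only: poly_pCons)
  then have a: "asy ac x = qx x * (1 + t * p)" by (simp add: asy_def t_def)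
  have b: "\<bar>p\<bar> \<le> 128/1000" unfolding p_def
    by (rule order_trans[OF poly_small_bound[OF t]]) simp
  have "asy ac x - qx x = (qx x * sx x) * p" unfolding a t_def by (simp add: algebra_simps)
  then have "\<bar>asy ac x - qx x\<bar> = 1 / (6 * x\<^sup>2) * \<bar>p\<bar>" unfolding s(5) using x by (simp add: abs_mult)
  also have "\<dots> \<le> 1 / (6 * x\<^sup>2) * (128/1000)" using b x by (intro mult_left_mono) auto
  finally show "\<bar>asy ac x - qx x\<bar> \<le> 128/1000 / (6 * x\<^sup>2)" by simp
  have "\<bar>t * p\<bar> \<le> 1 * 1" unfolding abs_mult using t b by (intro mult_mono) auto
  then have "\<bar>1 + t * p\<bar> \<le> 2" by arith
  then show "\<bar>asy ac x\<bar> \<le> 2 * qx x"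
    unfolding a using qx_pos[OF x] by (simp only: abs_mult) (simp add: mult.commute)
  have rcl: "rc = Poly [-7759635184525/65536, 521259289724005/1073741824, -919345895307525/134217728,
    12855236226571785249/68719476736, -487055264797454643675/68719476736, 4871135815564780869567201/17592186044416]"
    by (simp add: rc_def)
  \<comment> \<open>Together with 0.03166 for s x and 216 x^15 from the third power of 1 / s^2 = 6
    x^5, this accounts for the constant 17370.\<close>
  have r: "\<bar>poly rc t\<bar> \<le> 118500000" unfolding rcl
    by (rule order_trans[OF poly_small_bound[OF t]]) simp
  have "resid x = (sx x * x) * ((sx x)\<^sup>2) ^ 3 * poly rc t"
    by (simp add: resid_def t_def eval_nat_numeral)
  also have "\<dots> = (sx x * x) * (1 / (216 * x ^ 15)) * poly rc t"
    unfolding s(2) by (simp add: power_divide power_mult_distrib power_mult[symmetric])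
  finally have "\<bar>resid x\<bar> = (sx x * x) * (1 / (216 * x ^ 15)) * \<bar>poly rc t\<bar>"
    using s x by (simp add: abs_mult)
  also have "\<dots> \<le> 3166/100000 * (1 / (216 * x ^ 15)) * 118500000"
    using s r x by (intro mult_mono) auto
  also have "\<dots> \<le> 17370 / x ^ 15" using x by (simp add: divide_simps)
  finally show "\<bar>resid x\<bar> \<le> 17370 / x ^ 15" .
qed

lemma c4_bounds: "2213/1000 \<le> c4" "c4 \<le> 2214/1000"
proof -
  have "(2213/1000) ^ 4 \<le> c4 ^ 4" unfolding c4(2) by (simp add: eval_nat_numeral)
  then show "2213/1000 \<le> c4" using c4(1) by (simp add: power_mono_iff del: power_divide)
  have "c4 ^ 4 \<le> (2214/1000) ^ 4" unfolding c4(2) by (simp add: eval_nat_numeral)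
  then show "c4 \<le> 2214/1000" using c4(1) by (simp add: power_mono_iff del: power_divide)
qed

lemma eighth_root_bound:
  fixes x :: real
  assumes x: "x \<ge> 11/2"
  shows "1237/1000 \<le> x powr (1/8)"
proof -
  have "(1237/1000) ^ 8 \<le> (x powr (1/8)) ^ 8"
    using eighth_powers(2)[of x] x by (simp add: eval_nat_numeral)
  then show ?thesis by (simp add: power_mono_iff del: power_divide)
qed

context tritronquee
begin

definition Phi :: "real \<Rightarrow> complex" where
  "Phi x = - of_real (6 / c4\<^sup>2 * x powr (-5/8)) * of_real (c4 * x powr (1/4)) * (Vf x * Vf x) + psi x"

text \<open>The coordinate W + j V with the free rotation taken out, so that only \<open>Phi\<close>
  drives it; for j = i and j = -i the modulus is unaffected by the exponential.\<close>

definition rot :: "complex \<Rightarrow> real \<Rightarrow> complex" where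
  "rot j x = exp (- j * of_real (4/5 * c4 * x powr (5/4))) * (Wf x + j * Vf x)"

lemma norm_rot: "Re j = 0 \<Longrightarrow> cmod (rot j x) = cmod (Wf x + j * Vf x)"
  by (simp add: rot_def norm_mult norm_exp_eq_Re)

lemma rot_deriv:
  assumes j: "j * j = -1" and x: "x > 0" and np: "\<not> is_pole y (of_real x)"
  shows "(rot j has_vector_derivative exp (- j * of_real (4/5 * c4 * x powr (5/4))) * Phi x) (at x)"
proof -
  have "((\<lambda>x. 4/5 * c4 * x powr (5/4)) has_real_derivative c4 * x powr (1/4)) (at x)"
    using x by (auto intro!: derivative_eq_intros)
  then have 1: "((\<lambda>x. - j * complex_of_real (4/5 * c4 * x powr (5/4))) has_vector_derivative - j * of_real (c4 * x powr (1/4))) (at x)"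
    by (intro has_vector_derivative_mult_right has_vector_derivative_of_real)
  have de: "((\<lambda>x. exp (- j * complex_of_real (4/5 * c4 * x powr (5/4)))) has_vector_derivative
      - j * of_real (c4 * x powr (1/4)) * exp (- j * complex_of_real (4/5 * c4 * x powr (5/4)))) (at x)"
    using field_vector_diff_chain_at[OF 1 DERIV_exp] by (simp add: o_def)
  have dW: "((\<lambda>x. Wf x + j * Vf x) has_vector_derivative
      (- of_real (c4 * x powr (1/4)) * Vf x + Phi x) + j * (of_real (c4 * x powr (1/4)) * Wf x)) (at x)"
    unfolding Phi_def
    by (intro has_vector_derivative_add has_vector_derivative_mult_right Vf_deriv x np
         has_vector_derivative_eq_rhs[OF Wf_deriv[OF x np]]) simp
  define e w where "e = exp (- j * complex_of_real (4/5 * c4 * x powr (5/4)))" and "w = complex_of_real (c4 * x powr (1/4))"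
  have "e * (- w * Vf x + Phi x + j * (w * Wf x)) + - j * w * e * (Wf x + j * Vf x) = e * Phi x - (1 + j * j) * (e * w * Vf x)"
    by (simp add: algebra_simps)
  also have "\<dots> = e * Phi x" by (simp add: j)
  finally show ?thesis unfolding rot_def[abs_def]
    by (intro has_vector_derivative_eq_rhs[OF has_vector_derivative_mult[OF de dW]]) (simp only: e_def w_def)
qed

lemma cmod_Vf_le: "cmod (Vf x) \<le> (cmod (Wf x + \<i> * Vf x) + cmod (Wf x - \<i> * Vf x)) / 2"
  and cmod_Wf_le: "cmod (Wf x) \<le> (cmod (Wf x + \<i> * Vf x) + cmod (Wf x - \<i> * Vf x)) / 2"
proof -
  have "2 * cmod (Vf x) = cmod ((Wf x + \<i> * Vf x) - (Wf x - \<i> * Vf x))" by (simp add: norm_mult)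
  also have "\<dots> \<le> cmod (Wf x + \<i> * Vf x) + cmod (Wf x - \<i> * Vf x)" by (rule norm_triangle_ineq4)
  finally show "cmod (Vf x) \<le> (cmod (Wf x + \<i> * Vf x) + cmod (Wf x - \<i> * Vf x)) / 2" by simp
  have "2 * cmod (Wf x) = cmod ((Wf x + \<i> * Vf x) + (Wf x - \<i> * Vf x))" by (simp add: norm_mult)
  also have "\<dots> \<le> cmod (Wf x + \<i> * Vf x) + cmod (Wf x - \<i> * Vf x)" by (rule norm_triangle_ineq)
  finally show "cmod (Wf x) \<le> (cmod (Wf x + \<i> * Vf x) + cmod (Wf x - \<i> * Vf x)) / 2" by simp
qed

lemma cmod_Ef_le:
  assumes "x \<ge> 11/2"
  shows "cmod (Ef x) \<le> cmod (Vf x)"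
proof -
  have "cmod (Ef x) = x powr (-1/8) * cmod (Vf x)" using assms by (simp add: Ef_Vf norm_mult)
  also have "\<dots> \<le> 1 * cmod (Vf x)"
    using assms eighth_root_bound[of x] by (intro mult_right_mono) (auto simp: powr_minus field_simps)
  finally show ?thesis by simp
qed

text \<open>As 14 * 456 = 6384, this is precisely the slope of the barrier 456 / x^14. Nearly all of
  it is the residual: 17370 times 0.36531, the bound for x^(-1/8) / c4, is about 6345. The nonlinear
  term and the potential correction add about 14.\<close>

lemma Phi_bound:
  assumes x: "x \<ge> 11/2" and V: "cmod (Vf x) \<le> 456 / x ^ 14"
  shows "cmod (Phi x) \<le> 6384 / x ^ 15"
proof -
  have x0: "x > 0" using x by simp
  note e = eighth_powers[OF x0]
  define a where "a = x powr (1/8)"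
  have a: "a \<ge> 1237/1000" using eighth_root_bound[OF x] by (simp add: a_def)
  have h: "0 \<le> x powr (-1/8) / c4" "x powr (-1/8) / c4 \<le> 36531/100000"
  proof -
    have "(1237/1000) * (2213/1000) \<le> a * c4" using a c4_bounds(1) by (intro mult_mono) auto
    then have "36531/100000 * (a * c4) \<ge> 1" by simp
    then show "x powr (-1/8) / c4 \<le> 36531/100000"
      unfolding e(7) a_def[symmetric] using a c4(1) by (simp add: field_simps)
  qed (use c4(1) in simp)
  have "6 / c4\<^sup>2 * x powr (-5/8) * (c4 * x powr (1/4)) = 6 / c4 / a ^ 3"
    unfolding e(3,9) a_def[symmetric] using a c4(1) by (simp add: field_simps eval_nat_numeral)
  also have "\<dots> \<le> 6 / (2213/1000) / 1"
    using a c4_bounds(1) one_le_power[of a 3] by (intro frac_le divide_nonneg_pos) auto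
  finally have g: "6 / c4\<^sup>2 * x powr (-5/8) * (c4 * x powr (1/4)) \<le> 3" by simp
  have t1: "cmod (of_real (6 / c4\<^sup>2 * x powr (-5/8)) * of_real (c4 * x powr (1/4)) * (Vf x * Vf x)) \<le> 1 / x ^ 15"
  proof -
    have "cmod (of_real (6 / c4\<^sup>2 * x powr (-5/8)) * of_real (c4 * x powr (1/4)) * (Vf x * Vf x))
      = (6 / c4\<^sup>2 * x powr (-5/8) * (c4 * x powr (1/4))) * (cmod (Vf x) * cmod (Vf x))"
      using c4(1) by (simp add: norm_mult norm_divide norm_power)
    also have "\<dots> \<le> 3 * ((456 / x ^ 14) * (456 / x ^ 14))"
      using g V by (intro mult_mono mult_nonneg_nonneg) (use x0 in auto)
    also have "\<dots> = (3 * 456 * 456 / x ^ 13) / x ^ 15"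
      using x0 by (simp add: divide_simps flip: power_add)
    also have "\<dots> \<le> 1 / x ^ 15"
    proof (intro divide_right_mono)
      have "(11/2) ^ 13 \<le> x ^ 13" using x by (intro power_mono) auto
      then show "3 * 456 * 456 / x ^ 13 \<le> 1" using x0 by (simp add: divide_simps)
    qed (use x0 in simp)
    finally show ?thesis .
  qed
  have E: "cmod (Ef x) \<le> 456 / x ^ 14" using cmod_Ef_le[OF x] V by linarith
  have kap: "\<bar>12 * (asy ac x - qx x) + 9 / (64 * x\<^sup>2)\<bar> \<le> 4/10 / x\<^sup>2"
  proof -
    have "\<bar>12 * (asy ac x - qx x) + 9 / (64 * x\<^sup>2)\<bar> \<le> 12 * (128/1000 / (6 * x\<^sup>2)) + 9 / (64 * x\<^sup>2)"
      using asy_bounds(1)[OF x] x0 abs_triangle_ineq[of "12 * (asy ac x - qx x)" "9 / (64 * x\<^sup>2)"] by (simp add: abs_mult)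
    also have "\<dots> \<le> 4/10 / x\<^sup>2" using x0 by (simp add: divide_simps)
    finally show ?thesis .
  qed
  have "cmod (of_real (12 * (asy ac x - qx x) + 9 / (64 * x\<^sup>2)) * Ef x + of_real (resid x))
     \<le> 4/10 / x\<^sup>2 * (456 / x ^ 14) + 17370 / x ^ 15"
    unfolding norm_mult norm_of_real
    by (rule order_trans[OF norm_triangle_ineq], unfold norm_mult norm_of_real, intro add_mono mult_mono kap E asy_bounds(2)[OF x])
       (use x0 in auto)
  also have "4/10 / x\<^sup>2 * (456 / x ^ 14) = (4/10 * 456 / x) / x ^ 15" using x0 by (simp add: field_simps flip: power_add power_Suc)
  also have "\<dots> \<le> 34 / x ^ 15" using x x0 by (intro divide_right_mono) (auto simp: divide_simps)
  finally have s: "cmod (of_real (12 * (asy ac x - qx x) + 9 / (64 * x\<^sup>2)) * Ef x + of_real (resid x)) \<le> 17404 / x ^ 15" by (simp add: add_divide_distrib[symmetric])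
  have "cmod (psi x) = x powr (-1/8) / c4 * cmod (of_real (12 * (asy ac x - qx x) + 9 / (64 * x\<^sup>2)) * Ef x + of_real (resid x))"
    unfolding psi_def norm_mult norm_minus_cancel norm_of_real using h(1) c4(1) by simp
  also have "\<dots> \<le> 36531/100000 * (17404 / x ^ 15)" by (intro mult_mono h s) auto
  finally have "cmod (psi x) \<le> 6358 / x ^ 15" using x0 by (simp add: divide_simps)
  then have "cmod (Phi x) \<le> 1 / x ^ 15 + 6358 / x ^ 15"
    unfolding Phi_def mult_minus_left
    by (intro order_trans[OF norm_triangle_ineq] add_mono) (simp_all only: norm_minus_cancel t1)
  also have "\<dots> \<le> 6384 / x ^ 15" using x0 by (simp add: divide_simps)
  finally show ?thesis .
qed

text \<open>Because 115/8 > 14, V and W eventually fall below x^(-14), hence inside the barrier.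
  Some such R to the right of x starts the argument, and since the barrier does not involve R, its
  constants do not depend on where the decay sets in.\<close>

lemma large_x_bound:
  assumes x: "x \<ge> 11/2"
  shows "\<not> is_pole y (of_real x) \<and> cmod (Wf x + \<i> * Vf x) < 456 / x ^ 14 \<and> cmod (Wf x - \<i> * Vf x) < 456 / x ^ 14"
proof -
  have small: "eventually (\<lambda>x. cmod (f x) < 1 / x ^ 14) at_top" if d: "dec (115/8) f" for f :: "real \<Rightarrow> complex"
  proof -
    have "dec (3/8) (\<lambda>x. of_real (x powr 14) * f x)"
      by (rule dec_mult[OF dec_powr[OF order.refl] d]) simp
    then have "((\<lambda>x. of_real (x powr 14) * f x) \<longlongrightarrow> 0) at_top" by (rule dec_imp_tendsto) simp
    then have "eventually (\<lambda>x. cmod (of_real (x powr 14) * f x) < 1) at_top" by (auto simp: tendsto_iff)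
    then show ?thesis using eventually_gt_at_top[of 0]
    proof eventually_elim
      case (elim x)
      then show ?case by (simp add: norm_mult norm_power field_simps)
    qed
  qed
  from eventually_conj[OF small[OF osc.decay(1)] eventually_conj[OF small[OF osc.decay(2)]
      eventually_conj[OF eventually_not_pole eventually_ge_at_top[of x]]]]
  obtain R where R: "R \<ge> x" "cmod (Vf R) < 1 / R ^ 14" "cmod (Wf R) < 1 / R ^ 14" "\<not> is_pole y (of_real R)"
    unfolding eventually_at_top_linorder by (metis order.refl)
  have ex: "cmod (exp (- j * of_real r)) = 1" if "Re j = 0" for j r using that by (simp add: norm_exp_eq_Re)
  define B where "B = (\<lambda>x::real. 456 / x ^ 14)"
  have VB: "cmod (Vf x) \<le> B x" if "cmod (rot \<i> x) \<le> B x" "cmod (rot (-\<i>) x) \<le> B x" for x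
    using cmod_Vf_le[of x] that by (simp add: norm_rot)
  have "\<not> is_pole y (of_real x) \<and> cmod (rot \<i> x) < B x \<and> cmod (rot (-\<i>) x) < B x"
  proof (rule left_barrier)
    show "\<not> is_pole y (of_real R)" by (rule R)
    have "cmod (Wf R) + cmod (Vf R) < 2 / R ^ 14" using R by simp
    also have "\<dots> \<le> B R" using R x by (simp add: B_def divide_right_mono)
    finally have "cmod (Wf R) + cmod (Vf R) < B R" .
    then show "cmod (rot \<i> R) < B R" "cmod (rot (-\<i>) R) < B R"
      using norm_triangle_ineq[of "Wf R" "\<i> * Vf R"] norm_triangle_ineq4[of "Wf R" "\<i> * Vf R"]
      by (simp_all add: norm_rot norm_mult)
    show "x \<in> {x..R}" using R by simp
    fix z assume z: "z \<in> {x..R}"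
    then have z0: "z > 0" "z \<ge> 11/2" using x by auto
    show "(B has_real_derivative - (6384 / z ^ 15)) (at z)" "(B has_real_derivative - (6384 / z ^ 15)) (at z)"
      unfolding B_def using z0 by (auto intro!: derivative_eq_intros simp: divide_simps eval_nat_numeral)
    assume np: "\<not> is_pole y (of_real z)"
    show "(rot \<i> has_vector_derivative exp (- \<i> * of_real (4/5 * c4 * z powr (5/4))) * Phi z) (at z)"
      by (rule rot_deriv) (use z0 np in auto)
    show "(rot (-\<i>) has_vector_derivative exp (- (-\<i>) * of_real (4/5 * c4 * z powr (5/4))) * Phi z) (at z)"
      by (rule rot_deriv) (use z0 np in auto)
    assume b: "cmod (rot \<i> z) \<le> B z" "cmod (rot (-\<i>) z) \<le> B z"
    show "cmod (exp (- \<i> * of_real (4/5 * c4 * z powr (5/4))) * Phi z) \<le> 6384 / z ^ 15 \<and>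
          cmod (exp (- (-\<i>) * of_real (4/5 * c4 * z powr (5/4))) * Phi z) \<le> 6384 / z ^ 15"
      unfolding norm_mult using Phi_bound[OF z0(2)] VB[OF b] ex[of \<i>] ex[of "-\<i>"] by (simp add: B_def)
    have "cmod (y (of_real z)) \<le> cmod (Ef z) + \<bar>asy ac z\<bar>"
      using norm_triangle_ineq[of "Ef z" "of_real (asy ac z)"] by (simp add: Ef_def)
    also have "\<dots> \<le> B z + 2 * qx z"
      using cmod_Ef_le[OF z0(2)] VB[OF b] asy_bounds(3)[OF z0(2)] by linarith
    also have "\<dots> \<le> 456 + 2 * qx R"
    proof (intro add_mono mult_left_mono)
      have "1 \<le> z ^ 14" using z0 by (intro one_le_power) simp
      then show "B z \<le> 456" using z0 by (simp add: B_def divide_simps)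
      show "qx z \<le> qx R" using z z0 R x by (simp add: qx_sqrt)
    qed simp
    finally show "cmod (y (of_real z)) \<le> 456 + 2 * qx R" .
  qed
  then show ?thesis by (simp add: norm_rot B_def)
qed

lemma real_right_of:
  assumes "\<And>x. x > a \<Longrightarrow> x < 11/2 \<Longrightarrow> \<not> is_pole y (of_real x)" "x > a"
  shows "Im (y (of_real x)) = 0" "Im (deriv y (of_real x)) = 0"
  using real_on_axis[of a x] assms large_x_bound eventually_real by (meson not_le)+

end

section \<open>The explicit correction on the right half line\<close>

lemma tail_integral:
  fixes f :: "real \<Rightarrow> complex"
  assumes cont: "continuous_on {a..} f" and a: "a > 0" and e: "e < -1"
    and f: "\<And>t. t \<ge> a \<Longrightarrow> cmod (f t) \<le> K * t powr e" and x: "x > a"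
  shows "cmod (integral {x..} f) \<le> K * (x powr (e + 1) / (- e - 1))"
    and "((\<lambda>x. integral {x..} f) has_vector_derivative - f x) (at x)"
proof -
  have int: "((\<lambda>t. K * t powr e) has_integral K * (- (b powr (e + 1)) / (e + 1))) {b..}" if "b \<ge> a" for b
    using has_integral_powr_to_inf[OF e, of b] that a by (intro has_integral_mult_right) auto
  have f_int: "f integrable_on {b..}" if b: "b \<ge> a" for b
  proof -
    have "f absolutely_integrable_on {b..}"
    proof (rule measurable_bounded_by_integrable_imp_absolutely_integrable)
      have "continuous_on {b..} f" using cont by (rule continuous_on_subset) (use b in auto)
      then show "f \<in> borel_measurable (lebesgue_on {b..})"
        by (rule continuous_imp_measurable_on_sets_lebesgue) auto
      show "(\<lambda>t. K * t powr e) integrable_on {b..}" using int[OF b] by (auto simp: integrable_on_def)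
    qed (use f b in auto)
    then show ?thesis using set_lebesgue_integral_eq_integral(1) by blast
  qed
  have "norm (integral {x..} f) \<le> integral {x..} (\<lambda>t. K * t powr e)"
    by (rule integral_norm_bound_integral[OF f_int]) (use int[of x] f x in \<open>auto simp: integrable_on_def\<close>)
  also have "\<dots> = K * (x powr (e + 1) / (- e - 1))"
  proof -
    have "integral {x..} (\<lambda>t. K * t powr e) = K * (- (x powr (e + 1)) / (e + 1))"
      by (rule integral_unique[OF int]) (use x in simp)
    also have "- (x powr (e + 1)) / (e + 1) = x powr (e + 1) / (- (e + 1))" by (simp only: minus_divide_left[symmetric] minus_divide_right)
    finally show ?thesis by simp
  qed
  finally show "cmod (integral {x..} f) \<le> K * (x powr (e + 1) / (- e - 1))" .
  have split: "integral {u..} f = integral {a..} f - integral {a..u} f" if u: "u \<ge> a" for u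
  proof -
    have "f integrable_on {a..u}"
      using cont by (intro integrable_continuous_interval continuous_on_subset[OF cont]) auto
    then have "(f has_integral integral {a..u} f + integral {u..} f) ({a..u} \<union> {u..})"
      using f_int[OF u] by (intro has_integral_Un) (auto simp: Int_atLeastAtMost integrable_integral intro: negligible_subset[of "{u}"])
    moreover have "{a..u} \<union> {u..} = {a..}" using u by auto
    ultimately show ?thesis by (auto dest!: integral_unique)
  qed
  have "((\<lambda>u. integral {a..u} f) has_vector_derivative f x) (at x within {a..x + 1})"
    by (rule integral_has_vector_derivative) (use x continuous_on_subset[OF cont] in auto)
  moreover have "at x within {a..x + 1} = at x" by (rule at_within_interior) (use x in auto)
  ultimately have "((\<lambda>u. integral {a..} f - integral {a..u} f) has_vector_derivative 0 - f x) (at x)"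
    by (intro has_vector_derivative_diff has_vector_derivative_const) simp
  moreover have "eventually (\<lambda>u. integral {u..} f = integral {a..} f - integral {a..u} f) (nhds x)"
    using eventually_nhds_in_open[of "{a<..}" x] x by (auto elim!: eventually_mono intro: split)
  ultimately show "((\<lambda>x. integral {x..} f) has_vector_derivative - f x) (at x)"
    using x by (subst has_vector_derivative_cong_ev[where g = "\<lambda>u. integral {a..} f - integral {a..u} f"]) (auto intro: split eventually_mono)
qed

lemma bb_c4: "bb = 4/5 * c4" "aa = 2 * c4"
  by (simp_all add: bb_def aa_def c4_def)

definition Gj :: "complex \<Rightarrow> real \<Rightarrow> complex" where
  "Gj j x = of_real (x powr (-5/8)) * exp (j * of_real (bb * x powr (5/4)))"
definition Gd :: "complex \<Rightarrow> real \<Rightarrow> complex" where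
  "Gd j x = of_real (x powr (-5/8)) * (j * of_real (c4 * x powr (1/4)) * exp (j * of_real (bb * x powr (5/4))))
     + of_real (-5/8 * x powr (-13/8)) * exp (j * of_real (bb * x powr (5/4)))"
definition fj :: "complex \<Rightarrow> real \<Rightarrow> complex" where "fj j t = Gj j t * of_real (t * N0 t)"
definition Ij :: "complex \<Rightarrow> real \<Rightarrow> complex" where "Ij j x = integral {x..} (fj j)"

lemma w0_eq: "w0 x = 1 / (\<i> * of_real aa) * (Gj (- \<i>) x * Ij \<i> x - Gj \<i> x * Ij (- \<i>) x)"
proof -
  have "G1 = Gj (- \<i>)" "G2 = Gj \<i>" by (simp_all add: fun_eq_iff G1_def G2_def Gj_def)
  then show ?thesis by (simp add: w0_def Ij_def fj_def[abs_def] algebra_simps)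
qed

lemma Gj_deriv:
  assumes "x > 0"
  shows "(Gj j has_vector_derivative Gd j x) (at x)"
proof -
  have "((\<lambda>x. bb * x powr (5/4)) has_real_derivative c4 * x powr (1/4)) (at x)"
    unfolding bb_c4 using assms by (auto intro!: derivative_eq_intros)
  then have 1: "((\<lambda>x. j * complex_of_real (bb * x powr (5/4))) has_vector_derivative j * of_real (c4 * x powr (1/4))) (at x)"
    by (intro has_vector_derivative_mult_right has_vector_derivative_of_real)
  have de: "((\<lambda>x. exp (j * complex_of_real (bb * x powr (5/4)))) has_vector_derivative
      j * of_real (c4 * x powr (1/4)) * exp (j * complex_of_real (bb * x powr (5/4)))) (at x)"
    using field_vector_diff_chain_at[OF 1 DERIV_exp] by (simp add: o_def)
  have "((\<lambda>x. x powr (-5/8)) has_real_derivative -5/8 * x powr (-13/8)) (at x)"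
    by (rule DERIV_cong[OF has_real_derivative_powr[OF assms]]) simp
  then show ?thesis unfolding Gj_def[abs_def] Gd_def
    by (intro has_vector_derivative_mult de has_vector_derivative_of_real)
qed

lemma norm_Gj: "Re j = 0 \<Longrightarrow> cmod (Gj j x) = x powr (-5/8)"
  by (simp add: Gj_def norm_mult norm_exp_eq_Re)

lemma norm_Gd:
  assumes j: "Re j = 0" "cmod j = 1" and x: "x \<ge> 11/2"
  shows "cmod (Gd j x) \<le> 3 * x powr (-3/8)"
proof -
  have x0: "x > 0" using x by simp
  have ex: "cmod (exp (j * of_real (bb * x powr (5/4)))) = 1" using j by (simp add: norm_exp_eq_Re)
  have "cmod (Gd j x) \<le> x powr (-5/8) * (c4 * x powr (1/4)) + 5/8 * x powr (-13/8)"
    unfolding Gd_def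
    by (rule order_trans[OF norm_triangle_ineq]) (use c4(1) in \<open>simp add: norm_mult ex j del: of_real_mult of_real_divide\<close>)
  also have "x powr (-5/8) * (c4 * x powr (1/4)) = c4 * x powr (-3/8)" by (simp add: powr_add[symmetric])
  also have "x powr (-13/8) \<le> x powr (-3/8)" using x by (intro powr_mono) auto
  also have "c4 * x powr (-3/8) + 5/8 * x powr (-3/8) \<le> 3 * x powr (-3/8)"
    unfolding distrib_right[symmetric] using c4_bounds(2) by (intro mult_right_mono) auto
  finally show ?thesis by simp
qed

lemma N0_bound:
  assumes "t \<ge> 5"
  shows "\<bar>N0 t\<bar> \<le> 19 * t powr (-19/2)"
proof -
  have s: "sqrt 6 \<ge> 2449/1000" by (rule real_le_rsqrt) (simp add: power2_eq_square)
  have "4412401 / (98304 * sqrt 6) \<le> 4412401 / (98304 * (2449/1000))" using s by (intro divide_left_mono) auto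
  also have "\<dots> \<le> 184/10" by simp
  finally have 1: "4412401 / (98304 * sqrt 6) \<le> 184/10" .
  have p: "0 \<le> t powr (-5/2)" "t powr (-5/2) \<le> 1" "0 \<le> t powr (-5)" "t powr (-5) \<le> 1"
    using assms powr_mono[of "-5/2" 0 t] powr_mono[of "-5" 0 t] by auto
  have q: "0 \<le> 1225 / (90049 * sqrt 6)" "1225 / (90049 * sqrt 6) \<le> 1" using s by (auto simp: divide_simps)
  have pq: "0 \<le> 1225 / (90049 * sqrt 6) * t powr (-5/2)" "1225 / (90049 * sqrt 6) * t powr (-5/2) \<le> 1 * 1"
    using p q by (auto intro: mult_mono)
  have "\<bar>1 - 1225 / (90049 * sqrt 6) * t powr (-5/2) + 30625/2161176 * t powr (-5)\<bar> \<le> 102/100"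
  proof -
    have "0 \<le> a \<Longrightarrow> a \<le> 1 \<Longrightarrow> 0 \<le> q \<Longrightarrow> q \<le> 1 \<Longrightarrow> \<bar>1 - a + 30625/2161176 * q\<bar> \<le> 102/100" for a q :: real
      by arith
    from this[OF pq(1) _ p(3,4)] pq(2) show ?thesis by simp
  qed
  then have "4412401 / (98304 * sqrt 6) * t powr (-19/2) * \<bar>1 - 1225 / (90049 * sqrt 6) * t powr (-5/2) + 30625/2161176 * t powr (-5)\<bar>
      \<le> 184/10 * t powr (-19/2) * (102/100)"
    using 1 by (intro mult_mono) auto
  also have "\<dots> \<le> 19 * t powr (-19/2)" by simp
  finally show ?thesis unfolding N0_def abs_mult by simp
qed

lemma fj_props:
  assumes j: "Re j = 0"
  shows "continuous_on {5..} (fj j)" "t \<ge> 5 \<Longrightarrow> cmod (fj j t) \<le> 19 * t powr (-73/8)"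
proof -
  show "continuous_on {5..} (fj j)"
    unfolding fj_def Gj_def N0_def by (intro continuous_intros) auto
  assume t: "t \<ge> 5"
  have "cmod (fj j t) = t powr (-5/8) * (t powr 1 * \<bar>N0 t\<bar>)"
    using t j by (simp add: fj_def norm_mult norm_Gj abs_mult del: of_real_mult)
  also have "\<dots> \<le> t powr (-5/8) * (t powr 1 * (19 * t powr (-19/2)))"
    by (intro mult_left_mono N0_bound t) auto
  also have "\<dots> = 19 * (t powr (-5/8) * t powr 1 * t powr (-19/2))" by simp
  also have "\<dots> = 19 * t powr (-73/8)" unfolding powr_add[symmetric] by simp
  finally show "cmod (fj j t) \<le> 19 * t powr (-73/8)" .
qed

lemma Ij_props:
  assumes j: "Re j = 0" and x: "x \<ge> 11/2"
  shows "cmod (Ij j x) \<le> 19 / (65/8) * x powr (-65/8)" "(Ij j has_vector_derivative - fj j x) (at x)"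
  using tail_integral[OF fj_props(1)[OF j] _ _ fj_props(2)[OF j], of x] x
  by (auto simp: Ij_def[abs_def])

text \<open>As in variation of parameters, the terms from differentiating the two integrals cancel
  in the derivative, since G1 G2 enters both with opposite signs. Crude bounds for the integrals
  suffice, as \<open>w0\<close> only has to be small.\<close>

lemma w0_bounds:
  assumes x: "x \<ge> 11/2"
  shows "cmod (w0 x) \<le> 2 / x ^ 8" "\<exists>d. (w0 has_vector_derivative d) (at x) \<and> cmod d \<le> 4 / x ^ 8"
proof -
  have x0: "x > 0" using x by simp
  have a: "cmod (1 / (\<i> * of_real aa)) \<le> 1/4"
    using c4_bounds(1) by (simp add: norm_divide norm_mult bb_c4 divide_simps)
  have x8: "x powr (-35/4) \<le> 1 / x ^ 8" "x powr (-17/2) \<le> 1 / x ^ 8"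
    using powr_mono[of "-35/4" "-8" x] powr_mono[of "-17/2" "-8" x] x by (auto simp: powr_minus_divide powr_numeral)
  have I: "cmod (Ij j x) \<le> 19 / (65/8) * x powr (-65/8)" if "Re j = 0" for j using Ij_props(1)[OF that x] .
  have t: "cmod (Gj j x * Ij k x) \<le> 3 / x ^ 8" if "Re j = 0" "Re k = 0" for j k
  proof -
    have "cmod (Gj j x * Ij k x) \<le> x powr (-5/8) * (19 / (65/8) * x powr (-65/8))"
      unfolding norm_mult norm_Gj[OF that(1)] by (intro mult_left_mono I that) auto
    also have "\<dots> = 152/65 * x powr (-35/4)" by (simp add: powr_add[symmetric])
    also have "\<dots> \<le> 3 * (1 / x ^ 8)" using x8 by (intro mult_mono) auto
    finally show ?thesis by simp
  qed
  have "cmod (w0 x) \<le> 1/4 * (3 / x ^ 8 + 3 / x ^ 8)"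
    unfolding w0_eq norm_mult[of "1 / (\<i> * of_real aa)"]
    by (intro mult_mono a order_trans[OF norm_triangle_ineq4] add_mono t) auto
  also have "\<dots> \<le> 2 / x ^ 8" using x0 by (simp add: divide_simps)
  finally show "cmod (w0 x) \<le> 2 / x ^ 8" .
  define d where "d = 1 / (\<i> * of_real aa) * (Gd (- \<i>) x * Ij \<i> x - Gd \<i> x * Ij (- \<i>) x)"
  have "((\<lambda>x. 1 / (\<i> * of_real aa) * (Gj (- \<i>) x * Ij \<i> x - Gj \<i> x * Ij (- \<i>) x)) has_vector_derivative
     1 / (\<i> * of_real aa) * ((Gj (- \<i>) x * (- fj \<i> x) + Gd (- \<i>) x * Ij \<i> x) - (Gj \<i> x * (- fj (- \<i>) x) + Gd \<i> x * Ij (- \<i>) x))) (at x)"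
    by (intro has_vector_derivative_mult_right has_vector_derivative_diff has_vector_derivative_mult Gj_deriv Ij_props(2) x x0) auto
  then have "(w0 has_vector_derivative d) (at x)"
    unfolding w0_eq[abs_def] d_def by (rule has_vector_derivative_eq_rhs) (simp add: fj_def algebra_simps)
  moreover have "cmod d \<le> 4 / x ^ 8"
  proof -
    have t': "cmod (Gd j x * Ij k x) \<le> 8 / x ^ 8" if "Re j = 0" "cmod j = 1" "Re k = 0" for j k
    proof -
      have "cmod (Gd j x * Ij k x) \<le> (3 * x powr (-3/8)) * (19 / (65/8) * x powr (-65/8))"
        unfolding norm_mult by (intro mult_mono I norm_Gd that x) auto
      also have "\<dots> = 456/65 * x powr (-17/2)" by (simp add: powr_add[symmetric])
      also have "\<dots> \<le> 8 * (1 / x ^ 8)" using x8 by (intro mult_mono) auto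
      finally show ?thesis by simp
    qed
    have "cmod d \<le> 1/4 * (8 / x ^ 8 + 8 / x ^ 8)"
      unfolding d_def norm_mult[of "1 / (\<i> * of_real aa)"]
      by (intro mult_mono a order_trans[OF norm_triangle_ineq4] add_mono t') auto
    also have "\<dots> = 4 / x ^ 8" by simp
    finally show ?thesis .
  qed
  ultimately show "\<exists>d. (w0 has_vector_derivative d) (at x) \<and> cmod d \<le> 4 / x ^ 8" by blast
qed

text \<open>The part of the expansion \<open>ac\<close> that is written out in \<open>y0\<close> on
  \<open>D1\<close>.\<close>

definition a3 :: "real poly" where "a3 = [:1, 1/8, -49/128, 1225/256:]"

lemma y0_D1_eq:
  assumes "x > 0"
  shows "y0_D1 x = of_real (asy a3 x) + of_real (qx x) * w0 x"
proof -
  have s2: "sx x * sx x = x powr (-5) / 6" unfolding sx_def by (simp add: powr_add[symmetric])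
  have "sx x * (sx x * sx x) = x powr (-15/2) / (6 * sqrt 6)"
    unfolding s2 sx_def by (simp add: powr_add[symmetric])
  then have "1 + 1 / (8 * sqrt 6) * x powr (-5/2) - 49/768 * x powr (-5) + 1225 / (1536 * sqrt 6) * x powr (-15/2)
     = 1 + 1/8 * sx x - 49/128 * (sx x * sx x) + 1225/256 * (sx x * (sx x * sx x))"
    unfolding s2 by (simp add: sx_def)
  also have "\<dots> = poly a3 (sx x)" by (simp add: a3_def algebra_simps)
  finally show ?thesis
    unfolding y0_D1_def qx_sqrt[OF assms, symmetric] asy_def by (simp add: algebra_simps)
qed

lemma asy_small:
  assumes x: "x \<ge> 11/2" and p: "p = pCons 0 (Poly cs)"
    and b: "foldr (\<lambda>c acc. \<bar>c\<bar> + 576/100000 * acc) cs 0 \<le> B"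
  shows "\<bar>asy p x\<bar> \<le> B / 100"
proof -
  note s = sx_bounds[OF x]
  have "\<bar>poly (Poly cs) (sx x)\<bar> \<le> B"
    by (rule order_trans[OF poly_small_bound b]) (use s in simp)
  moreover have "asy p x = (qx x * sx x) * poly (Poly cs) (sx x)" unfolding asy_def p by simp
  moreover have "1 / (6 * x\<^sup>2) \<le> 1 / 100"
  proof -
    have "(11/2)\<^sup>2 \<le> x\<^sup>2" using x by (intro power_mono) auto
    then show ?thesis by (simp add: divide_simps power2_eq_square)
  qed
  ultimately show ?thesis unfolding s(5) abs_mult
    using mult_mono[of "1 / (6 * x\<^sup>2)" "1/100" "\<bar>poly (Poly cs) (sx x)\<bar>" B] x by simp
qed

context tritronquee
begin

text \<open>The barrier puts y within 10^(-7) of the long expansion. The omitted terms of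
  \<open>ac\<close> cost at most 10^(-5) and \<open>w0\<close> at most 132 / 10^7, and the sum still
  fits under 235 / 10^7.\<close>

lemma D1_estimate:
  assumes x: "x \<ge> 11/2"
  shows "\<not> is_pole y (of_real x)" "cmod (y (of_real x) - y0_D1 x) \<le> 235 / 10 ^ 7"
    "\<exists>d. ((\<lambda>t. y (of_real t) - y0_D1 t) has_vector_derivative d) (at x) \<and> cmod d \<le> 116 / 10 ^ 6"
proof -
  have x0: "x > 0" using x by simp
  note b = large_x_bound[OF x]
  show np: "\<not> is_pole y (of_real x)" using b by simp
  have x14: "(11/2) ^ 13 \<le> x ^ 13" "(11/2) ^ 7 \<le> x ^ 7" using x by (intro power_mono; simp)+
  have "1 / x ^ 13 \<le> 1 / (11/2) ^ 13" using x14 x0 by (intro divide_left_mono mult_pos_pos) auto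
  also have "\<dots> \<le> 1 / 10 ^ 9" by (simp add: power_divide)
  finally have i13: "1 / x ^ 13 \<le> 1 / 10 ^ 9" .
  have "1 / x ^ 7 \<le> 1 / (11/2) ^ 7" using x14 x0 by (intro divide_left_mono mult_pos_pos) auto
  also have "\<dots> \<le> 66 / 10 ^ 7" by (simp add: power_divide)
  finally have i7: "1 / x ^ 7 \<le> 66 / 10 ^ 7" .
  have avg: "v \<le> (p + q) / 2 \<Longrightarrow> p < s \<Longrightarrow> q < s \<Longrightarrow> v \<le> s" for v p q s :: real by (simp add: field_simps)
  have V: "cmod (Vf x) \<le> 456 / x ^ 14" "cmod (Wf x) \<le> 456 / x ^ 14"
    using avg[OF cmod_Vf_le] avg[OF cmod_Wf_le] b by blast+
  have x14': "456 / x ^ 14 = 456 / x * (1 / x ^ 13)" by (simp add: eval_nat_numeral)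
  have "456 / x * (1 / x ^ 13) \<le> 100 * (1 / 10 ^ 9)" using i13 x by (intro mult_mono) (auto simp: divide_simps)
  then have E: "cmod (Ef x) \<le> 1 / 10 ^ 7" using cmod_Ef_le[OF x] V(1) unfolding x14' by simp
  have Ed: "cmod (Ed x) \<le> 2 / 10 ^ 6"
  proof -
    note e = eighth_powers[OF x0]
    define a where "a = x powr (1/8)"
    have a: "a > 0" "a \<le> x" using e(1) x powr_mono[of "1/8" 1 x] by (auto simp: a_def)
    have "Ed x = of_real (c4 * a) * Wf x - of_real (1 / (8 * x)) * Ef x"
      using c4(1) a unfolding Wf_def e(7) a_def[symmetric] by (simp add: field_simps)
    then have "cmod (Ed x) \<le> c4 * a * cmod (Wf x) + 1 / (8 * x) * cmod (Ef x)"
      using norm_triangle_ineq4[of "of_real (c4 * a) * Wf x" "of_real (1 / (8 * x)) * Ef x"] c4(1) a x0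
      by (simp add: norm_mult norm_divide)
    also have "\<dots> \<le> 2214/1000 * x * (456 / x ^ 14) + 1 * (1 / 10 ^ 7)"
      using c4 c4_bounds a V E x by (intro add_mono mult_mono) (auto simp: divide_simps)
    also have "2214/1000 * x * (456 / x ^ 14) = 1009584 / 1000 * (1 / x ^ 13)" using x0 by (simp add: eval_nat_numeral)
    also have "\<dots> \<le> 1009584 / 1000 * (1 / 10 ^ 9)" by (intro mult_left_mono i13) auto
    finally show ?thesis by simp
  qed
  have pl: "ac - a3 = pCons 0 (Poly [0, 0, 0, -4412401/32768, 220680075/32768, -2207064977649/4194304])"
    by (simp add: ac_def a3_def)
  have A1: "\<bar>asy (ac - a3) x\<bar> \<le> 1/1000 / 100"
    by (rule asy_small[OF x pl]) simp
  \<comment> \<open>\<open>Dp\<close> multiplies the coefficient of s^n by (1 - 5 n) / 2, here for n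
    = 4, 5, 6.\<close>
  have pl2: "Dp (ac - a3) = pCons 0 (Poly [0, 0, 0, -19/2 * (-4412401/32768), -12 * (220680075/32768), -29/2 * (-2207064977649/4194304)])"
    unfolding pl by (simp add: Dp_def pderiv_pCons)
  have A2: "\<bar>asy (Dp (ac - a3)) x\<bar> \<le> 1/1000 / 100"
    by (rule asy_small[OF x pl2]) simp
  have q: "0 \<le> qx x" "qx x \<le> x"
  proof -
    have "x \<le> x\<^sup>2 * 6" using x by (simp add: power2_eq_square)
    then have "sqrt (x / 6) \<le> sqrt (x\<^sup>2)" by (intro real_sqrt_le_mono) simp
    then show "qx x \<le> x" using x0 by (simp add: qx_sqrt)
  qed (use qx_pos[OF x0] in simp)
  have asd: "asy (ac - a3) t = asy ac t - asy a3 t" for t by (simp add: asy_def algebra_simps)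
  have diff: "y (of_real t) - y0_D1 t = Ef t + of_real (asy (ac - a3) t) - of_real (qx t) * w0 t" if "t > 0" for t
    unfolding y0_D1_eq[OF that] Ef_def asd by simp
  note w = w0_bounds[OF x]
  have "cmod (of_real (qx x) * w0 x) \<le> x * (2 / x ^ 8)"
    unfolding norm_mult norm_of_real using q w(1) x0 by (intro mult_mono) auto
  also have "\<dots> = 2 * (1 / x ^ 7)" using x0 by (simp add: eval_nat_numeral)
  also have "\<dots> \<le> 132 / 10 ^ 7" using i7 by simp
  finally have qw: "cmod (of_real (qx x) * w0 x) \<le> 132 / 10 ^ 7" .
  have "cmod (y (of_real x) - y0_D1 x) \<le> cmod (Ef x) + \<bar>asy (ac - a3) x\<bar> + cmod (of_real (qx x) * w0 x)"
    unfolding diff[OF x0]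
    using norm_triangle_ineq4[of "Ef x + of_real (asy (ac - a3) x)" "of_real (qx x) * w0 x"]
      norm_triangle_ineq[of "Ef x" "of_real (asy (ac - a3) x)"] by simp
  then show "cmod (y (of_real x) - y0_D1 x) \<le> 235 / 10 ^ 7" using E A1 qw by simp
  obtain d where d: "(w0 has_vector_derivative d) (at x)" "cmod d \<le> 4 / x ^ 8" using w(2) by blast
  have dq: "(qx has_real_derivative qx x / (2 * x)) (at x)"
    using asy_deriv[OF x0, of "[:1:]"] by (simp add: asy_def[abs_def] Dp_def)
  define D where "D = Ed x + of_real (asy (Dp (ac - a3)) x / x) - (of_real (qx x) * d + of_real (qx x / (2 * x)) * w0 x)"
  have "((\<lambda>t. Ef t + of_real (asy (ac - a3) t) - of_real (qx t) * w0 t) has_vector_derivative D) (at x)"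
    unfolding D_def
    by (intro has_vector_derivative_diff has_vector_derivative_add has_vector_derivative_mult Ef_deriv x0 np
         has_vector_derivative_of_real asy_deriv dq d)
  then have "((\<lambda>t. y (of_real t) - y0_D1 t) has_vector_derivative D) (at x)"
  proof (rule has_vector_derivative_transform_within_open[of _ _ _ "{0<..}"])
    fix t :: real assume "t \<in> {0<..}"
    then show "Ef t + of_real (asy (ac - a3) t) - of_real (qx t) * w0 t = y (of_real t) - y0_D1 t"
      using diff[of t] by simp
  qed (use x0 in auto)
  moreover have "cmod D \<le> 116 / 10 ^ 6"
  proof -
    have "cmod (of_real (qx x) * d) \<le> x * (4 / x ^ 8)"
      unfolding norm_mult norm_of_real using q d(2) x0 by (intro mult_mono) auto
    also have "\<dots> = 4 * (1 / x ^ 7)" using x0 by (simp add: eval_nat_numeral)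
    finally have 1: "cmod (of_real (qx x) * d) \<le> 264 / 10 ^ 7" using i7 by simp
    have "qx x / (2 * x) \<le> 1" using q x0 by (simp add: divide_simps)
    then have "cmod (of_real (qx x / (2 * x)) * w0 x) \<le> 1 * (2 / x ^ 8)"
      unfolding norm_mult norm_of_real using q x0 w(1) by (intro mult_mono) auto
    also have "\<dots> = 2 / x * (1 / x ^ 7)" by (simp add: eval_nat_numeral)
    also have "\<dots> \<le> 1 * (66 / 10 ^ 7)" using i7 x by (intro mult_mono) (auto simp: divide_simps)
    finally have 2: "cmod (of_real (qx x / (2 * x)) * w0 x) \<le> 66 / 10 ^ 7" by simp
    have 3: "\<bar>asy (Dp (ac - a3)) x / x\<bar> \<le> 1/1000 / 100"
      using A2 x by (simp add: abs_divide divide_simps)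
    have "cmod D \<le> cmod (Ed x) + \<bar>asy (Dp (ac - a3)) x / x\<bar> + (cmod (of_real (qx x) * d) + cmod (of_real (qx x / (2 * x)) * w0 x))"
      unfolding D_def
      by (rule order_trans[OF norm_triangle_ineq4], intro add_mono order_trans[OF norm_triangle_ineq] norm_triangle_ineq order.refl)
         (simp_all del: of_real_divide)
    then show ?thesis using Ed 1 2 3 by simp
  qed
  ultimately show "\<exists>d. ((\<lambda>t. y (of_real t) - y0_D1 t) has_vector_derivative d) (at x) \<and> cmod d \<le> 116 / 10 ^ 6" by blast
qed

end

section \<open>Integer polynomials and Chebyshev norms\<close>

text \<open>Coefficients are integers, lowest degree first, so that every numerical claim about
  polynomials reduces to an evaluation by \<open>code_simp\<close> without rational
  arithmetic.\<close>

fun peval :: "int list \<Rightarrow> 'a :: real_normed_field \<Rightarrow> 'a" where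
  "peval [] x = 0"
| "peval (c # cs) x = of_int c + x * peval cs x"

fun padd :: "int list \<Rightarrow> int list \<Rightarrow> int list" where
  "padd [] q = q"
| "padd (c # cs) q = (case q of [] \<Rightarrow> c # cs | d # ds \<Rightarrow> (c + d) # padd cs ds)"

definition psmul :: "int \<Rightarrow> int list \<Rightarrow> int list" where
  "psmul c p = map ((*) c) p"

fun pmul :: "int list \<Rightarrow> int list \<Rightarrow> int list" where
  "pmul [] q = []"
| "pmul (c # cs) q = padd (psmul c q) (0 # pmul cs q)"

fun pder :: "int list \<Rightarrow> int list" where
  "pder [] = []"
| "pder (c # cs) = padd cs (0 # pder cs)"

lemma peval_padd: "peval (padd p q) x = peval p x + peval q x"
  by (induction p q rule: padd.induct) (auto split: list.splits simp: algebra_simps)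

lemma peval_psmul: "peval (psmul c p) x = of_int c * peval p x"
  by (induction p) (auto simp: psmul_def algebra_simps)

lemma peval_pmul: "peval (pmul p q) x = peval p x * peval q x"
  by (induction p) (auto simp: peval_padd peval_psmul algebra_simps)

lemma has_field_derivative_peval:
  "(peval p has_field_derivative peval (pder p) x) (at x within S)"
proof (induction p)
  case Nil
  show ?case by (simp add: fun_eq_iff[THEN iffD2, of "peval []" "\<lambda>_. 0"])
next
  case (Cons c cs)
  have "peval (c # cs) = (\<lambda>x. of_int c + x * peval cs x)" by auto
  then show ?case
    by (auto intro!: derivative_eq_intros Cons simp: peval_padd)
qed

fun ccos :: "nat \<Rightarrow> int list \<Rightarrow> real \<Rightarrow> real" where
  "ccos k [] t = 0"
| "ccos k (a # as) t = of_int a * cos (real k * t) + ccos (Suc k) as t"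

text \<open>\<open>dbl_cos\<close> acts on the list \<open>[a0, a1, a2, \<dots>]\<close> standing for
  \<open>a0 + 2 a1 cos t + 2 a2 cos 2t + \<dots>\<close>; with this normalisation no halves occur.\<close>

fun dbl_cos :: "int list \<Rightarrow> int list" where
  "dbl_cos [] = []"
| "dbl_cos [a] = [0, a]"
| "dbl_cos (a # b # cs) = 2 * b # padd (a # b # cs) cs"

text \<open>Horner's rule in the Chebyshev basis. Multiplication by cos t is available only in the
  doubled form \<open>dbl_cos\<close>, so each coefficient costs a factor 2 and the list represents
  2^(length p) p(cos t).\<close>

fun cheb :: "int list \<Rightarrow> int list" where
  "cheb [] = [0]"
| "cheb (c # cs) = padd [c * 2 ^ length (c # cs)] (dbl_cos (cheb cs))"

definition cheb_eval :: "int list \<Rightarrow> real \<Rightarrow> real" where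
  "cheb_eval d t = 2 * ccos 0 d t - (if d = [] then 0 else of_int (hd d))"

text \<open>The sum of the moduli of the Chebyshev coefficients bounds the polynomial on [-1, 1].
  Passing to this basis first lets the monomials cancel, which a sum of moduli of the monomial
  coefficients would ignore.\<close>

definition cheb_norm :: "int list \<Rightarrow> int" where
  "cheb_norm p = (let d = cheb p in 2 * sum_list (map abs (tl d)) + \<bar>hd d\<bar>)"

lemma ccos_padd: "ccos k (padd p q) t = ccos k p t + ccos k q t"
  by (induction p q arbitrary: k rule: padd.induct) (auto split: list.splits simp: algebra_simps)

lemma two_cos_mult_ccos:
  "2 * cos t * ccos (Suc k) as t = ccos (Suc (Suc k)) as t + ccos k as t"
proof (induction as arbitrary: k)
  case (Cons a as)
  have "2 * cos t * cos (real (Suc k) * t) = cos (real (Suc (Suc k)) * t) + cos (real k * t)"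
    using cos_add[of "real (Suc k) * t" t] cos_diff[of "real (Suc k) * t" t]
    by (simp add: algebra_simps)
  then show ?case using Cons.IH[of "Suc k"] by (simp add: algebra_simps)
qed simp

lemma cheb_eval_dbl_cos: "cheb_eval (dbl_cos d) t = 2 * cos t * cheb_eval d t"
proof (cases d rule: dbl_cos.cases)
  case 1
  then show ?thesis by (simp add: cheb_eval_def)
next
  case (2 a)
  then show ?thesis by (simp add: cheb_eval_def)
next
  case (3 a b cs)
  have hd: "hd (padd (a # b # cs) cs) = (if cs = [] then a else a + hd cs)" for cs
    by (cases cs) auto
  have "2 * cos t * ccos 0 (a # b # cs) t = 2 * of_int a * cos t + (ccos 2 (b # cs) t + ccos 0 (b # cs) t)"
    using two_cos_mult_ccos[of t 0 "b # cs"] by (simp add: algebra_simps numeral_2_eq_2)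
  moreover have "ccos 1 (padd (a # b # cs) cs) t = of_int a * cos t + ccos 2 (b # cs) t + ccos 1 cs t"
    unfolding ccos_padd by (simp add: numeral_2_eq_2)
  ultimately show ?thesis unfolding 3 by (simp add: cheb_eval_def algebra_simps)
qed

lemma padd_eq_Nil_iff: "padd p q = [] \<longleftrightarrow> p = [] \<and> q = []"
  by (cases p) (auto split: list.splits)

lemma cheb_eval_padd1: "q \<noteq> [] \<Longrightarrow> cheb_eval (padd [c] q) t = of_int c + cheb_eval q t"
  by (cases q) (auto simp: cheb_eval_def algebra_simps)

lemma dbl_cos_neq_Nil: "d \<noteq> [] \<Longrightarrow> dbl_cos d \<noteq> []"
  by (cases d rule: dbl_cos.cases) auto

lemma cheb_neq_Nil: "cheb p \<noteq> []"
  by (induction p) (auto simp: padd_eq_Nil_iff dbl_cos_neq_Nil split: list.splits)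

lemma cheb_eval_cheb: "cheb_eval (cheb p) t = 2 ^ length p * peval p (cos t)"
proof (induction p)
  case Nil
  show ?case by (simp add: cheb_eval_def)
next
  case (Cons c cs)
  have "cheb_eval (cheb (c # cs)) t = of_int (c * 2 ^ length (c # cs)) + cheb_eval (dbl_cos (cheb cs)) t"
    unfolding cheb.simps by (rule cheb_eval_padd1) (simp add: dbl_cos_neq_Nil cheb_neq_Nil)
  also have "\<dots> = 2 ^ length (c # cs) * peval (c # cs) (cos t)"
    unfolding cheb_eval_dbl_cos Cons by (simp add: algebra_simps)
  finally show ?case .
qed

lemma abs_ccos_le: "\<bar>ccos k d t\<bar> \<le> of_int (sum_list (map abs d))"
proof (induction d arbitrary: k)
  case (Cons a d)
  have "\<bar>of_int a * cos (real k * t)\<bar> \<le> \<bar>of_int a\<bar> * 1"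
    unfolding abs_mult by (intro mult_left_mono) auto
  then show ?case using Cons[of "Suc k"] by (simp add: abs_le_iff)
qed simp

lemma abs_cheb_eval_le:
  "d \<noteq> [] \<Longrightarrow> \<bar>cheb_eval d t\<bar> \<le> of_int (2 * sum_list (map abs (tl d)) + \<bar>hd d\<bar>)"
  using abs_ccos_le[of 1 "tl d" t] by (cases d) (auto simp: cheb_eval_def algebra_simps)

lemma abs_peval_le_cheb_norm:
  fixes x :: real
  assumes "\<bar>x\<bar> \<le> 1"
  shows "2 ^ length p * \<bar>peval p x\<bar> \<le> of_int (cheb_norm p)"
proof -
  have "cos (arccos x) = x" using assms by (simp add: cos_arccos_abs)
  then have "2 ^ length p * \<bar>peval p x\<bar> = \<bar>cheb_eval (cheb p) (arccos x)\<bar>"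
    by (simp add: cheb_eval_cheb abs_mult)
  also have "\<dots> \<le> of_int (cheb_norm p)"
    unfolding cheb_norm_def Let_def by (rule abs_cheb_eval_le) (rule cheb_neq_Nil)
  finally show ?thesis .
qed

text \<open>The coefficients of \<open>Pu\<close> times 10^14, rounded to integers;
  \<open>Pu_close\<close> certifies the rounding.\<close>

definition pz :: "int list" where
  "pz = [62305820109746, 42432655124479, -9958731206396, 3568939674592, -1123348183394, 80552313910, 328979342400, -439411550269, 411691795890, -320779201363, 236930838120, -208468704419, 139091299378, 14507211142, -14329142528, -144430564310, 87273042589, 106462417409, -64842706265, -61450478811, 35467781635, 16574882260, -9961897567]"

text \<open>With \<open>\<zeta> = x - x0\<close> one has \<open>646570 \<zeta> = 2775133 + 2322534 \<tau>\<close> and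
  \<open>646570 x = 1233601 + 2322534 \<tau>\<close>; all denominators are cleared.\<close>

definition resid_z :: "int list" where
  "resid_z = (let z2 = pmul [2775133, 2322534] [2775133, 2322534] in
     padd (pmul z2 (padd (psmul (646570 ^ 3 * 10 ^ 14) (pder (pder pz)))
             (padd (psmul (6 * 646570 * 2322534 ^ 2) (pmul pz pz))
                   (psmul (- (2322534 ^ 2 * 10 ^ 28)) [1233601, 2322534]))))
          (psmul (- (12 * 646570 ^ 3 * 2322534 ^ 2 * 10 ^ 14)) pz))"

lemma resid_z_length: "length resid_z = 47"
  by code_simp

text \<open>With the cleared denominators restored, this bounds (x - x0)^2 times the residual by 172
  / 10^9; the exponent 47 is the length of the list.\<close>

lemma cheb_norm_resid: "cheb_norm resid_z * 10 ^ 9 \<le> 172 * 646570 ^ 3 * 2322534 ^ 2 * 10 ^ 28 * 2 ^ 47"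
  by code_simp

text \<open>Divided by 10^14, the derivative with respect to \<open>\<tau>\<close> differs from 0.45
  by less than 0.44, so it is positive on the whole interval.\<close>

lemma cheb_norm_pder:
  "cheb_norm (padd [- 45000000000000] (pder pz)) < 44 * 10 ^ 12 * 2 ^ 23" 
  "length (padd [- 45000000000000] (pder pz)) = 23"
  by code_simp+

section \<open>The polynomial approximant on the real interval\<close>

text \<open>A homogenised Horner scheme: the value at the fraction n / d times d^(length), computed
  without leaving the integers.\<close>

fun ph :: "int list \<Rightarrow> int \<Rightarrow> int \<Rightarrow> int" where
  "ph [] n d = 0"
| "ph (c # cs) n d = c * d ^ length (c # cs) + n * ph cs n d"

lemma peval_rat: "d \<noteq> 0 \<Longrightarrow> peval cs (of_int n / of_int d :: real) * of_int d ^ length cs = of_int (ph cs n d)"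
  by (induction cs) (auto simp: field_simps)

lemma pz_ends: "peval pz (1::real) = 97419192198228" "peval (pder pz) (1::real) = 29712441219622"
  "peval pz (-1::real) = 7328889948988" "peval (pder pz) (-1::real) = 58884951002870"
proof -
  have "ph pz 1 1 = 97419192198228" "ph (pder pz) 1 1 = 29712441219622"
    "ph pz (-1) 1 = 7328889948988" "ph (pder pz) (-1) 1 = 58884951002870" by code_simp+
  then show "peval pz (1::real) = 97419192198228" "peval (pder pz) (1::real) = 29712441219622"
    "peval pz (-1::real) = 7328889948988" "peval (pder pz) (-1::real) = 58884951002870"
    using peval_rat[of 1 pz 1] peval_rat[of 1 "pder pz" 1] peval_rat[of 1 pz "-1"] peval_rat[of 1 "pder pz" "-1"]
    by simp_all
qed

lemma peval_bounds:
  assumes "d > 0" "lo * d ^ length cs \<le> ph cs n d" "ph cs n d \<le> hi * d ^ length cs"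
  shows "of_int lo \<le> peval cs (of_int n / of_int d :: real)" "peval cs (of_int n / of_int d :: real) \<le> of_int hi"
proof -
  have d: "real_of_int d ^ length cs > 0" using assms(1) by simp
  have "real_of_int (lo * d ^ length cs) \<le> of_int (ph cs n d)" "of_int (ph cs n d) \<le> real_of_int (hi * d ^ length cs)"
    using assms by (simp_all only: of_int_le_iff)
  then have "real_of_int lo * of_int d ^ length cs \<le> peval cs (of_int n / of_int d) * of_int d ^ length cs"
    "peval cs (of_int n / of_int d) * of_int d ^ length cs \<le> real_of_int hi * of_int d ^ length cs"
    using peval_rat[of d cs n] assms(1) by simp_all
  then show "of_int lo \<le> peval cs (of_int n / of_int d :: real)" "peval cs (of_int n / of_int d :: real) \<le> of_int hi"
    using d by (simp_all only: mult_le_cancel_right_pos)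
qed

text \<open>The argument is the image under \<open>tx\<close> of \<open>cc\<close>, the point where
  the energy argument ends.\<close>

lemma pz_mid: "31789258467000 \<le> peval pz (-61/100::real)" "peval pz (-61/100::real) \<le> 31789258468000"
proof -
  have "31789258467000 * 100 ^ length pz \<le> ph pz (-61) 100" "ph pz (-61) 100 \<le> 31789258468000 * 100 ^ length pz"
    by code_simp+
  from peval_bounds[OF _ this] show "31789258467000 \<le> peval pz (-61/100::real)" "peval pz (-61/100::real) \<le> 31789258468000"
    by simp_all
qed

text \<open>The argument is \<open>tx 0\<close>; these enclosures feed the Taylor coefficients at
  the origin.\<close>

lemma pz_zero: "36347868000000 \<le> peval pz (-1233601/2322534::real)" "peval pz (-1233601/2322534::real) \<le> 36347869000000"
  "56513706000000 \<le> peval (pder pz) (-1233601/2322534::real)" "peval (pder pz) (-1233601/2322534::real) \<le> 56513707000000"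
proof -
  have 1: "36347868000000 * 2322534 ^ length pz \<le> ph pz (-1233601) 2322534" "ph pz (-1233601) 2322534 \<le> 36347869000000 * 2322534 ^ length pz"
    by code_simp+
  have 2: "56513706000000 * 2322534 ^ length (pder pz) \<le> ph (pder pz) (-1233601) 2322534"
      "ph (pder pz) (-1233601) 2322534 \<le> 56513707000000 * 2322534 ^ length (pder pz)"
    by code_simp+
  from peval_bounds[OF _ 1] show "36347868000000 \<le> peval pz (-1233601/2322534::real)" "peval pz (-1233601/2322534::real) \<le> 36347869000000"
    by simp_all
  from peval_bounds[OF _ 2] show "56513706000000 \<le> peval (pder pz) (-1233601/2322534::real)" "peval (pder pz) (-1233601/2322534::real) \<le> 56513707000000"
    by simp_all
qed

lemma pder_pos:
  fixes t :: real
  assumes "\<bar>t\<bar> \<le> 1"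
  shows "peval (pder pz) t > 0"
proof -
  have "2 ^ 23 * \<bar>peval (padd [- 45000000000000] (pder pz)) t\<bar> \<le> of_int (cheb_norm (padd [- 45000000000000] (pder pz)))"
    using abs_peval_le_cheb_norm[OF assms, of "padd [- 45000000000000] (pder pz)"] cheb_norm_pder(2) by simp
  also have "\<dots> < of_int (44 * 10 ^ 12 * 2 ^ 23)" using cheb_norm_pder(1) by (simp only: of_int_less_iff)
  finally have "\<bar>peval (padd [- 45000000000000] (pder pz)) t\<bar> < 44 * 10 ^ 12" by simp
  then show ?thesis unfolding peval_padd by simp
qed

text \<open>Half the length of the interval from x0 + r to L, that is dx /
  d\<open>\<tau>\<close>.\<close>

definition hh :: real where "hh = 2322534/646570"
definition tx :: "real \<Rightarrow> real" where "tx x = (646570 * x - 1233601) / 2322534"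
lemma tx_eq: "2322534 * tx x = 646570 * x - 1233601"
  unfolding tx_def by (subst times_divide_eq_right, subst nonzero_mult_div_cancel_left) simp_all

definition Yr :: "real \<Rightarrow> real" where "Yr x = - 1 / (x - x0)\<^sup>2 + peval pz (tx x) / 10 ^ 14"
definition Yr1 :: "real \<Rightarrow> real" where "Yr1 x = 2 / (x - x0) ^ 3 + peval (pder pz) (tx x) / hh / 10 ^ 14"
definition Yr2 :: "real \<Rightarrow> real" where "Yr2 x = - 6 / (x - x0) ^ 4 + peval (pder (pder pz)) (tx x) / hh\<^sup>2 / 10 ^ 14"
definition Rr :: "real \<Rightarrow> real" where "Rr x = Yr2 x + 6 * (Yr x)\<^sup>2 - x"

lemma tx_deriv: "(tx has_real_derivative 1 / hh) (at x)"
  unfolding tx_def[abs_def] hh_def by (auto intro!: derivative_eq_intros)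

lemma Yr_deriv:
  assumes "x > x0"
  shows "(Yr has_real_derivative Yr1 x) (at x)" "(Yr1 has_real_derivative Yr2 x) (at x)"
proof -
  note p = DERIV_chain2[OF has_field_derivative_peval tx_deriv]
  have z: "((\<lambda>x. x - x0) has_real_derivative 1) (at x)" by (auto intro!: derivative_eq_intros)
  have x: "x - x0 \<noteq> 0" using assms by simp
  have 1: "((\<lambda>x. - 1 / (x - x0)\<^sup>2) has_real_derivative 2 / (x - x0) ^ 3) (at x)"
  proof -
    have d: "((\<lambda>x. - 1 / (x - x0)\<^sup>2) has_real_derivative (0 * (x - x0)\<^sup>2 - (- 1) * (2 * (x - x0))) / ((x - x0)\<^sup>2 * (x - x0)\<^sup>2)) (at x)"
      by (rule DERIV_divide) (use x in \<open>auto intro!: derivative_eq_intros\<close>)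
    have "(0 * u\<^sup>2 - (- 1) * (2 * u)) / (u\<^sup>2 * u\<^sup>2) = 2 / u ^ 3" if "u \<noteq> 0" for u :: real
      using that by (simp add: divide_simps eval_nat_numeral)
    from this[OF x] show ?thesis using d by (simp only:)
  qed
  have 2: "((\<lambda>x. 2 / (x - x0) ^ 3) has_real_derivative - 6 / (x - x0) ^ 4) (at x)"
  proof -
    have d: "((\<lambda>x. 2 / (x - x0) ^ 3) has_real_derivative (0 * (x - x0) ^ 3 - 2 * (3 * (x - x0)\<^sup>2)) / ((x - x0) ^ 3 * (x - x0) ^ 3)) (at x)"
      by (rule DERIV_divide) (use x in \<open>auto intro!: derivative_eq_intros\<close>)
    have "(0 * u ^ 3 - 2 * (3 * u\<^sup>2)) / (u ^ 3 * u ^ 3) = - 6 / u ^ 4" if "u \<noteq> 0" for u :: real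
      using that by (simp add: divide_simps eval_nat_numeral)
    from this[OF x] show ?thesis using d by (simp only:)
  qed
  show "(Yr has_real_derivative Yr1 x) (at x)"
    unfolding Yr_def[abs_def] Yr1_def
    by (rule DERIV_cong[OF DERIV_add[OF 1 DERIV_cdivide[OF p]]]) simp
  show "(Yr1 has_real_derivative Yr2 x) (at x)"
    unfolding Yr1_def[abs_def] Yr2_def
    by (rule DERIV_cong[OF DERIV_add[OF 2 DERIV_cdivide[OF DERIV_cdivide[OF p]]]]) (simp add: power2_eq_square)
qed

lemma tx_range: "x0 + r0 \<le> x \<Longrightarrow> x \<le> 11/2 \<Longrightarrow> \<bar>tx x\<bar> \<le> 1"
  by (simp add: tx_def x0_def r0_def abs_le_iff)

text \<open>The fourth-order poles -6 / z^4 of the second derivative and 6 / z^4 of the square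
  cancel. What remains has a pole of order 2 with coefficient -12 times the regular part, so z^2
  times the residual is a polynomial in \<open>\<tau>\<close>.\<close>

lemma Rr_bound:
  assumes "x0 + r0 \<le> x" "x \<le> 11/2"
  shows "\<bar>Rr x\<bar> \<le> 172 / 10 ^ 9 / (x - x0)\<^sup>2"
proof -
  define z where "z = x - x0"
  have z: "z > 0" using assms by (simp add: z_def r0_def)
  define t where "t = tx x"
  have t: "\<bar>t\<bar> \<le> 1" unfolding t_def by (rule tx_range[OF assms])
  define p p2 where "p = peval pz t" and "p2 = peval (pder (pder pz)) t"
  have zt: "2775133 + t * 2322534 = 646570 * z" using tx_eq[of x] by (simp add: t_def z_def x0_def algebra_simps)
  have xt: "1233601 + t * 2322534 = 646570 * x" using tx_eq[of x] unfolding t_def by linarith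
  have f1: "peval resid_z t = (646570 * z) * (646570 * z) * (646570 ^ 3 * 10 ^ 14 * p2 + 6 * 646570 * 2322534 ^ 2 * (p * p)
       - 2322534 ^ 2 * 10 ^ 28 * (646570 * x)) - 12 * 646570 ^ 3 * 2322534 ^ 2 * 10 ^ 14 * p"
    unfolding resid_z_def Let_def peval_pmul peval_padd peval_psmul zt[symmetric] xt[symmetric] p_def p2_def
    by (simp add: algebra_simps)
  have f2: "z\<^sup>2 * Rr x = z\<^sup>2 * (p2 / hh\<^sup>2 / 10 ^ 14 + 6 * (p / 10 ^ 14)\<^sup>2 - x) - 12 * (p / 10 ^ 14)"
    using z unfolding Rr_def Yr_def Yr2_def z_def[symmetric] t_def[symmetric] p_def[symmetric] p2_def[symmetric]
    by (simp add: field_simps eval_nat_numeral)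
  define K :: real where "K = 646570 ^ 3 * 2322534 ^ 2 * 10 ^ 28"
  have K: "K > 0" by (simp add: K_def)
  have "peval resid_z t = K * (z\<^sup>2 * Rr x)"
    unfolding f1 f2 by (simp add: K_def hh_def field_simps power2_eq_square)
  then have pz: "\<bar>peval resid_z t\<bar> = K * (z\<^sup>2 * \<bar>Rr x\<bar>)" using K by (simp add: abs_mult)
  have "2 ^ 47 * (K * (z\<^sup>2 * \<bar>Rr x\<bar>)) \<le> of_int (cheb_norm resid_z)"
    using abs_peval_le_cheb_norm[OF t, of resid_z] unfolding resid_z_length pz .
  then have "2 ^ 47 * (K * (z\<^sup>2 * \<bar>Rr x\<bar>)) * 10 ^ 9 \<le> of_int (cheb_norm resid_z) * 10 ^ 9"
    by (rule mult_right_mono) simp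
  also have "\<dots> = of_int (cheb_norm resid_z * 10 ^ 9)" by simp
  also have "\<dots> \<le> of_int (172 * 646570 ^ 3 * 2322534 ^ 2 * 10 ^ 28 * 2 ^ 47)"
    using cheb_norm_resid by (simp only: of_int_le_iff)
  also have "\<dots> = K * 2 ^ 47 * 172" by (simp add: K_def)
  finally have "K * 2 ^ 47 * (z\<^sup>2 * \<bar>Rr x\<bar> * 10 ^ 9) \<le> K * 2 ^ 47 * 172" by (simp only: ac_simps)
  then have "z\<^sup>2 * \<bar>Rr x\<bar> * 10 ^ 9 \<le> 172" using K by (subst (asm) mult_le_cancel_left_pos) simp_all
  then show ?thesis using z unfolding z_def[symmetric] by (simp add: field_simps)
qed

lemma Yr1_pos: "x0 + r0 \<le> x \<Longrightarrow> x \<le> 11/2 \<Longrightarrow> Yr1 x > 0"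
  unfolding Yr1_def using pder_pos[OF tx_range[of x]]
  by (intro add_pos_pos divide_pos_pos) (auto simp: r0_def hh_def)

lemma Yr_mono:
  assumes "x0 + r0 \<le> a" "a \<le> b" "b \<le> 11/2"
  shows "Yr a \<le> Yr b"
proof (rule DERIV_nonneg_imp_nondecreasing[OF assms(2)])
  fix x assume "a \<le> x" "x \<le> b"
  then show "\<exists>d. (Yr has_real_derivative d) (at x) \<and> 0 \<le> d"
    using Yr_deriv(1)[of x] Yr1_pos[of x] assms by (intro exI[of _ "Yr1 x"]) (auto simp: r0_def)
qed

text \<open>Divides the real interval. To the right of it \<open>Yr\<close> is at least 91/1000, and
  an oscillator energy controls the error; to the left \<open>Yr\<close> is bounded by 1 / (x -
  x0)^2 and the error is compared with powers of x - x0.\<close>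

definition cc :: real where "cc = - 18314474/64657000"

lemma tx_cc: "tx cc = -61/100" by (simp add: tx_def cc_def)

lemma Yr_cc: "91 / 1000 \<le> Yr cc" "Yr cc \<le> 92 / 1000"
  using pz_mid unfolding Yr_def tx_cc by (simp_all add: cc_def x0_def power2_eq_square divide_simps)

lemma Yr_lower: "cc \<le> x \<Longrightarrow> x \<le> 11/2 \<Longrightarrow> 91/1000 \<le> Yr x"
  using Yr_mono[of cc x] Yr_cc by (simp add: cc_def x0_def r0_def)

lemma Yr_upper: "x0 + r0 \<le> x \<Longrightarrow> x \<le> 11/2 \<Longrightarrow> Yr x \<le> 1"
proof -
  assume "x0 + r0 \<le> x" "x \<le> 11/2"
  then have "Yr x \<le> Yr (11/2)" by (intro Yr_mono) auto
  also have "\<dots> \<le> 1" by (simp add: Yr_def tx_def pz_ends x0_def power2_eq_square)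
  finally show ?thesis .
qed

lemma peval_pz_nonneg:
  assumes "x0 + r0 \<le> x" "x \<le> 11/2"
  shows "0 \<le> peval pz (tx x)"
proof -
  have "peval pz (-1) \<le> peval pz (tx x)"
  proof (rule DERIV_nonneg_imp_nondecreasing[where f = "peval pz" and a = "-1" and b = "tx x"])
    show "- 1 \<le> tx x" using tx_range[OF assms] by (simp add: abs_le_iff)
    fix t assume "- 1 \<le> t" "t \<le> tx x"
    then show "\<exists>d. (peval pz has_real_derivative d) (at t) \<and> 0 \<le> d"
      using tx_range[OF assms]
      by (intro exI[of _ "peval (pder pz) t"] conjI has_field_derivative_peval less_imp_le[OF pder_pos])
         (auto simp: abs_le_iff)
  qed
  then show ?thesis by (simp add: pz_ends)
qed

lemma abs_Yr_left:
  assumes "x0 + r0 \<le> x" "x \<le> cc"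
  shows "\<bar>Yr x\<bar> \<le> 1 / (x - x0)\<^sup>2"
proof -
  have x: "x \<le> 11/2" "x - x0 > 0" "x - x0 \<le> 3" using assms by (auto simp: cc_def r0_def x0_def)
  have "Yr x \<le> 92/1000" using Yr_mono[of x cc] Yr_cc assms x by (simp add: cc_def)
  also have "\<dots> \<le> 1 / 3\<^sup>2" by simp
  also have "\<dots> \<le> 1 / (x - x0)\<^sup>2" using x by (intro divide_left_mono power_mono) auto
  finally have "Yr x \<le> 1 / (x - x0)\<^sup>2" .
  moreover have "Yr x \<ge> - (1 / (x - x0)\<^sup>2)" using peval_pz_nonneg[OF assms(1) x(1)] by (simp add: Yr_def)
  ultimately show ?thesis by (simp add: abs_le_iff)
qed

lemma qx_at: "qx (11/2) > 95742710 / 10 ^ 8" "qx (11/2) < 95742711 / 10 ^ 8" "qx (11/2) * qx (11/2) = 11/12"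
proof -
  have q: "qx (11/2) = sqrt (11/12)" by (simp add: qx_sqrt)
  show "qx (11/2) * qx (11/2) = 11/12" unfolding q by simp
  show "qx (11/2) > 95742710 / 10 ^ 8" unfolding q by (rule real_less_rsqrt) (simp add: power2_eq_square)
  show "qx (11/2) < 95742711 / 10 ^ 8" unfolding q by (rule real_less_lsqrt) (simp_all add: power2_eq_square)
qed

section \<open>Error of the polynomial approximant along the real interval\<close>

context tritronquee
begin

lemma real_at:
  assumes "\<And>z. z \<in> {x..11/2} \<Longrightarrow> \<not> is_pole y (of_real z)"
  shows "Im (y (of_real x)) = 0" "Im (deriv y (of_real x)) = 0"
proof -
  have all: "\<not> is_pole y (of_real z)" if "z \<ge> x" for z
    using assms[of z] large_x_bound[of z] that by (cases "z \<le> 11/2") auto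
  \<comment> \<open>Reality is known on open rays only, so openness of the nonpole set is used to
    start the ray slightly to the left of x.\<close>
  have "isCont complex_of_real x" by (intro continuous_intros)
  from eventually_not_pole_path[OF this all[OF order.refl]]
  obtain d where d: "d > 0" "\<And>z. z \<noteq> x \<Longrightarrow> dist z x < d \<Longrightarrow> \<not> is_pole y (of_real z)"
    unfolding eventually_at by auto
  have "\<not> is_pole y (of_real z)" if "z > x - d" for z
    using all[of z] d(2)[of z] that by (cases "z \<ge> x") (auto simp: dist_real_def)
  then show "Im (y (of_real x)) = 0" "Im (deriv y (of_real x)) = 0"
    using real_right_of[of "x - d" x] d(1) by auto
qed

definition er :: "real \<Rightarrow> real" where "er x = Re (y (of_real x)) - Yr x"
definition dr :: "real \<Rightarrow> real" where "dr x = Re (deriv y (of_real x)) - Yr1 x"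

lemma er_deriv:
  assumes x: "x > x0" and np: "\<And>z. z \<in> {x..11/2} \<Longrightarrow> \<not> is_pole y (of_real z)" "x \<le> 11/2"
  shows "(er has_real_derivative dr x) (at x)"
    "(dr has_real_derivative - 12 * Yr x * er x - 6 * (er x)\<^sup>2 - Rr x) (at x)"
proof -
  have npx: "\<not> is_pole y (of_real x)" using np by simp
  show "(er has_real_derivative dr x) (at x)"
    unfolding er_def[abs_def] dr_def
    using bounded_linear.has_vector_derivative[OF bounded_linear_Re vderiv_real(1)[OF npx]]
    by (intro DERIV_diff Yr_deriv x) (simp add: has_real_derivative_iff_has_vector_derivative)
  have "(dr has_real_derivative Re (of_real x - 6 * (y (of_real x))\<^sup>2) - Yr2 x) (at x)"
    unfolding dr_def[abs_def]
    using bounded_linear.has_vector_derivative[OF bounded_linear_Re vderiv_real(2)[OF npx]]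
    by (intro DERIV_diff Yr_deriv x) (simp add: has_real_derivative_iff_has_vector_derivative)
  moreover have "Re (of_real x - 6 * (y (of_real x))\<^sup>2) - Yr2 x = - 12 * Yr x * er x - 6 * (er x)\<^sup>2 - Rr x"
    using real_at(1)[OF np(1)] by (simp add: er_def Rr_def power2_eq_square algebra_simps)
  ultimately show "(dr has_real_derivative - 12 * Yr x * er x - 6 * (er x)\<^sup>2 - Rr x) (at x)" by simp
qed

text \<open>The comparison of \<open>asy ac\<close> with \<open>Yr\<close> at 11/2 involves powers
  of q = sqrt(11/12). The relation q^2 = 11/12 makes it linear in q with rational coefficients, and
  the enclosure of q, narrowed below by squaring, decides it.\<close>

lemma er_start: "\<bar>er (11/2)\<bar> \<le> 24 / 10 ^ 9" "\<bar>dr (11/2)\<bar> \<le> 76 / 10 ^ 9"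
proof -
  define x :: real where "x = 11/2"
  have x: "x \<ge> 11/2" "x > 0" by (simp_all add: x_def)
  note b = large_x_bound[OF x(1)]
  note e = eighth_powers[OF x(2)]
  define a where "a = x powr (1/8)"
  have a: "1237/1000 \<le> a" "a > 0" using eighth_root_bound[OF x(1)] e(1) by (simp_all add: a_def)
  have a2: "a \<le> 1238/1000"
  proof -
    have "a ^ 8 \<le> (1238/1000) ^ 8" using e(2) by (simp add: a_def x_def eval_nat_numeral)
    then show ?thesis using a by (simp add: power_mono_iff del: power_divide)
  qed
  have B: "456 / x ^ 14 \<le> 19675 / 10 ^ 12" unfolding x_def by (simp add: power_divide)
  have b': "cmod (Wf x + \<i> * Vf x) < 456 / x ^ 14" "cmod (Wf x - \<i> * Vf x) < 456 / x ^ 14"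
    using b by auto
  have avg: "v \<le> (p + q) / 2 \<Longrightarrow> p < s \<Longrightarrow> q < s \<Longrightarrow> s \<le> b \<Longrightarrow> v \<le> b" for v p q s b :: real
    by (simp add: field_simps | argo)+
  note V = avg[OF cmod_Vf_le b' B] avg[OF cmod_Wf_le b' B]
  have "cmod (Ef x) = 1 / a * cmod (Vf x)" using x e(7) by (simp add: Ef_Vf norm_mult norm_divide a_def)
  also have "\<dots> \<le> 1 / (1237/1000) * (19675 / 10 ^ 12)" using a V by (intro mult_mono divide_left_mono) auto
  finally have E: "cmod (Ef x) \<le> 15910 / 10 ^ 12" by simp
  have "Ed x = of_real (c4 * a) * Wf x - of_real (1 / (8 * x)) * Ef x"
    using c4(1) a(2) unfolding Wf_def e(7) a_def[symmetric] by (simp add: field_simps)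
  then have "cmod (Ed x) \<le> c4 * a * cmod (Wf x) + 1 / (8 * x) * cmod (Ef x)"
    using norm_triangle_ineq4[of "of_real (c4 * a) * Wf x" "of_real (1 / (8 * x)) * Ef x"] c4(1) a(2) x
    by (simp add: norm_mult norm_divide)
  also have "\<dots> \<le> 2214/1000 * (1238/1000) * (19675 / 10 ^ 12) + 1 / 44 * (15910 / 10 ^ 12)"
    using c4 c4_bounds a a2 V E by (intro add_mono mult_mono) (auto simp: x_def)
  finally have D: "cmod (Ed x) \<le> 54290 / 10 ^ 12" by simp
  define q where "q = qx x"
  have q0: "95742710 / 10 ^ 8 < q" "q < 95742711 / 10 ^ 8" "q * q = 11/12" using qx_at by (simp_all add: q_def x_def)
  have "9574271077 / 10 ^ 10 < q"
  proof (rule ccontr)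
    assume "\<not> 9574271077 / 10 ^ 10 < q"
    then have "q * q \<le> 9574271077 / 10 ^ 10 * (9574271077 / 10 ^ 10)" using q0(1) by (intro mult_mono) auto
    then show False using q0(3) by simp
  qed
  moreover have "q < 95742710776 / 10 ^ 11"
  proof (rule ccontr)
    assume "\<not> q < 95742710776 / 10 ^ 11"
    then have "95742710776 / 10 ^ 11 * (95742710776 / 10 ^ 11) \<le> q * q" by (intro mult_mono) auto
    then show False using q0(3) by simp
  qed
  ultimately have q: "9574271077 / 10 ^ 10 < q" "q < 95742710776 / 10 ^ 11" "q * q = 11/12" using q0(3) by auto
  have sx: "sx x = q / x ^ 3" using qx_sx[OF x(2)] x by (simp add: q_def)
  have as1: "asy ac x = q * poly ac (q / x ^ 3)" by (simp add: asy_def q_def[symmetric] sx)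
  have as2: "asy (Dp ac) x = q * poly (Dp ac) (q / x ^ 3)" by (simp add: asy_def q_def[symmetric] sx)
  have qq: "q * (q * r) = 11/12 * r" for r using q(3) by (simp flip: mult.assoc)
  have y1: "Yr x = - 1 / (11/2 - x0)\<^sup>2 + 97419192198228 / 10 ^ 14"
    unfolding Yr_def by (simp add: x_def tx_def pz_ends)
  have y2: "Yr1 x = 2 / (11/2 - x0) ^ 3 + 29712441219622 / hh / 10 ^ 14"
    unfolding Yr1_def by (simp add: x_def tx_def pz_ends)
  have A1: "\<bar>asy ac x - Yr x\<bar> \<le> 68 / 10 ^ 10"
    unfolding as1 y1 unfolding ac_def using q(1,2)
    by (simp add: x_def x0_def algebra_simps qq abs_le_iff eval_nat_numeral)
  have A2: "\<bar>asy (Dp ac) x / x - Yr1 x\<bar> \<le> 193 / 10 ^ 10"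
    unfolding as2 y2 unfolding Dp_ac hh_def using q(1,2)
    by (simp add: x_def x0_def algebra_simps qq abs_le_iff eval_nat_numeral)
  have "er x = Re (Ef x) + (asy ac x - Yr x)" by (simp add: er_def Ef_def)
  then have "\<bar>er x\<bar> \<le> 15910 / 10 ^ 12 + 68 / 10 ^ 10"
    using A1 E abs_Re_le_cmod[of "Ef x"] by linarith
  then show "\<bar>er (11/2)\<bar> \<le> 24 / 10 ^ 9" by (simp add: x_def)
  have "dr x = Re (Ed x) + (asy (Dp ac) x / x - Yr1 x)" by (simp add: dr_def Ed_def)
  then have "\<bar>dr x\<bar> \<le> 54290 / 10 ^ 12 + 193 / 10 ^ 10"
    using A2 D abs_Re_le_cmod[of "Ed x"] by linarith
  then show "\<bar>dr (11/2)\<bar> \<le> 76 / 10 ^ 9" by (simp add: x_def)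
qed

text \<open>A bound for the square root of the energy. It starts from 113 because 76^2 + 12 * 24^2 <
  113^2. Its slope is 173 / 10^9 / (x - x0)^2, of which 172 are due to the residual and 1 to the
  quadratic term.\<close>

definition be :: "real \<Rightarrow> real" where
  "be x = 113 / 10 ^ 9 + 173 / 10 ^ 9 * (1 / (x - x0) - 1 / (11/2 - x0))"

lemma be_bounds:
  assumes "cc \<le> x" "x \<le> 11/2"
  shows "113 / 10 ^ 9 \<le> be x" "be x \<le> 174 / 10 ^ 9"
proof -
  have z: "x - x0 \<ge> 21/10" "x - x0 \<le> 11/2 - x0" using assms by (auto simp: cc_def x0_def)
  have "1 / (11/2 - x0) \<le> 1 / (x - x0)" using z by (intro divide_left_mono) auto
  then show "113 / 10 ^ 9 \<le> be x" by (simp add: be_def)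
  have "1 / (x - x0) \<le> 1 / (21/10)" using z by (intro divide_left_mono) auto
  then have "1 / (x - x0) - 1 / (11/2 - x0) \<le> 10/21 - 1 / (11/2 - x0)" by simp
  also have "\<dots> \<le> 35/100" by (simp add: x0_def)
  finally have "be x \<le> 113 / 10 ^ 9 + 173 / 10 ^ 9 * (35/100)"
    unfolding be_def by (intro add_left_mono mult_left_mono) auto
  then show "be x \<le> 174 / 10 ^ 9" by simp
qed

lemma energy_bounds:
  assumes "cc \<le> x" "x \<le> 11/2" and H: "(dr x)\<^sup>2 + 12 * Yr x * (er x)\<^sup>2 \<le> (be x)\<^sup>2"
  shows "\<bar>dr x\<bar> \<le> be x" "\<bar>er x\<bar> \<le> 167 / 10 ^ 9"
proof -
  note b = be_bounds[OF assms(1,2)]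
  have Y: "91/1000 \<le> Yr x" by (rule Yr_lower[OF assms(1,2)])
  have Y': "12 * (91/1000) * (er x)\<^sup>2 \<le> 12 * Yr x * (er x)\<^sup>2" using Y by (intro mult_right_mono) auto
  then have "0 \<le> 12 * Yr x * (er x)\<^sup>2" using zero_le_power2[of "er x"] by linarith
  then have "(dr x)\<^sup>2 \<le> (be x)\<^sup>2" using H by linarith
  then show "\<bar>dr x\<bar> \<le> be x" using b by (simp add: power2_le_iff_abs_le)
  have "(be x)\<^sup>2 \<le> (174 / 10 ^ 9)\<^sup>2" using b by (intro power_mono) auto
  then have "12 * (91/1000) * (er x)\<^sup>2 \<le> (174 / 10 ^ 9)\<^sup>2" using Y' H zero_le_power2[of "dr x"] by linarith
  then have "(er x)\<^sup>2 \<le> (167 / 10 ^ 9)\<^sup>2" by (simp add: power2_eq_square)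
  then show "\<bar>er x\<bar> \<le> 167 / 10 ^ 9" by (simp add: power2_le_iff_abs_le)
qed

text \<open>The energy has derivative 12 Y' e^2 - 2 d (6 e^2 + R). As x decreases, the first term
  works in the right direction because Y' > 0; the second is at most the slope of \<open>be\<close>
  squared.\<close>

lemma right_interval:
  assumes x: "x \<in> {cc..11/2}"
  shows "\<not> is_pole y (of_real x) \<and> (dr x)\<^sup>2 + 12 * Yr x * (er x)\<^sup>2 < (be x)\<^sup>2"
proof (rule left_barrier_real[where R = "11/2" and l = cc])
  show "\<not> is_pole y (of_real (11/2))" using large_x_bound[of "11/2"] by simp
  have "(dr (11/2))\<^sup>2 + 12 * Yr (11/2) * (er (11/2))\<^sup>2 \<le> (76 / 10 ^ 9)\<^sup>2 + 12 * 1 * (24 / 10 ^ 9)\<^sup>2"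
    using er_start Yr_upper[of "11/2"] Yr_lower[of "11/2"]
    by (intro add_mono mult_mono abs_le_square_iff[THEN iffD1]) (auto simp: x0_def r0_def cc_def)
  also have "\<dots> < (113 / 10 ^ 9)\<^sup>2" by (simp add: power2_eq_square)
  finally show "(dr (11/2))\<^sup>2 + 12 * Yr (11/2) * (er (11/2))\<^sup>2 < (be (11/2))\<^sup>2" by (simp add: be_def)
  show "x \<in> {cc..11/2}" by (rule x)
  fix z assume z: "z \<in> {cc..11/2}"
  have z0: "z > x0" "z \<le> 11/2" "cc \<le> z" "x0 + r0 \<le> z" using z by (auto simp: cc_def x0_def r0_def)
  have db: "(be has_real_derivative - (173 / 10 ^ 9 / (z - x0)\<^sup>2)) (at z)"
  proof -
    have "((\<lambda>x. 1 / (x - x0)) has_real_derivative (0 * (z - x0) - 1 * (1 - 0)) / ((z - x0) * (z - x0))) (at z)"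
      using z0 by (intro DERIV_divide DERIV_diff DERIV_const DERIV_ident) auto
    then have "(be has_real_derivative 0 + 173 / 10 ^ 9 * ((0 * (z - x0) - 1 * (1 - 0)) / ((z - x0) * (z - x0)) - 0)) (at z)"
      unfolding be_def[abs_def] by (intro DERIV_add DERIV_cmult DERIV_diff DERIV_const)
    then show ?thesis by (simp add: power2_eq_square)
  qed
  show "((\<lambda>x. (be x)\<^sup>2) has_real_derivative - (2 * be z * (173 / 10 ^ 9 / (z - x0)\<^sup>2))) (at z)"
    using DERIV_mult[OF db db] by (simp add: power2_eq_square[abs_def] algebra_simps)
  assume np: "\<And>w. w \<in> {z..11/2} \<Longrightarrow> \<not> is_pole y (of_real w)"
  note ed = er_deriv[OF z0(1) np z0(2)]
  have "((\<lambda>x. dr x * dr x + 12 * Yr x * (er x * er x)) has_real_derivative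
      ((- 12 * Yr z * er z - 6 * (er z)\<^sup>2 - Rr z) * dr z + (- 12 * Yr z * er z - 6 * (er z)\<^sup>2 - Rr z) * dr z)
      + (12 * Yr1 z * (er z * er z) + (dr z * er z + dr z * er z) * (12 * Yr z))) (at z)"
    by (intro DERIV_add DERIV_mult DERIV_cmult ed Yr_deriv z0)
  then show "((\<lambda>x. (dr x)\<^sup>2 + 12 * Yr x * (er x)\<^sup>2) has_real_derivative
      12 * Yr1 z * (er z)\<^sup>2 - 2 * dr z * (6 * (er z)\<^sup>2 + Rr z)) (at z)"
    by (simp add: power2_eq_square algebra_simps)
  assume H: "(dr z)\<^sup>2 + 12 * Yr z * (er z)\<^sup>2 \<le> (be z)\<^sup>2"
  note eb = energy_bounds[OF z0(3,2) H]
  show "cmod (y (of_real z)) \<le> 2"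
  proof -
    have "cmod (y (of_real z)) = \<bar>Re (y (of_real z))\<bar>"
      using real_at(1)[OF np] by (simp add: cmod_eq_Re)
    also have "\<dots> \<le> \<bar>er z\<bar> + \<bar>Yr z\<bar>" by (simp add: er_def)
    also have "\<dots> \<le> 2" using eb(2) Yr_upper[of z] Yr_lower[of z] z0 by simp
    finally show ?thesis .
  qed
  have "\<bar>6 * (er z)\<^sup>2 + Rr z\<bar> \<le> 173 / 10 ^ 9 / (z - x0)\<^sup>2"
  proof -
    have "(er z)\<^sup>2 \<le> (167 / 10 ^ 9)\<^sup>2" using eb(2) abs_le_square_iff[of "er z" "167 / 10 ^ 9"] by simp
    moreover have "(z - x0)\<^sup>2 \<le> 8\<^sup>2" using z0 by (intro power_mono) (auto simp: x0_def)
    ultimately have "6 * (er z)\<^sup>2 * (z - x0)\<^sup>2 \<le> 6 * (167 / 10 ^ 9)\<^sup>2 * 8\<^sup>2" by (intro mult_mono) auto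
    also have "\<dots> \<le> 1 / 10 ^ 9" by (simp add: power2_eq_square)
    finally have "6 * (er z)\<^sup>2 \<le> 1 / 10 ^ 9 / (z - x0)\<^sup>2" using z0 by (simp add: pos_le_divide_eq)
    moreover have "\<bar>Rr z\<bar> \<le> 172 / 10 ^ 9 / (z - x0)\<^sup>2" by (rule Rr_bound) (use z0 in auto)
    moreover have "172 / 10 ^ 9 / (z - x0)\<^sup>2 + 1 / 10 ^ 9 / (z - x0)\<^sup>2 = 173 / 10 ^ 9 / (z - x0)\<^sup>2"
      by (simp add: add_divide_distrib[symmetric])
    moreover have "6 * e \<le> p \<Longrightarrow> \<bar>R\<bar> \<le> q \<Longrightarrow> q + p = s \<Longrightarrow> 0 \<le> e \<Longrightarrow> \<bar>6 * e + R\<bar> \<le> s" for e p q R s :: real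
      by arith
    ultimately show ?thesis using zero_le_power2[of "er z"] by blast
  qed
  then have m: "\<bar>2 * dr z * (6 * (er z)\<^sup>2 + Rr z)\<bar> \<le> 2 * be z * (173 / 10 ^ 9 / (z - x0)\<^sup>2)"
    unfolding abs_mult using eb(1) by (intro mult_mono) auto
  have lower: "\<bar>m\<bar> \<le> b \<Longrightarrow> 0 \<le> a \<Longrightarrow> - b \<le> a - m" for m a b :: real by arith
  have "0 \<le> 12 * Yr1 z * (er z)\<^sup>2" using Yr1_pos[of z] z0 by simp
  then show "- (2 * be z * (173 / 10 ^ 9 / (z - x0)\<^sup>2)) \<le> 12 * Yr1 z * (er z)\<^sup>2 - 2 * dr z * (6 * (er z)\<^sup>2 + Rr z)"
    by (rule lower[OF m])
qed

definition ec :: "real \<Rightarrow> complex" where "ec x = y (of_real x) - of_real (Yr x)"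
definition dc :: "real \<Rightarrow> complex" where "dc x = deriv y (of_real x) - of_real (Yr1 x)"

lemma ec_real:
  assumes "\<And>z. z \<in> {x..11/2} \<Longrightarrow> \<not> is_pole y (of_real z)"
  shows "ec x = of_real (er x)" "dc x = of_real (dr x)"
  using real_at[OF assms] by (auto simp: ec_def dc_def er_def dr_def complex_eq_iff)

text \<open>With u = x - x0 the error obeys |E''| <= 12 |E| / u^2 + 173 / 10^9 / u^2. The power
  u^(-3) solves E'' = 12 E / u^2, and the subtracted constant 173 / 12 / 10^9 cancels the
  inhomogeneous term. The factor 17 / 10^7 is large enough for the bounds at \<open>cc\<close>
  inherited from the energy.\<close>

lemma left_interval:
  assumes x: "x \<in> {x0 + r0..cc}"
  shows "\<not> is_pole y (of_real x) \<and> cmod (ec x) < 17 / 10 ^ 7 / (x - x0) ^ 3 - 173 / 12 / 10 ^ 9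
     \<and> cmod (dc x) < 3 * (17 / 10 ^ 7) / (x - x0) ^ 4"
proof (rule left_barrier[where R = cc and l = "x0 + r0"])
  have cc: "cc \<in> {cc..11/2}" by (simp add: cc_def)
  have np: "\<not> is_pole y (of_real z)" if "z \<in> {cc..11/2}" for z using right_interval[OF that] by simp
  show "\<not> is_pole y (of_real cc)" using np cc .
  have cb: "\<bar>dr cc\<bar> \<le> be cc" "\<bar>er cc\<bar> \<le> 167 / 10 ^ 9"
    using energy_bounds[of cc] right_interval[OF cc] cc by auto
  have "be cc \<le> 174 / 10 ^ 9" using be_bounds[of cc] cc by simp
  moreover have "174 / 10 ^ 9 < 3 * (17 / 10 ^ 7) / (cc - x0) ^ 4"
    by (simp add: cc_def x0_def eval_nat_numeral)
  moreover have r: "ec cc = of_real (er cc)" "dc cc = of_real (dr cc)"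
    by (rule ec_real[OF np]; assumption)+
  ultimately show "cmod (dc cc) < 3 * (17 / 10 ^ 7) / (cc - x0) ^ 4"
    using cb unfolding r norm_of_real by linarith
  have "167 / 10 ^ 9 < 17 / 10 ^ 7 / (cc - x0) ^ 3 - 173 / 12 / 10 ^ 9"
    by (simp add: cc_def x0_def eval_nat_numeral)
  then show "cmod (ec cc) < 17 / 10 ^ 7 / (cc - x0) ^ 3 - 173 / 12 / 10 ^ 9"
    using cb unfolding r norm_of_real by linarith
  show "x \<in> {x0 + r0..cc}" by (rule x)
  fix z assume z: "z \<in> {x0 + r0..cc}"
  have z0: "z > x0" "x0 + r0 \<le> z" "z \<le> cc" "z \<le> 11/2" using z by (auto simp: cc_def r0_def)
  define u where "u = z - x0"
  have u: "u > 0" "u \<ge> 7/10" using z0 by (auto simp: u_def r0_def)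
  have du: "((\<lambda>x. x - x0) has_real_derivative 1) (at z)" by (auto intro!: derivative_eq_intros)
  have zu: "z - x0 \<noteq> 0" using u by (simp add: u_def)
  have "((\<lambda>x. 17 / 10 ^ 7 / (x - x0) ^ 3 - 173 / 12 / 10 ^ 9) has_real_derivative
     (0 * (z - x0) ^ 3 - 17 / 10 ^ 7 * (3 * (z - x0)\<^sup>2)) / ((z - x0) ^ 3 * (z - x0) ^ 3) - 0) (at z)"
    by (intro DERIV_diff DERIV_divide DERIV_const) (use zu in \<open>auto intro!: derivative_eq_intros\<close>)
  moreover have "(0 * u ^ 3 - 17 / 10 ^ 7 * (3 * u\<^sup>2)) / (u ^ 3 * u ^ 3) - 0 = - (3 * (17 / 10 ^ 7) / u ^ 4)"
    using u by (simp add: divide_simps eval_nat_numeral)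
  ultimately show "((\<lambda>x. 17 / 10 ^ 7 / (x - x0) ^ 3 - 173 / 12 / 10 ^ 9) has_real_derivative
      - (3 * (17 / 10 ^ 7) / (z - x0) ^ 4)) (at z)" unfolding u_def by (simp only:)
  have "((\<lambda>x. 3 * (17 / 10 ^ 7) / (x - x0) ^ 4) has_real_derivative
     (0 * (z - x0) ^ 4 - 3 * (17 / 10 ^ 7) * (4 * (z - x0) ^ 3)) / ((z - x0) ^ 4 * (z - x0) ^ 4)) (at z)"
    by (intro DERIV_divide DERIV_const) (use zu in \<open>auto intro!: derivative_eq_intros\<close>)
  moreover have "(0 * u ^ 4 - 3 * (17 / 10 ^ 7) * (4 * u ^ 3)) / (u ^ 4 * u ^ 4) = - (12 * (17 / 10 ^ 7) / u ^ 5)"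
    using u by (simp add: divide_simps eval_nat_numeral)
  ultimately show "((\<lambda>x. 3 * (17 / 10 ^ 7) / (x - x0) ^ 4) has_real_derivative
      - (12 * (17 / 10 ^ 7) / (z - x0) ^ 5)) (at z)" unfolding u_def by (simp only:)
  assume npz: "\<not> is_pole y (of_real z)"
  show "(ec has_vector_derivative dc z) (at z)"
    unfolding ec_def[abs_def] dc_def
    by (intro has_vector_derivative_diff vderiv_real npz has_vector_derivative_of_real Yr_deriv z0)
  show "(dc has_vector_derivative of_real z - 6 * (y (of_real z))\<^sup>2 - of_real (Yr2 z)) (at z)"
    unfolding dc_def[abs_def]
    by (intro has_vector_derivative_diff vderiv_real npz has_vector_derivative_of_real Yr_deriv z0)
  assume b1: "cmod (ec z) \<le> 17 / 10 ^ 7 / (z - x0) ^ 3 - 173 / 12 / 10 ^ 9"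
    and b2: "cmod (dc z) \<le> 3 * (17 / 10 ^ 7) / (z - x0) ^ 4"
  have Yb: "\<bar>Yr z\<bar> \<le> 1 / u\<^sup>2" using abs_Yr_left[of z] z0 by (simp add: u_def)
  have Rb: "\<bar>Rr z\<bar> \<le> 172 / 10 ^ 9 / u\<^sup>2" using Rr_bound[of z] z0 by (simp add: u_def)
  have u3: "(7/10) ^ 3 \<le> u ^ 3" "(7/10)\<^sup>2 \<le> u\<^sup>2" using u by (intro power_mono; simp)+
  have b0: "cmod (ec z) \<le> 17 / 10 ^ 7 / u ^ 3" using b1 by (simp add: u_def)
  also have "17 / 10 ^ 7 / u ^ 3 \<le> 17 / 10 ^ 7 / (7/10) ^ 3" using u3 u by (intro divide_left_mono) auto
  finally have b3: "cmod (ec z) \<le> 1 / 10 ^ 5" by (simp add: power_divide)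
  have e2: "6 * (cmod (ec z))\<^sup>2 \<le> 1 / 10 ^ 9 / u\<^sup>2"
  proof -
    have "cmod (ec z) * u \<le> 17 / 10 ^ 7 / u ^ 3 * u" using b0 u by (intro mult_right_mono) auto
    also have "\<dots> = 17 / 10 ^ 7 / u\<^sup>2" using u by (simp add: divide_simps eval_nat_numeral)
    also have "\<dots> \<le> 17 / 10 ^ 7 / (7/10)\<^sup>2" using u3 u by (intro divide_left_mono) auto
    finally have "cmod (ec z) * u \<le> 1 / 10 ^ 5" by (simp add: power_divide)
    then have "(cmod (ec z) * u)\<^sup>2 \<le> (1 / 10 ^ 5)\<^sup>2" using u by (intro power_mono) auto
    then have "6 * (cmod (ec z))\<^sup>2 * u\<^sup>2 \<le> 1 / 10 ^ 9" by (simp add: power_mult_distrib power_divide)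
    then show ?thesis using u by (simp add: pos_le_divide_eq)
  qed
  have "of_real z - 6 * (y (of_real z))\<^sup>2 - of_real (Yr2 z) = - of_real (12 * Yr z) * ec z - 6 * (ec z)\<^sup>2 - of_real (Rr z)"
    unfolding ec_def Rr_def by (simp add: power2_eq_square algebra_simps)
  then have "cmod (of_real z - 6 * (y (of_real z))\<^sup>2 - of_real (Yr2 z))
      \<le> cmod (- of_real (12 * Yr z) * ec z - 6 * (ec z)\<^sup>2) + \<bar>Rr z\<bar>"
    using norm_triangle_ineq4[of "- of_real (12 * Yr z) * ec z - 6 * (ec z)\<^sup>2" "of_real (Rr z)"] by simp
  also have "\<dots> \<le> (12 * \<bar>Yr z\<bar> * cmod (ec z) + 6 * (cmod (ec z))\<^sup>2) + \<bar>Rr z\<bar>"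
    using norm_triangle_ineq4[of "- of_real (12 * Yr z) * ec z" "6 * (ec z)\<^sup>2"]
    by (simp add: norm_mult norm_power abs_mult)
  also have "\<dots> \<le> (12 * (1 / u\<^sup>2) * (17 / 10 ^ 7 / u ^ 3 - 173 / 12 / 10 ^ 9) + 1 / 10 ^ 9 / u\<^sup>2) + 172 / 10 ^ 9 / u\<^sup>2"
    using b1 Yb Rb e2 u unfolding u_def[symmetric] by (intro add_mono mult_mono) auto
  also have "\<dots> = 12 * (17 / 10 ^ 7) / u ^ 5"
    using u by (simp add: field_simps eval_nat_numeral)
  finally show "cmod (dc z) \<le> 3 * (17 / 10 ^ 7) / (z - x0) ^ 4 \<and>
      cmod (of_real z - 6 * (y (of_real z))\<^sup>2 - of_real (Yr2 z)) \<le> 12 * (17 / 10 ^ 7) / (z - x0) ^ 5"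
    using b2 by (simp add: u_def)
  have "cmod (y (of_real z)) \<le> cmod (ec z) + \<bar>Yr z\<bar>"
    using norm_triangle_ineq[of "ec z" "of_real (Yr z)"] by (simp add: ec_def)
  also have "\<dots> \<le> 1 + 1 / (7/10)\<^sup>2"
  proof (intro add_mono)
    show "cmod (ec z) \<le> 1" using b3 by (rule order_trans) simp
    have "1 / u\<^sup>2 \<le> 1 / (7/10)\<^sup>2" using u3 u by (intro divide_left_mono) auto
    then show "\<bar>Yr z\<bar> \<le> 1 / (7/10)\<^sup>2" using Yb by linarith
  qed
  also have "\<dots> \<le> 4" by (simp add: power_divide)
  finally show "cmod (y (of_real z)) \<le> 4" .
qed

lemma real_interval:
  assumes x: "x0 + r0 \<le> x" "x \<le> 11/2"
  shows "\<not> is_pole y (of_real x)" "ec x = of_real (er x)" "dc x = of_real (dr x)"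
    "\<bar>er x\<bar> \<le> 17 / 10 ^ 7 / r0 ^ 3" "\<bar>dr x\<bar> \<le> 51 / 10 ^ 7 / r0 ^ 4"
proof -
  have np: "\<not> is_pole y (of_real z)" if "z \<in> {x..11/2}" for z
    using left_interval[of z] right_interval[of z] that x by (cases "z \<le> cc") auto
  then show "\<not> is_pole y (of_real x)" using x by simp
  show r: "ec x = of_real (er x)" "dc x = of_real (dr x)" by (rule ec_real[OF np]; simp)+
  show "\<bar>er x\<bar> \<le> 17 / 10 ^ 7 / r0 ^ 3" "\<bar>dr x\<bar> \<le> 51 / 10 ^ 7 / r0 ^ 4"
  proof -
    have "\<bar>er x\<bar> \<le> 17 / 10 ^ 7 / r0 ^ 3 \<and> \<bar>dr x\<bar> \<le> 51 / 10 ^ 7 / r0 ^ 4"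
    proof (cases "x \<le> cc")
      case True
      have u: "r0 \<le> x - x0" "0 < r0" using x by (auto simp: r0_def)
      then have "17 / 10 ^ 7 / (x - x0) ^ 3 \<le> 17 / 10 ^ 7 / r0 ^ 3" "51 / 10 ^ 7 / (x - x0) ^ 4 \<le> 51 / 10 ^ 7 / r0 ^ 4"
        by (intro divide_left_mono power_mono; simp)+
      moreover have "\<bar>er x\<bar> < 17 / 10 ^ 7 / (x - x0) ^ 3 - 173 / 12 / 10 ^ 9" "\<bar>dr x\<bar> < 3 * (17 / 10 ^ 7) / (x - x0) ^ 4"
        using left_interval[of x] True x r by auto
      ultimately show ?thesis by simp
    next
      case False
      then have *: "cc \<le> x" "x \<le> 11/2" using x by auto
      have "\<bar>dr x\<bar> \<le> be x" "\<bar>er x\<bar> \<le> 167 / 10 ^ 9"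
        using energy_bounds[OF *] right_interval[of x] * by auto
      moreover have "167 / 10 ^ 9 \<le> 17 / 10 ^ 7 / r0 ^ 3" "174 / 10 ^ 9 \<le> 51 / 10 ^ 7 / r0 ^ 4"
        by (simp_all add: r0_def power_divide)
      ultimately show ?thesis using be_bounds(2)[OF *] by linarith
    qed
    then show "\<bar>er x\<bar> \<le> 17 / 10 ^ 7 / r0 ^ 3" "\<bar>dr x\<bar> \<le> 51 / 10 ^ 7 / r0 ^ 4" by auto
  qed
qed

end

section \<open>The approximant on the circle\<close>

lemma norm_peval_le: "norm (peval p z) \<le> peval (map abs p) (norm z)"
  for z :: "'a :: real_normed_field"
proof (induction p)
  case (Cons c cs)
  have "norm (of_int c + z * peval cs z) \<le> norm (of_int c :: 'a) + norm z * norm (peval cs z)"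
    using norm_triangle_ineq[of "of_int c" "z * peval cs z"] by (simp add: norm_mult)
  also have "\<dots> \<le> \<bar>of_int c\<bar> + norm z * peval (map abs cs) (norm z)"
    using Cons by (intro add_mono mult_left_mono) auto
  finally show ?case by simp
qed simp

lemma peval_of_real: "peval p (of_real x :: complex) = of_real (peval p x)"
  by (induction p) auto

text \<open>The coefficients a_n times 10^12, rounded to integers, as certified by
  \<open>P_close\<close>.\<close>

definition qz :: "int list" where
  "qz = [238416876750, -166666666667, 62135771130, 0, -18947535706, 15894458450, -7828119648, 2071192371, 397997732, -850705685, 569275199, -232175688, 39332545, 26764923, -30362078, 16927420, -5692448, 304343]"

text \<open>The residual of the approximant on the circle times 323285 * 10^24, where 323285 is the
  denominator of x0. Squaring -1 / u^2 + u^2 q produces the cross term -12 q, while the fourth-order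
  poles cancel against the second derivative.\<close>

definition resid_q :: "int list" where
  "resid_q = padd (psmul (323285 * 10 ^ 12) (pder (pder (0 # 0 # qz))))
     (padd (psmul (- (12 * 323285 * 10 ^ 12)) qz)
       (padd (psmul (6 * 323285) (0 # 0 # 0 # 0 # pmul qz qz)) [770766 * 10 ^ 24, - (323285 * 10 ^ 24)]))"

text \<open>On a full circle the triangle inequality is precise enough: the moduli of the
  coefficients are summed with weights (7/10)^k.\<close>

lemma resid_q_bound:
  "ph (map abs resid_q) 7 10 \<le> 1311 * 323285 * 10 ^ 15 * 10 ^ length (map abs resid_q)"
  by code_simp

lemma qz_bound: "ph (map abs qz) 7 10 \<le> 394 * 10 ^ 9 * 10 ^ length (map abs qz)"
  by code_simp

lemma ph_pos: "0 * 10 ^ length (map abs resid_q) \<le> ph (map abs resid_q) 7 10" "0 * 10 ^ length (map abs qz) \<le> ph (map abs qz) 7 10"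
  by code_simp+

lemma qz_at_r:
  "73288899000 * 10 ^ length (0 # 0 # qz) \<le> ph (0 # 0 # qz) 7 10"
  "ph (0 # 0 # qz) 7 10 \<le> 73288900000 * 10 ^ length (0 # 0 # qz)"
  "163929000000 * 10 ^ length (pder (0 # 0 # qz)) \<le> ph (pder (0 # 0 # qz)) 7 10"
  "ph (pder (0 # 0 # qz)) 7 10 \<le> 163930000000 * 10 ^ length (pder (0 # 0 # qz))"
  by code_simp+

definition a_list :: "real list" where
  "a_list = [385383/1616425, -1/6, 19949/321055, 0, -49506685563/2612829780625, 128461/8082125, -97499792909/12455071881000, 19949/9631650, 90096826251431314708225793/226375225278394118135981078125, -544573541193/640143296253125, 22922081708252947/40265379130490850000, -1041035358169/4483825877160000, 587214351327162310761262272254561/14929477799641631066244491139694687500, 17538965929177365277646812/655296704753246131446261015625, -670831429508462862216520285639237/22094384977333466373836811131376250000, 1736688746159642627/102596186024490685800000, -519267392915250281694463921122899387124577/91220400755640034815841071012018124215468750000, 197922898847086344857290544484657263/650328052952389449245610034045100587500000]"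

lemma sum_upto_simps:
  "(\<Sum>k = 0..0. f k) = (f 0 :: real)"
  "(\<Sum>k = 0..Suc n. f k) = (\<Sum>k = 0..n. f k) + (f (Suc n) :: real)"
  "(\<Sum>k = 0..numeral w. f k) = (\<Sum>k = 0..pred_numeral w. f k) + (f (numeral w) :: real)"
  by (simp_all add: numeral_eq_Suc)

text \<open>The recursion is unrolled one coefficient at a time with the exact fractions inserted in
  between, so that no step has to simplify nested convolutions.\<close>

lemma P_coeffs_eq: "P_coeffs = a_list"
proof -
  have f: "(P_step ^^ 14) l = P_step (P_step (P_step (P_step (P_step (P_step (P_step (P_step
    (P_step (P_step (P_step (P_step (P_step (P_step l)))))))))))))" for l
    by (simp add: numeral_eq_Suc)
  have s4: "P_step [385383/1616425, -1/6, 19949/321055, 0]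
    = [385383/1616425, -1/6, 19949/321055, 0, -49506685563/2612829780625]"
    by (simp add: P_step_def Let_def sum_upto_simps)
  have s5: "P_step [385383/1616425, -1/6, 19949/321055, 0, -49506685563/2612829780625]
    = [385383/1616425, -1/6, 19949/321055, 0, -49506685563/2612829780625, 128461/8082125]"
    by (simp add: P_step_def Let_def sum_upto_simps)
  have s6: "P_step [385383/1616425, -1/6, 19949/321055, 0, -49506685563/2612829780625, 128461/8082125]
    = [385383/1616425, -1/6, 19949/321055, 0, -49506685563/2612829780625, 128461/8082125, -97499792909/12455071881000]"
    by (simp add: P_step_def Let_def sum_upto_simps)
  have s7: "P_step [385383/1616425, -1/6, 19949/321055, 0, -49506685563/2612829780625, 128461/8082125, -97499792909/12455071881000]
    = [385383/1616425, -1/6, 19949/321055, 0, -49506685563/2612829780625, 128461/8082125, -97499792909/12455071881000, 19949/9631650]"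
    by (simp add: P_step_def Let_def sum_upto_simps)
  have s8: "P_step [385383/1616425, -1/6, 19949/321055, 0, -49506685563/2612829780625, 128461/8082125, -97499792909/12455071881000, 19949/9631650]
    = [385383/1616425, -1/6, 19949/321055, 0, -49506685563/2612829780625, 128461/8082125, -97499792909/12455071881000, 19949/9631650, 90096826251431314708225793/226375225278394118135981078125]"
    by (simp add: P_step_def Let_def sum_upto_simps)
  have s9: "P_step [385383/1616425, -1/6, 19949/321055, 0, -49506685563/2612829780625, 128461/8082125, -97499792909/12455071881000, 19949/9631650, 90096826251431314708225793/226375225278394118135981078125]
    = [385383/1616425, -1/6, 19949/321055, 0, -49506685563/2612829780625, 128461/8082125, -97499792909/12455071881000, 19949/9631650, 90096826251431314708225793/226375225278394118135981078125, -544573541193/640143296253125]"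
    by (simp add: P_step_def Let_def sum_upto_simps)
  have s10: "P_step [385383/1616425, -1/6, 19949/321055, 0, -49506685563/2612829780625, 128461/8082125, -97499792909/12455071881000, 19949/9631650, 90096826251431314708225793/226375225278394118135981078125, -544573541193/640143296253125]
    = [385383/1616425, -1/6, 19949/321055, 0, -49506685563/2612829780625, 128461/8082125, -97499792909/12455071881000, 19949/9631650, 90096826251431314708225793/226375225278394118135981078125, -544573541193/640143296253125, 22922081708252947/40265379130490850000]"
    by (simp add: P_step_def Let_def sum_upto_simps)
  have s11: "P_step [385383/1616425, -1/6, 19949/321055, 0, -49506685563/2612829780625, 128461/8082125, -97499792909/12455071881000, 19949/9631650, 90096826251431314708225793/226375225278394118135981078125, -544573541193/640143296253125, 22922081708252947/40265379130490850000]
    = [385383/1616425, -1/6, 19949/321055, 0, -49506685563/2612829780625, 128461/8082125, -97499792909/12455071881000, 19949/9631650, 90096826251431314708225793/226375225278394118135981078125, -544573541193/640143296253125, 22922081708252947/40265379130490850000, -1041035358169/4483825877160000]"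
    by (simp add: P_step_def Let_def sum_upto_simps)
  have s12: "P_step [385383/1616425, -1/6, 19949/321055, 0, -49506685563/2612829780625, 128461/8082125, -97499792909/12455071881000, 19949/9631650, 90096826251431314708225793/226375225278394118135981078125, -544573541193/640143296253125, 22922081708252947/40265379130490850000, -1041035358169/4483825877160000]
    = [385383/1616425, -1/6, 19949/321055, 0, -49506685563/2612829780625, 128461/8082125, -97499792909/12455071881000, 19949/9631650, 90096826251431314708225793/226375225278394118135981078125, -544573541193/640143296253125, 22922081708252947/40265379130490850000, -1041035358169/4483825877160000, 587214351327162310761262272254561/14929477799641631066244491139694687500]"
    by (simp add: P_step_def Let_def sum_upto_simps)
  have s13: "P_step [385383/1616425, -1/6, 19949/321055, 0, -49506685563/2612829780625, 128461/8082125, -97499792909/12455071881000, 19949/9631650, 90096826251431314708225793/226375225278394118135981078125, -544573541193/640143296253125, 22922081708252947/40265379130490850000, -1041035358169/4483825877160000, 587214351327162310761262272254561/14929477799641631066244491139694687500]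
    = [385383/1616425, -1/6, 19949/321055, 0, -49506685563/2612829780625, 128461/8082125, -97499792909/12455071881000, 19949/9631650, 90096826251431314708225793/226375225278394118135981078125, -544573541193/640143296253125, 22922081708252947/40265379130490850000, -1041035358169/4483825877160000, 587214351327162310761262272254561/14929477799641631066244491139694687500, 17538965929177365277646812/655296704753246131446261015625]"
    by (simp add: P_step_def Let_def sum_upto_simps)
  have s14: "P_step [385383/1616425, -1/6, 19949/321055, 0, -49506685563/2612829780625, 128461/8082125, -97499792909/12455071881000, 19949/9631650, 90096826251431314708225793/226375225278394118135981078125, -544573541193/640143296253125, 22922081708252947/40265379130490850000, -1041035358169/4483825877160000, 587214351327162310761262272254561/14929477799641631066244491139694687500, 17538965929177365277646812/655296704753246131446261015625]
    = [385383/1616425, -1/6, 19949/321055, 0, -49506685563/2612829780625, 128461/8082125, -97499792909/12455071881000, 19949/9631650, 90096826251431314708225793/226375225278394118135981078125, -544573541193/640143296253125, 22922081708252947/40265379130490850000, -1041035358169/4483825877160000, 587214351327162310761262272254561/14929477799641631066244491139694687500, 17538965929177365277646812/655296704753246131446261015625, -670831429508462862216520285639237/22094384977333466373836811131376250000]"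
    by (simp add: P_step_def Let_def sum_upto_simps)
  have s15: "P_step [385383/1616425, -1/6, 19949/321055, 0, -49506685563/2612829780625, 128461/8082125, -97499792909/12455071881000, 19949/9631650, 90096826251431314708225793/226375225278394118135981078125, -544573541193/640143296253125, 22922081708252947/40265379130490850000, -1041035358169/4483825877160000, 587214351327162310761262272254561/14929477799641631066244491139694687500, 17538965929177365277646812/655296704753246131446261015625, -670831429508462862216520285639237/22094384977333466373836811131376250000]
    = [385383/1616425, -1/6, 19949/321055, 0, -49506685563/2612829780625, 128461/8082125, -97499792909/12455071881000, 19949/9631650, 90096826251431314708225793/226375225278394118135981078125, -544573541193/640143296253125, 22922081708252947/40265379130490850000, -1041035358169/4483825877160000, 587214351327162310761262272254561/14929477799641631066244491139694687500, 17538965929177365277646812/655296704753246131446261015625, -670831429508462862216520285639237/22094384977333466373836811131376250000, 1736688746159642627/102596186024490685800000]"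
    by (simp add: P_step_def Let_def sum_upto_simps)
  have s16: "P_step [385383/1616425, -1/6, 19949/321055, 0, -49506685563/2612829780625, 128461/8082125, -97499792909/12455071881000, 19949/9631650, 90096826251431314708225793/226375225278394118135981078125, -544573541193/640143296253125, 22922081708252947/40265379130490850000, -1041035358169/4483825877160000, 587214351327162310761262272254561/14929477799641631066244491139694687500, 17538965929177365277646812/655296704753246131446261015625, -670831429508462862216520285639237/22094384977333466373836811131376250000, 1736688746159642627/102596186024490685800000]
    = [385383/1616425, -1/6, 19949/321055, 0, -49506685563/2612829780625, 128461/8082125, -97499792909/12455071881000, 19949/9631650, 90096826251431314708225793/226375225278394118135981078125, -544573541193/640143296253125, 22922081708252947/40265379130490850000, -1041035358169/4483825877160000, 587214351327162310761262272254561/14929477799641631066244491139694687500, 17538965929177365277646812/655296704753246131446261015625, -670831429508462862216520285639237/22094384977333466373836811131376250000, 1736688746159642627/102596186024490685800000, -519267392915250281694463921122899387124577/91220400755640034815841071012018124215468750000]"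
    by (simp add: P_step_def Let_def sum_upto_simps)
  have s17: "P_step [385383/1616425, -1/6, 19949/321055, 0, -49506685563/2612829780625, 128461/8082125, -97499792909/12455071881000, 19949/9631650, 90096826251431314708225793/226375225278394118135981078125, -544573541193/640143296253125, 22922081708252947/40265379130490850000, -1041035358169/4483825877160000, 587214351327162310761262272254561/14929477799641631066244491139694687500, 17538965929177365277646812/655296704753246131446261015625, -670831429508462862216520285639237/22094384977333466373836811131376250000, 1736688746159642627/102596186024490685800000, -519267392915250281694463921122899387124577/91220400755640034815841071012018124215468750000]
    = [385383/1616425, -1/6, 19949/321055, 0, -49506685563/2612829780625, 128461/8082125, -97499792909/12455071881000, 19949/9631650, 90096826251431314708225793/226375225278394118135981078125, -544573541193/640143296253125, 22922081708252947/40265379130490850000, -1041035358169/4483825877160000, 587214351327162310761262272254561/14929477799641631066244491139694687500, 17538965929177365277646812/655296704753246131446261015625, -670831429508462862216520285639237/22094384977333466373836811131376250000, 1736688746159642627/102596186024490685800000, -519267392915250281694463921122899387124577/91220400755640034815841071012018124215468750000, 197922898847086344857290544484657263/650328052952389449245610034045100587500000]"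
    by (simp add: P_step_def Let_def sum_upto_simps)

  have init: "[- x0 / 10, - 1/6, 19949/321055, 0] = [385383/1616425, -1/6, 19949/321055, 0]"
    by (simp add: x0_def)
  show ?thesis unfolding P_coeffs_def f init s4 s5 s6 s7 s8 s9 s10 s11 s12 s13 s14 s15 s16 s17 a_list_def ..
qed

text \<open>In the variable \<open>z - x0\<close>, \<open>Q4\<close> is the regular part of the approximant near the pole,
  with coefficients rounded to multiples of \<open>10^-12\<close>.\<close>

definition Q4 :: "complex \<Rightarrow> complex" where "Q4 u = peval (0 # 0 # qz) u / 10 ^ 12"
definition Q4' :: "complex \<Rightarrow> complex" where "Q4' u = peval (pder (0 # 0 # qz)) u / 10 ^ 12"
definition Q4'' :: "complex \<Rightarrow> complex" where "Q4'' u = peval (pder (pder (0 # 0 # qz))) u / 10 ^ 12"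
definition Y4 :: "complex \<Rightarrow> complex" where "Y4 z = - 1 / (z - of_real x0)\<^sup>2 + Q4 (z - of_real x0)"
definition Y4' :: "complex \<Rightarrow> complex" where "Y4' z = 2 / (z - of_real x0) ^ 3 + Q4' (z - of_real x0)"
definition Y4'' :: "complex \<Rightarrow> complex" where "Y4'' z = - 6 / (z - of_real x0) ^ 4 + Q4'' (z - of_real x0)"

lemma Y4_deriv:
  assumes "z \<noteq> of_real x0"
  shows "(Y4 has_field_derivative Y4' z) (at z)" "(Y4' has_field_derivative Y4'' z) (at z)"
proof -
  define u where "u = z - of_real x0"
  have u: "u \<noteq> 0" using assms by (simp add: u_def)
  have du: "((\<lambda>z. z - of_real x0) has_field_derivative 1) (at z)" by (auto intro!: derivative_eq_intros)
  note p = DERIV_chain2[OF has_field_derivative_peval du]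
  have "((\<lambda>z. - 1 / (z - of_real x0)\<^sup>2 + Q4 (z - of_real x0)) has_field_derivative
     (0 * (z - of_real x0)\<^sup>2 - (- 1) * (2 * (z - of_real x0))) / ((z - of_real x0)\<^sup>2 * (z - of_real x0)\<^sup>2)
      + peval (pder (0 # 0 # qz)) (z - of_real x0) * 1 / 10 ^ 12) (at z)"
    unfolding Q4_def
    by (intro DERIV_add DERIV_divide DERIV_cdivide p DERIV_const) (use assms in \<open>auto intro!: derivative_eq_intros\<close>)
  moreover have "(0 * u\<^sup>2 - (- 1) * (2 * u)) / (u\<^sup>2 * u\<^sup>2) = 2 / u ^ 3"
    using u by (simp add: divide_simps eval_nat_numeral)
  ultimately show "(Y4 has_field_derivative Y4' z) (at z)"
    unfolding Y4_def[abs_def] Y4'_def Q4'_def u_def by (simp only: mult_1_right)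
  have "((\<lambda>z. 2 / (z - of_real x0) ^ 3 + Q4' (z - of_real x0)) has_field_derivative
     (0 * (z - of_real x0) ^ 3 - 2 * (3 * (z - of_real x0)\<^sup>2)) / ((z - of_real x0) ^ 3 * (z - of_real x0) ^ 3)
      + peval (pder (pder (0 # 0 # qz))) (z - of_real x0) * 1 / 10 ^ 12) (at z)"
    unfolding Q4'_def
    by (intro DERIV_add DERIV_divide DERIV_cdivide p DERIV_const) (use assms in \<open>auto intro!: derivative_eq_intros\<close>)
  moreover have "(0 * u ^ 3 - 2 * (3 * u\<^sup>2)) / (u ^ 3 * u ^ 3) = - 6 / u ^ 4"
    using u by (simp add: divide_simps eval_nat_numeral)
  ultimately show "(Y4' has_field_derivative Y4'' z) (at z)"
    unfolding Y4'_def[abs_def] Y4''_def Q4''_def u_def by (simp only: mult_1_right)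
qed

definition R4 :: "complex \<Rightarrow> complex" where "R4 z = Y4'' z + 6 * (Y4 z)\<^sup>2 - z"

lemma R4_bound:
  assumes "cmod (z - of_real x0) = r0"
  shows "cmod (R4 z) \<le> 1311 / 10 ^ 9"
proof -
  define u where "u = z - of_real x0"
  have cu: "cmod u = 7/10" using assms by (simp add: u_def r0_def)
  have u: "u \<noteq> 0" using cu by auto
  define q q2 where "q = peval qz u" and "q2 = peval (pder (pder (0 # 0 # qz))) u"
  have zx: "z = u - 770766/323285" by (simp add: u_def x0_def)
  have Q: "Q4 u = u\<^sup>2 * q / 10 ^ 12" by (simp add: Q4_def q_def power2_eq_square)
  have "R4 z = q2 / 10 ^ 12 - 12 * q / 10 ^ 12 + 6 * (u\<^sup>2 * q / 10 ^ 12)\<^sup>2 - (u - 770766/323285)"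
  proof -
    have "6 * (- 1 / u\<^sup>2 + u\<^sup>2 * q / 10 ^ 12)\<^sup>2 = 6 / u ^ 4 - 12 * q / 10 ^ 12 + 6 * (u\<^sup>2 * q / 10 ^ 12)\<^sup>2"
    proof -
      have "(- 1 / u\<^sup>2 + u\<^sup>2 * q / 10 ^ 12)\<^sup>2 = (1 / u\<^sup>2)\<^sup>2 - 2 * ((1 / u\<^sup>2) * u\<^sup>2) * (q / 10 ^ 12) + (u\<^sup>2 * q / 10 ^ 12)\<^sup>2"
        by (simp add: power2_eq_square algebra_simps)
      also have "(1 / u\<^sup>2) * u\<^sup>2 = 1" using u by simp
      also have "(1 / u\<^sup>2)\<^sup>2 = 1 / u ^ 4" by (simp add: power_divide power_mult[symmetric])
      finally have *: "(- 1 / u\<^sup>2 + u\<^sup>2 * q / 10 ^ 12)\<^sup>2 = 1 / u ^ 4 - 2 * 1 * (q / 10 ^ 12) + (u\<^sup>2 * q / 10 ^ 12)\<^sup>2" .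
      show ?thesis unfolding * by (simp add: algebra_simps)
    qed
    then show ?thesis
      unfolding R4_def Y4_def Y4''_def u_def[symmetric] Q unfolding Q4''_def q2_def[symmetric] zx
      by simp
  qed
  also have "\<dots> = peval resid_q u / (323285 * 10 ^ 24)"
    unfolding resid_q_def peval_padd peval_psmul peval_pmul peval.simps q_def[symmetric] q2_def[symmetric]
    by (simp add: field_simps eval_nat_numeral)
  finally have R: "R4 z = peval resid_q u / (323285 * 10 ^ 24)" .
  have "cmod (R4 z) = cmod (peval resid_q u) / (323285 * 10 ^ 24)"
    unfolding R by (simp add: norm_divide norm_mult norm_power)
  moreover have "cmod (peval resid_q u) \<le> peval (map abs resid_q) (7/10)"
    using norm_peval_le[of resid_q u] cu by simp
  moreover have "peval (map abs resid_q) (7/10) \<le> real_of_int (1311 * 323285 * 10 ^ 15)"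
    using peval_bounds(2)[OF _ ph_pos(1) resid_q_bound] by simp
  ultimately show ?thesis by simp
qed

lemma Q4_bound:
  assumes "cmod u = r0"
  shows "cmod (Q4 u) \<le> (7/10)\<^sup>2 * (394/1000)"
proof -
  have "cmod (peval qz u) \<le> peval (map abs qz) (7/10)"
    using norm_peval_le[of qz u] assms by (simp add: r0_def)
  also have "\<dots> \<le> real_of_int (394 * 10 ^ 9)"
    using peval_bounds(2)[OF _ ph_pos(2) qz_bound] by simp
  finally have "cmod (peval qz u) \<le> 394 * 10 ^ 9" by simp
  moreover have cu: "cmod u = 7/10" using assms by (simp add: r0_def)
  ultimately show ?thesis by (simp add: Q4_def norm_mult norm_divide power2_eq_square cu)
qed

text \<open>The point x0 + r, where \<open>tx\<close> is -1, belongs both to the real interval and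
  to the circle. Agreement of the approximants there lets the error of the interval serve as initial
  data on the circle.\<close>

lemma Y4_Yr:
  "cmod (Y4 (of_real (x0 + r0)) - of_real (Yr (x0 + r0))) \<le> 1 / 10 ^ 9"
  "cmod (Y4' (of_real (x0 + r0)) - of_real (Yr1 (x0 + r0))) \<le> 1 / 10 ^ 6"
proof -
  have t: "tx (x0 + r0) = -1" by (simp add: tx_def x0_def r0_def)
  have b1: "73288899000 \<le> peval (0 # 0 # qz) (7/10::real)" "peval (0 # 0 # qz) (7/10::real) \<le> 73288900000"
    using peval_bounds[OF _ qz_at_r(1,2)] by simp_all
  have b2: "163929000000 \<le> peval (pder (0 # 0 # qz)) (7/10::real)" "peval (pder (0 # 0 # qz)) (7/10::real) \<le> 163930000000"
    using peval_bounds[OF _ qz_at_r(3,4)] by simp_all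
  have "Y4 (of_real (x0 + r0)) - of_real (Yr (x0 + r0)) = of_real (peval (0 # 0 # qz) (7/10) / 10 ^ 12 - 7328889948988 / 10 ^ 14)"
    unfolding Y4_def Q4_def Yr_def t pz_ends by (simp add: r0_def peval_of_real[of _ "7/10", simplified, symmetric] del: peval.simps)
  moreover have "\<bar>peval (0 # 0 # qz) (7/10) / 10 ^ 12 - 7328889948988 / 10 ^ 14\<bar> \<le> (1 / 10 ^ 9 :: real)"
    using b1 unfolding abs_le_iff by (simp del: peval.simps)
  ultimately show "cmod (Y4 (of_real (x0 + r0)) - of_real (Yr (x0 + r0))) \<le> 1 / 10 ^ 9"
    by (simp only: norm_of_real)
  have "Y4' (of_real (x0 + r0)) - of_real (Yr1 (x0 + r0))
     = of_real (peval (pder (0 # 0 # qz)) (7/10) / 10 ^ 12 - 58884951002870 / hh / 10 ^ 14)"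
    unfolding Y4'_def Q4'_def Yr1_def t pz_ends by (simp add: r0_def peval_of_real[of _ "7/10", simplified, symmetric] del: peval.simps pder.simps)
  moreover have "\<bar>peval (pder (0 # 0 # qz)) (7/10) / 10 ^ 12 - 58884951002870 / hh / 10 ^ 14\<bar> \<le> (1 / 10 ^ 6 :: real)"
    using b2 unfolding hh_def abs_le_iff by (simp del: peval.simps pder.simps)
  ultimately show "cmod (Y4' (of_real (x0 + r0)) - of_real (Yr1 (x0 + r0))) \<le> 1 / 10 ^ 6"
    by (simp only: norm_of_real)
qed

text \<open>The angle is a complex variable so that the paths can be differentiated holomorphically.
  The choices j = i and j = -i describe the two half circles from x0 + r; with angles up to
  \<open>pi\<close> instead of 2 \<open>pi\<close> the exponential growth of the barrier stays
  affordable.\<close>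

definition circ :: "complex \<Rightarrow> complex \<Rightarrow> complex" where
  "circ j w = of_real x0 + of_real r0 * exp (j * w)"

lemma circ_deriv: "(circ j has_field_derivative j * (circ j w - of_real x0)) (at w)"
  unfolding circ_def[abs_def] by (auto intro!: derivative_eq_intros simp: algebra_simps)

lemma cmod_circ:
  assumes "j = \<i> \<or> j = - \<i>"
  shows "cmod (circ j (of_real t) - of_real x0) = r0" "cmod (exp (of_int k * j * of_real t)) = 1"
  using assms by (auto simp: circ_def norm_mult norm_exp_eq_Re r0_def)

lemma circ_inj:
  assumes j: "j = \<i> \<or> j = - \<i>" and s: "s \<in> {0..pi}" "t \<in> {0..pi}" "circ j (of_real s) = circ j (of_real t)"
  shows "s = t"
proof -
  have re: "Re (circ j (of_real u)) = x0 + r0 * cos u" for u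
    using j by (auto simp: circ_def Re_exp r0_def)
  have "cos s = cos t" using re[of s] re[of t] s(3) by (simp add: r0_def)
  then show ?thesis using s cos_inj_pi[of s t] by auto
qed

lemma circ_surj:
  assumes "cmod (z - of_real x0) = r0"
  obtains j t where "j = \<i> \<or> j = - \<i>" "t \<in> {0..pi}" "z = circ j (of_real t)"
proof -
  define u where "u = z - of_real x0"
  have u: "u \<noteq> 0" "cmod u = r0" using assms by (auto simp: u_def r0_def)
  have e: "z = of_real x0 + of_real r0 * exp (\<i> * of_real (Arg u))"
    using Arg_eq[OF u(1)] u(2) by (simp add: u_def)
  show ?thesis
  proof (cases "Arg u \<ge> 0")
    case True
    then show ?thesis using that[of \<i> "Arg u"] e Arg_bounded[of u] by (auto simp: circ_def)
  next
    case False
    then show ?thesis using that[of "- \<i>" "- Arg u"] e Arg_bounded[of u] by (auto simp: circ_def)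
  qed
qed

text \<open>A Gronwall barrier. The linear and quadratic terms contribute the rate sqrt 2 * 0.49 *
  2.31732 * 0.20204, about 0.3245. The residual, compared with the least value 355 / 10^7,
  contributes about 0.0256; together they stay below 0.351.\<close>

definition Nb :: "real \<Rightarrow> real" where "Nb t = 355 / 10 ^ 7 * exp (351/1000 * t)"

lemma Nb_bounds:
  assumes "t \<in> {0..pi}"
  shows "355 / 10 ^ 7 \<le> Nb t" "Nb t \<le> 1075 / 10 ^ 7"
proof -
  show "355 / 10 ^ 7 \<le> Nb t" using assms by (simp add: Nb_def)
  have e1: "exp 1 \<le> (27183/10000 :: real)" using e_approx_32[unfolded abs_le_iff] by (simp add: field_simps)
  have "351/1000 * t \<le> 1 + 1028/10000" using assms pi_approx(2) by simp
  then have "exp (351/1000 * t) \<le> exp (1 + 1028/10000 :: real)" by (simp only: exp_le_cancel_iff)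
  also have "\<dots> = exp 1 * exp (1028/10000)" by (rule exp_add)
  also have "\<dots> \<le> 27183/10000 * (1 + 1028/10000 + (1028/10000)\<^sup>2)"
    using exp_bound[of "1028/10000"] by (intro mult_mono e1) auto
  finally show "Nb t \<le> 1075 / 10 ^ 7" by (simp add: Nb_def power2_eq_square)
qed

lemma Nb_deriv: "(Nb has_real_derivative 351/1000 * Nb t) (at t within S)"
  unfolding Nb_def[abs_def] by (auto intro!: derivative_eq_intros)

section \<open>Propagation of the error along the two half circles\<close>

context tritronquee
begin

definition EE :: "complex \<Rightarrow> complex" where "EE z = y z - Y4 z"
definition DE :: "complex \<Rightarrow> complex" where "DE z = deriv y z - Y4' z"
definition FF :: "complex \<Rightarrow> complex" where
  "FF z = (z - of_real x0)\<^sup>2 * (12 * Q4 (z - of_real x0) * EE z + 6 * (EE z)\<^sup>2 + R4 z)"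

lemma EE_deriv:
  assumes "\<not> is_pole y z" "z \<noteq> of_real x0"
  shows "(EE has_field_derivative DE z) (at z)"
    "(DE has_field_derivative z - 6 * (y z)\<^sup>2 - Y4'' z) (at z)"
  unfolding EE_def[abs_def] DE_def[abs_def] by (intro DERIV_diff has_derivs Y4_deriv assms)+

text \<open>Multiplication by u^2 turns the pole part of the potential into the constant 12 of an
  Euler equation; all the rest is collected in \<open>FF\<close>.\<close>

lemma EE_ode:
  assumes "z \<noteq> of_real x0"
  shows "(z - of_real x0)\<^sup>2 * (z - 6 * (y z)\<^sup>2 - Y4'' z) = 12 * EE z - FF z"
proof -
  define u where "u = z - of_real x0"
  have u: "u \<noteq> 0" using assms by (simp add: u_def)
  have s: "u\<^sup>2 * Y4 z = - 1 + u\<^sup>2 * Q4 u" using u by (simp add: Y4_def u_def[symmetric] algebra_simps)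
  have "u\<^sup>2 * (z - 6 * (y z)\<^sup>2 - Y4'' z) = - 12 * EE z * (u\<^sup>2 * Y4 z) - u\<^sup>2 * (6 * (EE z)\<^sup>2 + R4 z)"
    unfolding R4_def EE_def by (simp add: power2_eq_square algebra_simps)
  also have "\<dots> = 12 * EE z - FF z" unfolding s FF_def u_def[symmetric] by (simp add: algebra_simps)
  finally show ?thesis unfolding u_def .
qed

text \<open>Along the circle, with \<open>u = z - x0\<close>, the error \<open>E\<close> satisfies \<open>u\<^sup>2 E'' = 12 E - F\<close>, whose homogeneous
  solutions are \<open>u\<^sup>4\<close> and \<open>u\<^sup>-\<^sup>3\<close>; \<open>U1\<close> and \<open>U2\<close> are the corresponding coefficients.\<close>

definition U1 :: "complex \<Rightarrow> complex \<Rightarrow> complex" where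
  "U1 j w = ((circ j w - of_real x0) * DE (circ j w) + 3 * EE (circ j w)) * exp (of_int (- 4) * j * w)"
definition U2 :: "complex \<Rightarrow> complex \<Rightarrow> complex" where
  "U2 j w = (4 * EE (circ j w) - (circ j w - of_real x0) * DE (circ j w)) * exp (of_int 3 * j * w)"
definition UU :: "complex \<Rightarrow> real \<Rightarrow> complex \<times> complex" where
  "UU j t = (U1 j (of_real t), U2 j (of_real t))"

text \<open>On the circle exp (-4 j w) and exp (3 j w) are constant multiples of u^(-4) and u^3.
  They cancel the two homogeneous solutions, so only \<open>FF\<close> drives the coefficients, with
  factors of modulus 1 when w is real.\<close>

lemma U_deriv:
  assumes np: "\<not> is_pole y (circ j w)"
  shows "(U1 j has_field_derivative - j * FF (circ j w) * exp (of_int (- 4) * j * w)) (at w)"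
    "(U2 j has_field_derivative j * FF (circ j w) * exp (of_int 3 * j * w)) (at w)"
proof -
  define z where "z = circ j w"
  define u where "u = z - of_real x0"
  have z: "z \<noteq> of_real x0" by (simp add: z_def circ_def r0_def)
  define d2 where "d2 = z - 6 * (y z)\<^sup>2 - Y4'' z"
  have dz: "(circ j has_field_derivative j * u) (at w)" using circ_deriv by (simp add: u_def z_def)
  have dE: "((\<lambda>w. EE (circ j w)) has_field_derivative DE z * (j * u)) (at w)"
    unfolding z_def by (rule DERIV_chain2[OF EE_deriv(1)[OF np] dz]) (use z in \<open>simp add: z_def\<close>)
  have dD: "((\<lambda>w. DE (circ j w)) has_field_derivative d2 * (j * u)) (at w)"
    unfolding z_def d2_def by (rule DERIV_chain2[OF EE_deriv(2)[OF np] dz]) (use z in \<open>simp add: z_def\<close>)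
  have dS: "((\<lambda>w. (circ j w - of_real x0) * DE (circ j w)) has_field_derivative
      (j * u - 0) * DE z + d2 * (j * u) * u) (at w)"
    using DERIV_mult[OF DERIV_diff[OF dz DERIV_const[of "of_real x0"]] dD]
    by (simp only: z_def[symmetric] u_def[symmetric])
  have dexp: "((\<lambda>w. exp (of_int k * j * w)) has_field_derivative of_int k * j * exp (of_int k * j * w)) (at w)" for k
    by (auto intro!: derivative_eq_intros)
  have o: "u\<^sup>2 * d2 = 12 * EE z - FF z" using EE_ode[OF z] by (simp add: u_def d2_def)
  have "(U1 j has_field_derivative
      ((j * u - 0) * DE z + d2 * (j * u) * u + 3 * (DE z * (j * u))) * exp (of_int (- 4) * j * w)
      + (of_int (- 4) * j * exp (of_int (- 4) * j * w)) * (u * DE z + 3 * EE z)) (at w)"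
    unfolding U1_def[abs_def] u_def z_def
    using DERIV_mult[OF DERIV_add[OF dS DERIV_cmult[OF dE, of 3]] dexp[of "- 4"]] by (simp only: z_def u_def)
  moreover have "((j * u - 0) * DE z + d2 * (j * u) * u + 3 * (DE z * (j * u))) * e + (of_int (- 4) * j * e) * (u * DE z + 3 * EE z)
      = j * (u\<^sup>2 * d2 - 12 * EE z) * e" for e
    by (simp add: power2_eq_square algebra_simps)
  ultimately show "(U1 j has_field_derivative - j * FF (circ j w) * exp (of_int (- 4) * j * w)) (at w)"
    unfolding o by (simp add: z_def)
  have "(U2 j has_field_derivative
      (4 * (DE z * (j * u)) - ((j * u - 0) * DE z + d2 * (j * u) * u)) * exp (of_int 3 * j * w)
      + (of_int 3 * j * exp (of_int 3 * j * w)) * (4 * EE z - u * DE z)) (at w)"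
    unfolding U2_def[abs_def] u_def z_def
    using DERIV_mult[OF DERIV_diff[OF DERIV_cmult[OF dE, of 4] dS] dexp[of 3]] by (simp only: z_def u_def)
  moreover have "(4 * (DE z * (j * u)) - ((j * u - 0) * DE z + d2 * (j * u) * u)) * e + (of_int 3 * j * e) * (4 * EE z - u * DE z)
      = j * (12 * EE z - u\<^sup>2 * d2) * e" for e
    by (simp add: power2_eq_square algebra_simps)
  ultimately show "(U2 j has_field_derivative j * FF (circ j w) * exp (of_int 3 * j * w)) (at w)"
    unfolding o by (simp add: z_def)
qed

lemma norm_UU:
  fixes t :: real
  assumes j: "j = \<i> \<or> j = - \<i>"
  defines "z \<equiv> circ j (of_real t)"
  shows "(norm (UU j t))\<^sup>2 = (cmod ((z - of_real x0) * DE z + 3 * EE z))\<^sup>2 + (cmod (4 * EE z - (z - of_real x0) * DE z))\<^sup>2"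
  unfolding UU_def norm_Pair z_def U1_def U2_def norm_mult cmod_circ(2)[OF j]
  by (simp add: power_mult_distrib)

text \<open>From 7 E = A + B and 7 u E' = 4 A - 3 B, Cauchy-Schwarz gives the factors sqrt 2 / 7,
  rounded up to 14143/70000, and 5 / (7 * 0.7) = 50/49.\<close>

lemma EE_le_UU:
  fixes t :: real
  assumes j: "j = \<i> \<or> j = - \<i>"
  defines "z \<equiv> circ j (of_real t)"
  shows "cmod (EE z) \<le> 14143/70000 * norm (UU j t)" "cmod (DE z) \<le> 50/49 * norm (UU j t)"
proof -
  define A B n where "A = (z - of_real x0) * DE z + 3 * EE z" and "B = 4 * EE z - (z - of_real x0) * DE z"
    and "n = norm (UU j t)"
  have n: "n\<^sup>2 = (cmod A)\<^sup>2 + (cmod B)\<^sup>2" "n \<ge> 0" using norm_UU[OF j] by (simp_all add: A_def B_def z_def n_def)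
  have "7 * EE z = A + B" by (simp add: A_def B_def)
  then have 1: "7 * cmod (EE z) \<le> cmod A + cmod B" using norm_triangle_ineq[of A B] by (metis norm_mult norm_numeral)
  have "(cmod A + cmod B)\<^sup>2 \<le> 2 * n\<^sup>2" unfolding n(1) using sum_squares_bound[of "cmod A" "cmod B"]
    by (simp add: power2_sum)
  also have "\<dots> \<le> (14143/10000 * n)\<^sup>2" by (simp add: power2_eq_square)
  finally have "cmod A + cmod B \<le> 14143/10000 * n" using n(2) by (auto intro: power2_le_imp_le)
  then show "cmod (EE z) \<le> 14143/70000 * norm (UU j t)" using 1 by (simp add: n_def)
  have "7 * ((z - of_real x0) * DE z) = 4 * A - 3 * B" by (simp add: A_def B_def algebra_simps)
  then have "cmod (7 * ((z - of_real x0) * DE z)) \<le> 4 * cmod A + 3 * cmod B"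
    using norm_triangle_ineq4[of "4 * A" "3 * B"] by (simp add: norm_mult)
  moreover have "cmod (z - of_real x0) = 7/10" using cmod_circ(1)[OF j] by (simp add: z_def r0_def)
  ultimately have 2: "49/10 * cmod (DE z) \<le> 4 * cmod A + 3 * cmod B" by (simp add: norm_mult)
  have "0 \<le> (3 * cmod A - 4 * cmod B)\<^sup>2" by simp
  then have "(4 * cmod A + 3 * cmod B)\<^sup>2 \<le> 25 * n\<^sup>2" unfolding n(1) by (simp add: power2_eq_square algebra_simps)
  also have "\<dots> = (5 * n)\<^sup>2" by (simp add: power2_eq_square)
  finally have "4 * cmod A + 3 * cmod B \<le> 5 * n" using n(2) by (auto intro: power2_le_imp_le)
  then show "cmod (DE z) \<le> 50/49 * norm (UU j t)" using 2 by (simp add: n_def)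
qed

lemma UU_start:
  assumes j: "j = \<i> \<or> j = - \<i>"
  shows "\<not> is_pole y (circ j (of_real 0))" "norm (UU j 0) < Nb 0"
proof -
  define z where "z = complex_of_real (x0 + r0)"
  have z: "circ j (of_real 0) = z" by (simp add: circ_def z_def)
  have x: "x0 + r0 \<le> x0 + r0" "x0 + r0 \<le> 11/2" by (simp_all add: x0_def r0_def)
  note R = real_interval[OF x]
  show "\<not> is_pole y (circ j (of_real 0))" using R(1) unfolding z z_def .
  define s e where "s = (z - of_real x0) * DE z" and "e = EE z"
  have "EE z = ec (x0 + r0) - (Y4 z - of_real (Yr (x0 + r0)))" by (simp add: EE_def ec_def z_def)
  then have "cmod (EE z) \<le> \<bar>er (x0 + r0)\<bar> + 1 / 10 ^ 9"
    using norm_triangle_ineq4[of "ec (x0 + r0)" "Y4 z - of_real (Yr (x0 + r0))"] Y4_Yr(1) R(2) by (simp add: z_def)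
  also have "\<dots> \<le> 17 / 10 ^ 7 / r0 ^ 3 + 1 / 10 ^ 9" using R(4) by simp
  also have "\<dots> \<le> 4958 / 10 ^ 9" by (simp add: r0_def power_divide)
  finally have e: "cmod e \<le> 4958 / 10 ^ 9" by (simp add: e_def)
  have "DE z = dc (x0 + r0) - (Y4' z - of_real (Yr1 (x0 + r0)))" by (simp add: DE_def dc_def z_def)
  then have "cmod (DE z) \<le> \<bar>dr (x0 + r0)\<bar> + 1 / 10 ^ 6"
    using norm_triangle_ineq4[of "dc (x0 + r0)" "Y4' z - of_real (Yr1 (x0 + r0))"] Y4_Yr(2) R(3) by (simp add: z_def)
  also have "\<dots> \<le> 51 / 10 ^ 7 / r0 ^ 4 + 1 / 10 ^ 6" using R(5) by simp
  also have "\<dots> \<le> 2225 / 10 ^ 8" by (simp add: r0_def power_divide)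
  finally have "cmod (DE z) \<le> 2225 / 10 ^ 8" .
  moreover have zx: "cmod (z - of_real x0) = 7/10" by (simp add: z_def r0_def)
  ultimately have s: "cmod s \<le> 1558 / 10 ^ 8" unfolding s_def norm_mult zx by simp
  have "(norm (UU j 0))\<^sup>2 = (cmod (s + 3 * e))\<^sup>2 + (cmod (4 * e - s))\<^sup>2"
    using norm_UU[OF j, of 0] unfolding z s_def e_def .
  \<comment> \<open>The cross terms 6 and -8 of the two squares nearly cancel; estimating the two
    components separately would lose this.\<close>
  also have "\<dots> = 2 * (cmod s)\<^sup>2 + 25 * (cmod e)\<^sup>2 - 2 * Re (e * cnj s)"
    unfolding cmod_power2 by (simp add: power2_eq_square algebra_simps)
  also have "\<dots> \<le> 2 * (cmod s)\<^sup>2 + 25 * (cmod e)\<^sup>2 + 2 * (cmod e * cmod s)"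
    using abs_Re_le_cmod[of "e * cnj s"] by (simp add: norm_mult)
  also have "\<dots> \<le> 2 * (1558 / 10 ^ 8)\<^sup>2 + 25 * (4958 / 10 ^ 9)\<^sup>2 + 2 * (4958 / 10 ^ 9 * (1558 / 10 ^ 8))"
    using s e by (intro add_mono mult_left_mono power_mono mult_mono) auto
  also have "\<dots> < (355 / 10 ^ 7)\<^sup>2" by (simp add: power2_eq_square)
  finally have "norm (UU j 0) < 355 / 10 ^ 7" by (rule power2_less_imp_less) simp
  then show "norm (UU j 0) < Nb 0" by (simp add: Nb_def)
qed

text \<open>Both coefficients are kept in one vector with the Euclidean norm, so a single bound
  suffices and the second slot of \<open>barrier\<close> is filled with the zero function.\<close>

lemma circle_path:
  assumes j: "j = \<i> \<or> j = - \<i>" and t: "t \<in> {0..pi}"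
  shows "\<not> is_pole y (circ j (of_real t)) \<and> norm (UU j t) < Nb t \<and> norm (0 :: complex \<times> complex) < 1"
proof (rule barrier[where a = 0 and b = pi and ?u2.0 = "\<lambda>_. 0" and ?B2.0 = "\<lambda>_. 1" and ?u2' = "\<lambda>_. 0" and ?B2' = "\<lambda>_. 0"
    and good = "\<lambda>t. \<not> is_pole y (circ j (of_real t))" and ?u1.0 = "UU j" and ?B1.0 = Nb
    and ?B1' = "\<lambda>t. 351/1000 * Nb t"
    and ?u1' = "\<lambda>t. (- j * FF (circ j (of_real t)) * exp (of_int (- 4) * j * of_real t),
          j * FF (circ j (of_real t)) * exp (of_int 3 * j * of_real t))"])
  have cont: "isCont (\<lambda>t. circ j (of_real t)) s" for s :: real
    unfolding circ_def by (intro continuous_intros)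
  have small: "cmod (EE (circ j (of_real s))) \<le> 1 / 10 ^ 4" if "s \<in> {0..pi}" "norm (UU j s) \<le> Nb s" for s
    using EE_le_UU(1)[OF j, of s] Nb_bounds(2)[OF that(1)] that(2) by simp
  have nj: "cmod j = 1" using j by auto
  show "\<not> is_pole y (circ j (of_real 0))" "norm (UU j 0) < Nb 0" by (rule UU_start[OF j])+
  show "t \<in> {0..pi}" by (rule t)
  fix s :: real assume s: "s \<in> {0..pi}"
  show "(Nb has_real_derivative 351/1000 * Nb s) (at s within {0..pi})" by (rule Nb_deriv)
  assume np: "\<not> is_pole y (circ j (of_real s))"
  show "\<forall>\<^sub>F t in at s within {0..pi}. \<not> is_pole y (circ j (of_real t))"
    by (rule eventually_not_pole_path[OF continuous_at_imp_continuous_at_within[OF cont] np])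
  show "(UU j has_vector_derivative (- j * FF (circ j (of_real s)) * exp (of_int (- 4) * j * of_real s),
          j * FF (circ j (of_real s)) * exp (of_int 3 * j * of_real s))) (at s within {0..pi})"
    unfolding UU_def[abs_def]
    by (intro has_vector_derivative_Pair has_vector_derivative_real_field U_deriv np)
  assume N: "norm (UU j s) \<le> Nb s"
  define z where "z = circ j (of_real s)"
  have z: "cmod (z - of_real x0) = r0" using cmod_circ(1)[OF j] by (simp add: z_def)
  have e: "cmod (EE z) \<le> 1 / 10 ^ 4" using small[OF s N] by (simp add: z_def)
  have "cmod (12 * Q4 (z - of_real x0) * EE z + 6 * (EE z)\<^sup>2 + R4 z)
     \<le> 12 * cmod (Q4 (z - of_real x0)) * cmod (EE z) + 6 * (cmod (EE z) * cmod (EE z)) + cmod (R4 z)"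
    by (rule order_trans[OF norm_triangle_ineq] add_right_mono)+
      (use norm_triangle_ineq[of "12 * Q4 (z - of_real x0) * EE z" "6 * (EE z)\<^sup>2"] in
        \<open>simp add: norm_mult norm_power power2_eq_square\<close>)
  also have "\<dots> \<le> 12 * ((7/10)\<^sup>2 * (394/1000)) * cmod (EE z) + 6 * (1 / 10 ^ 4 * cmod (EE z)) + 1311 / 10 ^ 9"
    using Q4_bound[OF z] R4_bound[OF z] e by (intro add_mono mult_left_mono mult_right_mono) auto
  \<comment> \<open>Here 2.31672 is 12 * 0.49 * 0.394, and 0.0006 is the quadratic term made linear
    by |E| <= 10^(-4).\<close>
  also have "\<dots> = (23167200 + 6000) / 10 ^ 7 * cmod (EE z) + 1311 / 10 ^ 9" by (simp add: power2_eq_square algebra_simps)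
  also have "\<dots> \<le> (23167200 + 6000) / 10 ^ 7 * (14143/70000 * Nb s) + 1311 / 10 ^ 9"
    using EE_le_UU(1)[OF j, of s] N by (intro add_right_mono mult_left_mono) (auto simp: z_def)
  finally have "cmod (FF z) \<le> (7/10)\<^sup>2 * ((23167200 + 6000) / 10 ^ 7 * (14143/70000 * Nb s) + 1311 / 10 ^ 9)"
    unfolding FF_def norm_mult norm_power z r0_def by (intro mult_left_mono) auto
  then have F: "14143/10000 * cmod (FF z) \<le> 351/1000 * Nb s"
    using Nb_bounds(1)[OF s] by (simp add: power2_eq_square)
  have "norm (- j * FF z * exp (of_int (- 4) * j * of_real s), j * FF z * exp (of_int 3 * j * of_real s))
      = sqrt (2 * (cmod (FF z))\<^sup>2)"
    unfolding norm_Pair norm_mult cmod_circ(2)[OF j] by (simp add: nj)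
  also have "\<dots> \<le> sqrt ((14143/10000 * cmod (FF z))\<^sup>2)" by (rule real_sqrt_le_mono) (simp add: power2_eq_square)
  also have "\<dots> = 14143/10000 * cmod (FF z)" by simp
  also note F
  finally show "norm (- j * FF (circ j (of_real s)) * exp (of_int (- 4) * j * of_real s),
      j * FF (circ j (of_real s)) * exp (of_int 3 * j * of_real s)) \<le> 351/1000 * Nb s" by (simp only: z_def)
next
  fix s assume s: "s \<in> {0<..pi}"
    and before: "\<And>r. r \<in> {0..<s} \<Longrightarrow> \<not> is_pole y (circ j (of_real r)) \<and> norm (UU j r) < Nb r \<and> norm (0 :: complex \<times> complex) < 1"
  show "\<not> is_pole y (circ j (of_real s))"
  proof (rule not_pole_left_limit[where a = 0 and \<gamma> = "\<lambda>t. circ j (of_real t)" and C = 4])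
    show "0 < s" using s by simp
    show "isCont (\<lambda>t. circ j (of_real t)) s" unfolding circ_def by (intro continuous_intros)
    fix r assume r: "r \<in> {0..<s}"
    then have r': "r \<in> {0..pi}" "s \<in> {0..pi}" using s by auto
    show "circ j (of_real r) \<noteq> circ j (of_real s)" using circ_inj[OF j r'] r by auto
    define z where "z = circ j (of_real r)"
    have z: "cmod (z - of_real x0) = r0" using cmod_circ(1)[OF j] by (simp add: z_def)
    have "cmod (EE z) \<le> 1" using EE_le_UU(1)[OF j, of r] Nb_bounds(2)[OF r'(1)] before[OF r] by (simp add: z_def)
    moreover have "cmod (Y4 z) \<le> 1 / (7/10)\<^sup>2 + (7/10)\<^sup>2 * (394/1000)"
      unfolding Y4_def by (rule order_trans[OF norm_triangle_ineq])
        (use Q4_bound[OF z] in \<open>simp add: norm_divide norm_power z r0_def\<close>)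
    moreover have "cmod (y z) \<le> cmod (EE z) + cmod (Y4 z)"
      using norm_triangle_ineq[of "EE z" "Y4 z"] by (simp add: EE_def)
    ultimately show "cmod (y (circ j (of_real r))) \<le> 4" by (simp add: z_def power2_eq_square)
  qed
qed (auto intro: derivative_eq_intros)

lemma circle_bounds:
  assumes z: "cmod (z - of_real x0) = r0"
  shows "\<not> is_pole y z" "cmod (EE z) \<le> 218 / 10 ^ 7" "cmod (DE z) \<le> 110 / 10 ^ 6"
proof -
  obtain j t where jt: "j = \<i> \<or> j = - \<i>" "t \<in> {0..pi}" "z = circ j (of_real t)" using circ_surj[OF z] .
  note p = circle_path[OF jt(1,2)]
  show "\<not> is_pole y z" using p jt(3) by simp
  have "norm (UU j t) \<le> 1075 / 10 ^ 7" using p Nb_bounds(2)[OF jt(2)] by simp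
  then show "cmod (EE z) \<le> 218 / 10 ^ 7" "cmod (DE z) \<le> 110 / 10 ^ 6"
    using EE_le_UU[OF jt(1), of t] unfolding jt(3) by simp_all
qed

end

section \<open>Rounding and the pole in the disc\<close>

lemma peval_sum: "peval c t = (\<Sum>k<length c. of_int (c ! k) * t ^ k)"
proof (induction c)
  case (Cons a c)
  have "(\<Sum>k<length (a # c). of_int ((a # c) ! k) * t ^ k) = of_int a + (\<Sum>k<length c. of_int (c ! k) * t ^ Suc k)"
    by (simp add: sum.lessThan_Suc_shift del: sum.lessThan_Suc)
  also have "(\<Sum>k<length c. of_int (c ! k) * t ^ Suc k) = t * (\<Sum>k<length c. of_int (c ! k) * t ^ k)"
    by (simp add: sum_distrib_left mult_ac)
  finally show ?case using Cons by simp
qed simp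

definition roundoff :: "real list \<Rightarrow> int list \<Rightarrow> real \<Rightarrow> complex \<Rightarrow> complex" where
  "roundoff l c D t = (\<Sum>k<length l. of_real (l ! k - of_int (c ! k) / D) * t ^ k)"
definition roundoff' :: "real list \<Rightarrow> int list \<Rightarrow> real \<Rightarrow> complex \<Rightarrow> complex" where
  "roundoff' l c D t = (\<Sum>k<length l. of_real (l ! k - of_int (c ! k) / D) * (of_nat k * t ^ (k - 1)))"

lemma roundoff_deriv: "(roundoff l c D has_field_derivative roundoff' l c D t) (at t)"
  unfolding roundoff_def[abs_def] roundoff'_def
  by (auto intro!: derivative_eq_intros simp: mult_ac)

lemma roundoff:
  assumes "list_all2 (\<lambda>a b. \<bar>a - of_int b / D\<bar> \<le> e) l c"
  shows "(\<Sum>k<length l. of_real (l ! k) * t ^ k) = peval c t / of_real D + roundoff l c D t"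
    "cmod t \<le> 1 \<Longrightarrow> cmod (roundoff l c D t) \<le> real (length l) * e"
    "cmod t \<le> 1 \<Longrightarrow> cmod (roundoff' l c D t) \<le> real (length l) * (e * real (length l))"
proof -
  have len: "length l = length c" using assms by (rule list_all2_lengthD)
  have d: "\<bar>l ! k - of_int (c ! k) / D\<bar> \<le> e" if "k < length l" for k
    using assms that by (rule list_all2_nthD)
  show "(\<Sum>k<length l. of_real (l ! k) * t ^ k) = peval c t / of_real D + roundoff l c D t"
    unfolding peval_sum roundoff_def len[symmetric] sum_divide_distrib sum.distrib[symmetric]
    by (intro sum.cong) (simp_all add: algebra_simps)
  assume t: "cmod t \<le> 1"
  have "cmod (roundoff l c D t) \<le> (\<Sum>k<length l. e)"
    unfolding roundoff_def
  proof (rule sum_norm_le)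
    fix k assume "k \<in> {..<length l}"
    then have "\<bar>l ! k - of_int (c ! k) / D\<bar> * cmod t ^ k \<le> e * 1"
      using d[of k] t by (intro mult_mono) (auto simp: power_le_one)
    then show "cmod (of_real (l ! k - of_int (c ! k) / D) * t ^ k) \<le> e"
      by (simp only: norm_mult norm_of_real norm_power mult_1_right)
  qed
  then show "cmod (roundoff l c D t) \<le> real (length l) * e" by simp
  have "cmod (roundoff' l c D t) \<le> (\<Sum>k<length l. e * real (length l))"
    unfolding roundoff'_def
  proof (rule sum_norm_le)
    fix k assume k: "k \<in> {..<length l}"
    have "0 \<le> e" using d[of k] k by auto
    then have "\<bar>l ! k - of_int (c ! k) / D\<bar> * (real k * cmod t ^ (k - 1)) \<le> e * (real (length l) * 1)"
      using d[of k] t k by (intro mult_mono) (auto simp: power_le_one)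
    then show "cmod (of_real (l ! k - of_int (c ! k) / D) * (of_nat k * t ^ (k - 1))) \<le> e * real (length l)"
      by (simp only: norm_mult norm_of_real norm_of_nat norm_power mult_1_right)
  qed
  then show "cmod (roundoff' l c D t) \<le> real (length l) * (e * real (length l))" by simp
qed

lemma Pu_close: "list_all2 (\<lambda>a b. \<bar>a - of_int b / 10 ^ 14\<bar> \<le> 1 / 10 ^ 14) Pu_coeffs pz"
  unfolding Pu_coeffs_def pz_def by (simp add: abs_le_iff)

lemma P_close: "list_all2 (\<lambda>a b. \<bar>a - of_int b / 10 ^ 12\<bar> \<le> 1 / 10 ^ 12) P_coeffs qz"
  unfolding P_coeffs_eq a_list_def qz_def by (simp add: abs_le_iff)

lemma y0_D23_eq: "y0_D23 (of_real x) = of_real (Yr x) + roundoff Pu_coeffs pz (10 ^ 14) (of_real (tx x))"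
proof -
  have t: "tau (of_real x) = of_real (tx x)"
    unfolding tau_def tx_def LL_def x0_def r0_def of_real_diff[symmetric] of_real_divide[symmetric] of_real_eq_iff
    by (simp add: field_simps)
  have "{..22} = {..<length Pu_coeffs}" by (auto simp: Pu_coeffs_def)
  then have "Pu (of_real (tx x)) = peval pz (of_real (tx x)) / of_real (10 ^ 14) + roundoff Pu_coeffs pz (10 ^ 14) (of_real (tx x))"
    unfolding Pu_def using roundoff(1)[OF Pu_close] by simp
  then show ?thesis unfolding y0_D23_def t Yr_def by (simp add: peval_of_real)
qed

lemma y0_D4_eq:
  "y0_D4 z = Y4 z + (z - of_real x0)\<^sup>2 * roundoff P_coeffs qz (10 ^ 12) (z - of_real x0)"
proof -
  have "{..17} = {..<length P_coeffs}" by (auto simp: P_coeffs_eq a_list_def)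
  then have "PP u = peval qz u / of_real (10 ^ 12) + roundoff P_coeffs qz (10 ^ 12) u" for u
    unfolding PP_def using roundoff(1)[OF P_close] by simp
  then show ?thesis unfolding y0_D4_def Y4_def Q4_def by (simp add: power2_eq_square algebra_simps)
qed

lemma Q4_holomorphic: "(\<lambda>z. Q4 (z - c)) holomorphic_on S"
proof -
  have "(\<lambda>z. peval (0 # 0 # qz) (z - c)) field_differentiable at z within S" for z
  proof -
    have "((\<lambda>z. peval (0 # 0 # qz) (z - c)) has_field_derivative peval (pder (0 # 0 # qz)) (z - c) * (1 - 0)) (at z within S)"
      by (rule DERIV_chain2[OF has_field_derivative_peval]) (intro DERIV_diff DERIV_ident DERIV_const)
    then show ?thesis by (auto simp: field_differentiable_def)
  qed
  then have "(\<lambda>z. peval (0 # 0 # qz) (z - c)) holomorphic_on S" unfolding holomorphic_on_def by blast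
  then show ?thesis unfolding Q4_def by (intro holomorphic_intros) auto
qed

section \<open>Moments over a circle and the pole in the disc\<close>

context painleve_I
begin

lemma finite_poles: "compact K \<Longrightarrow> finite (K \<inter> {z. is_pole y z})"
proof (rule finite_not_islimpt_in_compact)
  fix z
  show "\<not> z islimpt {z. is_pole y z}"
  proof (cases "is_pole y z")
    case False
    then show ?thesis using open_nonpoles by (auto simp: islimpt_def)
  qed (rule poles_isolated)
qed

text \<open>The residue at the double pole is the derivative of g(z) (z - c)^k at p; by g(p) = -1
  and g'(p) = 0 only the power contributes.\<close>

lemma residue_moment:
  assumes "is_pole y p"
  shows "residue (\<lambda>z. y z * (z - c) ^ k) p = - of_nat k * (p - c) ^ (k - 1)"
proof -
  obtain e g where e: "e > 0" and g: "g holomorphic_on ball p e"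
    and eq: "\<And>w. w \<in> ball p e \<Longrightarrow> w \<noteq> p \<Longrightarrow> \<not> is_pole y w \<and> y w = g w / (w - p)\<^sup>2"
    and gp: "g p = -1" "deriv g p = 0"
    using pole_expansion[OF assms] by metis
  define h where "h z = g z * (z - c) ^ k" for z
  have "eventually (\<lambda>w. w \<in> ball p e \<and> w \<noteq> p) (at p)"
    using e by (intro eventually_conj eventually_at_in_open') (auto simp: eventually_at_filter)
  then have "eventually (\<lambda>w. y w * (w - c) ^ k = h w / (w - p) ^ Suc 1) (at p)"
    by eventually_elim (use eq in \<open>simp add: h_def power2_eq_square\<close>)
  then have "residue (\<lambda>z. y z * (z - c) ^ k) p = residue (\<lambda>w. h w / (w - p) ^ Suc 1) p"
    by (rule residue_cong) simp
  also have "\<dots> = (deriv ^^ 1) h p / fact 1"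
    by (rule residue_holomorphic_over_power[where A = "ball p e"])
      (use e g in \<open>auto simp: h_def[abs_def] intro!: holomorphic_intros\<close>)
  also have "\<dots> = deriv h p" by simp
  also have "\<dots> = - of_nat k * (p - c) ^ (k - 1)"
  proof (rule DERIV_imp_deriv)
    have "(g has_field_derivative 0) (at p)"
      using holomorphic_derivI[OF g open_ball, of p] e gp(2) by simp
    then have "(h has_field_derivative 0 * (p - c) ^ k + of_nat k * (1 * (p - c) ^ (k - Suc 0)) * g p) (at p)"
      unfolding h_def[abs_def]
      by (intro DERIV_mult DERIV_power) (auto intro!: derivative_eq_intros)
    then show "(h has_field_derivative - of_nat k * (p - c) ^ (k - 1)) (at p)" by (simp add: gp)
  qed
  finally show ?thesis .
qed

text \<open>Up to the factor 2 \<open>pi\<close> i, the case k = 1 gives minus the number of poles,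
  and k = 2 gives minus twice the sum of their displacements from c.\<close>

lemma moment_integral:
  fixes c :: complex
  assumes r: "r > 0" and np: "\<And>z. cmod (z - c) = r \<Longrightarrow> \<not> is_pole y z"
  defines "P \<equiv> {z. is_pole y z} \<inter> ball c r"
  shows "finite P"
    "((\<lambda>z. y z * (z - c) ^ k) has_contour_integral 2 * pi * \<i> * (\<Sum>p\<in>P. - of_nat k * (p - c) ^ (k - 1))) (circlepath c r)"
proof -
  define S where "S = ball c (r + 1)"
  define pts where "pts = S \<inter> {z. is_pole y z}"
  have fin: "finite (cball c (r + 1) \<inter> {z. is_pole y z})" by (rule finite_poles) simp
  have fp: "finite pts" by (rule finite_subset[OF _ fin]) (auto simp: pts_def S_def)
  have P: "P \<subseteq> pts" by (auto simp: P_def pts_def S_def)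
  show "finite P" using fp P by (rule rev_finite_subset)
  have holo: "(\<lambda>z. y z * (z - c) ^ k) holomorphic_on S - pts"
    by (intro holomorphic_intros holomorphic_onI) (auto simp: pts_def)
  have sub: "path_image (circlepath c r) \<subseteq> S - pts"
    using r np by (auto simp: path_image_circlepath pts_def S_def sphere_def dist_norm norm_minus_commute)
  have "contour_integral (circlepath c r) (\<lambda>z. y z * (z - c) ^ k)
      = 2 * pi * \<i> * (\<Sum>p\<in>pts. winding_number (circlepath c r) p * residue (\<lambda>z. y z * (z - c) ^ k) p)"
  proof (rule Residue_theorem[OF _ _ fp holo _ _ sub])
    show "\<forall>z. z \<notin> S \<longrightarrow> winding_number (circlepath c r) z = 0"
    proof (intro allI impI)
      fix z assume "z \<notin> S"
      then show "winding_number (circlepath c r) z = 0"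
        using r by (intro winding_number_zero_outside[where s = "cball c r"]) (auto simp: S_def path_image_circlepath sphere_def)
    qed
  qed (auto simp: S_def)
  also have "(\<Sum>p\<in>pts. winding_number (circlepath c r) p * residue (\<lambda>z. y z * (z - c) ^ k) p)
      = (\<Sum>p\<in>P. - of_nat k * (p - c) ^ (k - 1))"
  proof (rule sum.mono_neutral_cong_right[OF fp P])
    show "\<forall>p\<in>pts - P. winding_number (circlepath c r) p * residue (\<lambda>z. y z * (z - c) ^ k) p = 0"
    proof
      fix p assume p: "p \<in> pts - P"
      then have "cmod (p - c) \<noteq> r" using np[of p] by (auto simp: pts_def)
      moreover have "\<not> dist c p < r" using p by (auto simp: pts_def P_def)
      ultimately have "p \<notin> cball c r" by (auto simp: dist_norm norm_minus_commute)
      then have "winding_number (circlepath c r) p = 0"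
        using r by (intro winding_number_zero_outside[where s = "cball c r"]) (auto simp: path_image_circlepath sphere_def)
      then show "winding_number (circlepath c r) p * residue (\<lambda>z. y z * (z - c) ^ k) p = 0" by simp
    qed
    fix p assume p: "p \<in> P"
    then have "winding_number (circlepath c r) p = 1"
      by (intro winding_number_circlepath) (auto simp: P_def dist_norm norm_minus_commute)
    then show "winding_number (circlepath c r) p * residue (\<lambda>z. y z * (z - c) ^ k) p = - of_nat k * (p - c) ^ (k - 1)"
      using p residue_moment by (simp add: P_def)
  qed
  finally have "contour_integral (circlepath c r) (\<lambda>z. y z * (z - c) ^ k) = 2 * pi * \<i> * (\<Sum>p\<in>P. - of_nat k * (p - c) ^ (k - 1))" .
  moreover have "(\<lambda>z. y z * (z - c) ^ k) contour_integrable_on circlepath c r"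
    by (rule contour_integrable_holomorphic_simple[OF holo _ _ sub])
      (use fp in \<open>auto simp: S_def intro!: open_Diff finite_imp_closed\<close>)
  ultimately show "((\<lambda>z. y z * (z - c) ^ k) has_contour_integral 2 * pi * \<i> * (\<Sum>p\<in>P. - of_nat k * (p - c) ^ (k - 1))) (circlepath c r)"
    using has_contour_integral_integral by metis
qed

end

context tritronquee
begin

lemma unique_pole:
  obtains xp where "{z. is_pole y z} \<inter> ball (of_real x0) r0 = {xp}" "cmod (xp - of_real x0) \<le> 41 / 10 ^ 7" "zorder y xp = -2"
proof -
  define c where "c = complex_of_real x0"
  define P where "P = {z. is_pole y z} \<inter> ball c r0"
  have r: "r0 > 0" by (simp add: r0_def)
  have np: "\<not> is_pole y z" if "cmod (z - c) = r0" for z using circle_bounds(1) that by (simp add: c_def)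
  note m = moment_integral[of r0 c, OF r np]
  have fin: "finite P" using m(1) by (simp add: P_def)
  have bound: "cmod (2 * pi * \<i> * (\<Sum>p\<in>P. - of_nat (Suc k) * (p - c) ^ k) - 2 * pi * \<i> * ((if k = 0 then - 1 else 0)))
      \<le> 218 / 10 ^ 7 * r0 ^ Suc k * (2 * pi * r0)" for k
  proof (rule has_contour_integral_bound_circlepath)
    \<comment> \<open>The entire function h satisfies h(z) / (z - c) = Y4(z) (z - c)^(k + 1), so
      Cauchy's formula yields the moments of the approximant: those of one double pole at c. The
      moments of y differ from them by integrals of the error over the circle.\<close>
    define h where "h z = (z - c) ^ k * (- 1 + (z - c)\<^sup>2 * Q4 (z - c))" for z
    have hol: "h holomorphic_on S" for S
      unfolding h_def[abs_def] by (intro holomorphic_intros Q4_holomorphic)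
    have "((\<lambda>u. h u / (u - c)) has_contour_integral 2 * of_real pi * \<i> * h c) (circlepath c r0)"
      using r by (intro Cauchy_integral_circlepath holomorphic_on_imp_continuous_on hol) auto
    moreover have "h c = (if k = 0 then - 1 else 0)" by (simp add: h_def)
    ultimately have "((\<lambda>u. h u / (u - c)) has_contour_integral 2 * pi * \<i> * (if k = 0 then - 1 else 0)) (circlepath c r0)"
      by simp
    from has_contour_integral_diff[OF m(2)[of "Suc k"] this]
    show "((\<lambda>z. y z * (z - c) ^ Suc k - h z / (z - c)) has_contour_integral
        2 * pi * \<i> * (\<Sum>p\<in>P. - of_nat (Suc k) * (p - c) ^ k) - 2 * pi * \<i> * ((if k = 0 then - 1 else 0))) (circlepath c r0)"
      by (simp add: P_def)
    show "0 \<le> 218 / 10 ^ 7 * r0 ^ Suc k" "0 < r0" using r by simp_all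
    fix z assume z: "cmod (z - c) = r0"
    define u where "u = z - c"
    have u: "u \<noteq> 0" using z r by (auto simp: u_def)
    have "u\<^sup>2 * Y4 z = - 1 + u\<^sup>2 * Q4 u" using u by (simp add: Y4_def c_def[symmetric] u_def[symmetric] algebra_simps)
    then have "h z / (z - c) = Y4 z * (z - c) ^ Suc k"
      using u unfolding h_def u_def[symmetric] by (metis (no_types, opaque_lifting) mult.assoc mult.commute nonzero_mult_div_cancel_left power2_eq_square power_Suc times_divide_eq_right)
    then have "y z * (z - c) ^ Suc k - h z / (z - c) = EE z * (z - c) ^ Suc k" by (simp add: EE_def algebra_simps)
    then have "cmod (y z * (z - c) ^ Suc k - h z / (z - c)) = cmod (EE z) * r0 ^ Suc k"
      by (simp only: norm_mult norm_power z)
    also have "\<dots> \<le> 218 / 10 ^ 7 * r0 ^ Suc k"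
      using circle_bounds(2)[of z] z r by (intro mult_right_mono) (auto simp: c_def)
    finally show "cmod (y z * (z - c) ^ Suc k - h z / (z - c)) \<le> 218 / 10 ^ 7 * r0 ^ Suc k" .
  qed
  have "2 * pi * \<bar>1 - real (card P)\<bar> \<le> 218 / 10 ^ 7 * r0 * (2 * pi * r0)"
  proof -
    have "2 * pi * \<i> * (\<Sum>p\<in>P. - of_nat (Suc 0) * (p - c) ^ 0) - 2 * pi * \<i> * (if (0::nat) = 0 then - 1 else 0)
        = (2 * pi * \<i>) * of_real (1 - real (card P))" by (simp add: algebra_simps)
    then have "cmod (2 * pi * \<i> * (\<Sum>p\<in>P. - of_nat (Suc 0) * (p - c) ^ 0) - 2 * pi * \<i> * (if (0::nat) = 0 then - 1 else 0))
        = 2 * pi * \<bar>1 - real (card P)\<bar>" by (simp only: norm_mult norm_of_real) simp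
    then show ?thesis using bound[of 0] by simp
  qed
  \<comment> \<open>An integer at distance less than 1 from 1 is 1.\<close>
  then have "\<bar>1 - real (card P)\<bar> \<le> 218 / 10 ^ 7 * r0 * r0" by (simp add: field_simps)
  also have "\<dots> < 1" by (simp add: r0_def)
  finally have "card P = 1" by linarith
  then obtain xp where xp: "P = {xp}" by (rule card_1_singletonE)
  have "2 * pi * (2 * cmod (xp - c)) \<le> 218 / 10 ^ 7 * r0\<^sup>2 * (2 * pi * r0)"
  proof -
    have *: "A * (\<Sum>p\<in>P. - of_nat (Suc 1) * (p - c) ^ 1) - A * (if (1::nat) = 0 then - 1 else 0) = - (A * (2 * (xp - c)))"
      for A by (simp add: xp right_diff_distrib)
    have "cmod (2 * pi * \<i> * (2 * (xp - c))) = 2 * pi * (2 * cmod (xp - c))" unfolding norm_mult by simp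
    then show ?thesis using bound[of 1] unfolding * norm_minus_cancel by (simp only: power2_eq_square power_Suc One_nat_def power_0 mult_1_right)
  qed
  then have "2 * cmod (xp - c) \<le> 218 / 10 ^ 7 * r0\<^sup>2 * r0" by (simp add: field_simps)
  then have "cmod (xp - c) \<le> 41 / 10 ^ 7" by (simp add: r0_def power2_eq_square)
  moreover have "zorder y xp = -2" using xp pole_expansion[of xp] by (auto simp: P_def)
  ultimately show ?thesis using that[of xp] xp by (simp add: P_def c_def)
qed

lemma D23_estimate:
  assumes x: "x0 + r0 \<le> x" "x \<le> 11/2"
  shows "\<not> is_pole y (of_real x)" "cmod (y (of_real x) - y0_D23 (of_real x)) \<le> 235 / 10 ^ 7"
    "\<exists>d. ((\<lambda>t. y (of_real t) - y0_D23 (of_real t)) has_vector_derivative d) (at x) \<and> cmod d \<le> 116 / 10 ^ 6"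
proof -
  note R = real_interval[OF x]
  have xx: "x > x0" using x(1) by (simp add: r0_def)
  show "\<not> is_pole y (of_real x)" by (rule R(1))
  have len: "length Pu_coeffs = 23" by (simp add: Pu_coeffs_def)
  have t: "cmod (of_real (tx x)) \<le> 1" using tx_range[OF x] by simp
  have eq: "y (of_real t) - y0_D23 (of_real t) = ec t - roundoff Pu_coeffs pz (10 ^ 14) (of_real (tx t))" for t
    by (simp add: ec_def y0_D23_eq)
  have "cmod (y (of_real x) - y0_D23 (of_real x)) \<le> \<bar>er x\<bar> + 23 * (1 / 10 ^ 14)"
    unfolding eq using norm_triangle_ineq4[of "ec x" "roundoff Pu_coeffs pz (10 ^ 14) (of_real (tx x))"]
      roundoff(2)[OF Pu_close t] by (simp add: R(2) len)
  also have "\<dots> \<le> 17 / 10 ^ 7 / r0 ^ 3 + 23 * (1 / 10 ^ 14)" using R(4) by simp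
  also have "\<dots> \<le> 235 / 10 ^ 7" by (simp add: r0_def power_divide)
  finally show "cmod (y (of_real x) - y0_D23 (of_real x)) \<le> 235 / 10 ^ 7" .
  have "((\<lambda>t. complex_of_real (tx t)) has_vector_derivative of_real (1 / hh)) (at x)"
    by (rule has_vector_derivative_of_real[OF tx_deriv])
  from field_vector_diff_chain_at[OF this roundoff_deriv]
  have "((\<lambda>t. ec t - roundoff Pu_coeffs pz (10 ^ 14) (of_real (tx t))) has_vector_derivative
      dc x - of_real (1 / hh) * roundoff' Pu_coeffs pz (10 ^ 14) (of_real (tx x))) (at x)"
    unfolding ec_def[abs_def] dc_def o_def
    by (intro has_vector_derivative_diff vderiv_real R has_vector_derivative_of_real Yr_deriv xx)
  moreover have "cmod (dc x - of_real (1 / hh) * roundoff' Pu_coeffs pz (10 ^ 14) (of_real (tx x))) \<le> 116 / 10 ^ 6"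
  proof -
    have "cmod (of_real (1 / hh) * roundoff' Pu_coeffs pz (10 ^ 14) (of_real (tx x))) \<le> 1 * (23 * (1 / 10 ^ 14 * 23))"
      unfolding norm_mult using roundoff(3)[OF Pu_close t] by (intro mult_mono) (simp_all add: hh_def len)
    then have "cmod (dc x - of_real (1 / hh) * roundoff' Pu_coeffs pz (10 ^ 14) (of_real (tx x))) \<le> \<bar>dr x\<bar> + 1 * (23 * (1 / 10 ^ 14 * 23))"
      using norm_triangle_ineq4[of "dc x" "of_real (1 / hh) * roundoff' Pu_coeffs pz (10 ^ 14) (of_real (tx x))"]
      unfolding R(3) norm_of_real by linarith
    also have "\<dots> \<le> 51 / 10 ^ 7 / r0 ^ 4 + 1 * (23 * (1 / 10 ^ 14 * 23))" using R(5) by simp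
    also have "\<dots> \<le> 116 / 10 ^ 6" by (simp add: r0_def power_divide)
    finally show ?thesis .
  qed
  ultimately show "\<exists>d. ((\<lambda>t. y (of_real t) - y0_D23 (of_real t)) has_vector_derivative d) (at x) \<and> cmod d \<le> 116 / 10 ^ 6"
    unfolding eq by blast
qed

lemma D4_estimate:
  assumes z: "cmod (z - of_real x0) = r0"
  shows "\<not> is_pole y z" "cmod (y z - y0_D4 z) \<le> 235 / 10 ^ 7"
    "\<exists>d. ((\<lambda>w. y w - y0_D4 w) has_field_derivative d) (at z) \<and> cmod d \<le> 116 / 10 ^ 6"
proof -
  note C = circle_bounds[OF z]
  show np: "\<not> is_pole y z" by (rule C(1))
  define u where "u = z - of_real x0"
  have u: "cmod u = 7/10" using z by (simp add: u_def r0_def)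
  have zx: "z \<noteq> of_real x0" using z by (auto simp: r0_def)
  define g g' where "g = roundoff P_coeffs qz (10 ^ 12)" and "g' = roundoff' P_coeffs qz (10 ^ 12)"
  have len: "length P_coeffs = 18" by (simp add: P_coeffs_eq a_list_def)
  have g: "cmod (g u) \<le> 18 / 10 ^ 12" "cmod (g' u) \<le> 18 * 18 / 10 ^ 12"
    using roundoff(2,3)[OF P_close, of u] u by (simp_all add: g_def g'_def len)
  have eq: "y w - y0_D4 w = EE w - (w - of_real x0)\<^sup>2 * g (w - of_real x0)" for w
    by (simp add: y0_D4_eq EE_def g_def)
  have "cmod (y z - y0_D4 z) \<le> cmod (EE z) + (7/10)\<^sup>2 * cmod (g u)"
    unfolding eq u_def[symmetric] using norm_triangle_ineq4[of "EE z" "u\<^sup>2 * g u"] by (simp add: norm_mult norm_power u)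
  also have "\<dots> \<le> 235 / 10 ^ 7" using C(2) g(1) by (simp add: power2_eq_square)
  finally show "cmod (y z - y0_D4 z) \<le> 235 / 10 ^ 7" .
  have du: "((\<lambda>w. w - complex_of_real x0) has_field_derivative 1) (at z)" by (auto intro!: derivative_eq_intros)
  have dg: "((\<lambda>w. g (w - of_real x0)) has_field_derivative g' u * 1) (at z)"
    unfolding u_def g_def g'_def by (rule DERIV_chain2[OF roundoff_deriv du])
  have "((\<lambda>w. (w - of_real x0)\<^sup>2) has_field_derivative 2 * u) (at z)"
    unfolding u_def by (auto intro!: derivative_eq_intros)
  from DERIV_diff[OF EE_deriv(1)[OF np zx] DERIV_mult[OF this dg]]
  have "((\<lambda>w. y w - y0_D4 w) has_field_derivative DE z - (2 * u * g u + g' u * 1 * u\<^sup>2)) (at z)"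
    unfolding eq u_def[symmetric] .
  moreover have "cmod (DE z - (2 * u * g u + g' u * 1 * u\<^sup>2)) \<le> 116 / 10 ^ 6"
  proof -
    have "cmod (2 * u * g u + g' u * 1 * u\<^sup>2) \<le> 2 * (7/10) * cmod (g u) + cmod (g' u) * (7/10)\<^sup>2"
      using norm_triangle_ineq[of "2 * u * g u" "g' u * 1 * u\<^sup>2"] by (simp add: norm_mult norm_power u)
    also have "\<dots> \<le> 1 / 10 ^ 6" using g by (simp add: power2_eq_square)
    finally show ?thesis using norm_triangle_ineq4[of "DE z" "2 * u * g u + g' u * 1 * u\<^sup>2"] C(3) by simp
  qed
  ultimately show "\<exists>d. ((\<lambda>w. y w - y0_D4 w) has_field_derivative d) (at z) \<and> cmod d \<le> 116 / 10 ^ 6" by blast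
qed

end

section \<open>Taylor coefficients at the origin\<close>

fun dotp :: "'a :: comm_semiring_1 list \<Rightarrow> 'a list \<Rightarrow> 'a" where
  "dotp (a # as) (b # bs) = a * b + dotp as bs"
| "dotp _ _ = 0"

lemma of_int_dotp: "of_int (dotp xs ys) = dotp (map of_int xs) (map of_int ys)"
  by (induction xs ys rule: dotp.induct) auto

lemma dotp_mono:
  fixes xs ys :: "real list"
  assumes "list_all2 (\<lambda>a b. 0 \<le> a \<and> a \<le> b) xs xs'" "list_all2 (\<lambda>a b. 0 \<le> a \<and> a \<le> b) ys ys'"
  shows "dotp xs ys \<le> dotp xs' ys'"
  using assms
proof (induction xs xs' arbitrary: ys ys' rule: list_all2_induct)
  case (Cons a as b bs)
  show ?case using Cons.prems Cons.hyps Cons.IH by (cases rule: list.rel_cases) (auto intro!: add_mono mult_mono)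
qed simp

lemma dotp_map: "length xs = length ys \<Longrightarrow> dotp (map f xs) (map g ys) = (\<Sum>i<length xs. f (xs ! i) * g (ys ! i))"
proof (induction xs ys rule: list_induct2)
  case (Cons x xs y ys)
  then show ?case by (simp add: sum.lessThan_Suc_shift del: sum.lessThan_Suc)
qed simp

text \<open>The Cauchy square without the two end terms, which contain \<open>f 0\<close>, the only
  negative coefficient in the application.\<close>

definition conv :: "(nat \<Rightarrow> real) \<Rightarrow> nat \<Rightarrow> real" where
  "conv f n = (\<Sum>k\<in>{1..<n}. f k * f (n - k))"

lemma conv_dotp: "conv f n = dotp (map f (rev [1..<n])) (map f [1..<n])"
proof -
  have "dotp (map f (rev [1..<n])) (map f [1..<n]) = (\<Sum>i<n - 1. f (n - Suc i) * f (Suc i))"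
    by (subst dotp_map) (auto intro!: sum.cong simp: rev_nth Suc_diff_Suc less_diff_conv)
  also have "\<dots> = conv f n"
    unfolding conv_def by (rule sum.reindex_bij_witness[of _ "\<lambda>k. k - 1" Suc]) (auto simp: mult.commute)
  finally show ?thesis by simp
qed

lemma conv_weighted:
  "real n * conv f n = 2 * (\<Sum>k\<in>{1..<n}. real k * (f k * f (n - k)))"
proof -
  define A where "A = (\<Sum>k\<in>{1..<n}. real k * (f k * f (n - k)))"
  have "A = (\<Sum>k\<in>{1..<n}. real (n - k) * (f k * f (n - k)))"
    unfolding A_def by (rule sum.reindex_bij_witness[of _ "\<lambda>k. n - k" "\<lambda>k. n - k"]) auto
  then have "2 * A = A + (\<Sum>k\<in>{1..<n}. real (n - k) * (f k * f (n - k)))" by simp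
  also have "\<dots> = (\<Sum>k\<in>{1..<n}. real n * (f k * f (n - k)))"
    unfolding A_def sum.distrib[symmetric] by (intro sum.cong) (auto simp: of_nat_diff algebra_simps)
  finally have "2 * A = (\<Sum>k\<in>{1..<n}. real n * (f k * f (n - k)))" .
  then show ?thesis unfolding conv_def A_def by (simp add: sum_distrib_left)
qed

text \<open>A lower bound \<open>f k / f (k - 1) \<ge> l (k + 3) / k\<close> carries over to the self-convolution, where it improves to
  \<open>l (n + 7) / n\<close>: by symmetry a factor \<open>k\<close> under the sum has mean \<open>n / 2\<close>.\<close>

lemma conv_growth:
  assumes pos: "\<And>k. 1 \<le> k \<Longrightarrow> k \<le> N \<Longrightarrow> 0 \<le> f k"
    and ratio: "\<And>k. 3 \<le> k \<Longrightarrow> k \<le> N \<Longrightarrow> 172 * (real k + 3) * f (k - 1) \<le> 1000 * real k * f k"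
    and r2: "688 * f 1 \<le> 2000 * f 2" and N: "N \<ge> 3"
  shows "172 * (real N + 8) * conv f N \<le> 1000 * (real N + 1) * conv f (Suc N)"
proof -
  have split: "(\<Sum>j\<in>{1..<N}. w j) = w 1 + (\<Sum>j\<in>{2..<N}. w j)" for w :: "nat \<Rightarrow> real"
    using sum.atLeast_Suc_lessThan[of 1 N w] N by (simp add: numeral_2_eq_2)
  define g where "g j = 1000 * (real (Suc j) * (f (Suc j) * f (N - j)))" for j
  define h where "h j = 172 * ((real j + 4) * (f j * f (N - j)))" for j
  have "1000 * (\<Sum>k\<in>{1..<Suc N}. real k * (f k * f (Suc N - k))) = 1000 * (f 1 * f N) + (\<Sum>j\<in>{1..<N}. g j)"
    using N by (simp add: sum.atLeast_Suc_lessThan sum.shift_bounds_Suc_ivl g_def distrib_left sum_distrib_left del: sum.op_ivl_Suc)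
  also have "\<dots> = 1000 * (f 1 * f N) + (g 1 + (\<Sum>j\<in>{2..<N}. g j))"
    unfolding split ..
  also have "\<dots> \<ge> h 1 + (\<Sum>j\<in>{2..<N}. h j)"
  proof -
    \<comment> \<open>The ratio bound is assumed from index 3 on, so the term j = 1 needs separate
      care. Its factor 5 * 172 is split as 172 + 688: the first part is covered by the additional
      term f 1 f N of the longer convolution, the second by \<open>r2\<close>.\<close>
    have "172 * real N * f (N - 1) \<le> 172 * (real N + 3) * f (N - 1)"
      using pos[of "N - 1"] N by (intro mult_right_mono) auto
    also have "\<dots> \<le> 1000 * real N * f N" using ratio[of N] N by simp
    finally have "real N * (172 * f (N - 1)) \<le> real N * (1000 * f N)" by (simp add: mult_ac)
    then have fN: "172 * f (N - 1) \<le> 1000 * f N" using N by simp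
    have "f 1 * (172 * f (N - 1)) \<le> f 1 * (1000 * f N)" using fN pos[of 1] N by (intro mult_left_mono) auto
    moreover have "688 * f 1 * f (N - 1) \<le> 2000 * f 2 * f (N - 1)" using r2 pos[of "N - 1"] N by (intro mult_right_mono) auto
    ultimately have "h 1 \<le> 1000 * (f 1 * f N) + g 1" by (simp add: h_def g_def numeral_2_eq_2 mult_ac)
    moreover have "(\<Sum>j\<in>{2..<N}. h j) \<le> (\<Sum>j\<in>{2..<N}. g j)"
    proof (rule sum_mono)
      fix j assume j: "j \<in> {2..<N}"
      have "172 * (real (Suc j) + 3) * f j * f (N - j) \<le> 1000 * real (Suc j) * f (Suc j) * f (N - j)"
        using ratio[of "Suc j"] pos[of "N - j"] j by (intro mult_right_mono) auto
      then show "h j \<le> g j" by (simp add: h_def g_def algebra_simps)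
    qed
    ultimately show ?thesis by linarith
  qed
  also have "h 1 + (\<Sum>j\<in>{2..<N}. h j) = (\<Sum>j\<in>{1..<N}. h j)"
    unfolding split ..
  also have "\<dots> = 172 * ((\<Sum>j\<in>{1..<N}. real j * (f j * f (N - j))) + 4 * conv f N)"
    unfolding h_def conv_def by (simp add: sum_distrib_left sum.distrib[symmetric] distrib_right)
  finally have "172 * (2 * (\<Sum>j\<in>{1..<N}. real j * (f j * f (N - j))) + 8 * conv f N)
      \<le> 1000 * (2 * (\<Sum>k\<in>{1..<Suc N}. real k * (f k * f (Suc N - k))))" by simp
  then show ?thesis unfolding conv_weighted[symmetric] by (simp add: algebra_simps)
qed

text \<open>The negative term 12 a f (N + 1) is the obstacle. \<open>conv_growth\<close> delivers N
  + 8 where N + 6 is wanted, and the surplus 2 * 172 = 344 pays for this term as soon as 0.344 * 172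
  * (N + 5) >= 2251. This holds from N = 34 on, that is for n = N + 3 >= 37, which explains the
  explicit range up to 36.\<close>

lemma ratio_extend:
  assumes rec: "\<And>n. n \<ge> 2 \<Longrightarrow> (real n + 2) * (real n + 1) * f (n + 2) = 6 * conv f n - 12 * a * f n"
    and a: "0 \<le> a" "12000 * a \<le> 2251"
    and r2: "688 * f 1 \<le> 2000 * f 2" and pos: "0 \<le> f 1" "0 \<le> f 2"
    and base: "\<And>k. 3 \<le> k \<Longrightarrow> k \<le> 36 \<Longrightarrow> 172 * (real k + 3) * f (k - 1) \<le> 1000 * real k * f k \<and> 0 \<le> f k"
    and n: "3 \<le> n"
  shows "172 * (real n + 3) * f (n - 1) \<le> 1000 * real n * f n \<and> 0 \<le> f n"
  using n
proof (induction n rule: less_induct)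
  case (less n)
  show ?case
  proof (cases "n \<le> 36")
    case True
    then show ?thesis using base less.prems by simp
  next
    case False
    define N where "N = n - 3"
    have n: "n = N + 3" "N \<ge> 34" using False by (auto simp: N_def)
    have p: "0 \<le> f k" if "1 \<le> k" "k < n" for k
    proof (cases "k \<ge> 3")
      case False
      then have "k = 1 \<or> k = 2" using that by linarith
      then show ?thesis using pos by auto
    qed (use less.IH[of k] that in auto)
    have growth: "172 * (real N + 8) * conv f N \<le> 1000 * (real N + 1) * conv f (Suc N)"
      by (rule conv_growth) (use less.IH p r2 n in auto)
    have recN: "(real N + 2) * (real N + 1) * f (N + 2) = 6 * conv f N - 12 * a * f N" using rec[of N] n by simp
    have recS: "(real N + 3) * (real N + 2) * f (N + 3) = 6 * conv f (Suc N) - 12 * a * f (N + 1)"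
      using rec[of "Suc N"] n by (simp add: algebra_simps numeral_3_eq_3)
    have "0 \<le> 12 * a * f N" using a p[of N] n by simp
    then have "172 * (real N + 8) * ((real N + 2) * (real N + 1) * f (N + 2)) \<le> 172 * (real N + 8) * (6 * conv f N)"
      using recN by (intro mult_left_mono) auto
    also have "\<dots> \<le> 6 * (1000 * (real N + 1) * conv f (Suc N))" using growth by simp
    also have "\<dots> = (real N + 1) * (6000 * conv f (Suc N))" by (simp add: algebra_simps)
    also have "172 * (real N + 8) * ((real N + 2) * (real N + 1) * f (N + 2))
        = (real N + 1) * (172 * (real N + 8) * (real N + 2) * f (N + 2))" by (simp add: algebra_simps)
    finally have "(real N + 1) * (172 * (real N + 8) * (real N + 2) * f (N + 2)) \<le> (real N + 1) * (6000 * conv f (Suc N))" .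
    then have c: "172 * (real N + 8) * (real N + 2) * f (N + 2) \<le> 6000 * conv f (Suc N)" by (rule mult_left_le_imp_le) simp
    have fp: "0 \<le> f (N + 1)" "0 \<le> f (N + 2)" using p[of "N + 1"] p[of "N + 2"] n by auto
    have "12000 * a * f (N + 1) \<le> 2251 * f (N + 1)" using a fp by (intro mult_right_mono) auto
    also have "\<dots> \<le> 344/1000 * (172 * (real N + 5)) * f (N + 1)" using fp n by (intro mult_right_mono) auto
    also have "\<dots> = 344/1000 * (172 * (real N + 5) * f (N + 1))" by simp
    also have "172 * (real N + 5) * f (N + 1) \<le> 1000 * (real N + 2) * f (N + 2)"
      using less.IH[of "N + 2"] n by (simp add: algebra_simps numeral_2_eq_2)
    finally have d: "12000 * a * f (N + 1) \<le> 344 * ((real N + 2) * f (N + 2))" by (simp add: algebra_simps)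
    have "(real N + 2) * (172 * (real N + 6) * f (N + 2)) + 344 * ((real N + 2) * f (N + 2))
        = 172 * (real N + 8) * (real N + 2) * f (N + 2)" by (simp add: algebra_simps)
    moreover have "1000 * ((real N + 3) * (real N + 2) * f (N + 3)) = 6000 * conv f (Suc N) - 12000 * a * f (N + 1)"
      unfolding recS by simp
    ultimately have "(real N + 2) * (172 * (real N + 6) * f (N + 2)) \<le> 1000 * ((real N + 3) * (real N + 2) * f (N + 3))"
      using c d by linarith
    also have "\<dots> = (real N + 2) * (1000 * (real N + 3) * f (N + 3))" by (simp add: algebra_simps)
    finally have "(real N + 2) * (172 * (real N + 6) * f (N + 2)) \<le> (real N + 2) * (1000 * (real N + 3) * f (N + 3))" .
    then have r: "172 * (real N + 6) * f (N + 2) \<le> 1000 * (real N + 3) * f (N + 3)" by (rule mult_left_le_imp_le) simp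
    moreover have "0 \<le> 172 * (real N + 6) * f (N + 2)" using fp by simp
    ultimately have "0 \<le> (1000 * (real N + 3)) * f (N + 3)" by (metis order_trans)
    then have "0 \<le> f (N + 3)" by (simp add: zero_le_mult_iff)
    then show ?thesis using r n by (simp add: add_ac)
  qed
qed

text \<open>\<open>enclosure L U m r\<close> checks that \<open>r\<close> lists enclosures, scaled by \<open>10^20\<close>, of the terms from index \<open>m\<close> on;
  \<open>L\<close> and \<open>U\<close> contain the bounds for the earlier indices in descending order.\<close>

fun enclosure :: "int list \<Rightarrow> int list \<Rightarrow> int \<Rightarrow> (int \<times> int) list \<Rightarrow> bool" where
  "enclosure (l1 # l2 # L) (u1 # u2 # U) m ((l, u) # r) \<longleftrightarrow>
     0 \<le> l \<and> l * (m * (m - 1) * 10 ^ 20) \<le> 6 * dotp L (rev L) - 12 * (18755449 * 10 ^ 12) * u2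
     \<and> 6 * dotp U (rev U) - 12 * (18755413 * 10 ^ 12) * l2 \<le> u * (m * (m - 1) * 10 ^ 20)
     \<and> 172 * (m + 3) * u1 \<le> 1000 * m * l
     \<and> enclosure (l # l1 # l2 # L) (u # u1 # u2 # U) (m + 1) r"
| "enclosure _ _ _ [] \<longleftrightarrow> True"
| "enclosure _ _ _ _ \<longleftrightarrow> False"

text \<open>Interval arithmetic for the recursion: in a lower bound the subtracted product takes the
  upper ends of a and f n, and conversely. The convolution is monotone in its entries because all of
  them are nonnegative.\<close>

lemma enclosure_correct:
  assumes rec: "\<And>n. n \<ge> 2 \<Longrightarrow> (real n + 2) * (real n + 1) * f (n + 2) = 6 * conv f n - 12 * a * f n"
    and a: "18755413 / 10 ^ 8 \<le> a" "a \<le> 18755449 / 10 ^ 8"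
    and L: "list_all2 (\<lambda>l k. 0 \<le> l \<and> of_int l \<le> f k * 10 ^ 20) L (rev [1..<n + 2])"
    and U: "list_all2 (\<lambda>u k. f k * 10 ^ 20 \<le> of_int u) U (rev [1..<n + 2])"
    and n: "n \<ge> 2" and enc: "enclosure L U (int n + 2) r" and k: "n + 2 \<le> k" "k < n + 2 + length r"
  shows "172 * (real k + 3) * f (k - 1) \<le> 1000 * real k * f k \<and> 0 \<le> f k"
  using L U n enc k
proof (induction r arbitrary: L U n)
  case (Cons lu r)
  obtain l u where lu: "lu = (l, u)" by (cases lu)
  \<comment> \<open>The lists are headed by the indices n + 1 and n. The convolution at n uses the
    indices 1 to n - 1 only, that is the tails.\<close>
  have up: "rev [1..<n + 2] = (n + 1) # n # rev [1..<n]" using Cons.prems(3) by (simp add: numeral_2_eq_2)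
  obtain l1 l2 L' where Le: "L = l1 # l2 # L'" and l12: "0 \<le> l2" "of_int l2 \<le> f n * 10 ^ 20"
    and L': "list_all2 (\<lambda>l k. 0 \<le> l \<and> of_int l \<le> f k * 10 ^ 20) L' (rev [1..<n])"
    using Cons.prems(1) unfolding up list_all2_Cons2 by auto
  obtain u1 u2 U' where Ue: "U = u1 # u2 # U'" and u12: "f (n + 1) * 10 ^ 20 \<le> of_int u1" "f n * 10 ^ 20 \<le> of_int u2"
    and U': "list_all2 (\<lambda>u k. f k * 10 ^ 20 \<le> of_int u) U' (rev [1..<n])"
    using Cons.prems(2) unfolding up list_all2_Cons2 by auto
  have e: "0 \<le> l" "l * ((int n + 2) * (int n + 1) * 10 ^ 20) \<le> 6 * dotp L' (rev L') - 12 * (18755449 * 10 ^ 12) * u2"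
    "6 * dotp U' (rev U') - 12 * (18755413 * 10 ^ 12) * l2 \<le> u * ((int n + 2) * (int n + 1) * 10 ^ 20)"
    "172 * (int n + 5) * u1 \<le> 1000 * (int n + 2) * l"
    "enclosure (l # L) (u # U) (int (Suc n) + 2) r"
    using Cons.prems(4) unfolding Le Ue lu by (simp_all add: algebra_simps)
  define F where "F = (\<lambda>k. f k * 10 ^ 20)"
  have convF: "10 ^ 40 * conv f n = dotp (map F (rev [1..<n])) (rev (map F (rev [1..<n])))"
  proof -
    have "conv F n = dotp (map F (rev [1..<n])) (rev (map F (rev [1..<n])))" unfolding conv_dotp by (simp add: rev_map)
    moreover have "conv F n = 10 ^ 40 * conv f n" unfolding conv_def F_def sum_distrib_left by (intro sum.cong refl) simp
    ultimately show ?thesis by simp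
  qed
  have rl: "list_all2 (\<lambda>a b. 0 \<le> a \<and> a \<le> b) (map real_of_int L') (map F (rev [1..<n]))"
    using L' unfolding list_all2_map1 list_all2_map2 F_def by (rule list_all2_mono) auto
  have "list_all2 (\<lambda>l k. 0 \<le> F k) L' (rev [1..<n])"
    using L' unfolding F_def by (rule list_all2_mono) (auto intro: order_trans[of 0 "of_int _"])
  note A = this
  have Fp: "0 \<le> F k" if k: "k \<in> set (rev [1..<n])" for k
  proof -
    obtain i where i: "i < length (rev [1..<n])" "rev [1..<n] ! i = k" using k unfolding in_set_conv_nth by blast
    show ?thesis using list_all2_nthD2[OF A i(1)] unfolding i(2) .
  qed
  have ru: "list_all2 (\<lambda>a b. 0 \<le> a \<and> a \<le> b) (map F (rev [1..<n])) (map real_of_int U')"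
    unfolding list_all2_map1 list_all2_map2
  proof (rule list_all2_all_nthI)
    show "length (rev [1..<n]) = length U'" using list_all2_lengthD[OF U'] by simp
    fix i assume i: "i < length (rev [1..<n])"
    have "F (rev [1..<n] ! i) \<le> of_int (U' ! i)" using list_all2_nthD2[OF U' i] unfolding F_def .
    with Fp[OF nth_mem[OF i]] show "0 \<le> F (rev [1..<n] ! i) \<and> F (rev [1..<n] ! i) \<le> of_int (U' ! i)" by (rule conjI)
  qed
  have lo: "real_of_int (dotp L' (rev L')) \<le> 10 ^ 40 * conv f n"
  proof -
    have "dotp (map real_of_int L') (rev (map real_of_int L')) \<le> dotp (map F (rev [1..<n])) (rev (map F (rev [1..<n])))"
      by (rule dotp_mono[OF rl]) (simp only: list_all2_rev rl)
    then show ?thesis unfolding of_int_dotp convF by (simp only: rev_map)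
  qed
  have hi: "10 ^ 40 * conv f n \<le> real_of_int (dotp U' (rev U'))"
  proof -
    have "dotp (map F (rev [1..<n])) (rev (map F (rev [1..<n]))) \<le> dotp (map real_of_int U') (rev (map real_of_int U'))"
      by (rule dotp_mono[OF ru]) (simp only: list_all2_rev ru)
    then show ?thesis unfolding of_int_dotp convF by (simp only: rev_map)
  qed
  have fn: "0 \<le> f n * 10 ^ 20" using l12 by (rule_tac order_trans[of 0 "of_int l2"]) auto
  have x: "(real n + 2) * (real n + 1) * f (n + 2) * 10 ^ 40 = 6 * (10 ^ 40 * conv f n) - 12 * (a * 10 ^ 20) * (f n * 10 ^ 20)"
    unfolding rec[OF Cons.prems(3)] by (simp add: algebra_simps)
  have "(a * 10 ^ 20) * (f n * 10 ^ 20) \<le> (18755449 * 10 ^ 12) * of_int u2"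
    using a fn u12 by (rule_tac mult_mono) auto
  moreover have "(18755413 * 10 ^ 12) * of_int l2 \<le> (a * 10 ^ 20) * (f n * 10 ^ 20)"
    using a l12 by (rule_tac mult_mono) auto
  ultimately have I:
    "real_of_int (6 * dotp L' (rev L') - 12 * (18755449 * 10 ^ 12) * u2) \<le> (real n + 2) * (real n + 1) * f (n + 2) * 10 ^ 40"
    "(real n + 2) * (real n + 1) * f (n + 2) * 10 ^ 40 \<le> real_of_int (6 * dotp U' (rev U') - 12 * (18755413 * 10 ^ 12) * l2)"
    unfolding x using lo hi by simp_all
  note b = order_trans[OF of_int_le_iff[THEN iffD2, OF e(2)] I(1)] order_trans[OF I(2) of_int_le_iff[THEN iffD2, OF e(3)]]
  define w where "w = (real n + 2) * (real n + 1) * 10 ^ 20"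
  have w: "w > 0" by (simp add: w_def)
  have wi: "w * real_of_int v = real_of_int (v * ((int n + 2) * (int n + 1) * 10 ^ 20))" for v
    by (simp add: w_def mult_ac)
  have wf: "w * (f (n + 2) * 10 ^ 20) = (real n + 2) * (real n + 1) * f (n + 2) * 10 ^ 40"
    by (simp add: w_def algebra_simps)
  have "w * of_int l \<le> w * (f (n + 2) * 10 ^ 20)" "w * (f (n + 2) * 10 ^ 20) \<le> w * of_int u"
    unfolding wi wf by (rule b)+
  then have lu2: "of_int l \<le> f (n + 2) * 10 ^ 20" "f (n + 2) * 10 ^ 20 \<le> of_int u"
    using mult_left_le_imp_le[OF _ w] by blast+
  show ?case
  proof (cases "k = n + 2")
    case True
    have "172 * (real n + 5) * (f (n + 1) * 10 ^ 20) \<le> 172 * (real n + 5) * of_int u1"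
      using u12 by (intro mult_left_mono) auto
    also have "\<dots> = of_int (172 * (int n + 5) * u1)" by simp
    also have "\<dots> \<le> of_int (1000 * (int n + 2) * l)" using e(4) by (simp only: of_int_le_iff)
    also have "\<dots> = 1000 * (real n + 2) * of_int l" by simp
    also have "\<dots> \<le> 1000 * (real n + 2) * (f (n + 2) * 10 ^ 20)" using lu2 by (intro mult_left_mono) auto
    finally have "(172 * (real n + 5) * f (n + 1)) * 10 ^ 20 \<le> (1000 * (real n + 2) * f (n + 2)) * 10 ^ 20"
      by (simp only: mult.assoc)
    then have "172 * (real n + 5) * f (n + 1) \<le> 1000 * (real n + 2) * f (n + 2)"
      by (rule mult_right_le_imp_le) simp
    moreover have "0 \<le> f (n + 2) * 10 ^ 20" using e(1) lu2(1) by (rule_tac order_trans[of 0 "of_int l"]) auto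
    ultimately show ?thesis using True by (simp add: add_ac)
  next
    case False
    have up': "rev [1..<Suc n + 2] = (n + 2) # rev [1..<n + 2]" by simp
    show ?thesis
    proof (rule Cons.IH[where L = "l # L" and n = "Suc n" and U = "u # U"])
      show "list_all2 (\<lambda>l k. 0 \<le> l \<and> of_int l \<le> f k * 10 ^ 20) (l # L) (rev [1..<Suc n + 2])"
        unfolding up' using Cons.prems(1) e(1) lu2(1) by simp
      show "list_all2 (\<lambda>u k. f k * 10 ^ 20 \<le> of_int u) (u # U) (rev [1..<Suc n + 2])"
        unfolding up' using Cons.prems(2) lu2(2) by simp
    qed (use Cons.prems False e(5) in auto)
  qed
qed simp

text \<open>Enclosures of f 4 to f 36 in units of 10^(-20). They are only proposed here;
  \<open>enclosure\<close> checks each of them from its predecessors.\<close>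

definition fbounds :: "(int \<times> int) list" where
  "fbounds = [(2669100876396666264, 2669123250221446932), (1342113527575789873, 1342128338001872386), (660274003938751584, 660282854353810881), (318273010256110085, 318277839973106340), (150809982038293364, 150812594862875932), (70472804087166187, 70474167373656485), (32565434148074398, 32566124888632664), (14913039319413379, 14913384391995199), (6778905719790586, 6779075473752294), (3062488758836816, 3062571192908007), (1376320423620545, 1376360056950076), (615758224015152, 615777110006002), (274406931474095, 274415860862976), (121863705844905, 121867898943377), (53952660107708, 53954617134906), (23820368199300, 23821276603433), (10490553471195, 10490973052582), (4609601220726, 4609794154427), (2021299318882, 2021387673282), (884660112619, 884700424024), (386516255230, 386534584291), (168602383113, 168610690839), (73437307936, 73441062483), (31942848272, 31944540500), (13876381252, 13877142050), (6020909419, 6021250661), (2609547112, 2609699835), (1129837624, 1129905836), (488700293, 488730701), (211188459, 211201990), (91184687, 91190698), (39338606, 39341273), (16958240, 16959422)]"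

text \<open>The two starting lists enclose f 3, f 2 and f 1 in this order.\<close>

lemma fbounds_enclosure:
  "enclosure [5229378553912146666, 10552965504017070000, 30490538000000000000] [5229414011022786667, 10553006015748030000, 30490574000000000000] 4 fbounds" "length fbounds = 33"
  by code_simp+

text \<open>With a = - f 0 the recursion starts with f 2 = 3 a^2 and f 3 = (1 - 12 a f 1) / 6. The
  factor 172 of the ratio test is limited by these values: 4 * 172 * f 1 only just stays below 2000
  f 2.\<close>

lemma coefficients_nonneg:
  fixes f :: "nat \<Rightarrow> real"
  assumes rec: "\<And>n. (real n + 2) * (real n + 1) * f (n + 2) = 6 * (\<Sum>k\<le>n. f k * f (n - k)) + (if n = 1 then 1 else 0)"
    and f0: "18755413 / 10 ^ 8 \<le> - f 0" "- f 0 \<le> 18755449 / 10 ^ 8"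
    and f1: "30490538 / 10 ^ 8 \<le> f 1" "f 1 \<le> 30490574 / 10 ^ 8"
    and n: "n \<ge> 1"
  shows "0 \<le> f n"
proof -
  have rec': "(real n + 2) * (real n + 1) * f (n + 2) = 6 * conv f n - 12 * (- f 0) * f n" if "n \<ge> 2" for n
  proof -
    have "(\<Sum>k\<le>n. f k * f (n - k)) = (\<Sum>k<n. f k * f (n - k)) + f n * f 0"
      by (simp add: lessThan_Suc_atMost[symmetric])
    also have "(\<Sum>k<n. f k * f (n - k)) = f 0 * f n + conv f n"
      unfolding conv_def using that by (simp add: lessThan_atLeast0 sum.atLeast_Suc_lessThan)
    finally show ?thesis using rec[of n] that by (simp add: algebra_simps)
  qed
  define a where "a = - f 0"
  have a: "18755413 / 10 ^ 8 \<le> a" "a \<le> 18755449 / 10 ^ 8" using f0 by (simp_all add: a_def)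
  have aa: "(18755413 / 10 ^ 8) * (18755413 / 10 ^ 8) \<le> a * a" "a * a \<le> (18755449 / 10 ^ 8) * (18755449 / 10 ^ 8)"
    using a by (intro mult_mono; simp)+
  have ab: "(18755413 / 10 ^ 8) * (30490538 / 10 ^ 8) \<le> a * f 1" "a * f 1 \<le> (18755449 / 10 ^ 8) * (30490574 / 10 ^ 8)"
    using a f1 by (intro mult_mono; simp)+
  have f2: "f 2 = 3 * (a * a)" using rec[of 0] by (simp add: a_def numeral_2_eq_2)
  have f3: "f 3 = (1 - 12 * (a * f 1)) / 6" using rec[of 1] by (simp add: a_def numeral_3_eq_3 field_simps)
  have up: "rev [1..<2 + 2] = [3, 2, 1::nat]" by (simp add: upt_rec)
  have "list_all2 (\<lambda>l k. 0 \<le> l \<and> of_int l \<le> f k * 10 ^ 20) [5229378553912146666, 10552965504017070000, 30490538000000000000] (rev [1..<2 + 2])"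
    unfolding up f2 f3 using aa(1) ab(2) f1 by (simp add: f2 f3)
  moreover have "list_all2 (\<lambda>u k. f k * 10 ^ 20 \<le> of_int u) [5229414011022786667, 10553006015748030000, 30490574000000000000] (rev [1..<2 + 2])"
    unfolding up f2 f3 using aa(2) ab(1) f1 by (simp add: f2 f3)
  moreover have "enclosure [5229378553912146666, 10552965504017070000, 30490538000000000000] [5229414011022786667, 10553006015748030000, 30490574000000000000] (int 2 + 2) fbounds" using fbounds_enclosure(1) by simp
  ultimately have base: "172 * (real k + 3) * f (k - 1) \<le> 1000 * real k * f k \<and> 0 \<le> f k" if "4 \<le> k" "k \<le> 36" for k
    using enclosure_correct[OF rec' f0, of _ 2 _ fbounds k] that fbounds_enclosure(2) by simp
  have "172 * (3 + 3) * f 2 \<le> 1000 * 3 * f 3 \<and> 0 \<le> f 3" unfolding f2 f3 using aa ab by simp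
  then have base': "172 * (real k + 3) * f (k - 1) \<le> 1000 * real k * f k \<and> 0 \<le> f k" if "3 \<le> k" "k \<le> 36" for k
    using base[of k] that by (cases "k = 3") auto
  have p: "0 \<le> f 1" "0 \<le> f 2" "688 * f 1 \<le> 2000 * f 2" unfolding f2 using aa f1 by simp_all
  show ?thesis
  proof (cases "n \<ge> 3")
    case True
    then show ?thesis
      using ratio_extend[OF rec' _ _ p(3,1,2) base' True] f0 by simp
  next
    case False
    then have "n = 1 \<or> n = 2" using n by auto
    then show ?thesis using p by auto
  qed
qed

section \<open>Sign pattern of the Taylor coefficients and the closest pole\<close>

context tritronquee
begin

definition tcoef :: "nat \<Rightarrow> complex" where "tcoef n = (deriv ^^ n) y 0 / fact n"

lemma zero_bounds:
  "\<not> is_pole y 0" "y 0 = of_real (Re (y 0))" "deriv y 0 = of_real (Re (deriv y 0))"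
  "18755413 / 10 ^ 8 \<le> Re (y 0)" "Re (y 0) \<le> 18755449 / 10 ^ 8"
  "30490538 / 10 ^ 8 \<le> Re (deriv y 0)" "Re (deriv y 0) \<le> 30490574 / 10 ^ 8"
proof -
  have c: "cc \<le> 0" "(0::real) \<le> 11/2" "x0 + r0 \<le> 0" by (simp_all add: cc_def x0_def r0_def)
  note R = real_interval[OF c(3,2)]
  show "\<not> is_pole y 0" using R(1) by simp
  show "y 0 = of_real (Re (y 0))" using R(2) by (simp add: ec_def er_def)
  show "deriv y 0 = of_real (Re (deriv y 0))" using R(3) by (simp add: dc_def dr_def)
  have "(dr 0)\<^sup>2 + 12 * Yr 0 * (er 0)\<^sup>2 \<le> (be 0)\<^sup>2" using right_interval[of 0] c by simp
  from energy_bounds[OF c(1,2) this] be_bounds[OF c(1,2)]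
  have e: "\<bar>er 0\<bar> \<le> 167 / 10 ^ 9" "\<bar>dr 0\<bar> \<le> 174 / 10 ^ 9" by auto
  have t: "tx 0 = -1233601/2322534" by (simp add: tx_def)
  have Y: "Re (y 0) = er 0 + Yr 0" "Re (deriv y 0) = dr 0 + Yr1 0" by (simp_all add: er_def dr_def)
  show "18755413 / 10 ^ 8 \<le> Re (y 0)" "Re (y 0) \<le> 18755449 / 10 ^ 8"
    unfolding Y Yr_def t using e(1)[unfolded abs_le_iff] pz_zero(1,2) by (simp_all add: x0_def power2_eq_square)
  show "30490538 / 10 ^ 8 \<le> Re (deriv y 0)" "Re (deriv y 0) \<le> 30490574 / 10 ^ 8"
    unfolding Y Yr1_def t hh_def using e(2)[unfolded abs_le_iff] pz_zero(3,4) by (simp_all add: x0_def eval_nat_numeral)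
qed

lemma tcoef_rec:
  "of_nat ((n + 2) * (n + 1)) * tcoef (n + 2) = (if n = 1 then 1 else 0) - 6 * (\<Sum>k\<le>n. tcoef k * tcoef (n - k))"
proof -
  define F where "F = fps_expansion y 0"
  have an: "y analytic_on {0}" using zero_bounds(1) by (intro analytic_on_subset[OF mero]) auto
  have F: "y has_fps_expansion F" unfolding F_def by (rule analytic_at_imp_has_fps_expansion_0[OF an])
  have t: "tcoef m = fps_nth F m" for m unfolding tcoef_def by (rule fps_nth_fps_expansion[OF F, symmetric])
  have "eventually (\<lambda>z. z \<in> {z. \<not> is_pole y z}) (nhds 0)"
    using open_nonpoles zero_bounds(1) by (intro eventually_nhds_in_open) auto
  then have ev: "eventually (\<lambda>z. deriv (deriv y) z = z - 6 * (y z)\<^sup>2) (nhds 0)"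
    by eventually_elim (use ode in auto)
  have "(\<lambda>z. z - 6 * (y z)\<^sup>2) has_fps_expansion fps_X - 6 * F\<^sup>2" by (intro fps_expansion_intros F)
  then have "deriv (deriv y) has_fps_expansion fps_X - 6 * F\<^sup>2" using has_fps_expansion_cong[OF ev refl] by blast
  moreover have "deriv (deriv y) has_fps_expansion fps_deriv (fps_deriv F)" by (intro fps_expansion_intros F)
  ultimately have "fps_deriv (fps_deriv F) = fps_X - 6 * F\<^sup>2" using fps_expansion_unique_complex by blast
  then have "fps_nth (fps_deriv (fps_deriv F)) n = fps_nth (fps_X - 6 * F\<^sup>2) n" by (simp only:)
  then show ?thesis unfolding t by (simp add: numeral_fps_const fps_square_nth algebra_simps)
qed

lemma tcoef_real: "tcoef n \<in> \<real>"
proof (induction n rule: less_induct)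
  case (less n)
  consider "n = 0" | "n = 1" | m where "n = m + 2"
    by (metis One_nat_def add_2_eq_Suc' not0_implies_Suc)
  then show ?case
  proof cases
    case 3
    have "tcoef n = ((if m = 1 then 1 else 0) - 6 * (\<Sum>k\<le>m. tcoef k * tcoef (m - k))) / of_nat ((m + 2) * (m + 1))"
      unfolding 3 tcoef_rec[symmetric] by (rule nonzero_mult_div_cancel_left[symmetric]) (simp only: of_nat_eq_0_iff, simp)
    also have "\<dots> \<in> \<real>" using less 3 by (intro Reals_divide Reals_diff Reals_mult sum_in_Reals) auto
    finally show ?thesis .
  qed (use zero_bounds(2,3) in \<open>auto simp: tcoef_def complex_is_Real_iff complex_eq_iff\<close>)
qed

text \<open>The Taylor coefficients of v(z) = -y(-z), which solves v'' = 6 v^2 + z.\<close>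

definition ft :: "nat \<Rightarrow> real" where "ft n = (-1) ^ Suc n * Re (tcoef n)"

lemma tcoef_ft: "tcoef n = of_real ((-1) ^ Suc n * ft n)"
  using tcoef_real[of n] by (auto simp: ft_def complex_is_Real_iff complex_eq_iff mult.assoc[symmetric] power_mult_distrib[symmetric])

lemma ft_nonneg: "n \<ge> 1 \<Longrightarrow> 0 \<le> ft n"
proof (rule coefficients_nonneg[of ft])
  fix n
  define s :: real where "s = (-1) ^ n"
  have s: "s * s = 1" by (simp add: s_def power_mult_distrib[symmetric])
  have sm: "tcoef k * tcoef (n - k) = of_real (s * (ft k * ft (n - k)))" if "k \<le> n" for k
  proof -
    have "(-1 :: real) ^ Suc k * (-1) ^ Suc (n - k) = s"
      using that by (simp add: power_add[symmetric] s_def)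
    then show ?thesis unfolding tcoef_ft of_real_mult[symmetric] by (simp add: mult_ac)
  qed
  have key: "X * v = 6 * Q - s * d" if "X * - (s * v) = d - 6 * (s * Q)" for X v Q d :: real
  proof -
    have "X * v = (s * s) * (X * v)" by (simp only: s mult_1)
    also have "\<dots> = - s * (X * - (s * v))" by (simp add: mult_ac)
    also have "\<dots> = 6 * ((s * s) * Q) - s * d" unfolding that by (simp add: algebra_simps)
    finally show ?thesis by (simp only: s mult_1)
  qed
  have "of_real ((real n + 2) * (real n + 1) * - (s * ft (n + 2))) = of_nat ((n + 2) * (n + 1)) * tcoef (n + 2)"
    unfolding tcoef_ft by (simp add: s_def algebra_simps)
  also have "\<dots> = (if n = 1 then 1 else 0) - 6 * (\<Sum>k\<le>n. of_real (s * (ft k * ft (n - k))))"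
    unfolding tcoef_rec using sm by simp
  also have "\<dots> = of_real ((if n = 1 then 1 else 0) - 6 * (s * (\<Sum>k\<le>n. ft k * ft (n - k))))"
    by (simp add: sum_distrib_left)
  finally have "(real n + 2) * (real n + 1) * - (s * ft (n + 2)) = (if n = 1 then 1 else 0) - 6 * (s * (\<Sum>k\<le>n. ft k * ft (n - k)))"
    by (simp only: of_real_eq_iff)
  then have "(real n + 2) * (real n + 1) * ft (n + 2) = 6 * (\<Sum>k\<le>n. ft k * ft (n - k)) - s * (if n = 1 then 1 else 0)"
    by (rule key)
  \<comment> \<open>The inhomogeneous term is present only for n = 1, where the sign s equals
    -1.\<close>
  then show "(real n + 2) * (real n + 1) * ft (n + 2) = 6 * (\<Sum>k\<le>n. ft k * ft (n - k)) + (if n = 1 then 1 else 0)"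
    by (auto simp: s_def)
qed (use zero_bounds in \<open>auto simp: ft_def tcoef_def\<close>)

text \<open>For n >= 1 the moduli of the Taylor terms at z are those of v at |z|, whose full sum is
  -y(-|z|). The term n = 0 enters that sum as -y(0) instead of y(0), and 2 y(0) makes up for
  it.\<close>

lemma bound_by_negative_axis:
  assumes hol: "y holomorphic_on ball 0 R" and z: "cmod z < R"
  shows "cmod (y z) \<le> 2 * Re (y 0) + cmod (y (of_real (- cmod z)))"
proof -
  define t where "t = cmod z"
  have "(\<lambda>n. tcoef n * (z - 0) ^ n) sums y z"
    unfolding tcoef_def by (rule holomorphic_power_series[OF hol]) (use z in simp)
  then have 1: "(\<lambda>n. tcoef n * z ^ n) sums y z" by simp
  have "(\<lambda>n. tcoef n * (of_real (- t) - 0) ^ n) sums y (of_real (- t))"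
    unfolding tcoef_def by (rule holomorphic_power_series[OF hol]) (use z in \<open>simp add: t_def\<close>)
  from bounded_linear.sums[OF bounded_linear_Re this]
  have "(\<lambda>n. Re (tcoef n * of_real (- t) ^ n)) sums Re (y (of_real (- t)))" by simp
  moreover have "Re (tcoef n * of_real (- t) ^ n) = - (ft n * t ^ n)" for n
  proof -
    have "tcoef n * of_real (- t) ^ n = of_real ((-1) ^ Suc n * ft n * (- t) ^ n)"
      unfolding tcoef_ft by (simp only: of_real_mult of_real_power)
    also have "(-1) ^ Suc n * ft n * (- t) ^ n = - (((-1) * (-1)) ^ n * (ft n * t ^ n))"
      unfolding power_minus[of t] power_mult_distrib by (simp add: mult_ac)
    finally show ?thesis by simp
  qed
  ultimately have "(\<lambda>n. - (ft n * t ^ n)) sums Re (y (of_real (- t)))" by simp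
  then have 2: "(\<lambda>n. ft n * t ^ n) sums (- Re (y (of_real (- t))))" using sums_minus by fastforce
  have 3: "(\<lambda>n. if n = 0 then 2 * Re (y 0) else 0) sums (2 * Re (y 0))" by (rule sums_single)
  have "cmod (y z) \<le> 2 * Re (y 0) + - Re (y (of_real (- t)))"
  proof (rule norm_sums_le[OF 1 sums_add[OF 3 2]])
    fix n
    show "cmod (tcoef n * z ^ n) \<le> (if n = 0 then 2 * Re (y 0) else 0) + ft n * t ^ n"
    proof (cases "n = 0")
      case True
      then show ?thesis using zero_bounds(2,4) by (simp add: tcoef_def ft_def cmod_eq_Re complex_eq_iff)
    next
      case False
      have "cmod (tcoef n * z ^ n) = \<bar>ft n\<bar> * t ^ n"
        unfolding tcoef_ft norm_mult norm_of_real norm_power t_def by (simp add: abs_mult power_abs)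
      then show ?thesis using False ft_nonneg[of n] by simp
    qed
  qed
  also have "- Re (y (of_real (- t))) \<le> cmod (y (of_real (- t)))" using abs_Re_le_cmod[of "y (of_real (- t))"] by simp
  finally show ?thesis by (simp add: t_def)
qed

lemma closest_pole:
  assumes P: "{z. is_pole y z} \<inter> ball (of_real x0) r0 = {xp}" and xp: "cmod (xp - of_real x0) \<le> 41 / 10 ^ 7"
    and s: "is_pole y s"
  shows "cmod xp \<le> cmod s"
proof (rule ccontr)
  assume "\<not> cmod xp \<le> cmod s"
  then have less: "cmod s < cmod xp" by simp
  define K where "K = cball 0 (cmod s) \<inter> {z. is_pole y z}"
  have "finite K" "K \<noteq> {}" using s by (auto simp: K_def intro!: finite_poles)
  from ex_min_if_finite[of "cmod ` K"] this obtain p where p: "p \<in> K" "\<And>q. q \<in> K \<Longrightarrow> \<not> cmod q < cmod p"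
    by auto
  define R where "R = cmod p"
  have pole: "is_pole y p" and R: "R \<le> cmod s" using p(1) by (auto simp: K_def R_def)
  have "p \<noteq> 0" using pole zero_bounds(1) by auto
  then have R0: "R > 0" by (simp add: R_def)
  have np: "\<not> is_pole y z" if "cmod z < R" for z
    using p(2)[of z] that R by (auto simp: K_def R_def)
  have hol: "y holomorphic_on ball 0 R" by (rule holomorphic_onI) (use np in auto)
  have xpb: "cmod xp \<le> 41 / 10 ^ 7 - x0"
    using norm_triangle_ineq[of "xp - of_real x0" "of_real x0"] xp by (simp add: x0_def)
  have axis: "\<not> is_pole y (of_real t)" if t: "t \<in> {-R..0}" for t
  proof (cases "x0 + r0 \<le> t")
    case True
    then show ?thesis using real_interval(1)[of t] t by simp
  next
    case False
    \<comment> \<open>Left of x0 + r the segment [-R, 0] stays in the disc, because R < |xp| is at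
      most 41 / 10^7 - x0. The only pole in the disc is xp, which has too large a modulus to lie on
      the segment.\<close>
    have "\<bar>t - x0\<bar> < r0" unfolding abs_less_iff using False t R less xpb by (auto simp: x0_def r0_def)
    then have "of_real t \<in> ball (complex_of_real x0) r0"
      by (simp add: dist_norm norm_minus_commute flip: of_real_diff)
    moreover have "of_real t \<noteq> xp" using t R less by auto
    ultimately show ?thesis using P by blast
  qed
  have K: "compact (of_real ` {-R..0} :: complex set)" by (intro compact_continuous_image continuous_intros) auto
  have c: "continuous_on (of_real ` {-R..0}) y"
    by (intro holomorphic_on_imp_continuous_on holomorphic_onI) (use axis in auto)
  have "bounded (y ` of_real ` {-R..0})" by (rule compact_imp_bounded[OF compact_continuous_image[OF c K]])
  then obtain B where B: "\<forall>t\<in>{-R..0}. cmod (y (of_real t)) \<le> B"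
    unfolding bounded_iff by auto
  have "\<not> is_pole y p"
  \<comment> \<open>The pole p is approached from inside the disc of radius R, where |y| is
    dominated by its values on the pole-free segment of the negative axis.\<close>
  proof (rule not_pole_if_bounded[where F = "at p within ball 0 R" and \<gamma> = "\<lambda>z. z" and C = "2 * Re (y 0) + B"])
    show "((\<lambda>z. z) \<longlongrightarrow> p) (at p within ball 0 R)" by (rule tendsto_ident_at)
    show "at p within ball 0 R \<noteq> bot" unfolding trivial_limit_within using R0 by (simp add: islimpt_ball R_def)
    show "eventually (\<lambda>z. z \<noteq> p) (at p within ball 0 R)" by (simp add: eventually_at_filter)
    have "eventually (\<lambda>z. z \<in> ball 0 R) (at p within ball 0 R)" by (simp add: eventually_at_filter)
    then show "eventually (\<lambda>z. cmod (y z) \<le> 2 * Re (y 0) + B) (at p within ball 0 R)"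
    proof eventually_elim
      case (elim z)
      then have z: "cmod z < R" by simp
      then show ?case using bound_by_negative_axis[OF hol z] bspec[OF B, of "- cmod z"] by simp
    qed
  qed
  then show False using pole by simp
qed

end

theorem theorem2p2:
  fixes y :: "complex \<Rightarrow> complex"
  assumes mero: "y analytic_on {z. \<not> is_pole y z}"
    and painleve: "\<forall>z. \<not> is_pole y z \<longrightarrow> deriv (deriv y) z + 6 * (y z)^2 - z = 0"
    and tritronquee:
      "((\<lambda>x::real. (y (complex_of_real x) / complex_of_real (sqrt (x / 6)) - 1)
                      * complex_of_real (x powr (5/8))) \<longlongrightarrow> 0) at_top"
  shows "(\<forall>z\<in>DD. \<not> is_pole y z \<and> cmod (y z - y0 z) \<le> 235 / 10^7)
    \<and> (\<forall>x\<in>D1. \<exists>E'. ((\<lambda>t. y (complex_of_real t) - y0 (complex_of_real t))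
                         has_vector_derivative E') (at x within D1) \<and> cmod E' \<le> 116 / 10^6)
    \<and> (\<forall>x\<in>D2 \<union> D3. \<exists>E'. ((\<lambda>t. y (complex_of_real t) - y0 (complex_of_real t))
                         has_vector_derivative E') (at x within (D2 \<union> D3)) \<and> cmod E' \<le> 116 / 10^6)
    \<and> (\<forall>z\<in>D4. \<exists>E'. ((\<lambda>w. y w - y0_D4 w) has_field_derivative E') (at z)
                         \<and> cmod E' \<le> 116 / 10^6)
    \<and> (\<exists>xp. {z. is_pole y z} \<inter> ball (complex_of_real x0) r0 = {xp}
           \<and> zorder y xp = -2
           \<and> cmod (xp - complex_of_real x0) \<le> 41 / 10^7
           \<and> (\<forall>s. is_pole y s \<longrightarrow> cmod xp \<le> cmod s))"
proof -
  interpret tritronquee y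
  proof unfold_locales
    show "y analytic_on {z. \<not> is_pole y z}" by (rule mero)
    show "deriv (deriv y) z = z - 6 * (y z)\<^sup>2" if "\<not> is_pole y z" for z
      using painleve that by (simp add: eq_diff_eq)
  qed (rule tritronquee)
  have D1: "x \<in> D1 \<longleftrightarrow> 11/2 \<le> x" for x by (simp add: D1_def LL_def)
  have D23: "x \<in> D2 \<union> D3 \<longleftrightarrow> x0 + r0 \<le> x \<and> x < 11/2" for x
    by (auto simp: D2_def D3_def LL_def L0_def x0_def r0_def)
  have mem: "complex_of_real x \<in> of_real ` S \<longleftrightarrow> x \<in> S" for x S by auto
  have y0_1: "y0 (of_real x) = y0_D1 x" if "x \<in> D1" for x
    using that by (simp add: y0_def)
  have y0_23: "y0 (of_real x) = y0_D23 (of_real x)" if "x \<in> D2 \<union> D3" for x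
    using that D1[of x] D23[of x] unfolding y0_def mem by auto
  \<comment> \<open>The definition of \<open>y0\<close> tests the real pieces first.
    \<open>D4\<close> meets the real axis only at x0 - r, to the left of all of them.\<close>
  have y0_4: "y0 z = y0_D4 z" if z: "z \<in> D4" for z
  proof -
    have "z \<notin> of_real ` {x0 + r0..}"
    proof
      assume "z \<in> of_real ` {x0 + r0..}"
      then obtain x where x: "z = of_real x" "x0 + r0 \<le> x" by auto
      then have "\<bar>x - x0\<bar> = r0" using z by (simp add: D4_def flip: of_real_diff)
      then have "x = x0 + r0" using x(2) by (simp add: r0_def)
      then show False using z x(1) by (simp add: D4_def)
    qed
    moreover have "D1 \<subseteq> {x0 + r0..}" "D2 \<union> D3 \<subseteq> {x0 + r0..}"
      using D1 D23 by (auto simp: x0_def r0_def)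
    ultimately have "z \<notin> of_real ` D1" "z \<notin> of_real ` (D2 \<union> D3)" by blast+
    then show ?thesis using z by (simp add: y0_def)
  qed
  have A: "\<not> is_pole y z \<and> cmod (y z - y0 z) \<le> 235 / 10^7" if z: "z \<in> DD" for z
  proof -
    consider x where "x \<in> D1" "z = of_real x" | x where "x \<in> D2 \<union> D3" "z = of_real x" | "z \<in> D4"
      using z unfolding DD_def by blast
    then show ?thesis
    proof cases
      case 1
      then show ?thesis using D1_estimate(1,2)[of x] by (simp add: D1 y0_1)
    next
      case 2
      then show ?thesis using D23_estimate(1,2)[of x] D23[of x] y0_23[of x] by simp
    next
      case 3
      then show ?thesis using D4_estimate(1,2)[of z] y0_4[of z] by (simp add: D4_def)
    qed
  qed
  have B: "\<exists>E'. ((\<lambda>t. y (of_real t) - y0 (of_real t)) has_vector_derivative E') (at x within D1) \<and> cmod E' \<le> 116 / 10^6"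
    if x: "x \<in> D1" for x
  proof -
    have "11/2 \<le> x" using x D1 by simp
    from D1_estimate(3)[OF this] obtain d where
      d: "((\<lambda>t. y (of_real t) - y0_D1 t) has_vector_derivative d) (at x)" "cmod d \<le> 116 / 10 ^ 6" by blast
    have "((\<lambda>t. y (of_real t) - y0 (of_real t)) has_vector_derivative d) (at x within D1)"
      by (rule has_vector_derivative_transform[OF x _ has_vector_derivative_at_within[OF d(1)]]) (simp add: y0_1)
    then show ?thesis using d(2) by blast
  qed
  have C: "\<exists>E'. ((\<lambda>t. y (of_real t) - y0 (of_real t)) has_vector_derivative E') (at x within (D2 \<union> D3)) \<and> cmod E' \<le> 116 / 10^6"
    if x: "x \<in> D2 \<union> D3" for x
  proof -
    have "x0 + r0 \<le> x" "x \<le> 11/2" using x D23[of x] by auto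
    from D23_estimate(3)[OF this] obtain d where
      d: "((\<lambda>t. y (of_real t) - y0_D23 (of_real t)) has_vector_derivative d) (at x)" "cmod d \<le> 116 / 10 ^ 6" by blast
    have "((\<lambda>t. y (of_real t) - y0 (of_real t)) has_vector_derivative d) (at x within (D2 \<union> D3))"
      by (rule has_vector_derivative_transform[OF x _ has_vector_derivative_at_within[OF d(1)]]) (simp only: y0_23)
    then show ?thesis using d(2) by blast
  qed
  have D: "\<exists>E'. ((\<lambda>w. y w - y0_D4 w) has_field_derivative E') (at z) \<and> cmod E' \<le> 116 / 10^6" if "z \<in> D4" for z
    using D4_estimate(3)[of z] that by (simp add: D4_def)
  obtain xp where xp: "{z. is_pole y z} \<inter> ball (of_real x0) r0 = {xp}"
      "cmod (xp - of_real x0) \<le> 41 / 10 ^ 7" "zorder y xp = -2" by (rule unique_pole)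
  have "\<forall>s. is_pole y s \<longrightarrow> cmod xp \<le> cmod s" using closest_pole[OF xp(1,2)] by blast
  with xp have "\<exists>xp. {z. is_pole y z} \<inter> ball (of_real x0) r0 = {xp} \<and> zorder y xp = -2
      \<and> cmod (xp - of_real x0) \<le> 41 / 10 ^ 7 \<and> (\<forall>s. is_pole y s \<longrightarrow> cmod xp \<le> cmod s)"
    by (intro exI[of _ xp] conjI)
  then show ?thesis
    by (intro conjI ballI A[THEN conjunct1] A[THEN conjunct2] B C D)
qed

end
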